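(* Let $\alpha\in[0,1)$. The density of $\mathbf{M}_\alpha$ is log-concave if and only if $\alpha\le\alpha_*$, where $\alpha_*=0.771667...$ is the unique solution on $(0,1)$ of the equation (in the unknown $a$) $$\frac{1}{\Gamma(1-2a)^2}=\frac{1}{\Gamma(1-a)\,\Gamma(1-3a)}.$$
   Context: $1/\Gamma$ is the entire reciprocal Gamma function (equal to $0$ at the non-positive integers). The Wright function is $\phi(\rho,\beta,z)=\sum_{n\ge 0}\frac{z^n}{n!\,\Gamma(\beta+\rho n)}$ for $\beta,z\in\mathbb{C}$, $\rho>-1$. For $\alpha\in[0,1)$, $\mathbf{M}_\alpha$ is the Mittag-Leffler random variable, i.e. the positive random variable with moment generating function $\mathbb{E}[e^{z\mathbf{M}_\alpha}]=E_\alpha(z)$, where $E_\alpha(z)=\sum_{n\ge 0}\frac{z^n}{\Gamma(1+\alpha n)}$ (for $\alpha=0$, $E_0(z)=1/(1-z)$ on $\Re(z)<1$). Its density on $(0,\infty)$ is $x\mapsto\phi(-\alpha,1-\alpha,-x)$; for $\alpha=0$ this is $e^{-x}$. A positive function $f$ on $(0,\infty)$ is log-concave if $\log f$ is concave there. *)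

theory Defs
  imports "HOL-Probability.Probability"
begin

text \<open>
  For \<open>\<alpha> = 0\<close> the power series only converges on the unit disc; the function is
  its continuation \<open>1 / (1 - z)\<close>, used below on the half-plane \<open>Re z < 1\<close>.
\<close>

definition mittag_leffler :: "real \<Rightarrow> complex \<Rightarrow> complex" where
  "mittag_leffler \<alpha> z =
     (if \<alpha> = 0 then 1 / (1 - z)
      else (\<Sum>n. z ^ n * rGamma (1 + of_real \<alpha> * of_nat n)))"

text \<open>
  Integrability is demanded explicitly because the Bochner integral of a non-integrable
  function is \<open>0\<close> by convention.
\<close>

definition mittag_leffler_rv :: "real \<Rightarrow> 'a measure \<Rightarrow> ('a \<Rightarrow> real) \<Rightarrow> bool" where
  "mittag_leffler_rv \<alpha> M X \<longleftrightarrow>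
     prob_space M \<and> X \<in> borel_measurable M \<and> (AE \<omega> in M. X \<omega> > 0) \<and>
     (\<forall>z::complex. (\<alpha> = 0 \<longrightarrow> Re z < 1) \<longrightarrow>
        integrable M (\<lambda>\<omega>. exp (z * of_real (X \<omega>))) \<and>
        (LINT \<omega>|M. exp (z * of_real (X \<omega>))) = mittag_leffler \<alpha> z)"

text \<open>
  A density is determined only almost everywhere; continuity on \<open>(0, \<infinity>)\<close> selects a unique
  version there. For the Mittag-Leffler variable this version is the Wright function
  \<open>x \<mapsto> \<phi>(-\<alpha>, 1 - \<alpha>, -x)\<close>.
\<close>

definition continuous_density :: "'a measure \<Rightarrow> ('a \<Rightarrow> real) \<Rightarrow> (real \<Rightarrow> real) \<Rightarrow> bool" where
  "continuous_density M X f \<longleftrightarrow>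
     (\<forall>x. 0 \<le> f x) \<and> continuous_on {0<..} f \<and>
     distributed M lborel X (\<lambda>x. ennreal (f x))"

definition log_concave :: "(real \<Rightarrow> real) \<Rightarrow> bool" where
  "log_concave f \<longleftrightarrow> (\<forall>x>0. 0 < f x) \<and> concave_on {0<..} (\<lambda>x. ln (f x))"

end

theory Submission
  imports Defs "HOL-Complex_Analysis.Complex_Analysis"
begin

text \<open>
  Let \<open>f\<close> be the density, \<open>F\<close> its entire continuation, and
  \<open>turan \<alpha> = 1/\<Gamma>(1 - 2\<alpha>)\<^sup>2 - 1/(\<Gamma>(1 - \<alpha>) \<Gamma>(1 - 3\<alpha>)) = F'(0)\<^sup>2 - F(0) F''(0)\<close>. If \<open>f\<close> is log-concave, letting
  \<open>h\<close> tend to \<open>0\<close> in \<open>F(0) F(2h) \<le> F(h)\<^sup>2\<close> gives \<open>turan \<alpha> \<ge> 0\<close>; shifting the arguments of \<open>\<Gamma>\<close> and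
  using Euler's product shows that \<open>turan\<close> changes sign exactly once.

  For \<open>\<alpha> \<le> 1/2\<close> the characteristic function of \<open>ln M\<close> is \<open>\<Gamma>(1 + iy)/\<Gamma>(1 + i\<alpha>y)\<close>. Truncating the Gamma
  products writes its law as a limit of laws with interlacing zeros and poles, which are convolutions
  of exponentials with a log-concave density, so \<open>f(e\<^sup>v)\<close> is log-concave in \<open>v\<close>. The passage from
  \<open>x\<close> to \<open>x + h\<close> in the hitting-time density \<open>t\<^sup>-\<^sup>\<alpha> f(x t\<^sup>-\<^sup>\<alpha>)\<close> is a convolution in \<open>t\<close>, and this upgrades the
  multiplicative statement to log-concavity of \<open>f\<close>.

  For \<open>\<alpha> > 1/2\<close> the function \<open>\<alpha> F\<close> is the density on the whole line of the extremal stable law with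
  characteristic function \<open>exp ((iy)\<^sup>g)\<close>, \<open>g = 1/\<alpha>\<close>; both sides have the same Mellin transform on
  the half-line. The stable law is a limit of reflected densities \<open>v\<close> whose Laplace transforms have interlacing
  zeros and poles. Exponential convolution preserves the fact that \<open>v' + b v\<close> never has the sign
  pattern \<open>-, +, -\<close>, so \<open>v'/v\<close> falls first and rises afterwards. Hence \<open>F\<close> is log-concave on the
  positive half-line or log-convex on the negative one. The second alternative forces
  \<open>turan \<alpha> \<le> 0\<close>, so the first one holds below the root, and at the root by continuity.
\<close>

section \<open>Laplace transforms and Gamma integrals\<close>

text \<open>The approximating densities are controlled only through their characteristic functions,
  so no pointwise convergence of densities or slopes is available. Log-concavity is therefore
  carried as the four-point inequality F(x) F(t) \<le> F(r) F(r') for r + r' = x + t with x the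
  smallest point. Integrated over short intervals it survives convergence of interval probabilities,
  and dividing by the interval lengths returns it for the limit density. The index 1/2 is a natural
  border. For \<alpha> \<le> 1/2 the first zero 1/\<alpha> is at least 2, so the pole 1 is paired
  with no zero and supplies the exponential factor that makes the product log-concave. For \<alpha>
  > 1/2 the exponent 1/\<alpha> lies between 1 and 2. There the turning point of v'/v cannot be
  compared with the reflection point for a single approximant; only an alternative is known, and the
  local expansion at 0 decides it. Turning a contour is replaced by analytic continuation in a
  parameter, or by observing that all admissible angles produce the same power series.\<close>

lemma exp_abs_le_sum: "exp (x * v + e * \<bar>v\<bar>) \<le> exp ((x + e) * v) + exp ((x - e) * v)" for x v e :: real
  by (cases "v \<ge> 0") (auto simp: algebra_simps add_increasing add_increasing2)

lemma exp_partial_sum_norm_le: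
  fixes z :: complex
  shows "norm (\<Sum>n<N. z ^ n / of_nat (fact n)) \<le> exp (norm z)"
proof -
  have "norm (\<Sum>n<N. z ^ n / of_nat (fact n)) \<le> (\<Sum>n<N. norm z ^ n / fact n)"
    by (rule order_trans[OF norm_sum]) (simp add: norm_divide norm_power)
  also have "\<dots> \<le> exp (norm z)"
    using sum_le_suminf[OF summable_exp_generic[of "norm z"], of "{..<N}"]
    by (simp add: exp_def scaleR_conv_of_real field_simps)
  finally show ?thesis .
qed

lemma of_real_islimpt_interval:
  fixes w :: real
  assumes "a < w" "w < b"
  shows "(of_real w :: complex) islimpt of_real ` {a<..<b}"
proof -
  have "w islimpt {a<..<b}" using assms
    by (intro interior_limit_point) (auto simp: interior_open)
  then show ?thesis unfolding islimpt_def
  proof (intro allI impI)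
    fix T assume *: "\<forall>T. w \<in> T \<longrightarrow> open T \<longrightarrow> (\<exists>y\<in>{a<..<b}. y \<in> T \<and> y \<noteq> w)"
      and T: "complex_of_real w \<in> T" "open T"
    have "open (of_real -` T :: real set)"
      by (intro continuous_open_vimage T) (auto intro: continuous_intros)
    then show "\<exists>y\<in>complex_of_real ` {a<..<b}. y \<in> T \<and> y \<noteq> complex_of_real w"
      using *[rule_format, of "of_real -` T"] T by (metis image_eqI of_real_eq_iff vimage_eq)
  qed
qed

lemma vertical_strip: "open {z. a < Re z \<and> Re z < b}" "connected {z. a < Re z \<and> Re z < b}"
  unfolding Collect_conj_eq
  by (auto intro!: convex_connected convex_Int convex_halfspace_Re_gt convex_halfspace_Re_lt
             open_halfspace_Re_gt open_halfspace_Re_lt open_Int)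

text \<open>Around \<open>z0\<close> the integrand is expanded in powers of \<open>w - z0\<close>.
  All partial sums are dominated by two real exponentials whose rates \<open>Re z0 + norm e\<close>
  and \<open>Re z0 - norm e\<close> stay inside the strip, so integrating the series yields a power
  series in \<open>w - z0\<close>.\<close>

lemma bilateral_laplace_holomorphic:
  fixes M :: "real measure"
  assumes M: "sets M = sets borel"
    and int: "\<And>w. a < w \<Longrightarrow> w < b \<Longrightarrow> integrable M (\<lambda>v. exp (w * v))"
  shows "(\<lambda>z. \<integral>v. exp (z * of_real v) \<partial>M) holomorphic_on {z. a < Re z \<and> Re z < b}"
proof -
  note [measurable_cong] = M
  note op = vertical_strip(1)[of a b]
  have *: "\<exists>r>0. (\<lambda>z. \<integral>v. exp (z * of_real v) \<partial>M) holomorphic_on ball z0 r"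
    if z0: "a < Re z0" "Re z0 < b" for z0
  proof -
    define r where "r = min (Re z0 - a) (b - Re z0)"
    have "r > 0" using z0 by (simp add: r_def)
    have "(\<lambda>z. \<integral>v. exp (z * of_real v) \<partial>M) holomorphic_on ball z0 r"
    proof (rule power_series_holomorphic)
      fix w assume w: "w \<in> ball z0 r"
      define e where "e = w - z0"
      have e: "norm e < r" using w by (simp add: e_def dist_norm norm_minus_commute)
      define g where "g = (\<lambda>v. exp ((Re z0 + norm e) * v) + exp ((Re z0 - norm e) * v))"
      have g: "integrable M g"
        unfolding g_def using e using norm_ge_zero[of e] z0
          by (intro Bochner_Integration.integrable_add int) (auto simp: r_def simp del: norm_ge_zero)
      define t where "t = (\<lambda>n v. exp (z0 * of_real v) * ((e * of_real v) ^ n / of_nat (fact n)) :: complex)"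
      have bnd: "norm (\<Sum>n<N. t n v) \<le> g v" for N v
      proof -
        have "norm (\<Sum>n<N. t n v) = exp (Re z0 * v) * norm (\<Sum>n<N. (e * of_real v) ^ n / of_nat (fact n))"
          unfolding t_def sum_distrib_left[symmetric] norm_mult by simp
        also have "\<dots> \<le> exp (Re z0 * v) * exp (norm (e * of_real v))"
          by (intro mult_left_mono exp_partial_sum_norm_le) auto
        also have "\<dots> \<le> g v"
          using exp_abs_le_sum[of "Re z0" v "norm e"] by (simp add: g_def norm_mult exp_add)
        finally show ?thesis .
      qed
      have [measurable]: "t n \<in> borel_measurable M" for n unfolding t_def by measurable
      \<comment> \<open>A term is the difference of two partial sums, so the bound for partial sums
        also makes every single term integrable.\<close>
      have tb: "norm (t n v) \<le> 2 * g v" for n v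
      proof -
        have "t n v = (\<Sum>n<Suc n. t n v) - (\<Sum>n<n. t n v)" by simp
        then have "norm (t n v) \<le> norm (\<Sum>n<Suc n. t n v) + norm (\<Sum>n<n. t n v)"
          by (metis norm_triangle_ineq4)
        then show ?thesis using bnd[where N="Suc n" and v=v] bnd[where N=n and v=v] by linarith
      qed
      have ti: "integrable M (t n)" for n
        by (rule Bochner_Integration.integrable_bound[OF integrable_mult_right[OF g, of 2]])
           (auto intro!: AE_I2 order_trans[OF tb])
      have "(\<lambda>N. \<integral>v. (\<Sum>n<N. t n v) \<partial>M) \<longlonglongrightarrow> (\<integral>v. exp (w * of_real v) \<partial>M)"
      proof (rule integral_dominated_convergence[OF _ _ g])
        show "AE v in M. (\<lambda>N. \<Sum>n<N. t n v) \<longlonglongrightarrow> exp (w * of_real v)"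
        proof (rule AE_I2)
          fix v
          have "(\<lambda>n. (e * of_real v) ^ n / of_nat (fact n)) sums exp (e * of_real v)"
            using exp_converges[of "e * of_real v"] by (simp add: scaleR_conv_of_real field_simps)
          then have "(\<lambda>n. t n v) sums (exp (z0 * of_real v) * exp (e * of_real v))"
            unfolding t_def by (rule sums_mult)
          also have "exp (z0 * of_real v) * exp (e * of_real v) = exp (w * of_real v)"
            by (simp add: e_def exp_add[symmetric] algebra_simps)
          finally show "(\<lambda>N. \<Sum>n<N. t n v) \<longlonglongrightarrow> exp (w * of_real v)"
            by (simp add: sums_def)
        qed
      qed (use bnd in auto)
      moreover have "(\<integral>v. (\<Sum>n<N. t n v) \<partial>M) =
          (\<Sum>n<N. (\<integral>v. exp (z0 * of_real v) * (of_real v ^ n / of_nat (fact n)) \<partial>M) * e ^ n)" for N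
      proof -
        have "(\<integral>v. (\<Sum>n<N. t n v) \<partial>M) = (\<Sum>n<N. \<integral>v. t n v \<partial>M)"
          by (rule Bochner_Integration.integral_sum) (rule ti)
        also have "(\<lambda>n. \<integral>v. t n v \<partial>M) =
            (\<lambda>n. (\<integral>v. exp (z0 * of_real v) * (of_real v ^ n / of_nat (fact n)) \<partial>M) * e ^ n)"
          unfolding t_def by (subst integral_mult_left_zero[symmetric]) (simp add: power_mult_distrib mult_ac)
        finally show ?thesis .
      qed
      ultimately show "(\<lambda>n. (\<integral>v. exp (z0 * of_real v) * (of_real v ^ n / of_nat (fact n)) \<partial>M) * (w - z0) ^ n)
          sums (\<integral>v. exp (w * of_real v) \<partial>M)"
        by (simp add: sums_def e_def)
    qed
    then show ?thesis using \<open>r > 0\<close> by blast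
  qed
  show ?thesis
    unfolding holomorphic_on_open[OF op]
    using * by (smt (verit) centre_in_ball holomorphic_on_open mem_Collect_eq open_ball)
qed

text \<open>Tilting by \<open>exp (w0 * v)\<close> at the midpoint \<open>w0\<close> and normalising
  gives probability measures whose characteristic functions are the transforms on the vertical line
  through \<open>w0\<close>. Equality on the real interval spreads to that line by the identity
  theorem, Levy's theorem identifies the tilted measures, and the density
  \<open>C * exp (- w0 * v)\<close> removes the tilt.\<close>

lemma bilateral_laplace_unique:
  fixes M1 M2 :: "real measure"
  assumes M1: "sets M1 = sets borel" and M2: "sets M2 = sets borel" and "a < b"
    and eq: "\<And>w. a < w \<Longrightarrow> w < b \<Longrightarrow> (\<integral>\<^sup>+v. ennreal (exp (w * v)) \<partial>M1) = (\<integral>\<^sup>+v. ennreal (exp (w * v)) \<partial>M2)"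
    and fin: "\<And>w. a < w \<Longrightarrow> w < b \<Longrightarrow> (\<integral>\<^sup>+v. ennreal (exp (w * v)) \<partial>M1) < \<infinity>"
  shows "M1 = M2"
proof -
  note [measurable_cong] = M1 M2
  define w0 where "w0 = (a + b) / 2"
  have w0: "a < w0" "w0 < b" using \<open>a < b\<close> by (auto simp: w0_def)
  define c where "c = (\<integral>\<^sup>+v. ennreal (exp (w0 * v)) \<partial>M1)"
  have c2: "c = (\<integral>\<^sup>+v. ennreal (exp (w0 * v)) \<partial>M2)" using eq[OF w0] by (simp add: c_def)
  have int: "integrable M (\<lambda>v. exp (w * v))" if "a < w" "w < b" "M = M1 \<or> M = M2" for M w
    using that eq[OF that(1,2)] fin[OF that(1,2)] by (auto intro!: integrableI_nonneg)
  show ?thesis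
  proof (cases "c = 0")
    \<comment> \<open>A zero total mass cannot be normalised, but the integrand is positive, so both
      measures are null.\<close>
    case True
    have "emeasure M (space M) = 0" if "M = M1 \<or> M = M2" for M
    proof -
      have "(\<integral>\<^sup>+v. ennreal (exp (w0 * v)) \<partial>M) = 0" using that True c_def c2 by auto
      then have "AE v in M. ennreal (exp (w0 * v)) = 0"
        using that by (subst (asm) nn_integral_0_iff_AE) auto
      then have "AE v in M. False" by (rule AE_mp) (simp add: ennreal_eq_0_iff not_le)
      then show ?thesis by (simp add: AE_iff_null null_setsD1)
    qed
    then have *: "emeasure M A = 0" if "M = M1 \<or> M = M2" for M A
      using that emeasure_mono[OF sets.sets_into_space, of A M] 
      by (metis emeasure_notin_sets le_zero_eq sets.top)
    show ?thesis by (rule measure_eqI) (use M1 M2 * in auto)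
  next
    case False
    have cfin: "c < \<infinity>" using fin[OF w0] by (simp add: c_def)
    define C where "C = enn2real c"
    have C: "c = ennreal C" "C > 0" using False cfin by (auto simp: C_def enn2real_positive_iff less_top zero_less_iff_neq_zero)
    define N where "N = (\<lambda>M. density M (\<lambda>v. ennreal (exp (w0 * v) / C)))"
    have N: "real_distribution (N M)" if "M = M1 \<or> M = M2" for M
    proof -
      note [measurable_cong] = M1 M2
      have [measurable_cong]: "sets M = sets borel" using that M1 M2 by auto
      have "(\<integral>\<^sup>+v. ennreal (exp (w0 * v) / C) \<partial>M) = (\<integral>\<^sup>+v. ennreal (exp (w0 * v)) \<partial>M) / ennreal C"
        using C by (simp add: nn_integral_divide[symmetric] divide_ennreal)
      also have "(\<integral>\<^sup>+v. ennreal (exp (w0 * v)) \<partial>M) = ennreal C" using that c2 c_def C by auto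
      finally have "(\<integral>\<^sup>+v. ennreal (exp (w0 * v) / C) \<partial>M) = 1" using C
        by (simp add: ennreal_divide_self)
      then have "emeasure (N M) (space (N M)) = 1"
        by (simp add: N_def emeasure_density)
      then show ?thesis
        unfolding real_distribution_def real_distribution_axioms_def
        using that M1 M2 by (auto intro!: prob_spaceI simp: N_def)
    qed
    have char: "char (N M) t = (\<integral>v. exp ((of_real w0 + \<i> * of_real t) * of_real v) \<partial>M) / of_real C"
      if "M = M1 \<or> M = M2" for M t
    proof -
      have [measurable_cong]: "sets M = sets borel" using that M1 M2 by auto
      have "char (N M) t = (\<integral>v. (exp (w0 * v) / C) *\<^sub>R iexp (t * v) \<partial>M)"
        unfolding char_def N_def using C by (subst integral_density) auto
      also have "\<dots> = (\<integral>v. exp ((of_real w0 + \<i> * of_real t) * of_real v) / of_real C \<partial>M)"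
        by (intro Bochner_Integration.integral_cong)
           (auto simp: scaleR_conv_of_real exp_of_real[symmetric] exp_add[symmetric] algebra_simps)
      finally show ?thesis by simp
    qed
    define S where "S = {z. a < Re z \<and> Re z < b}"
    have conn: "connected S" "open S" by (simp_all add: S_def vertical_strip)
    define h where "h = (\<lambda>M::real measure. \<lambda>z::complex. \<integral>v. exp (z * of_real v) \<partial>M)"
    have hol: "h M holomorphic_on S" if "M = M1 \<or> M = M2" for M
      unfolding h_def S_def using that M1 M2 int by (intro bilateral_laplace_holomorphic) auto
    have real: "h M1 (of_real w) = h M2 (of_real w)" if "a < w" "w < b" for w
    proof -
      have "h M (of_real w) = of_real (enn2real (\<integral>\<^sup>+v. ennreal (exp (w * v)) \<partial>M))" if "M = M1 \<or> M = M2" for M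
      proof -
        have [measurable_cong]: "sets M = sets borel" using that M1 M2 by auto
        have "h M (of_real w) = of_real (\<integral>v. exp (w * v) \<partial>M)"
          unfolding h_def by (simp add: exp_of_real flip: of_real_mult integral_complex_of_real)
        then show ?thesis by (simp add: integral_eq_nn_integral)
      qed
      then show ?thesis using eq[OF that] by auto
    qed
    have eqS: "h M1 z = h M2 z" if "z \<in> S" for z
    proof -
      define U :: "complex set" where "U = of_real ` {a<..<b}"
      have "(of_real w0 :: complex) islimpt U" unfolding U_def by (rule of_real_islimpt_interval) (use w0 in auto)
      moreover have "(\<lambda>z. h M1 z - h M2 z) holomorphic_on S"
        by (intro holomorphic_intros hol) auto
      ultimately have "h M1 z - h M2 z = 0"
        by (intro analytic_continuation[of "\<lambda>z. h M1 z - h M2 z" S U "of_real w0" z])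
           (use conn w0 that real in \<open>auto simp: S_def U_def\<close>)
      then show ?thesis by simp
    qed
    have "char (N M1) = char (N M2)"
    proof
      fix t
      have "h M1 (of_real w0 + \<i> * of_real t) = h M2 (of_real w0 + \<i> * of_real t)"
        by (rule eqS) (use w0 in \<open>auto simp: S_def\<close>)
      then show "char (N M1) t = char (N M2) t"
        using char[of M1 t] char[of M2 t] by (simp add: h_def)
    qed
    then have NN: "N M1 = N M2" by (intro Levy_uniqueness N) auto
    have "density (N M) (\<lambda>v. ennreal (C * exp (- w0 * v))) = M" if "M = M1 \<or> M = M2" for M
    proof -
      have [measurable_cong]: "sets M = sets borel" using that M1 M2 by auto
      have "density (N M) (\<lambda>v. ennreal (C * exp (- w0 * v))) =
        density M (\<lambda>v. ennreal (exp (w0 * v) / C) * ennreal (C * exp (- w0 * v)))"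
        unfolding N_def by (rule density_density_eq) auto
      also have "\<dots> = density M (\<lambda>_. 1)"
        using C by (intro density_cong) (auto simp: ennreal_mult[symmetric] exp_add[symmetric])
      finally show ?thesis by (simp add: density_1)
    qed
    then show ?thesis using NN by metis
  qed
qed

section \<open>Gamma integrals with a complex rate\<close>

lemma AE_lborel_neq: "AE x in lborel. x \<noteq> (c::real)"
  by (rule AE_lborel_singleton)

lemma set_integral_nonneg_nn:
  fixes f :: "'a \<Rightarrow> real"
  assumes m: "set_borel_measurable M A f" and nn: "\<And>x. x \<in> A \<Longrightarrow> 0 \<le> f x"
    and eq: "(\<integral>\<^sup>+x\<in>A. ennreal (f x) \<partial>M) = ennreal c" and c: "0 \<le> c"
  shows "set_integrable M A f" "(LINT x:A|M. f x) = c"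
proof -
  have *: "(\<integral>\<^sup>+x. ennreal (indicator A x *\<^sub>R f x) \<partial>M) = ennreal c"
    unfolding eq[symmetric] by (intro nn_integral_cong) (auto simp: indicator_def)
  have nn': "AE x in M. 0 \<le> indicator A x *\<^sub>R f x" using nn by (auto simp: indicator_def)
  show "set_integrable M A f"
    unfolding set_integrable_def
    by (rule integrableI_nonneg) (use m * nn' in \<open>auto simp: set_borel_measurable_def\<close>)
  show "(LINT x:A|M. f x) = c"
    unfolding set_lebesgue_integral_def
    by (subst integral_eq_nn_integral) (use m * nn' c in \<open>auto simp: set_borel_measurable_def\<close>)
qed

lemma nn_integral_Gamma:
  fixes a c :: real
  assumes "0 < a" "0 < c"
  shows "(\<integral>\<^sup>+r\<in>{0<..}. ennreal (r powr (a - 1) * exp (- c * r)) \<partial>lborel) = ennreal (Gamma a * c powr - a)"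
proof -
  have "ennreal (Gamma a) = (\<integral>\<^sup>+ t. ennreal (indicat_real {0..} t * t powr (a - 1) / exp t) \<partial>lborel)"
    by (rule Gamma_conv_nn_integral_real) fact
  also have "\<dots> = (\<integral>\<^sup>+ t. ennreal (t powr (a - 1) * exp (- t)) * indicator {0<..} t \<partial>lborel)"
    by (rule nn_integral_cong_AE, rule AE_mp[OF AE_lborel_neq[of 0]], rule AE_I2)
       (auto simp: indicator_def exp_minus field_simps)
  also have "\<dots> = ennreal \<bar>c\<bar> * (\<integral>\<^sup>+ r. ennreal ((0 + c * r) powr (a - 1) * exp (- (0 + c * r))) * indicator {0<..} (0 + c * r) \<partial>lborel)"
    using assms by (subst nn_integral_real_affine[where c = c and t = 0]) auto
  also have "\<dots> = (\<integral>\<^sup>+ r. ennreal (c powr a) * (ennreal (r powr (a - 1) * exp (- c * r)) * indicator {0<..} r) \<partial>lborel)"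
    using assms
    by (subst nn_integral_cmult[symmetric], measurable, intro nn_integral_cong)
       (auto simp: indicator_def zero_less_mult_iff powr_mult powr_diff ennreal_mult[symmetric] field_simps)
  also have "\<dots> = ennreal (c powr a) * (\<integral>\<^sup>+r\<in>{0<..}. ennreal (r powr (a - 1) * exp (- c * r)) \<partial>lborel)"
    by (rule nn_integral_cmult) auto
  finally have "ennreal (c powr - a) * ennreal (Gamma a) =
     (ennreal (c powr - a) * ennreal (c powr a)) * (\<integral>\<^sup>+r\<in>{0<..}. ennreal (r powr (a - 1) * exp (- c * r)) \<partial>lborel)"
    by (simp add: mult.assoc)
  moreover have "ennreal (c powr - a) * ennreal (c powr a) = 1"
    using assms by (simp add: ennreal_mult[symmetric] powr_add[symmetric])
  ultimately show ?thesis using assms Gamma_real_nonneg[of a]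
    by (simp add: ennreal_mult[symmetric] mult.commute)
qed

text \<open>Both sides are holomorphic in \<open>- c\<close> on a strip to the left of the imaginary
  axis and agree at negative real points by \<open>nn_integral_Gamma\<close>. Analytic continuation
  takes the place of turning the contour.\<close>

lemma Gamma_integral_rotated:
  fixes a :: real and c :: complex
  assumes a: "0 < a" and c: "0 < Re c"
  shows "set_integrable lborel {0<..} (\<lambda>r. of_real (r powr (a - 1)) * exp (- c * of_real r))"
    and "(LINT r:{0<..}|lborel. of_real (r powr (a - 1)) * exp (- c * of_real r)) = of_real (Gamma a) * c powr (- of_real a)"
proof -
  have rint: "set_integrable lborel {0<..} (\<lambda>r. r powr (a - 1) * exp (- w * r))" if "w > 0" for w
    by (rule set_integral_nonneg_nn[OF _ _ nn_integral_Gamma[OF a that]])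
       (use a that in \<open>auto simp: set_borel_measurable_def\<close>)
  show int: "set_integrable lborel {0<..} (\<lambda>r. of_real (r powr (a - 1)) * exp (- c * of_real r) :: complex)"
    using rint[OF c] unfolding set_integrable_def
    by (rule Bochner_Integration.integrable_bound) (auto simp: norm_mult indicator_def)
  define M where "M = density lborel (\<lambda>r. ennreal (indicator {0<..} r * r powr (a - 1)))"
  have M: "integrable M (\<lambda>v. exp (w * v))" if "w < 0" for w
    unfolding M_def using rint[of "-w"] that
    by (subst integrable_density) (auto simp: set_integrable_def mult_ac)
  \<comment> \<open>The strip contains both \<open>- c\<close> and the real number
    \<open>- Re c\<close>, which serves as limit point for the identity theorem.\<close>
  define S where "S = {z. - Re c - 1 < Re z \<and> Re z < 0}"
  have hol: "(\<lambda>z. \<integral>v. exp (z * of_real v) \<partial>M) holomorphic_on S"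
    unfolding S_def by (rule bilateral_laplace_holomorphic) (use M in \<open>auto simp: M_def\<close>)
  have hol2: "(\<lambda>z. of_real (Gamma a) * (- z) powr (- of_real a)) holomorphic_on S"
    by (intro holomorphic_intros) (auto simp: S_def complex_nonpos_Reals_iff)
  have conn: "connected S" "open S" by (simp_all add: S_def vertical_strip)
  have eqr: "(\<integral>v. exp (of_real w * of_real v) \<partial>M) - of_real (Gamma a) * (- of_real w) powr (- of_real a) = (0::complex)" if "w < 0" for w
  proof -
    have "(\<integral>v. exp (of_real w * of_real v :: complex) \<partial>M) = of_real (\<integral>v. exp (w * v) \<partial>M)"
      by (simp add: exp_of_real flip: of_real_mult integral_complex_of_real)
    also have "(\<integral>v. exp (w * v) \<partial>M) = enn2real (\<integral>\<^sup>+v. ennreal (exp (w * v)) \<partial>M)"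
      by (rule integral_eq_nn_integral) (auto simp: M_def)
    also have "(\<integral>\<^sup>+v. ennreal (exp (w * v)) \<partial>M) = (\<integral>\<^sup>+r\<in>{0<..}. ennreal (r powr (a - 1) * exp (- (-w) * r)) \<partial>lborel)"
      unfolding M_def by (subst nn_integral_density) (auto intro!: nn_integral_cong simp: indicator_def ennreal_mult[symmetric])
    also have "\<dots> = ennreal (Gamma a * (-w) powr - a)"
      by (rule nn_integral_Gamma) (use a that in auto)
    also have "enn2real \<dots> = Gamma a * (-w) powr - a" using a Gamma_real_pos[of a] by simp
    finally show ?thesis using that by (simp add: powr_of_real[symmetric])
  qed
  define U :: "complex set" where "U = of_real ` {- Re c - 1<..<0}"
  have lim: "of_real (- Re c) islimpt U" unfolding U_def by (rule of_real_islimpt_interval) (use c in auto)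
  have "(\<integral>v. exp ((- c) * of_real v) \<partial>M) - of_real (Gamma a) * (- (- c)) powr (- of_real a) = 0"
  proof (rule analytic_continuation[of "\<lambda>z. (\<integral>v. exp (z * of_real v) \<partial>M) - of_real (Gamma a) * (- z) powr (- of_real a)" S U "of_real (- Re c)"])
    show "(\<lambda>z. (CLINT v|M. exp (z * of_real v)) - of_real (Gamma a) * (- z) powr (- of_real a)) holomorphic_on S"
      by (intro holomorphic_on_diff hol hol2)
    show "(CLINT v|M. exp (z * complex_of_real v)) - of_real (Gamma a) * (- z) powr (- of_real a) = 0" if "z \<in> U" for z
      using that eqr by (auto simp: U_def)
  qed (use conn c lim in \<open>auto simp: S_def U_def\<close>)
  moreover have "(\<integral>v. exp ((- c) * of_real v) \<partial>M) = (LINT r:{0<..}|lborel. of_real (r powr (a - 1)) * exp (- c * of_real r))"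
    unfolding M_def set_lebesgue_integral_def
    by (subst integral_density) (auto intro!: Bochner_Integration.integral_cong simp: indicator_def scaleR_conv_of_real)
  ultimately show "(LINT r:{0<..}|lborel. of_real (r powr (a - 1)) * exp (- c * of_real r)) = of_real (Gamma a) * c powr (- of_real a)"
    by simp
qed

section \<open>Convolutions of exponential densities\<close>

text \<open>Continuity is asked on the whole line because the convolutions below are global
  solutions of a differential equation; decay is asked only on the half-line that
  \<open>laplace\<close> sees.\<close>

definition exp_bounded :: "(real \<Rightarrow> real) \<Rightarrow> bool" where
  "exp_bounded u \<longleftrightarrow> (\<forall>x. isCont u x) \<and> (\<exists>C e. e > 0 \<and> (\<forall>x\<ge>0. \<bar>u x\<bar> \<le> C * exp (- e * x)))"

definition laplace :: "(real \<Rightarrow> real) \<Rightarrow> complex \<Rightarrow> complex" where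
  "laplace u z = (LINT x:{0<..}|lborel. exp (- z * of_real x) * of_real (u x))"

lemma set_integrable_exp_decay:
  assumes "0 < e" shows "set_integrable lborel {0<..} (\<lambda>x::real. exp (- e * x))"
proof -
  have "(\<integral>\<^sup>+r\<in>{0<..}. ennreal (exp (- e * r)) \<partial>lborel) = (\<integral>\<^sup>+r\<in>{0<..}. ennreal (r powr (1 - 1) * exp (- e * r)) \<partial>lborel)"
    by (intro nn_integral_cong) (auto simp: indicator_def)
  also have "\<dots> = ennreal (Gamma 1 * e powr - 1)" using assms by (intro nn_integral_Gamma) auto
  finally show ?thesis using assms
    by (intro set_integral_nonneg_nn(1)[where c = "Gamma 1 * e powr - 1"]) (auto simp: set_borel_measurable_def)
qed

lemma exp_bounded_set_integrable:
  assumes u: "exp_bounded u" and z: "Re z \<ge> 0"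
  shows "set_integrable lborel {0<..} (\<lambda>x. exp (- z * of_real x) * of_real (u x))"
proof -
  obtain C e where e: "e > 0" and C: "\<And>x. x \<ge> 0 \<Longrightarrow> \<bar>u x\<bar> \<le> C * exp (- e * x)"
    using u by (auto simp: exp_bounded_def)
  have [measurable]: "u \<in> borel_measurable borel"
    by (rule borel_measurable_continuous_onI) (use u in \<open>auto simp: exp_bounded_def continuous_on_eq_continuous_at\<close>)
  have "set_integrable lborel {0<..} (\<lambda>x. C * exp (- e * x))"
    using set_integrable_exp_decay[OF e] by simp
  then show ?thesis unfolding set_integrable_def
  proof (rule Bochner_Integration.integrable_bound)
    show "AE x in lborel. norm (indicat_real {0<..} x *\<^sub>R (exp (- z * of_real x) * of_real (u x)))
      \<le> norm (indicat_real {0<..} x *\<^sub>R (C * exp (- e * x)))"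
    proof (rule AE_I2)
      fix x :: real
      have "exp (- (Re z * x)) * \<bar>u x\<bar> \<le> 1 * (C * exp (- e * x))" if "x > 0"
        using C[of x] that z by (intro mult_mono) auto
      then show "norm (indicat_real {0<..} x *\<^sub>R (exp (- z * of_real x) * of_real (u x)))
      \<le> norm (indicat_real {0<..} x *\<^sub>R (C * exp (- e * x)))"
        by (auto simp: indicator_def norm_mult)
    qed
  qed measurable
qed

lemma exp_bounded_add:
  assumes "exp_bounded u" "exp_bounded v" shows "exp_bounded (\<lambda>x. u x + v x)"
proof -
  obtain C e where e: "e > 0" and C: "\<And>x. x \<ge> 0 \<Longrightarrow> \<bar>u x\<bar> \<le> C * exp (- e * x)"
    using assms by (auto simp: exp_bounded_def)
  obtain D d where d: "d > 0" and D: "\<And>x. x \<ge> 0 \<Longrightarrow> \<bar>v x\<bar> \<le> D * exp (- d * x)"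
    using assms by (auto simp: exp_bounded_def)
  have "\<bar>u x + v x\<bar> \<le> (\<bar>C\<bar> + \<bar>D\<bar>) * exp (- min e d * x)" if "x \<ge> 0" for x
  proof -
    have "\<bar>u x\<bar> \<le> \<bar>C\<bar> * exp (- min e d * x)"
      by (rule order_trans[OF C[OF that]], intro mult_mono) (use that in \<open>auto intro!: mult_right_mono\<close>)
    moreover have "\<bar>v x\<bar> \<le> \<bar>D\<bar> * exp (- min e d * x)"
      by (rule order_trans[OF D[OF that]], intro mult_mono) (use that in \<open>auto intro!: mult_right_mono\<close>)
    ultimately show ?thesis using abs_triangle_ineq[of "u x" "v x"] by (simp add: distrib_right)
  qed
  then show ?thesis using e d assms unfolding exp_bounded_def
    by (intro conjI exI[of _ "\<bar>C\<bar> + \<bar>D\<bar>"] exI[of _ "min e d"]) auto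
qed

lemma exp_bounded_cmult:
  assumes "exp_bounded u" shows "exp_bounded (\<lambda>x. c * u x)"
proof -
  obtain C e where e: "e > 0" and C: "\<And>x. x \<ge> 0 \<Longrightarrow> \<bar>u x\<bar> \<le> C * exp (- e * x)"
    using assms by (auto simp: exp_bounded_def)
  have "\<bar>c * u x\<bar> \<le> (\<bar>c\<bar> * C) * exp (- e * x)" if "x \<ge> 0" for x
    using mult_left_mono[OF C[OF that], of "\<bar>c\<bar>"] by (simp add: abs_mult mult_ac)
  then show ?thesis using e assms unfolding exp_bounded_def by auto
qed

lemma laplace_add:
  assumes "exp_bounded u" "exp_bounded v" "Re z \<ge> 0"
  shows "laplace (\<lambda>x. u x + v x) z = laplace u z + laplace v z"
  unfolding laplace_def of_real_add distrib_left
  by (rule set_integral_add(2)) (intro exp_bounded_set_integrable assms)+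

lemma laplace_cmult: "laplace (\<lambda>x. c * u x) z = of_real c * laplace u z"
  unfolding laplace_def by (subst set_integral_mult_right[symmetric]) (simp add: algebra_simps)

lemma laplace_exp:
  assumes "0 < p" "Re z \<ge> 0"
  shows "exp_bounded (\<lambda>x. exp (- p * x))" "laplace (\<lambda>x. exp (- p * x)) z = 1 / (z + of_real p)"
proof -
  show "exp_bounded (\<lambda>x. exp (- p * x))"
    unfolding exp_bounded_def by (intro conjI exI[of _ 1] exI[of _ p]) (use assms in auto)
  have "laplace (\<lambda>x. exp (- p * x)) z = (LINT r:{0<..}|lborel. of_real (r powr (1 - 1)) * exp (- (z + of_real p) * of_real r))"
    unfolding laplace_def set_lebesgue_integral_def
    by (intro Bochner_Integration.integral_cong)
       (auto simp: indicator_def exp_of_real[symmetric] exp_add[symmetric] algebra_simps)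
  also have "\<dots> = of_real (Gamma 1) * (z + of_real p) powr (- of_real 1)"
    by (rule Gamma_integral_rotated) (use assms in auto)
  also have "\<dots> = 1 / (z + of_real p)"
    using assms by (auto simp: powr_minus complex_eq_iff field_simps)
  finally show "laplace (\<lambda>x. exp (- p * x)) z = 1 / (z + of_real p)" .
qed

text \<open>\<open>v\<close> is the convolution of the exponential density of rate \<open>a\<close> with the function \<open>u\<close>
  together with a point mass \<open>k\<close> at \<open>0\<close>.\<close>

definition exp_conv :: "real \<Rightarrow> real \<Rightarrow> (real \<Rightarrow> real) \<Rightarrow> (real \<Rightarrow> real) \<Rightarrow> bool" where
  "exp_conv a k u v \<longleftrightarrow> (\<forall>x. (v has_real_derivative a * (u x - v x)) (at x)) \<and> v 0 = a * k"

lemma exp_conv_deriv: "exp_conv a k u v \<Longrightarrow> (v has_real_derivative a * (u x - v x)) (at x)"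
  and exp_conv_0: "exp_conv a k u v \<Longrightarrow> v 0 = a * k"
  by (auto simp: exp_conv_def)

lemma exp_conv_exists:
  assumes u: "\<And>x. isCont u x"
  shows "\<exists>v. exp_conv a k u v"
proof -
  have "\<exists>F. \<forall>x::real. (-\<infinity>::ereal) < x \<longrightarrow> x < (\<infinity>::ereal) \<longrightarrow> (F has_vector_derivative exp (a * x) * u x) (at x)"
    by (rule einterval_antiderivative) (use u in auto)
  then obtain V where V: "\<And>x. (V has_real_derivative exp (a * x) * u x) (at x)"
    by (auto simp: has_real_derivative_iff_has_vector_derivative)
  have "exp_conv a k u (\<lambda>x. exp (- a * x) * (a * k + a * (V x - V 0)))"
    unfolding exp_conv_def
    by (auto intro!: derivative_eq_intros V simp: algebra_simps exp_minus)
  then show ?thesis by blast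
qed

text \<open>With the integrating factor \<open>exp (a * x)\<close> the equation for \<open>v\<close>
  becomes a plain integration, so the sign of \<open>u\<close> turns into monotonicity.\<close>

lemma exp_conv_scaled_deriv:
  assumes "exp_conv a k u v"
  shows "((\<lambda>x. exp (a * x) * v x) has_real_derivative a * exp (a * x) * u x) (at x)"
  by (auto intro!: derivative_eq_intros exp_conv_deriv[OF assms] simp: algebra_simps)

lemma exp_conv_scaled_mono:
  assumes v: "exp_conv a k u v" and a: "0 < a" and u: "\<And>x. 0 \<le> x \<Longrightarrow> 0 \<le> u x" and x: "0 \<le> x"
  shows "a * k \<le> exp (a * x) * v x"
proof -
  have "exp (a * 0) * v 0 \<le> exp (a * x) * v x"
  proof (rule DERIV_nonneg_imp_nondecreasing[OF x])
    fix y assume "0 \<le> y" "y \<le> x"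
    then have "0 \<le> a * exp (a * y) * u y" using a u by simp
    then show "\<exists>z. ((\<lambda>x. exp (a * x) * v x) has_real_derivative z) (at y) \<and> 0 \<le> z"
      using exp_conv_scaled_deriv[OF v] by blast
  qed
  then show ?thesis using exp_conv_0[OF v] by simp
qed

lemma exp_conv_nonneg:
  assumes v: "exp_conv a k u v" and a: "0 < a" and k: "0 \<le> k" and u: "\<And>x. 0 \<le> x \<Longrightarrow> 0 \<le> u x" and x: "0 \<le> x"
  shows "0 \<le> v x"
proof -
  have "0 \<le> a * k" using a k by simp
  then have "0 \<le> exp (a * x) * v x" using exp_conv_scaled_mono[OF v a u x] by linarith
  then show ?thesis by (simp add: zero_le_mult_iff)
qed

lemma exp_conv_pos:
  assumes v: "exp_conv a k u v" and a: "0 < a" and k: "0 \<le> k" and u: "\<And>x. 0 \<le> x \<Longrightarrow> 0 \<le> u x" and x: "0 < x"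
    and pos: "0 < k \<or> (\<forall>x>0. 0 < u x)"
  shows "0 < v x"
proof -
  have ak: "0 \<le> a * k" using a k by simp
  have "0 < exp (a * x) * v x"
  proof (cases "0 < k")
    case True
    then have "0 < a * k" using a by simp
    then show ?thesis using exp_conv_scaled_mono[OF v a u, of x] x by linarith
  next
    case False
    have "exp (a * 0) * v 0 < exp (a * x) * v x"
    proof (rule DERIV_pos_imp_increasing_open[OF x])
      fix y assume "0 < y" "y < x"
      then have "0 < a * exp (a * y) * u y" using a pos False by simp
      then show "\<exists>z. ((\<lambda>x. exp (a * x) * v x) has_real_derivative z) (at y) \<and> 0 < z"
        using exp_conv_scaled_deriv[OF v] by blast
    qed (rule DERIV_continuous_on, rule has_field_derivative_at_within, rule exp_conv_scaled_deriv[OF v])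
    then show ?thesis using exp_conv_0[OF v] ak by simp
  qed
  then show ?thesis by (simp add: zero_less_mult_iff)
qed

lemma exp_conv_exp_bounded:
  assumes v: "exp_conv a k u v" and a: "0 < a" and u: "exp_bounded u"
  shows "exp_bounded v"
proof -
  obtain C e where e: "e > 0" and C: "\<And>x. x \<ge> 0 \<Longrightarrow> \<bar>u x\<bar> \<le> C * exp (- e * x)"
    using u by (auto simp: exp_bounded_def)
  have C0: "C \<ge> 0" using C[of 0] by (smt (verit) exp_zero mult_cancel_left1 mult_zero_right)
  \<comment> \<open>The rate \<open>d\<close> is kept strictly below \<open>a\<close>, so that
    \<open>exp ((a - d) * x)\<close> has a primitive with finite factor \<open>1 / (a - d)\<close>;
    at equal rates a factor \<open>x\<close> would appear.\<close>
  define d where "d = min e a / 2"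
  have d: "0 < d" "d < a" "d \<le> e" using e a by (auto simp: d_def)
  define K where "K = a * C / (a - d)"
  have K0: "K \<ge> 0" using d C0 a by (auto simp: K_def)
  have main: "\<bar>v x\<bar> \<le> (\<bar>a * k\<bar> + K) * exp (- d * x)" if x: "x \<ge> 0" for x
  proof -
    have ub: "\<bar>u y\<bar> \<le> C * exp (- d * y)" if "y \<ge> 0" for y
      using C[OF that] that d C0 by (rule_tac order_trans[OF C[OF that]]) (auto intro!: mult_left_mono mult_right_mono)
    have eq: "a * exp (a * y) * (C * exp (- d * y)) = K * ((a - d) * exp ((a - d) * y))" for y
      using d by (simp add: K_def exp_diff exp_minus field_simps left_diff_distrib)
    have D: "((\<lambda>x. K * exp ((a - d) * x) - s * (exp (a * x) * v x)) has_real_derivative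
       (K * ((a - d) * exp ((a - d) * y)) - s * (a * exp (a * y) * u y))) (at y)" for y s
      by (rule DERIV_diff[OF _ DERIV_cmult[OF exp_conv_scaled_deriv[OF v]]]) (auto intro!: derivative_eq_intros)
    \<comment> \<open>The two values of \<open>s\<close> give the upper and the lower bound for
      \<open>exp (a * x) * v x\<close> by one comparison of derivatives.\<close>
    have mono: "K * exp ((a - d) * 0) - s * (exp (a * 0) * v 0) \<le> K * exp ((a - d) * x) - s * (exp (a * x) * v x)"
      if s: "s = 1 \<or> s = -1" for s
    proof (rule DERIV_nonneg_imp_nondecreasing[OF x])
      fix y assume y: "0 \<le> y" "y \<le> x"
      have "s * (a * exp (a * y) * u y) \<le> a * exp (a * y) * (C * exp (- d * y))"
        using mult_left_mono[OF ub[OF y(1)], of "a * exp (a * y)"] s a by (auto simp: abs_le_iff)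
      then show "\<exists>D. ((\<lambda>x. K * exp ((a - d) * x) - s * (exp (a * x) * v x)) has_real_derivative D) (at y) \<and> 0 \<le> D"
        using D[of s y] eq[of y] by (intro exI conjI) auto
    qed
    have ab: "\<bar>exp (a * x) * v x\<bar> \<le> \<bar>a * k\<bar> + K * exp ((a - d) * x)"
      using mono[of 1] mono[of "-1"] exp_conv_0[OF v] K0 by simp
    have "\<bar>v x\<bar> = exp (- a * x) * \<bar>exp (a * x) * v x\<bar>"
      by (simp add: abs_mult mult.assoc[symmetric] exp_add[symmetric])
    also have "\<dots> \<le> exp (- a * x) * (\<bar>a * k\<bar> + K * exp ((a - d) * x))"
      by (intro mult_left_mono ab) auto
    also have "\<dots> = \<bar>a * k\<bar> * exp (- a * x) + K * exp (- d * x)"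
      by (simp add: algebra_simps exp_add[symmetric])
    also have "\<dots> \<le> \<bar>a * k\<bar> * exp (- d * x) + K * exp (- d * x)"
      using d x by (intro add_right_mono mult_left_mono) (auto intro!: mult_right_mono)
    finally show ?thesis by (simp add: algebra_simps)
  qed
  then show ?thesis using d exp_conv_deriv[OF v] unfolding exp_bounded_def by (blast intro: DERIV_isCont)
qed

text \<open>The derivative of \<open>exp (- z * x) * v x\<close> is integrated over the half-line.
  Its boundary value at \<open>0\<close> is \<open>a * k\<close>, which is how the point mass enters
  the transform.\<close>

lemma laplace_exp_conv:
  assumes v: "exp_conv a k u v" and a: "0 < a" and u: "exp_bounded u" and z: "Re z \<ge> 0"
  shows "laplace v z = (of_real k + laplace u z) * of_real a / (z + of_real a)"
proof -
  note vb = exp_conv_exp_bounded[OF v a u]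
  define F where "F = (\<lambda>x. exp (- z * of_real x) * of_real (v x))"
  define f where "f = (\<lambda>x. of_real a * (exp (- z * of_real x) * of_real (u x)) - (z + of_real a) * F x)"
  have intF: "set_integrable lborel {0<..} F" unfolding F_def by (rule exp_bounded_set_integrable[OF vb z])
  have intu: "set_integrable lborel {0<..} (\<lambda>x. exp (- z * of_real x) * of_real (u x))"
    by (rule exp_bounded_set_integrable[OF u z])
  have intf: "set_integrable lborel {0<..} f" unfolding f_def
    using intF intu by (intro set_integral_diff set_integrable_mult_right) auto
  have cont: "isCont v x" "isCont u x" for x using vb u by (auto simp: exp_bounded_def)
  have D: "(F has_vector_derivative f x) (at x)" for x
  proof -
    have 1: "((\<lambda>x. complex_of_real (v x)) has_vector_derivative of_real (a * (u x - v x))) (at x)"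
      by (rule has_vector_derivative_of_real)
         (use exp_conv_deriv[OF v, of x] in \<open>simp add: has_real_derivative_iff_has_vector_derivative\<close>)
    have 2: "((\<lambda>x. exp (- z * of_real x)) has_vector_derivative - z * exp (- z * of_real x)) (at x)"
      by (rule has_vector_derivative_real_field) (auto intro!: derivative_eq_intros)
    show ?thesis unfolding F_def f_def
      by (rule has_vector_derivative_eq_rhs[OF has_vector_derivative_mult[OF 2 1]]) (simp add: algebra_simps)
  qed
  obtain C e where e: "e > 0" and C: "\<And>x. x \<ge> 0 \<Longrightarrow> \<bar>v x\<bar> \<le> C * exp (- e * x)"
    using vb by (auto simp: exp_bounded_def)
  have lim: "(F \<longlongrightarrow> 0) at_top"
  proof (rule Lim_null_comparison)
    show "\<forall>\<^sub>F x in at_top. norm (F x) \<le> C * exp (- e * x)"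
      using eventually_ge_at_top[of 0]
    proof eventually_elim
      case (elim x)
      have "exp (- (Re z * x)) * \<bar>v x\<bar> \<le> 1 * (C * exp (- e * x))"
        using C[OF elim] elim z by (intro mult_mono) auto
      then show ?case by (simp add: F_def norm_mult)
    qed
    have "filterlim (\<lambda>x. - e * x) at_bot at_top"
      by (rule filterlim_tendsto_neg_mult_at_bot[OF tendsto_const _ filterlim_ident]) (use e in simp)
    then show "((\<lambda>x. C * exp (- e * x)) \<longlongrightarrow> 0) at_top"
      by (intro tendsto_mult_right_zero filterlim_compose[OF exp_at_bot])
  qed
  have "(LBINT x=ereal 0..\<infinity>. f x) = 0 - F 0"
  proof (rule interval_integral_FTC_integrable)
    show "isCont f x" for x unfolding f_def F_def by (intro continuous_intros cont)
    show "((F \<circ> real_of_ereal) \<longlongrightarrow> F 0) (at_right (ereal 0))"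
      using has_vector_derivative_continuous[OF D, of 0]
      by (auto simp: ereal_tendsto_simps1 continuous_within isCont_def intro: tendsto_within_subset)
    show "((F \<circ> real_of_ereal) \<longlongrightarrow> 0) (at_left \<infinity>)"
      using lim by (simp add: ereal_tendsto_simps1)
  qed (use D intf in auto)
  moreover have "(LBINT x=ereal 0..\<infinity>. f x) = (LINT x:{0<..}|lborel. f x)"
    by (simp add: interval_lebesgue_integral_def)
  moreover have "(LINT x:{0<..}|lborel. f x) = of_real a * laplace u z - (z + of_real a) * laplace v z"
    unfolding f_def laplace_def using intF intu by (simp add: set_integral_diff F_def)
  moreover have "F 0 = of_real a * of_real k" by (simp add: F_def exp_conv_0[OF v])
  moreover have "z + of_real a \<noteq> 0" using a z by (auto simp: complex_eq_iff)
  ultimately show ?thesis by (simp add: field_simps)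
qed

text \<open>For positive \<open>u\<close> the condition says that \<open>u'/u\<close> first falls and then rises. Quantifying over
  all levels \<open>-b\<close> makes it stable under convolution, since \<open>v' + b v\<close> inherits the sign pattern of \<open>u' + b u\<close>.\<close>

definition slope_valley :: "(real \<Rightarrow> real) \<Rightarrow> bool" where
  "slope_valley u \<longleftrightarrow> (\<exists>u'. (\<forall>x. (u has_real_derivative u' x) (at x)) \<and>
     (\<forall>b x y z. 0 < x \<longrightarrow> x < y \<longrightarrow> y < z \<longrightarrow>
        u' x + b * u x < 0 \<longrightarrow> 0 < u' y + b * u y \<longrightarrow> 0 \<le> u' z + b * u z))"

text \<open>For positive \<open>u\<close> this means that \<open>u'/u\<close> does not increase,
  that is, log-concavity on the positive half-line.\<close>

definition slope_falling :: "(real \<Rightarrow> real) \<Rightarrow> bool" where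
  "slope_falling u \<longleftrightarrow> (\<exists>u'. (\<forall>x. (u has_real_derivative u' x) (at x)) \<and>
     (\<forall>b x y. 0 < x \<longrightarrow> x < y \<longrightarrow> u' x + b * u x < 0 \<longrightarrow> u' y + b * u y \<le> 0))"

section \<open>Sign patterns of slopes under exponential convolution\<close>

lemma MVT_sign:
  fixes W :: "real \<Rightarrow> real"
  assumes W: "\<And>x. (W has_real_derivative W' x) (at x)" and "x < y"
  shows "W x < W y \<Longrightarrow> \<exists>t>x. t < y \<and> 0 < W' t" "W y < W x \<Longrightarrow> \<exists>t>x. t < y \<and> W' t < 0"
proof -
  obtain t where t: "x < t" "t < y" "W y - W x = (y - x) * W' t"
    using MVT2[OF \<open>x < y\<close>, of W W'] W by auto
  show "\<exists>t>x. t < y \<and> 0 < W' t" if "W x < W y"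
  proof -
    have "0 < (y - x) * W' t" using t that by linarith
    then show ?thesis using t \<open>x < y\<close> by (auto simp: zero_less_mult_iff)
  qed
  show "\<exists>t>x. t < y \<and> W' t < 0" if "W y < W x"
  proof -
    have "(y - x) * W' t < 0" using t that by linarith
    then show ?thesis using t \<open>x < y\<close> by (auto simp: mult_less_0_iff)
  qed
qed

text \<open>The scaled slope of \<open>v\<close> has a positive multiple of the slope of
  \<open>u\<close> at the same level \<open>b\<close> as its derivative. Each rise or fall of the
  former therefore exhibits a point where the latter has the corresponding sign.\<close>

lemma exp_conv_slope_deriv:
  assumes v: "exp_conv a k u v" and u: "(u has_real_derivative u' x) (at x)"
  shows "((\<lambda>x. exp (a * x) * (a * (u x - v x) + b * v x)) has_real_derivative a * exp (a * x) * (u' x + b * u x)) (at x)"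
  by (auto intro!: derivative_eq_intros exp_conv_deriv[OF v] u simp: algebra_simps)

text \<open>\<open>W\<close> starts nonnegative because \<open>v\<close> vanishes at
  \<open>0\<close> and \<open>u 0\<close> is nonnegative. A pattern -, +, - of \<open>W\<close> thus
  contains a fall, a rise and a fall, which \<open>exp_conv_slope_deriv\<close> converts into the
  forbidden pattern for \<open>u\<close>.\<close>

lemma exp_conv_slope_valley:
  assumes v: "exp_conv a 0 u v" and a: "0 < a" and u0: "0 \<le> u 0" and u: "slope_valley u"
  shows "slope_valley v"
proof -
  obtain u' where u': "\<And>x. (u has_real_derivative u' x) (at x)"
    and sg: "\<And>b x y z. 0 < x \<Longrightarrow> x < y \<Longrightarrow> y < z \<Longrightarrow> u' x + b * u x < 0 \<Longrightarrow> 0 < u' y + b * u y \<Longrightarrow> 0 \<le> u' z + b * u z"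
    using u unfolding slope_valley_def by blast
  have "0 \<le> a * (u z - v z) + b * v z"
    if xyz: "0 < x" "x < y" "y < z" and x: "a * (u x - v x) + b * v x < 0" and y: "0 < a * (u y - v y) + b * v y" for b x y z
  proof (rule ccontr)
    assume z: "\<not> ?thesis"
    define W where "W = (\<lambda>x. exp (a * x) * (a * (u x - v x) + b * v x))"
    note D = exp_conv_slope_deriv[where u' = u' and b = b, OF v u', folded W_def]
    have "W 0 \<ge> 0" using a u0 exp_conv_0[OF v] by (simp add: W_def)
    moreover have W: "W x < 0" "0 < W y" "W z < 0" using x y z by (auto simp: W_def mult_less_0_iff not_le)
    ultimately obtain r where r: "0 < r" "r < x" "a * exp (a * r) * (u' r + b * u r) < 0"
      using MVT_sign(2)[OF D, of 0 x] xyz by auto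
    obtain s where s: "x < s" "s < y" "0 < a * exp (a * s) * (u' s + b * u s)"
      using MVT_sign(1)[OF D, of x y] xyz W by auto
    obtain t where t: "y < t" "t < z" "a * exp (a * t) * (u' t + b * u t) < 0"
      using MVT_sign(2)[OF D, of y z] xyz W by auto
    have "u' r + b * u r < 0" "0 < u' s + b * u s" "u' t + b * u t < 0"
      using r(3) s(3) t(3) a by (simp_all add: mult_less_0_iff zero_less_mult_iff)
    then show False using sg[where x = r and y = s and z = t and b = b] r s t by auto
  qed
  then show ?thesis unfolding slope_valley_def using exp_conv_deriv[OF v]
    by (intro exI[of _ "\<lambda>x. a * (u x - v x)"]) blast
qed

lemma exp_conv_slope_falling:
  assumes v: "exp_conv a 0 u v" and a: "0 < a" and u0: "0 \<le> u 0" and u: "slope_falling u"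
  shows "slope_falling v"
proof -
  obtain u' where u': "\<And>x. (u has_real_derivative u' x) (at x)"
    and sg: "\<And>b x y. 0 < x \<Longrightarrow> x < y \<Longrightarrow> u' x + b * u x < 0 \<Longrightarrow> u' y + b * u y \<le> 0"
    using u unfolding slope_falling_def by blast
  have "a * (u y - v y) + b * v y \<le> 0"
    if xyz: "0 < x" "x < y" and x: "a * (u x - v x) + b * v x < 0" for b x y
  proof (rule ccontr)
    assume y: "\<not> ?thesis"
    define W where "W = (\<lambda>x. exp (a * x) * (a * (u x - v x) + b * v x))"
    note D = exp_conv_slope_deriv[where u' = u' and b = b, OF v u', folded W_def]
    have "W 0 \<ge> 0" using a u0 exp_conv_0[OF v] by (simp add: W_def)
    moreover have W: "W x < 0" "0 < W y" using x y by (auto simp: W_def mult_less_0_iff not_le)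
    ultimately obtain r where r: "0 < r" "r < x" "a * exp (a * r) * (u' r + b * u r) < 0"
      using MVT_sign(2)[OF D, of 0 x] xyz by auto
    obtain s where s: "x < s" "s < y" "0 < a * exp (a * s) * (u' s + b * u s)"
      using MVT_sign(1)[OF D, of x y] xyz W by auto
    have "u' r + b * u r < 0" "0 < u' s + b * u s"
      using r(3) s(3) a by (simp_all add: mult_less_0_iff zero_less_mult_iff)
    then show False using sg[where x = r and y = s and b = b] r s by auto
  qed
  then show ?thesis unfolding slope_falling_def using exp_conv_deriv[OF v]
    by (intro exI[of _ "\<lambda>x. a * (u x - v x)"]) blast
qed

text \<open>This is for the first convolution, where the point mass \<open>k\<close> leaves the sign
  of \<open>W\<close> at \<open>0\<close> open. Log-convexity of \<open>u\<close> compensates: a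
  rise of \<open>W\<close> followed by a fall already contradicts it.\<close>

lemma exp_conv_log_convex_slope_valley:
  assumes v: "exp_conv a k u v" and a: "0 < a"
    and u': "\<And>x. (u has_real_derivative u' x) (at x)"
    and sg: "\<And>b x y. x < y \<Longrightarrow> 0 < u' x + b * u x \<Longrightarrow> 0 \<le> u' y + b * u y"
  shows "slope_valley v"
proof -
  have "0 \<le> a * (u z - v z) + b * v z"
    if xyz: "0 < x" "x < y" "y < z" and x: "a * (u x - v x) + b * v x < 0" and y: "0 < a * (u y - v y) + b * v y" for b x y z
  proof (rule ccontr)
    assume z: "\<not> ?thesis"
    define W where "W = (\<lambda>x. exp (a * x) * (a * (u x - v x) + b * v x))"
    note D = exp_conv_slope_deriv[where u' = u' and b = b, OF v u', folded W_def]
    have W: "W x < 0" "0 < W y" "W z < 0" using x y z by (auto simp: W_def mult_less_0_iff not_le)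
    obtain s where s: "x < s" "s < y" "0 < a * exp (a * s) * (u' s + b * u s)"
      using MVT_sign(1)[OF D, of x y] xyz W by auto
    obtain t where t: "y < t" "t < z" "a * exp (a * t) * (u' t + b * u t) < 0"
      using MVT_sign(2)[OF D, of y z] xyz W by auto
    have "0 < u' s + b * u s" "u' t + b * u t < 0"
      using s(3) t(3) a by (simp_all add: mult_less_0_iff zero_less_mult_iff)
    then show False using sg[where x = s and y = t and b = b] s t by auto
  qed
  then show ?thesis unfolding slope_valley_def using exp_conv_deriv[OF v]
    by (intro exI[of _ "\<lambda>x. a * (u x - v x)"]) blast
qed

text \<open>The scaled slope is \<open>a * exp (a * x) * u x\<close> plus \<open>b - a\<close> times
  the nondecreasing function \<open>Z\<close>. It can be negative only for \<open>b \<le> a\<close>,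
  and then both parts are nonincreasing, so it stays negative.\<close>

lemma exp_conv_decreasing_slope_falling:
  assumes v: "exp_conv a k u v" and a: "0 < a" and k: "0 \<le> k"
    and u: "\<And>x. 0 \<le> x \<Longrightarrow> 0 \<le> u x"
    and decr: "\<And>x y. 0 \<le> x \<Longrightarrow> x \<le> y \<Longrightarrow> exp (a * y) * u y \<le> exp (a * x) * u x"
  shows "slope_falling v"
proof -
  have "a * (u y - v y) + b * v y \<le> 0"
    if xy: "0 < x" "x < y" and x: "a * (u x - v x) + b * v x < 0" for b x y
  proof -
    define Z where "Z = (\<lambda>x. exp (a * x) * v x)"
    have eq: "exp (a * x) * (a * (u x - v x) + b * v x) = a * (exp (a * x) * u x) + (b - a) * Z x" for x
      by (simp add: Z_def algebra_simps)
    have "Z x \<le> Z y"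
    proof (rule DERIV_nonneg_imp_nondecreasing[where f = Z and a = x and b = y])
      show "x \<le> y" using xy by simp
      fix t assume t: "x \<le> t" "t \<le> y"
      then have "0 \<le> a * exp (a * t) * u t" using a u xy by simp
      then show "\<exists>z. (Z has_real_derivative z) (at t) \<and> 0 \<le> z"
        using exp_conv_scaled_deriv[OF v] unfolding Z_def by blast
    qed
    have neg: "a * (exp (a * x) * u x) + (b - a) * Z x < 0" using x unfolding eq[symmetric] by (simp add: mult_less_0_iff)
    have "b \<le> a"
    proof (rule ccontr)
      assume "\<not> b \<le> a"
      moreover have "0 \<le> Z x" using exp_conv_nonneg[OF v a k u] xy by (simp add: Z_def)
      ultimately have "0 \<le> (b - a) * Z x" by simp
      moreover have "0 \<le> a * (exp (a * x) * u x)" using a u xy by simp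
      ultimately show False using neg by linarith
    qed
    then have "(b - a) * Z y \<le> (b - a) * Z x" using \<open>Z x \<le> Z y\<close> by (intro mult_left_mono_neg) auto
    moreover have "a * (exp (a * y) * u y) \<le> a * (exp (a * x) * u x)"
      using decr[of x y] xy a by (intro mult_left_mono) auto
    ultimately have "a * (exp (a * y) * u y) + (b - a) * Z y < 0" using neg by linarith
    then show ?thesis unfolding eq[symmetric] by (simp add: mult_less_0_iff)
  qed
  then show ?thesis unfolding slope_falling_def using exp_conv_deriv[OF v]
    by (intro exI[of _ "\<lambda>x. a * (u x - v x)"]) blast
qed

definition nice :: "(real \<Rightarrow> real) \<Rightarrow> bool" where
  "nice u \<longleftrightarrow> exp_bounded u \<and> 0 \<le> u 0 \<and> (\<forall>x>0. 0 < u x)"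

lemma nice_nonneg: "nice u \<Longrightarrow> 0 \<le> x \<Longrightarrow> 0 \<le> u x"
  unfolding nice_def by (cases "x = 0") (auto intro: less_imp_le)

lemma exp_conv_nice:
  assumes "exp_conv a k u v" "0 < a" "0 \<le> k" "exp_bounded u" "\<And>x. 0 \<le> x \<Longrightarrow> 0 \<le> u x" "0 < k \<or> (\<forall>x>0. 0 < u x)"
  shows "nice v"
  unfolding nice_def
  using assms exp_conv_pos[of a k u v] exp_conv_nonneg[of a k u v 0] exp_conv_exp_bounded[of a k u v] by auto

lemma exp_conv_chain:
  assumes P: "\<And>a u v. exp_conv a 0 u v \<Longrightarrow> 0 < a \<Longrightarrow> 0 \<le> u 0 \<Longrightarrow> P u \<Longrightarrow> P v"
    and u: "nice u" "P u" and as: "\<forall>a\<in>set as. 0 < a"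
  shows "\<exists>v. nice v \<and> P v \<and> (\<forall>z. Re z \<ge> 0 \<longrightarrow> laplace v z = laplace u z / (\<Prod>a\<leftarrow>as. 1 + z / of_real a))"
  using as
proof (induction as)
  case Nil
  then show ?case using u by (intro exI[of _ u]) auto
next
  case (Cons a as)
  then obtain v where v: "nice v" "P v" "\<And>z. Re z \<ge> 0 \<Longrightarrow> laplace v z = laplace u z / (\<Prod>a\<leftarrow>as. 1 + z / of_real a)"
    by auto
  have a: "0 < a" using Cons.prems by simp
  obtain w where w: "exp_conv a 0 v w" using exp_conv_exists[of v a 0] v(1) by (auto simp: nice_def exp_bounded_def)
  have "nice w" by (rule exp_conv_nice[OF w a]) (use v(1) nice_nonneg in \<open>auto simp: nice_def\<close>)
  moreover have "P w" using P[OF w a] v by (auto simp: nice_def)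
  moreover have "laplace w z = laplace u z / (\<Prod>a\<leftarrow>a # as. 1 + z / of_real a)" if "Re z \<ge> 0" for z
  proof -
    have "z + of_real a \<noteq> 0" using a that by (auto simp: complex_eq_iff)
    have "laplace w z = laplace v z * (of_real a / (z + of_real a))"
      using laplace_exp_conv[OF w a _ that] v(1) by (simp add: nice_def)
    also have "of_real a / (z + of_real a) = 1 / (1 + z / of_real a)"
      using a \<open>z + of_real a \<noteq> 0\<close> by (simp add: field_simps)
    finally show ?thesis using v(3)[OF that] by simp
  qed
  ultimately show ?case by blast
qed

section \<open>Interlacing zeros and poles\<close>

lemma partial_fraction_step:
  fixes z p q r :: complex
  assumes "p \<noteq> 0" "q \<noteq> 0" "r \<noteq> 0" "p \<noteq> r" "z + p \<noteq> 0" "z + r \<noteq> 0"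
  shows "1 / (1 + z / r) * ((1 + z / q) / (1 + z / p)) =
    (1 - r / q) / (1 - r / p) / (1 + z / r) + (1 - p / q) / (1 - p / r) / (1 + z / p)"
proof -
  have "r - p \<noteq> 0" using assms by simp
  have *: "1 - r / p = - (r - p) / p" "1 - p / r = (r - p) / r" "1 + z / r = (z + r) / r" "1 + z / p = (z + p) / p"
     "1 + z / q = (z + q) / q" "1 - r / q = (q - r) / q" "1 - p / q = (q - p) / q"
    using assms by (auto simp: field_simps)
  show ?thesis
    unfolding * using assms \<open>r - p \<noteq> 0\<close> by (simp add: divide_simps) (simp add: algebra_simps)
qed

lemma partial_fraction_one:
  fixes z p q :: complex
  assumes "p \<noteq> 0" "q \<noteq> 0" "z + p \<noteq> 0"
  shows "(1 + z / q) / (1 + z / p) = p / q + (1 - p / q) / (1 + z / p)"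
proof -
  have *: "1 + z / p = (z + p) / p" "1 + z / q = (z + q) / q" "1 - p / q = (q - p) / q"
    using assms by (auto simp: field_simps)
  show ?thesis
    unfolding * using assms by (simp add: divide_simps) (simp add: algebra_simps)
qed

text \<open>Induction adds the largest pole \<open>p n\<close>. An old coefficient is multiplied by
  the value of the new factor at \<open>- p i\<close>, positive or zero since
  \<open>p i < p n \<le> q n\<close>. The new coefficient is \<open>1 - p n / q n\<close> times the
  value \<open>K\<close> of the old product at \<open>- p n\<close>, where every factor is a
  quotient of two negative numbers because \<open>q i < p n\<close>.\<close>

lemma interlacing_partial_fractions:
  fixes p q :: "nat \<Rightarrow> real"
  assumes "\<And>i. i < n \<Longrightarrow> 0 < p i" "\<And>i. i < n \<Longrightarrow> p i \<le> q i" "\<And>i. Suc i < n \<Longrightarrow> q i < p (Suc i)"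
  shows "\<exists>A k. 0 < k \<and> (\<forall>i<n. 0 \<le> A i) \<and> (\<forall>z::complex. (\<forall>i<n. z + of_real (p i) \<noteq> 0) \<longrightarrow>
    of_real k + (\<Sum>i<n. of_real (A i) / (1 + z / of_real (p i))) = (\<Prod>i<n. (1 + z / of_real (q i)) / (1 + z / of_real (p i))))"
  using assms
proof (induction n)
  case 0
  then show ?case by (intro exI[of _ "\<lambda>_. 0"] exI[of _ 1]) auto
next
  case (Suc n)
  have pos: "0 < p i" "0 < q i" if "i < Suc n" for i using Suc.prems(1,2)[OF that] by auto
  have inc: "q i < p n" if "i < n" for i
  proof -
    have "q i < p (Suc j)" if "i \<le> j" "Suc j < Suc n" for j using that
    proof (induction j rule: dec_induct)
      case base then show ?case using Suc.prems(3) by simp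
    next
      case (step j)
      then show ?case using Suc.prems(2)[of "Suc j"] Suc.prems(3)[of "Suc j"] by (smt (verit) Suc_lessD)
    qed
    from this[of "n - 1"] that show ?thesis by simp
  qed
  have less: "p i < p n" if "i < n" for i using inc[OF that] Suc.prems(2)[of i] that by simp
  obtain A k where k: "0 < k" and A: "\<And>i. i < n \<Longrightarrow> 0 \<le> A i"
    and eq: "\<And>z::complex. (\<And>i. i < n \<Longrightarrow> z + of_real (p i) \<noteq> 0) \<Longrightarrow>
    of_real k + (\<Sum>i<n. of_real (A i) / (1 + z / of_real (p i))) = (\<Prod>i<n. (1 + z / of_real (q i)) / (1 + z / of_real (p i)))"
    using Suc.IH Suc.prems by (force simp: less_Suc_eq)
  define K where "K = k + (\<Sum>i<n. A i / (1 - p n / p i))"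
  have "complex_of_real K = of_real (\<Prod>i<n. (1 - p n / q i) / (1 - p n / p i))"
  proof -
    have "- of_real (p n) + of_real (p i) \<noteq> (0::complex)" if "i < n" for i
      using less[OF that] by (auto simp flip: of_real_minus of_real_add)
    from eq[of "- of_real (p n)"] this show ?thesis by (simp add: K_def)
  qed
  then have "K = (\<Prod>i<n. (1 - p n / q i) / (1 - p n / p i))" by (simp only: of_real_eq_iff)
  also have "\<dots> \<ge> 0"
    using inc less pos by (intro prod_nonneg) (auto intro!: divide_nonpos_nonpos simp: less_imp_le)
  finally have K: "0 \<le> K" .
  define B where "B i = (if i < n then A i * ((1 - p i / q n) / (1 - p i / p n)) else (1 - p n / q n) * K)" for i
  have pq: "p n \<le> q n" "0 < p n" "0 < q n" using Suc.prems(2)[of n] pos[of n] by auto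
  show ?case
  proof (intro exI[of _ B] exI[of _ "k * (p n / q n)"] conjI allI impI)
    show "0 < k * (p n / q n)" using k pq by simp
    show "0 \<le> B i" if "i < Suc n" for i
      using that A[of i] less[of i] K pq by (auto simp: B_def less_Suc_eq intro!: mult_nonneg_nonneg divide_nonneg_nonneg)
    fix z :: complex assume "\<forall>i<Suc n. z + complex_of_real (p i) \<noteq> 0"
    then have z: "z + of_real (p i) \<noteq> 0" if "i < Suc n" for i using that by auto
    define f where "f = (1 + z / of_real (q n)) / (1 + z / of_real (p n))"
    have st: "1 / (1 + z / of_real (p i)) * f = of_real ((1 - p i / q n) / (1 - p i / p n)) / (1 + z / of_real (p i))
       + of_real ((1 - p n / q n) / (1 - p n / p i)) / (1 + z / of_real (p n))" if "i < n" for i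
      unfolding f_def
      using partial_fraction_step[of "of_real (p n)" "of_real (q n)" "of_real (p i)" z] pos[of i] pq less[OF that] z that by auto
    have "(\<Prod>i<Suc n. (1 + z / of_real (q i)) / (1 + z / of_real (p i))) =
      (of_real k + (\<Sum>i<n. of_real (A i) / (1 + z / of_real (p i)))) * f"
      using eq[of z] z by (simp add: f_def)
    also have "\<dots> = of_real k * f + (\<Sum>i<n. of_real (A i) * (1 / (1 + z / of_real (p i)) * f))"
      by (simp add: distrib_right sum_distrib_right)
    also have "(\<Sum>i<n. of_real (A i) * (1 / (1 + z / of_real (p i)) * f)) =
       (\<Sum>i<n. of_real (B i) / (1 + z / of_real (p i)) + of_real (A i / (1 - p n / p i)) * (of_real (1 - p n / q n) / (1 + z / of_real (p n))))"
      by (intro sum.cong refl, subst st) (auto simp: B_def distrib_left)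
    also have "\<dots> = (\<Sum>i<n. of_real (B i) / (1 + z / of_real (p i))) + of_real (K - k) * (of_real (1 - p n / q n) / (1 + z / of_real (p n)))"
      by (simp only: sum.distrib sum_distrib_right of_real_sum K_def add_diff_cancel_left')
    also have "of_real k * f = of_real (k * (p n / q n)) + of_real k * (of_real (1 - p n / q n) / (1 + z / of_real (p n)))"
      unfolding f_def using partial_fraction_one[of "of_real (p n)" "of_real (q n)" z] pq z[of n]
      by (simp add: distrib_left)
    finally show "of_real (k * (p n / q n)) + (\<Sum>i<Suc n. of_real (B i) / (1 + z / of_real (p i))) =
       (\<Prod>i<Suc n. (1 + z / of_real (q i)) / (1 + z / of_real (p i)))"
      by (simp add: B_def algebra_simps diff_divide_distrib add_divide_distrib)
  qed
qed

text \<open>A summand \<open>A / (1 + z / p)\<close> is the transform of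
  \<open>A * p * exp (- p * x)\<close>, and the constant \<open>k\<close> is that of a point mass.
  An interlacing product is therefore the transform of an atom at \<open>0\<close> plus a mixture of
  exponentials with nonnegative weights.\<close>

lemma interlacing_exponential_sum:
  fixes p q :: "nat \<Rightarrow> real"
  assumes "\<And>i. i < n \<Longrightarrow> 0 < p i" "\<And>i. i < n \<Longrightarrow> p i \<le> q i" "\<And>i. Suc i < n \<Longrightarrow> q i < p (Suc i)"
  shows "\<exists>A k. 0 < k \<and> (\<forall>i<n. 0 \<le> A i) \<and> exp_bounded (\<lambda>x. \<Sum>i<n. A i * exp (- p i * x)) \<and>
    (\<forall>z. Re z \<ge> 0 \<longrightarrow> of_real k + laplace (\<lambda>x. \<Sum>i<n. A i * exp (- p i * x)) z =
       (\<Prod>i<n. (1 + z / of_real (q i)) / (1 + z / of_real (p i))))"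
proof -
  obtain A k where k: "0 < k" and A: "\<And>i. i < n \<Longrightarrow> 0 \<le> A i"
    and eq: "\<And>z::complex. (\<And>i. i < n \<Longrightarrow> z + of_real (p i) \<noteq> 0) \<Longrightarrow>
    of_real k + (\<Sum>i<n. of_real (A i) / (1 + z / of_real (p i))) = (\<Prod>i<n. (1 + z / of_real (q i)) / (1 + z / of_real (p i)))"
    using interlacing_partial_fractions[of n p q, OF assms] by blast
  have *: "exp_bounded (\<lambda>x. \<Sum>i<m. (A i * p i) * exp (- p i * x)) \<and>
     (\<forall>z. Re z \<ge> 0 \<longrightarrow> laplace (\<lambda>x. \<Sum>i<m. (A i * p i) * exp (- p i * x)) z = (\<Sum>i<m. of_real (A i) / (1 + z / of_real (p i))))"
    if "m \<le> n" for m
    using that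
  proof (induction m)
    case 0
    show ?case by (auto simp: exp_bounded_def laplace_def intro!: exI[of _ 1])
  next
    case (Suc m)
    have pm: "0 < p m" using assms(1)[of m] Suc.prems by simp
    have 1: "exp_bounded (\<lambda>x. (A m * p m) * exp (- p m * x))"
      by (rule exp_bounded_cmult, rule laplace_exp(1)[of _ 0]) (use pm in auto)
    have 2: "laplace (\<lambda>x. (A m * p m) * exp (- p m * x)) z = of_real (A m) / (1 + z / of_real (p m))" if "Re z \<ge> 0" for z
    proof -
      have "z + of_real (p m) \<noteq> 0" using that pm by (auto simp: complex_eq_iff)
      then show ?thesis using pm that
        by (subst laplace_cmult, subst laplace_exp(2)) (auto simp: field_simps)
    qed
    show ?case using Suc 1 2
      by (auto simp: laplace_add simp del: mult_minus_left intro!: exp_bounded_add)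
  qed
  have "of_real k + laplace (\<lambda>x. \<Sum>i<n. (A i * p i) * exp (- p i * x)) z =
       (\<Prod>i<n. (1 + z / of_real (q i)) / (1 + z / of_real (p i)))" if "Re z \<ge> 0" for z
  proof -
    have "z + of_real (p i) \<noteq> 0" if "i < n" for i
      using \<open>Re z \<ge> 0\<close> assms(1)[OF that] by (auto simp: complex_eq_iff)
    from eq[OF this] show ?thesis using *[of n] that by simp
  qed
  moreover have "\<forall>i<n. 0 \<le> A i * p i" using A assms(1) by (metis mult_nonneg_nonneg less_imp_le)
  ultimately show ?thesis using k * by (intro exI[of _ "\<lambda>i. A i * p i"] exI[of _ k]) blast
qed

lemma exp_conv_interlacing_laplace:
  assumes v: "exp_conv a k u v" and a: "0 < a" and u: "exp_bounded u" and z: "Re z \<ge> 0"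
    and eq: "of_real k + laplace u z = R"
  shows "laplace v z = R / (1 + z / of_real a)"
proof -
  have "z + of_real a \<noteq> 0" using a z by (auto simp: complex_eq_iff)
  then show ?thesis using laplace_exp_conv[OF v a u z] a eq by (simp add: field_simps)
qed

text \<open>Mixtures of exponentials are log-convex, so the first convolution, which absorbs the
  atom, falls under \<open>exp_conv_log_convex_slope_valley\<close>; the later ones fall under
  \<open>exp_conv_slope_valley\<close>.\<close>

theorem interlacing_slope_valley:
  fixes p q :: "nat \<Rightarrow> real"
  assumes pq: "\<And>i. i < n \<Longrightarrow> 0 < p i" "\<And>i. i < n \<Longrightarrow> p i \<le> q i" "\<And>i. Suc i < n \<Longrightarrow> q i < p (Suc i)"
    and a: "0 < a" and as: "\<forall>a\<in>set as. 0 < a"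
  shows "\<exists>v. nice v \<and> slope_valley v \<and> (\<forall>z. Re z \<ge> 0 \<longrightarrow> laplace v z =
    (\<Prod>i<n. (1 + z / of_real (q i)) / (1 + z / of_real (p i))) / (\<Prod>a\<leftarrow>a # as. 1 + z / of_real a))"
proof -
  obtain A k where k: "0 < k" and A: "\<And>i. i < n \<Longrightarrow> 0 \<le> A i"
    and b: "exp_bounded (\<lambda>x. \<Sum>i<n. A i * exp (- p i * x))"
    and eq: "\<And>z. Re z \<ge> 0 \<Longrightarrow> of_real k + laplace (\<lambda>x. \<Sum>i<n. A i * exp (- p i * x)) z =
       (\<Prod>i<n. (1 + z / of_real (q i)) / (1 + z / of_real (p i)))"
    using interlacing_exponential_sum[of n p q, OF pq] by blast
  define G where "G = (\<lambda>x. \<Sum>i<n. A i * exp (- p i * x))"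
  note b = b[folded G_def] and eq = eq[folded G_def]
  define G' where "G' = (\<lambda>x. \<Sum>i<n. A i * (- p i * exp (- p i * x)))"
  have D: "(G has_real_derivative G' x) (at x)" for x
    unfolding G_def G'_def by (auto intro!: derivative_eq_intros sum.cong)
  have G0: "0 \<le> G x" for x unfolding G_def using A by (auto intro!: sum_nonneg)
  obtain u where u: "exp_conv a k G u" using exp_conv_exists[of G a k] b by (auto simp: exp_bounded_def)
  have un: "nice u" by (rule exp_conv_nice[OF u a _ b]) (use k G0 in auto)
  have uv: "slope_valley u"
  proof (rule exp_conv_log_convex_slope_valley[where u' = G', OF u a D])
    fix b x y :: real assume xy: "x < y" and pos: "0 < G' x + b * G x"
    \<comment> \<open>Summand by summand, \<open>c * exp (c * x)\<close> is nondecreasing in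
      \<open>x\<close> for either sign of \<open>c\<close>.\<close>
    have e: "exp (b * x) * (G' x + b * G x) = (\<Sum>i<n. A i * ((b - p i) * exp ((b - p i) * x)))" for x
      unfolding G_def G'_def sum_distrib_left sum.distrib[symmetric]
      by (intro sum.cong) (auto simp: algebra_simps exp_add exp_diff exp_minus divide_inverse)
    have "exp (b * x) * (G' x + b * G x) \<le> exp (b * y) * (G' y + b * G y)"
      unfolding e
    proof (rule sum_mono, rule mult_left_mono)
      fix i assume "i \<in> {..<n}"
      then show "0 \<le> A i" using A by simp
      show "(b - p i) * exp ((b - p i) * x) \<le> (b - p i) * exp ((b - p i) * y)"
      proof (cases "b - p i \<ge> 0")
        case True then show ?thesis using xy by (intro mult_left_mono) (auto intro!: mult_left_mono)
      next
        case False then show ?thesis using xy by (intro mult_left_mono_neg) (auto intro!: mult_left_mono_neg)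
      qed
    qed
    moreover have "0 < exp (b * x) * (G' x + b * G x)" using pos by simp
    ultimately have "0 < exp (b * y) * (G' y + b * G y)" by linarith
    then show "0 \<le> G' y + b * G y" by (simp add: zero_less_mult_iff)
  qed
  have "\<exists>v. nice v \<and> slope_valley v \<and> (\<forall>z. Re z \<ge> 0 \<longrightarrow> laplace v z = laplace u z / (\<Prod>a\<leftarrow>as. 1 + z / of_real a))"
    by (rule exp_conv_chain[where P = slope_valley, OF _ un uv as]) (rule exp_conv_slope_valley)
  then obtain v where "nice v" "slope_valley v" "\<And>z. Re z \<ge> 0 \<Longrightarrow> laplace v z = laplace u z / (\<Prod>a\<leftarrow>as. 1 + z / of_real a)"
    by blast
  then show ?thesis using exp_conv_interlacing_laplace[OF u a b _ eq] by auto
qed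

text \<open>The condition that \<open>a\<close> lies below all poles makes
  \<open>exp (a * x) * G x\<close> a sum of nonincreasing exponentials. This is what yields
  log-concavity in place of a valley.\<close>

theorem interlacing_slope_falling:
  fixes p q :: "nat \<Rightarrow> real"
  assumes pq: "\<And>i. i < n \<Longrightarrow> 0 < p i" "\<And>i. i < n \<Longrightarrow> p i \<le> q i" "\<And>i. Suc i < n \<Longrightarrow> q i < p (Suc i)"
    and a: "0 < a" "\<And>i. i < n \<Longrightarrow> a \<le> p i" and as: "\<forall>a\<in>set as. 0 < a"
  shows "\<exists>v. nice v \<and> slope_falling v \<and> (\<forall>z. Re z \<ge> 0 \<longrightarrow> laplace v z =
    (\<Prod>i<n. (1 + z / of_real (q i)) / (1 + z / of_real (p i))) / (\<Prod>a\<leftarrow>a # as. 1 + z / of_real a))"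
proof -
  obtain A k where k: "0 < k" and A: "\<And>i. i < n \<Longrightarrow> 0 \<le> A i"
    and b: "exp_bounded (\<lambda>x. \<Sum>i<n. A i * exp (- p i * x))"
    and eq: "\<And>z. Re z \<ge> 0 \<Longrightarrow> of_real k + laplace (\<lambda>x. \<Sum>i<n. A i * exp (- p i * x)) z =
       (\<Prod>i<n. (1 + z / of_real (q i)) / (1 + z / of_real (p i)))"
    using interlacing_exponential_sum[of n p q, OF pq] by blast
  define G where "G = (\<lambda>x. \<Sum>i<n. A i * exp (- p i * x))"
  note b = b[folded G_def] and eq = eq[folded G_def]
  have G0: "0 \<le> G x" for x unfolding G_def using A by (auto intro!: sum_nonneg)
  obtain u where u: "exp_conv a k G u" using exp_conv_exists[of G a k] b by (auto simp: exp_bounded_def)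
  have un: "nice u" by (rule exp_conv_nice[OF u a(1) _ b]) (use k G0 in auto)
  have uv: "slope_falling u"
  proof (rule exp_conv_decreasing_slope_falling[OF u a(1) _ G0])
    fix x y :: real assume xy: "x \<le> y"
    have e: "exp (a * x) * G x = (\<Sum>i<n. A i * exp (- ((p i - a) * x)))" for x
      unfolding G_def sum_distrib_left
      by (intro sum.cong) (auto simp: algebra_simps exp_add exp_diff exp_minus divide_inverse)
    show "exp (a * y) * G y \<le> exp (a * x) * G x" unfolding e
      using a A xy by (intro sum_mono mult_left_mono) (auto intro!: mult_left_mono)
  qed (use k in auto)
  have "\<exists>v. nice v \<and> slope_falling v \<and> (\<forall>z. Re z \<ge> 0 \<longrightarrow> laplace v z = laplace u z / (\<Prod>a\<leftarrow>as. 1 + z / of_real a))"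
    by (rule exp_conv_chain[where P = slope_falling, OF _ un uv as]) (rule exp_conv_slope_falling)
  then obtain v where "nice v" "slope_falling v" "\<And>z. Re z \<ge> 0 \<Longrightarrow> laplace v z = laplace u z / (\<Prod>a\<leftarrow>as. 1 + z / of_real a)"
    by blast
  then show ?thesis using exp_conv_interlacing_laplace[OF u a(1) b _ eq] by auto
qed

section \<open>Four-point inequalities\<close>

lemma slope_mono_four_points:
  assumes D: "\<And>x. (u has_real_derivative u' x) (at x)" and pos: "\<And>x. x \<in> {p..t} \<Longrightarrow> 0 < u x"
    and sg: "\<And>x y. p \<le> x \<Longrightarrow> x \<le> y \<Longrightarrow> y \<le> t \<Longrightarrow> 0 \<le> s * (u' x / u x - u' y / u y)"
    and pr: "p \<le> r" "p \<le> r'" "r + r' = p + t"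
  shows "s * (ln (u p) + ln (u t)) \<le> s * (ln (u r) + ln (u r'))"
proof -
  have main: "s * (ln (u p) + ln (u t)) \<le> s * (ln (u r) + ln (u r'))" if pr: "p \<le> r" "r \<le> r'" "r + r' = p + t" for r r'
  proof -
    define \<phi> where "\<phi> = (\<lambda>h. s * (ln (u (p + h)) + ln (u (t - h))))"
    have "\<phi> 0 \<le> \<phi> (r - p)"
    proof (rule DERIV_nonneg_imp_nondecreasing[where f = \<phi> and a = 0 and b = "r - p"])
      show "0 \<le> r - p" using pr by simp
      fix h assume h: "0 \<le> h" "h \<le> r - p"
      have u: "0 < u (p + h)" "0 < u (t - h)" using h pr by (auto intro!: pos)
      have "(\<phi> has_real_derivative s * (u' (p + h) / u (p + h) - u' (t - h) / u (t - h))) (at h)"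
        unfolding \<phi>_def using u
        by (auto intro!: derivative_eq_intros DERIV_chain2[OF D] simp: divide_simps)
      moreover have "0 \<le> s * (u' (p + h) / u (p + h) - u' (t - h) / u (t - h))"
        by (rule sg) (use h pr in auto)
      ultimately show "\<exists>y. (\<phi> has_real_derivative y) (at h) \<and> 0 \<le> y" by blast
    qed
    moreover have "t - (r - p) = r'" using pr by simp
    ultimately show ?thesis by (simp add: \<phi>_def)
  qed
  show ?thesis using main[of r r'] main[of r' r] pr by (cases "r \<le> r'") (auto simp: add.commute)
qed

lemma four_points_exp:
  assumes "0 < a" "0 < b" "0 < c" "0 < d"
  shows "ln a + ln b \<le> ln c + ln d \<longleftrightarrow> a * b \<le> c * (d::real)"
proof -
  have "ln a + ln b = ln (a * b)" "ln c + ln d = ln (c * d)" using assms by (simp_all add: ln_mult)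
  then show ?thesis using assms by simp
qed

text \<open>A level strictly between two increasing values of \<open>u'/u\<close> gives a
  \<open>b\<close> at which \<open>u' + b u\<close> changes from negative to positive, which is
  excluded. So \<open>u'/u\<close> is nonincreasing, and moving the outer points inwards can only
  raise the sum of logarithms.\<close>

lemma slope_falling_four_points:
  assumes u: "nice u" and f: "slope_falling u" and p: "0 < p" "p \<le> r" "p \<le> r'" "r + r' = p + t"
  shows "u p * u t \<le> u r * u r'"
proof -
  obtain u' where u': "\<And>x. (u has_real_derivative u' x) (at x)"
    and sg: "\<And>b x y. 0 < x \<Longrightarrow> x < y \<Longrightarrow> u' x + b * u x < 0 \<Longrightarrow> u' y + b * u y \<le> 0"
    using f unfolding slope_falling_def by blast
  have pos: "0 < u x" if "0 < x" for x using u that by (auto simp: nice_def)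
  have "0 \<le> 1 * (u' x / u x - u' y / u y)" if xy: "p \<le> x" "x \<le> y" for x y
  proof (rule ccontr)
    assume *: "\<not> ?thesis"
    obtain c where "u' x / u x < c" "c < u' y / u y" using * dense[of "u' x / u x" "u' y / u y"] by auto
    moreover define b where "b = - c"
    ultimately have "u' x + b * u x < 0" "0 < u' y + b * u y"
      using pos[of x] pos[of y] xy p by (auto simp: field_simps)
    moreover have "x \<noteq> y" using * by auto
    ultimately show False using sg[where x = x and y = y and b = b] xy p by auto
  qed
  from slope_mono_four_points[where u' = u' and s = 1, OF u' _ this p(2,3,4)]
  have "ln (u p) + ln (u t) \<le> ln (u r) + ln (u r')" using pos p by auto
  then show ?thesis using pos p by (subst (asm) four_points_exp) auto
qed

text \<open>If \<open>u'/u\<close> has risen somewhere before \<open>c\<close>, the valley shape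
  keeps it nondecreasing from there on, so \<open>u\<close> is log-convex beyond \<open>c\<close>;
  otherwise \<open>u\<close> is log-concave up to \<open>c\<close>. The cut \<open>c\<close> is the
  point that \<open>reflected\<close> carries to the origin.\<close>

lemma slope_valley_four_points:
  assumes u: "nice u" and f: "slope_valley u"
  shows "(\<forall>p t r r'. 0 < p \<longrightarrow> p \<le> r \<longrightarrow> p \<le> r' \<longrightarrow> r + r' = p + t \<longrightarrow> t \<le> c \<longrightarrow> u p * u t \<le> u r * u r') \<or>
    (\<forall>p t r r'. 0 < p \<longrightarrow> c \<le> p \<longrightarrow> p \<le> r \<longrightarrow> p \<le> r' \<longrightarrow> r + r' = p + t \<longrightarrow> u r * u r' \<le> u p * u t)"
proof -
  obtain u' where u': "\<And>x. (u has_real_derivative u' x) (at x)"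
    and sg: "\<And>b x y z. 0 < x \<Longrightarrow> x < y \<Longrightarrow> y < z \<Longrightarrow> u' x + b * u x < 0 \<Longrightarrow> 0 < u' y + b * u y \<Longrightarrow> 0 \<le> u' z + b * u z"
    using f unfolding slope_valley_def by blast
  have pos: "0 < u x" if "0 < x" for x using u that by (auto simp: nice_def)
  define q where "q x = u' x / u x" for x
  have valley: "q y \<le> max (q x) (q z)" if xyz: "0 < x" "x < y" "y < z" for x y z
  proof (rule ccontr)
    assume *: "\<not> ?thesis"
    obtain d where "q x < d" "q z < d" "d < q y" using * dense[of "max (q x) (q z)" "q y"] by (metis max_less_iff_conj not_le)
    moreover define b where "b = - d"
    ultimately have "u' x + b * u x < 0" "0 < u' y + b * u y" "u' z + b * u z < 0"
      using pos[of x] pos[of y] pos[of z] xyz by (auto simp: field_simps q_def)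
    then show False using sg[where x = x and y = y and z = z and b = b] xyz by auto
  qed
  show ?thesis
  proof (cases "\<forall>x y. 0 < x \<longrightarrow> x \<le> y \<longrightarrow> y \<le> c \<longrightarrow> q y \<le> q x")
    case True
    have "u p * u t \<le> u r * u r'" if p: "0 < p" "p \<le> r" "p \<le> r'" "r + r' = p + t" "t \<le> c" for p t r r'
    proof -
      have "0 \<le> 1 * (u' x / u x - u' y / u y)" if "p \<le> x" "x \<le> y" "y \<le> t" for x y
        using True[rule_format, of x y] that p by (auto simp: q_def)
      from slope_mono_four_points[where u' = u' and s = 1, OF u' _ this p(2,3,4)]
      have "ln (u p) + ln (u t) \<le> ln (u r) + ln (u r')" using pos p by auto
      then show ?thesis using pos p by (subst (asm) four_points_exp) auto
    qed
    then show ?thesis by blast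
  next
    case False
    then obtain x y where xy: "0 < x" "x \<le> y" "y \<le> c" "q x < q y" by (auto simp: not_le)
    then have "x < y" by (cases "x = y") auto
    have mono: "q z \<le> q w" if "y \<le> z" "z \<le> w" for z w
    proof -
      have 1: "q y \<le> q z" if "y \<le> z" for z
        using valley[of x y z] xy \<open>x < y\<close> that by (cases "y = z") auto
      show ?thesis using valley[of x z w] 1[of z] xy \<open>x < y\<close> that by (cases "z = w") auto
    qed
    have "u r * u r' \<le> u p * u t" if p: "0 < p" "c \<le> p" "p \<le> r" "p \<le> r'" "r + r' = p + t" for p t r r'
    proof -
      have "0 \<le> - 1 * (u' x / u x - u' y / u y)" if "p \<le> x" "x \<le> y" "y \<le> t" for x y
        using mono[of x y] that p xy by (auto simp: q_def)
      from slope_mono_four_points[where u' = u' and s = "-1", OF u' _ this p(3,4,5)]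
      have "ln (u r) + ln (u r') \<le> ln (u p) + ln (u t)" using pos p by auto
      then show ?thesis using pos p by (subst (asm) four_points_exp) auto
    qed
    then show ?thesis by blast
  qed
qed

section \<open>Limits of densities through characteristic functions\<close>

text \<open>Density of \<open>c - Y\<close> when \<open>Y\<close> has density \<open>v\<close>. The
  reflection makes the values of \<open>laplace v\<close> on the imaginary axis, up to the phase of
  the shift, a characteristic function.\<close>

definition reflected :: "(real \<Rightarrow> real) \<Rightarrow> real \<Rightarrow> real \<Rightarrow> real" where
  "reflected v c x = (if x < c then v (c - x) else 0)"

lemma nice_measurable: "nice v \<Longrightarrow> v \<in> borel_measurable borel"
  by (rule borel_measurable_continuous_onI) (auto simp: nice_def exp_bounded_def continuous_on_eq_continuous_at)

lemma reflected_measurable: "nice v \<Longrightarrow> reflected v c \<in> borel_measurable borel"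
proof -
  assume "nice v"
  note [measurable] = nice_measurable[OF this]
  show ?thesis unfolding reflected_def[abs_def] by measurable
qed

lemma reflected_nonneg: "nice v \<Longrightarrow> 0 \<le> reflected v c x"
  by (auto simp: reflected_def nice_def less_imp_le)

lemma reflected_real_distribution:
  assumes v: "nice v" and one: "laplace v 0 = 1"
  shows "real_distribution (density lborel (\<lambda>x. ennreal (reflected v c x)))"
    and "char (density lborel (\<lambda>x. ennreal (reflected v c x))) t = iexp (t * c) * laplace v (\<i> * of_real t)"
proof -
  note [measurable] = reflected_measurable[OF v] nice_measurable[OF v]
  have vb: "exp_bounded v" using v by (simp add: nice_def)
  have int: "integrable lborel (\<lambda>x. indicat_real {0<..} x * v x)"
  proof -
    have "set_integrable lborel {0<..} (\<lambda>x. complex_of_real (v x))"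
      using exp_bounded_set_integrable[OF vb, of 0] by simp
    then show ?thesis unfolding set_integrable_def
      by (rule Bochner_Integration.integrable_bound) (auto simp: indicator_def)
  qed
  have "laplace v 0 = of_real (LINT x|lborel. indicat_real {0<..} x * v x)"
    unfolding laplace_def set_lebesgue_integral_def integral_complex_of_real[symmetric]
    by (intro Bochner_Integration.integral_cong) (auto simp: scaleR_conv_of_real)
  then have "(LINT x|lborel. indicat_real {0<..} x * v x) = 1" using one by simp
  then have nn: "(\<integral>\<^sup>+x. ennreal (indicat_real {0<..} x * v x) \<partial>lborel) = 1"
    using int v by (subst nn_integral_eq_integral) (auto simp: nice_def indicator_def less_imp_le)
  have refl: "(\<integral>\<^sup>+x. ennreal (reflected v c x) \<partial>lborel) = (\<integral>\<^sup>+x. ennreal (indicat_real {0<..} x * v x) \<partial>lborel)"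
    by (subst nn_integral_real_affine[where c = "-1" and t = c])
       (auto intro!: nn_integral_cong simp: reflected_def indicator_def)
  show "real_distribution (density lborel (\<lambda>x. ennreal (reflected v c x)))"
    unfolding real_distribution_def real_distribution_axioms_def
    by (auto intro!: prob_spaceI simp: emeasure_density refl nn)
  have "char (density lborel (\<lambda>x. ennreal (reflected v c x))) t = (CLINT x|lborel. reflected v c x *\<^sub>R iexp (t * x))"
    unfolding char_def using reflected_nonneg[OF v] by (subst integral_density) auto
  also have "\<dots> = (CLINT x|lborel. reflected v c (c + - 1 * x) *\<^sub>R iexp (t * (c + - 1 * x)))"
    by (subst lborel_integral_real_affine[where c = "-1" and t = c]) auto
  also have "\<dots> = (CLINT x|lborel. iexp (t * c) * (indicat_real {0<..} x *\<^sub>R (exp (- (\<i> * of_real t) * of_real x) * of_real (v x))))"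
    by (intro Bochner_Integration.integral_cong)
       (auto simp: reflected_def indicator_def scaleR_conv_of_real algebra_simps exp_diff exp_minus divide_inverse)
  also have "\<dots> = iexp (t * c) * laplace v (\<i> * of_real t)"
    unfolding laplace_def set_lebesgue_integral_def by (rule integral_mult_right_zero)
  finally show "char (density lborel (\<lambda>x. ennreal (reflected v c x))) t = iexp (t * c) * laplace v (\<i> * of_real t)" .
qed

lemma emeasure_density_interval:
  fixes h :: "real \<Rightarrow> real"
  assumes [measurable]: "h \<in> borel_measurable borel"
  shows "emeasure (density lborel (\<lambda>x. ennreal (h x))) {a<..a + d} = (\<integral>\<^sup>+s. ennreal (h (a + s)) * indicator {0<..d} s \<partial>lborel)"
proof -
  have "emeasure (density lborel (\<lambda>x. ennreal (h x))) {a<..a + d} = (\<integral>\<^sup>+x. ennreal (h x) * indicator {a<..a + d} x \<partial>lborel)"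
    by (rule emeasure_density) auto
  also have "\<dots> = (\<integral>\<^sup>+s. ennreal (h (a + s)) * indicator {0<..d} s \<partial>lborel)"
    by (subst nn_integral_real_affine[where c = 1 and t = a]) (auto intro!: nn_integral_cong simp: indicator_def)
  finally show ?thesis .
qed

text \<open>The offsets \<open>s\<close> and \<open>r\<close> inside the two intervals run
  independently, so both products are double integrals over the same square, and the pointwise
  inequality is integrated over it.\<close>

lemma four_points_intervals:
  fixes h :: "real \<Rightarrow> real"
  assumes [measurable]: "h \<in> borel_measurable borel" and nn: "\<And>x. 0 \<le> h x"
    and fin: "finite_measure (density lborel (\<lambda>x. ennreal (h x)))" (is "finite_measure ?M")
    and le: "\<And>s r. 0 < s \<Longrightarrow> s \<le> d \<Longrightarrow> 0 < r \<Longrightarrow> r \<le> d \<Longrightarrow> h (a1 + s) * h (a2 + r) \<le> h (a3 + s) * h (a4 + r)"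
  shows "measure ?M {a1<..a1 + d} * measure ?M {a2<..a2 + d} \<le> measure ?M {a3<..a3 + d} * measure ?M {a4<..a4 + d}"
proof -
  interpret finite_measure ?M by fact
  have prod: "emeasure ?M {a<..a + d} * emeasure ?M {b<..b + d} =
    (\<integral>\<^sup>+s. (\<integral>\<^sup>+r. ennreal (h (a + s) * h (b + r)) * (indicator {0<..d} s * indicator {0<..d} r) \<partial>lborel) \<partial>lborel)" for a b
  proof -
    have "emeasure ?M {a<..a + d} * emeasure ?M {b<..b + d} =
      (\<integral>\<^sup>+s. ennreal (h (a + s)) * indicator {0<..d} s * (\<integral>\<^sup>+r. ennreal (h (b + r)) * indicator {0<..d} r \<partial>lborel) \<partial>lborel)"
      unfolding emeasure_density_interval[OF assms(1)] by (rule nn_integral_multc[symmetric]) simp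
    also have "\<dots> = (\<integral>\<^sup>+s. (\<integral>\<^sup>+r. ennreal (h (a + s)) * indicator {0<..d} s * (ennreal (h (b + r)) * indicator {0<..d} r) \<partial>lborel) \<partial>lborel)"
      by (intro nn_integral_cong nn_integral_cmult[symmetric]) simp
    finally show ?thesis by (simp add: ennreal_mult nn mult_ac)
  qed
  have "emeasure ?M {a1<..a1 + d} * emeasure ?M {a2<..a2 + d} \<le> emeasure ?M {a3<..a3 + d} * emeasure ?M {a4<..a4 + d}"
    unfolding prod using le by (intro nn_integral_mono) (auto simp: indicator_def intro!: ennreal_leI)
  then show ?thesis
    by (simp add: emeasure_eq_measure ennreal_mult[symmetric] del: ennreal_mult'')
qed

lemma frequently_limit_le:
  fixes a b :: "nat \<Rightarrow> real"
  assumes "a \<longlonglongrightarrow> A" "b \<longlonglongrightarrow> B" "\<exists>\<^sub>F n in sequentially. a n \<le> b n"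
  shows "A \<le> B"
proof (rule ccontr)
  assume "\<not> A \<le> B"
  then obtain c where c: "B < c" "c < A" using dense[of B A] by auto
  have "\<forall>\<^sub>F n in sequentially. b n < a n"
    using order_tendstoD(2)[OF assms(2) c(1)] order_tendstoD(1)[OF assms(1) c(2)] by eventually_elim simp
  then show False using assms(3) by (simp add: frequently_def not_le)
qed

text \<open>After the limit in \<open>n\<close>, dividing the interval inequality by
  \<open>e\<close> twice and letting \<open>e\<close> tend to \<open>0\<close> recovers the limit
  density at the four left endpoints. An inequality for infinitely many \<open>n\<close> is enough,
  which is all that an alternative between approximants can provide.\<close>

lemma four_points_limit:
  fixes h :: "nat \<Rightarrow> real \<Rightarrow> real" and p F :: "real \<Rightarrow> real"
  assumes h: "\<And>n. h n \<in> borel_measurable borel" "\<And>n x. 0 \<le> h n x"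
    and fin: "\<And>n. finite_measure (density lborel (\<lambda>x. ennreal (h n x)))"
    and lim: "\<And>a b. a < b \<Longrightarrow> (\<lambda>n. measure (density lborel (\<lambda>x. ennreal (h n x))) {a<..b}) \<longlonglongrightarrow> F b - F a"
    and F: "\<And>x. (F has_real_derivative p x) (at x)"
    and d: "0 < d"
    and freq: "\<exists>\<^sub>F n in sequentially. \<forall>s r. 0 < s \<longrightarrow> s \<le> d \<longrightarrow> 0 < r \<longrightarrow> r \<le> d \<longrightarrow> h n (a1 + s) * h n (a2 + r) \<le> h n (a3 + s) * h n (a4 + r)"
  shows "p a1 * p a2 \<le> p a3 * p a4"
proof -
  have le: "(F (a1 + e) - F a1) * (F (a2 + e) - F a2) \<le> (F (a3 + e) - F a3) * (F (a4 + e) - F a4)" if e: "0 < e" "e \<le> d" for e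
  proof (rule frequently_limit_le)
    show "(\<lambda>n. measure (density lborel (\<lambda>x. ennreal (h n x))) {a1<..a1 + e} * measure (density lborel (\<lambda>x. ennreal (h n x))) {a2<..a2 + e})
       \<longlonglongrightarrow> (F (a1 + e) - F a1) * (F (a2 + e) - F a2)"
      using e by (intro tendsto_mult lim) auto
    show "(\<lambda>n. measure (density lborel (\<lambda>x. ennreal (h n x))) {a3<..a3 + e} * measure (density lborel (\<lambda>x. ennreal (h n x))) {a4<..a4 + e})
       \<longlonglongrightarrow> (F (a3 + e) - F a3) * (F (a4 + e) - F a4)"
      using e by (intro tendsto_mult lim) auto
    show "\<exists>\<^sub>F n in sequentially. measure (density lborel (\<lambda>x. ennreal (h n x))) {a1<..a1 + e} * measure (density lborel (\<lambda>x. ennreal (h n x))) {a2<..a2 + e}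
      \<le> measure (density lborel (\<lambda>x. ennreal (h n x))) {a3<..a3 + e} * measure (density lborel (\<lambda>x. ennreal (h n x))) {a4<..a4 + e}"
      using freq by (rule frequently_elim1) (intro four_points_intervals h fin, use e in auto)
  qed
  have D: "((\<lambda>e. (F (a + e) - F a) / e) \<longlongrightarrow> p a) (at_right 0)" for a
    using F[of a] unfolding DERIV_def by (rule filterlim_mono) (auto simp: at_le)
  show ?thesis
  proof (rule tendsto_le[OF _ tendsto_mult[OF D D] tendsto_mult[OF D D]])
    show "\<forall>\<^sub>F e in at_right 0. (F (a1 + e) - F a1) / e * ((F (a2 + e) - F a2) / e) \<le> (F (a3 + e) - F a3) / e * ((F (a4 + e) - F a4) / e)"
      using eventually_at_right_less[of 0] eventually_at_right_real[OF d]
    proof eventually_elim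
      case (elim e)
      then show ?case using le[of e] by (simp add: divide_right_mono)
    qed
  qed simp
qed

section \<open>Fourier inversion\<close>

lemma iexp_difference_bound:
  "cmod ((iexp (- (t * a)) - iexp (- (t * b))) / (\<i> * t)) \<le> \<bar>b - a\<bar>"
proof (cases "t = 0")
  case False
  have *: "cmod ((iexp (- (t * a)) - iexp (- (t * b))) / (\<i> * t)) \<le> b - a" if "a \<le> b" for a b
    using Levy_Inversion_aux2[of "-b" "-a" t] that False by simp
  show ?thesis
  proof (cases "a \<le> b")
    case True then show ?thesis using *[of a b] by simp
  next
    case F: False
    have "cmod ((iexp (- (t * a)) - iexp (- (t * b))) / (\<i> * t)) = cmod ((iexp (- (t * b)) - iexp (- (t * a))) / (\<i> * t))"
      by (simp add: norm_divide norm_minus_commute)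
    then show ?thesis using *[of b a] F by simp
  qed
qed auto

definition inverse_fourier :: "(real \<Rightarrow> complex) \<Rightarrow> real \<Rightarrow> real" where
  "inverse_fourier \<psi> x = Re (CLINT y|lborel. iexp (- (y * x)) * \<psi> y) / (2 * pi)"

text \<open>The integrand carries Levy's inversion kernel for the interval from \<open>0\<close> to
  \<open>x\<close>. Differences of this function are thus limits of interval probabilities, while
  its derivative is \<open>inverse_fourier\<close>.\<close>

definition inverse_fourier_primitive :: "(real \<Rightarrow> complex) \<Rightarrow> real \<Rightarrow> real" where
  "inverse_fourier_primitive \<psi> x = Re (CLINT y|lborel. (iexp (- (y * 0)) - iexp (- (y * x))) / (\<i> * y) * \<psi> y) / (2 * pi)"

lemma inverse_fourier_primitive_diff:
  assumes \<psi>: "integrable lborel \<psi>"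
  shows "inverse_fourier_primitive \<psi> b - inverse_fourier_primitive \<psi> a =
     Re (CLINT y|lborel. (iexp (- (y * a)) - iexp (- (y * b))) / (\<i> * y) * \<psi> y) / (2 * pi)"
    and "integrable lborel (\<lambda>y. (iexp (- (y * a)) - iexp (- (y * b))) / (\<i> * y) * \<psi> y)"
proof -
  note [measurable] = borel_measurable_integrable[OF \<psi>]
  have int: "integrable lborel (\<lambda>y. (iexp (- (y * a)) - iexp (- (y * b))) / (\<i> * y) * \<psi> y)" for a b
  proof (rule Bochner_Integration.integrable_bound)
    show "integrable lborel (\<lambda>y. \<bar>b - a\<bar> * norm (\<psi> y))" using \<psi> by simp
    show "AE y in lborel. norm ((iexp (- (y * a)) - iexp (- (y * b))) / (\<i> * y) * \<psi> y) \<le> norm (\<bar>b - a\<bar> * norm (\<psi> y))"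
      unfolding norm_mult by (intro AE_I2 mult_mono) (use iexp_difference_bound in auto)
  qed measurable
  then show "integrable lborel (\<lambda>y. (iexp (- (y * a)) - iexp (- (y * b))) / (\<i> * y) * \<psi> y)" .
  have "(CLINT y|lborel. (iexp (- (y * 0)) - iexp (- (y * b))) / (\<i> * y) * \<psi> y) -
     (CLINT y|lborel. (iexp (- (y * 0)) - iexp (- (y * a))) / (\<i> * y) * \<psi> y) =
     (CLINT y|lborel. (iexp (- (y * a)) - iexp (- (y * b))) / (\<i> * y) * \<psi> y)"
    by (subst Bochner_Integration.integral_diff[symmetric, OF int int])
       (auto intro!: Bochner_Integration.integral_cong simp: diff_divide_distrib[symmetric] left_diff_distrib[symmetric])
  then show "inverse_fourier_primitive \<psi> b - inverse_fourier_primitive \<psi> a =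
     Re (CLINT y|lborel. (iexp (- (y * a)) - iexp (- (y * b))) / (\<i> * y) * \<psi> y) / (2 * pi)"
    unfolding inverse_fourier_primitive_def diff_divide_distrib[symmetric] minus_complex.sel[symmetric] by simp
qed

lemma inverse_fourier_primitive_deriv:
  assumes \<psi>: "integrable lborel \<psi>"
  shows "(inverse_fourier_primitive \<psi> has_real_derivative inverse_fourier \<psi> x) (at x)"
  unfolding DERIV_def tendsto_at_iff_sequentially
proof (intro allI impI)
  note [measurable] = borel_measurable_integrable[OF \<psi>]
  fix e :: "nat \<Rightarrow> real" assume e: "\<forall>i. e i \<in> UNIV - {0}" "e \<longlonglongrightarrow> 0"
  define k where "k = (\<lambda>i y. (iexp (- (y * x)) - iexp (- (y * (x + e i)))) / (\<i> * y) * \<psi> y / of_real (e i))"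
  have "(\<lambda>i. CLINT y|lborel. k i y) \<longlonglongrightarrow> (CLINT y|lborel. iexp (- (y * x)) * \<psi> y)"
  proof (rule integral_dominated_convergence)
    show "integrable lborel (\<lambda>y. norm (\<psi> y))" using \<psi> by simp
    show "AE y in lborel. (\<lambda>i. k i y) \<longlonglongrightarrow> iexp (- (y * x)) * \<psi> y"
    proof (rule AE_mp[OF AE_lborel_singleton[of 0]], rule AE_I2, rule impI)
      fix y :: real assume y: "y \<noteq> 0"
      have "((\<lambda>s. exp (- \<i> * y * s)) has_field_derivative (- \<i> * y) * exp (- \<i> * y * of_real x)) (at (of_real x))"
        by (auto intro!: derivative_eq_intros)
      then have "((\<lambda>s. (exp (- \<i> * y * (of_real x + s)) - exp (- \<i> * y * of_real x)) / s) \<longlongrightarrow> (- \<i> * y) * exp (- \<i> * y * of_real x)) (at 0)"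
        by (simp add: DERIV_def)
      moreover have "filterlim (\<lambda>i. complex_of_real (e i)) (at 0) sequentially"
        using e tendsto_of_real[OF e(2), where ?'a = complex] by (auto simp: filterlim_at)
      ultimately have "(\<lambda>i. (exp (- \<i> * y * (of_real x + of_real (e i))) - exp (- \<i> * y * of_real x)) / of_real (e i)) \<longlonglongrightarrow> (- \<i> * y) * exp (- \<i> * y * of_real x)"
        by (rule filterlim_compose)
      then have "(\<lambda>i. (exp (- \<i> * y * (of_real x + of_real (e i))) - exp (- \<i> * y * of_real x)) / of_real (e i) * (- 1 / (\<i> * y) * \<psi> y))
         \<longlonglongrightarrow> (- \<i> * y) * exp (- \<i> * y * of_real x) * (- 1 / (\<i> * y) * \<psi> y)"
        by (rule tendsto_mult_right)
      moreover have "(- \<i> * y) * exp (- \<i> * y * of_real x) * (- 1 / (\<i> * y) * \<psi> y) = iexp (- (y * x)) * \<psi> y"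
        using y by (simp add: field_simps)
      moreover have "(\<lambda>i. (exp (- \<i> * y * (of_real x + of_real (e i))) - exp (- \<i> * y * of_real x)) / of_real (e i) * (- 1 / (\<i> * y) * \<psi> y)) = (\<lambda>i. k i y)"
      proof
        fix i
        have alg: "(B - A) / s * (- 1 / w * p) = (A - B) / w * p / s" for A B s w p :: complex
          by (simp add: divide_inverse algebra_simps)
        have "exp (- \<i> * y * (of_real x + of_real (e i))) = iexp (- (y * (x + e i)))" "exp (- \<i> * y * of_real x) = iexp (- (y * x))"
          by (simp_all add: algebra_simps)
        then show "(exp (- \<i> * y * (of_real x + of_real (e i))) - exp (- \<i> * y * of_real x)) / of_real (e i) * (- 1 / (\<i> * y) * \<psi> y) = k i y"
          unfolding k_def by (simp only: alg)
      qed
      ultimately show "(\<lambda>i. k i y) \<longlonglongrightarrow> iexp (- (y * x)) * \<psi> y" by simp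
    qed
    show "AE y in lborel. norm (k i y) \<le> norm (\<psi> y)" for i
    proof (rule AE_I2)
      fix y
      have "norm (k i y) = cmod ((iexp (- (y * x)) - iexp (- (y * (x + e i)))) / (\<i> * y)) / \<bar>e i\<bar> * norm (\<psi> y)"
        by (simp add: k_def norm_mult norm_divide)
      also have "\<dots> \<le> 1 * norm (\<psi> y)"
        using iexp_difference_bound[of y x "x + e i"] e(1) by (intro mult_right_mono) (auto simp: divide_le_eq_1)
      finally show "norm (k i y) \<le> norm (\<psi> y)" by simp
    qed
  qed (unfold k_def, measurable)
  then have "(\<lambda>i. Re (CLINT y|lborel. k i y) / (2 * pi)) \<longlonglongrightarrow> inverse_fourier \<psi> x"
    unfolding inverse_fourier_def by (intro tendsto_intros) auto
  moreover have "Re (CLINT y|lborel. k i y) / (2 * pi) = (inverse_fourier_primitive \<psi> (x + e i) - inverse_fourier_primitive \<psi> x) / e i" for i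
    unfolding inverse_fourier_primitive_diff(1)[OF \<psi>] k_def
    by (subst integral_divide_zero) (simp add: Re_divide_of_real)
  ultimately show "((\<lambda>h. (inverse_fourier_primitive \<psi> (x + h) - inverse_fourier_primitive \<psi> x) / h) \<circ> e) \<longlonglongrightarrow> inverse_fourier \<psi> x"
    by (simp add: o_def)
qed

text \<open>The common majorant \<open>g\<close> first removes the truncation in Levy's inversion
  formula for fixed \<open>n\<close>, and then lets \<open>n\<close> tend to infinity inside the
  integral. The limit is expressed through \<open>\<psi>\<close> alone.\<close>

lemma measure_interval_limit_from_char:
  fixes \<mu> :: "nat \<Rightarrow> real measure"
  assumes \<mu>: "\<And>n. real_distribution (\<mu> n)" and na: "\<And>n x. measure (\<mu> n) {x} = 0"
    and g: "integrable lborel g" and bnd: "\<And>n y. norm (char (\<mu> n) y) \<le> g y"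
    and lim: "\<And>y. (\<lambda>n. char (\<mu> n) y) \<longlonglongrightarrow> \<psi> y"
    and ab: "a < b"
  shows "integrable lborel \<psi>"
    and "(\<lambda>n. measure (\<mu> n) {a<..b}) \<longlonglongrightarrow> inverse_fourier_primitive \<psi> b - inverse_fourier_primitive \<psi> a"
proof -
  have [measurable]: "char (\<mu> n) \<in> borel_measurable borel" for n
    using real_distribution.char_measurable[OF \<mu>] .
  have [measurable]: "\<psi> \<in> borel_measurable borel"
    by (rule borel_measurable_LIMSEQ_metric[of "\<lambda>n. char (\<mu> n)"]) (use lim in auto)
  have bl: "norm (\<psi> y) \<le> g y" for y
    by (rule tendsto_upperbound[OF tendsto_norm[OF lim]]) (use bnd in auto)
  have g0: "0 \<le> g y" for y using bl[of y] norm_ge_zero order_trans by blast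
  show \<psi>: "integrable lborel \<psi>"
    by (rule Bochner_Integration.integrable_bound[OF g]) (use bl g0 in auto)
  have ci: "integrable lborel (char (\<mu> n))" for n
    by (rule Bochner_Integration.integrable_bound[OF g]) (use bnd g0 in auto)
  define K where "K = (\<lambda>y. (iexp (- (y * a)) - iexp (- (y * b))) / (\<i> * y))"
  have [measurable]: "K \<in> borel_measurable borel" unfolding K_def by measurable
  have Kb: "norm (K y) \<le> b - a" for y using iexp_difference_bound[of y a b] ab by (simp add: K_def)
  have meas: "of_real (measure (\<mu> n) {a<..b}) = 1 / (2 * pi) * (CLINT y|lborel. K y * char (\<mu> n) y)" for n
  proof -
    interpret real_distribution "\<mu> n" by (rule \<mu>)
    have "(\<lambda>T::nat. CLINT y|lborel. indicat_real (einterval (- real T) (real T)) y *\<^sub>R (K y * char (\<mu> n) y)) \<longlonglongrightarrow> (CLINT y|lborel. K y * char (\<mu> n) y)"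
    proof (rule integral_dominated_convergence)
      show "integrable lborel (\<lambda>y. (b - a) * g y)" using g by simp
      show "AE y in lborel. (\<lambda>T::nat. indicat_real (einterval (- real T) (real T)) y *\<^sub>R (K y * char (\<mu> n) y)) \<longlonglongrightarrow> K y * char (\<mu> n) y"
      proof (rule AE_I2, rule tendsto_eventually)
        fix y
        obtain m :: nat where "\<bar>y\<bar> < real m" using reals_Archimedean2[of "\<bar>y\<bar>"] by auto
        then show "\<forall>\<^sub>F T::nat in sequentially. indicat_real (einterval (- real T) (real T)) y *\<^sub>R (K y * char (\<mu> n) y) = K y * char (\<mu> n) y"
          by (intro eventually_sequentiallyI[of m]) (auto simp: indicator_def einterval_def)
      qed
      show "AE y in lborel. norm (indicat_real (einterval (- real T) (real T)) y *\<^sub>R (K y * char (\<mu> n) y)) \<le> (b - a) * g y" for T :: nat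
        using Kb bnd g0 ab by (intro AE_I2) (auto simp: indicator_def norm_mult intro!: mult_mono)
    qed measurable
    then have "(\<lambda>T::nat. 1 / (2 * pi) * (CLBINT t=-T..T. K t * char (\<mu> n) t)) \<longlonglongrightarrow> 1 / (2 * pi) * (CLINT y|lborel. K y * char (\<mu> n) y)"
      by (intro tendsto_mult_left) (simp add: interval_lebesgue_integral_def set_lebesgue_integral_def)
    moreover have "(\<lambda>T::nat. 1 / (2 * pi) * (CLBINT t=-T..T. K t * char (\<mu> n) t)) \<longlonglongrightarrow> measure (\<mu> n) {a<..b}"
      unfolding K_def by (rule Levy_Inversion) (use ab na in auto)
    ultimately show ?thesis using LIMSEQ_unique by blast
  qed
  have "(\<lambda>n. CLINT y|lborel. K y * char (\<mu> n) y) \<longlonglongrightarrow> (CLINT y|lborel. K y * \<psi> y)"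
  proof (rule integral_dominated_convergence)
    show "integrable lborel (\<lambda>y. (b - a) * g y)" using g by simp
    show "AE y in lborel. (\<lambda>n. K y * char (\<mu> n) y) \<longlonglongrightarrow> K y * \<psi> y" by (intro AE_I2 tendsto_mult_left lim)
    show "AE y in lborel. norm (K y * char (\<mu> n) y) \<le> (b - a) * g y" for n
      using Kb bnd g0 ab by (intro AE_I2) (auto simp: norm_mult intro!: mult_mono)
  qed measurable
  then have "(\<lambda>n. Re (1 / (2 * pi) * (CLINT y|lborel. K y * char (\<mu> n) y))) \<longlonglongrightarrow> Re (1 / (2 * pi) * (CLINT y|lborel. K y * \<psi> y))"
    by (intro tendsto_Re tendsto_mult_left)
  moreover have "Re (1 / (2 * pi) * (CLINT y|lborel. K y * char (\<mu> n) y)) = measure (\<mu> n) {a<..b}" for n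
    unfolding meas[symmetric] by simp
  moreover have "Re (1 / (2 * pi) * (CLINT y|lborel. K y * \<psi> y)) = inverse_fourier_primitive \<psi> b - inverse_fourier_primitive \<psi> a"
  proof -
    have "Re (1 / (2 * pi) * z) = Re z / (2 * pi)" for z
      by (metis Re_divide_of_real mult.commute mult_cancel_right1 of_real_1 of_real_divide times_divide_eq_right)
    then show ?thesis unfolding inverse_fourier_primitive_diff(1)[OF \<psi>] K_def by simp
  qed
  ultimately show "(\<lambda>n. measure (\<mu> n) {a<..b}) \<longlonglongrightarrow> inverse_fourier_primitive \<psi> b - inverse_fourier_primitive \<psi> a"
    by simp
qed

section \<open>Stieltjes integrals\<close>

lemma norm_add_iy_ge:
  fixes s y :: real assumes "0 \<le> s" "0 \<le> Re w"
  shows "(s + norm w) / 2 \<le> norm (of_real s + w)"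
proof -
  have "s \<le> norm (of_real s + w)"
    using abs_Re_le_cmod[of "of_real s + w"] assms by simp
  moreover have "norm w \<le> norm (of_real s + w)"
    unfolding cmod_def using power_mono[of "Re w" "s + Re w" 2] assms by simp
  ultimately show ?thesis by simp
qed

text \<open>Writing \<open>1 / (s + r)\<close> as the integral of \<open>exp (- (s + r) * t)\<close>
  over positive \<open>t\<close> and exchanging the order separates two Gamma integrals.\<close>

lemma nn_integral_Stieltjes:
  fixes a r :: real
  assumes a: "0 < a" "a < 1" and r: "0 < r"
  shows "(\<integral>\<^sup>+s\<in>{0<..}. ennreal (s powr (a - 1) / (s + r)) \<partial>lborel) = ennreal (Gamma a * Gamma (1 - a) * r powr (a - 1))"
proof -
  have "(\<integral>\<^sup>+s\<in>{0<..}. ennreal (s powr (a - 1) / (s + r)) \<partial>lborel) =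
    (\<integral>\<^sup>+s. (\<integral>\<^sup>+t. ennreal (s powr (a - 1) * exp (- (s + r) * t)) * (indicator {0<..} s * indicator {0<..} t) \<partial>lborel) \<partial>lborel)"
  proof (intro nn_integral_cong)
    fix s :: real
    show "ennreal (s powr (a - 1) / (s + r)) * indicator {0<..} s =
      (\<integral>\<^sup>+t. ennreal (s powr (a - 1) * exp (- (s + r) * t)) * (indicator {0<..} s * indicator {0<..} t) \<partial>lborel)"
    proof (cases "s > 0")
      case True
      have "(\<integral>\<^sup>+t. ennreal (s powr (a - 1) * exp (- (s + r) * t)) * (indicator {0<..} s * indicator {0<..} t) \<partial>lborel)
        = (\<integral>\<^sup>+t. ennreal (s powr (a - 1)) * (ennreal (t powr (1 - 1) * exp (- (s + r) * t)) * indicator {0<..} t) \<partial>lborel)"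
        using True by (intro nn_integral_cong) (auto simp: indicator_def ennreal_mult)
      also have "\<dots> = ennreal (s powr (a - 1)) * (\<integral>\<^sup>+t\<in>{0<..}. ennreal (t powr (1 - 1) * exp (- (s + r) * t)) \<partial>lborel)"
        by (rule nn_integral_cmult) simp
      also have "(\<integral>\<^sup>+t\<in>{0<..}. ennreal (t powr (1 - 1) * exp (- (s + r) * t)) \<partial>lborel) = ennreal (Gamma 1 * (s + r) powr - 1)"
        by (rule nn_integral_Gamma) (use True r in auto)
      finally show ?thesis using True r
        by (simp add: ennreal_mult[symmetric] powr_minus divide_inverse)
    qed simp
  qed
  also have "\<dots> = (\<integral>\<^sup>+t. (\<integral>\<^sup>+s. ennreal (s powr (a - 1) * exp (- (s + r) * t)) * (indicator {0<..} s * indicator {0<..} t) \<partial>lborel) \<partial>lborel)"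
    by (rule lborel_pair.Fubini') measurable
  also have "\<dots> = (\<integral>\<^sup>+t. ennreal (Gamma a) * (ennreal (t powr ((1 - a) - 1) * exp (- r * t)) * indicator {0<..} t) \<partial>lborel)"
  proof (intro nn_integral_cong)
    fix t :: real
    show "(\<integral>\<^sup>+s. ennreal (s powr (a - 1) * exp (- (s + r) * t)) * (indicator {0<..} s * indicator {0<..} t) \<partial>lborel) =
      ennreal (Gamma a) * (ennreal (t powr ((1 - a) - 1) * exp (- r * t)) * indicator {0<..} t)"
    proof (cases "t > 0")
      case True
      have "(\<integral>\<^sup>+s. ennreal (s powr (a - 1) * exp (- (s + r) * t)) * (indicator {0<..} s * indicator {0<..} t) \<partial>lborel)
        = (\<integral>\<^sup>+s. ennreal (exp (- r * t)) * (ennreal (s powr (a - 1) * exp (- t * s)) * indicator {0<..} s) \<partial>lborel)"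
        using True by (intro nn_integral_cong) (auto simp: indicator_def ennreal_mult[symmetric] algebra_simps exp_diff exp_minus divide_inverse)
      also have "\<dots> = ennreal (exp (- r * t)) * (\<integral>\<^sup>+s\<in>{0<..}. ennreal (s powr (a - 1) * exp (- t * s)) \<partial>lborel)"
        by (rule nn_integral_cmult) simp
      also have "(\<integral>\<^sup>+s\<in>{0<..}. ennreal (s powr (a - 1) * exp (- t * s)) \<partial>lborel) = ennreal (Gamma a * t powr - a)"
        by (rule nn_integral_Gamma) (use True a in auto)
      finally show ?thesis using True Gamma_real_pos[of a] a
        by (simp add: ennreal_mult[symmetric] mult_ac)
    qed simp
  qed
  also have "\<dots> = ennreal (Gamma a) * (\<integral>\<^sup>+t\<in>{0<..}. ennreal (t powr ((1 - a) - 1) * exp (- r * t)) \<partial>lborel)"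
    by (rule nn_integral_cmult) simp
  also have "(\<integral>\<^sup>+t\<in>{0<..}. ennreal (t powr ((1 - a) - 1) * exp (- r * t)) \<partial>lborel) = ennreal (Gamma (1 - a) * r powr - (1 - a))"
    by (rule nn_integral_Gamma) (use a r in auto)
  finally show ?thesis using Gamma_real_pos[of a] Gamma_real_pos[of "1 - a"] a by (simp add: ennreal_mult[symmetric] mult_ac)
qed

lemma Stieltjes_set_integrable:
  assumes a: "0 < a" "a < 1" and w: "0 \<le> Re w" "w \<noteq> 0"
  shows "set_integrable lborel {0<..} (\<lambda>s. of_real (s powr (a - 1)) / (of_real s + w))"
proof -
  have r: "0 < norm w" using w by simp
  have i: "set_integrable lborel {0<..} (\<lambda>s. s powr (a - 1) / (s + norm w))"
    by (rule set_integral_nonneg_nn(1)[OF _ _ nn_integral_Stieltjes[OF a r]])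
       (use a r in \<open>auto simp: set_borel_measurable_def\<close>)
  show ?thesis
    using set_integrable_mult_right[of 2, OF i] unfolding set_integrable_def
  proof (rule Bochner_Integration.integrable_bound)
    show "AE s in lborel. norm (indicat_real {0<..} s *\<^sub>R (of_real (s powr (a - 1)) / (of_real s + w)))
       \<le> norm (indicat_real {0<..} s *\<^sub>R (2 * (s powr (a - 1) / (s + norm w))))"
    proof (rule AE_I2)
      fix s :: real
      have "s powr (a - 1) / norm (of_real s + w) \<le> s powr (a - 1) / ((s + norm w) / 2)" if "s > 0"
        using norm_add_iy_ge[of s w] w that r by (intro divide_left_mono) (auto intro!: mult_pos_pos add_pos_pos simp: complex_eq_iff)
      then show "norm (indicat_real {0<..} s *\<^sub>R (of_real (s powr (a - 1)) / (of_real s + w)))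
       \<le> norm (indicat_real {0<..} s *\<^sub>R (2 * (s powr (a - 1) / (s + norm w))))"
        by (auto simp: indicator_def norm_divide mult.commute)
    qed
  qed measurable
qed

text \<open>The exchange of \<open>nn_integral_Stieltjes\<close> is repeated with Fubini's theorem;
  a positive real part of \<open>w\<close> makes the inner integral absolutely convergent, with
  \<open>s powr (a - 1) / (s + Re w)\<close> as the integral of the norm.\<close>

lemma Stieltjes_integral_right_half_plane:
  assumes a: "0 < a" "a < 1" and w: "0 < Re w"
  shows "(LINT s:{0<..}|lborel. of_real (s powr (a - 1)) / (of_real s + w)) = of_real (Gamma a * Gamma (1 - a)) * w powr (of_real (a - 1))"
proof -
  define f where "f = (\<lambda>s t. indicat_real {0<..} s *\<^sub>R indicat_real {0<..} t *\<^sub>R (of_real (s powr (a - 1)) * exp (- (of_real s + w) * of_real t)))"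
  have inner: "(LINT t|lborel. f s t) = indicat_real {0<..} s *\<^sub>R (of_real (s powr (a - 1)) / (of_real s + w))" 
    and innerint: "integrable lborel (f s)"
    and innernorm: "(LINT t|lborel. norm (f s t)) = indicat_real {0<..} s *\<^sub>R (s powr (a - 1) / (s + Re w))" for s
  proof -
    have pos: "0 < Re (of_real s + w)" if "s > 0" using w that by simp
    have ii: "set_integrable lborel {0<..} (\<lambda>r. of_real (r powr (1 - 1)) * exp (- (of_real s + w) * of_real r))" if "s > 0"
      by (rule Gamma_integral_rotated(1)) (use pos that in auto)
    have eq: "f s t = (indicat_real {0<..} s * s powr (a - 1)) *\<^sub>R (indicat_real {0<..} t *\<^sub>R (of_real (t powr (1 - 1)) * exp (- (of_real s + w) * of_real t)))" for t
      by (auto simp: f_def indicator_def scaleR_conv_of_real)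
    show "integrable lborel (f s)"
    proof (cases "s > 0")
      case True
      show ?thesis unfolding eq[abs_def] using ii[OF True] unfolding set_integrable_def
        by (intro integrable_scaleR_right)
    qed (auto simp: f_def)
    show "(LINT t|lborel. f s t) = indicat_real {0<..} s *\<^sub>R (of_real (s powr (a - 1)) / (of_real s + w))"
    proof (cases "s > 0")
      case True
      have "(LINT t|lborel. f s t) = (indicat_real {0<..} s * s powr (a - 1)) *\<^sub>R (LINT r:{0<..}|lborel. of_real (r powr (1 - 1)) * exp (- (of_real s + w) * of_real r))"
        unfolding eq set_lebesgue_integral_def by (rule integral_scaleR_right)
      also have "(LINT r:{0<..}|lborel. of_real (r powr (1 - 1)) * exp (- (of_real s + w) * of_real r)) = of_real (Gamma 1) * (of_real s + w) powr (- of_real 1)"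
        by (rule Gamma_integral_rotated(2)) (use pos True in auto)
      also have "\<dots> = 1 / (of_real s + w)" using pos[OF True] by (auto simp: powr_minus complex_eq_iff field_simps)
      finally show ?thesis using True by (simp add: scaleR_conv_of_real)
    qed (auto simp: f_def)
    have eqn: "norm (f s t) = (indicat_real {0<..} s * s powr (a - 1)) *\<^sub>R (indicat_real {0<..} t *\<^sub>R exp (- (s + Re w) * t))" for t
      by (auto simp: f_def indicator_def norm_mult)
    show "(LINT t|lborel. norm (f s t)) = indicat_real {0<..} s *\<^sub>R (s powr (a - 1) / (s + Re w))"
    proof (cases "s > 0")
      case True
      have "(\<integral>\<^sup>+r\<in>{0<..}. ennreal (exp (- (s + Re w) * r)) \<partial>lborel) = (\<integral>\<^sup>+r\<in>{0<..}. ennreal (r powr (1 - 1) * exp (- (s + Re w) * r)) \<partial>lborel)"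
        by (intro nn_integral_cong) (auto simp: indicator_def)
      also have "\<dots> = ennreal (Gamma 1 * (s + Re w) powr - 1)" by (rule nn_integral_Gamma) (use True w in auto)
      finally have "(LINT t:{0<..}|lborel. exp (- (s + Re w) * t)) = Gamma 1 * (s + Re w) powr - 1"
        using True w by (intro set_integral_nonneg_nn(2)) (auto simp: set_borel_measurable_def)
      then show ?thesis unfolding eqn
        using True w by (simp add: set_lebesgue_integral_def powr_minus divide_inverse)
    qed (auto simp: f_def)
  qed
  have [measurable]: "(\<lambda>x. f (fst x) (snd x)) \<in> borel_measurable (lborel \<Otimes>\<^sub>M lborel)" unfolding f_def by measurable
  have rint: "set_integrable lborel {0<..} (\<lambda>s. s powr (a - 1) / (s + Re w))"
    by (rule set_integral_nonneg_nn(1)[OF _ _ nn_integral_Stieltjes[OF a w]])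
       (use a w in \<open>auto simp: set_borel_measurable_def\<close>)
  have F: "integrable (lborel \<Otimes>\<^sub>M lborel) (\<lambda>(s, t). f s t)"
    by (rule lborel_pair.Fubini_integrable)
       (use innerint rint in \<open>auto simp: innernorm set_integrable_def split_def\<close>)
  have "(LINT s:{0<..}|lborel. of_real (s powr (a - 1)) / (of_real s + w)) = (LINT s|lborel. LINT t|lborel. f s t)"
    by (simp add: inner set_lebesgue_integral_def)
  also have "\<dots> = (LINT t|lborel. LINT s|lborel. f s t)"
    by (rule lborel_pair.Fubini_integral[OF F, symmetric])
  also have "\<dots> = (LINT t|lborel. of_real (Gamma a) * (indicat_real {0<..} t *\<^sub>R (of_real (t powr ((1 - a) - 1)) * exp (- w * of_real t))))"
  proof (intro Bochner_Integration.integral_cong refl)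
    fix t :: real
    show "(LINT s|lborel. f s t) = of_real (Gamma a) * (indicat_real {0<..} t *\<^sub>R (of_real (t powr ((1 - a) - 1)) * exp (- w * of_real t)))"
    proof (cases "t > 0")
      case True
      have "(LINT s|lborel. f s t) = (LINT s|lborel. exp (- w * of_real t) * (indicat_real {0<..} s *\<^sub>R (of_real (s powr (a - 1)) * exp (- of_real t * of_real s))))"
        using True by (intro Bochner_Integration.integral_cong) (auto simp: f_def indicator_def algebra_simps exp_diff exp_minus divide_inverse)
      also have "\<dots> = exp (- w * of_real t) * (LINT s:{0<..}|lborel. of_real (s powr (a - 1)) * exp (- of_real t * of_real s))"
        unfolding set_lebesgue_integral_def by (rule integral_mult_right_zero)
      also have "(LINT s:{0<..}|lborel. of_real (s powr (a - 1)) * exp (- complex_of_real t * of_real s)) = of_real (Gamma a) * of_real t powr (- of_real a)"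
        by (rule Gamma_integral_rotated(2)) (use True a in auto)
      also have "complex_of_real t powr (- of_real a) = of_real (t powr (- a))"
        using True by (simp add: powr_of_real[symmetric])
      finally show ?thesis using True by (simp add: mult_ac)
    qed (auto simp: f_def)
  qed
  also have "\<dots> = of_real (Gamma a) * (LINT t:{0<..}|lborel. of_real (t powr ((1 - a) - 1)) * exp (- w * of_real t))"
    unfolding set_lebesgue_integral_def by (rule integral_mult_right_zero)
  also have "(LINT t:{0<..}|lborel. of_real (t powr ((1 - a) - 1)) * exp (- w * of_real t)) = of_real (Gamma (1 - a)) * w powr (- of_real (1 - a))"
    by (rule Gamma_integral_rotated(2)) (use a w in auto)
  finally show ?thesis by simp
qed

text \<open>The stable exponent needs imaginary \<open>w\<close>, on the boundary of the half-plane
  treated before. Shifting \<open>w\<close> to the right only enlarges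
  \<open>norm (of_real s + w)\<close>, so the integrand at \<open>w\<close> itself dominates the
  approximating ones.\<close>

lemma Stieltjes_integral:
  assumes a: "0 < a" "a < 1" and w: "0 \<le> Re w" "w \<noteq> 0"
  shows "(LINT s:{0<..}|lborel. of_real (s powr (a - 1)) / (of_real s + w)) = of_real (Gamma a * Gamma (1 - a)) * w powr (of_real (a - 1))"
proof -
  define e :: "nat \<Rightarrow> complex" where "e n = w + of_real (inverse (real (Suc n)))" for n
  have el: "e \<longlonglongrightarrow> w + of_real 0" unfolding e_def[abs_def]
    by (intro tendsto_add tendsto_const tendsto_of_real LIMSEQ_inverse_real_of_nat)
  have e: "0 < Re (e n)" for n using w by (simp add: e_def add_nonneg_pos)
  have "(\<lambda>n. LINT s|lborel. indicat_real {0<..} s *\<^sub>R (of_real (s powr (a - 1)) / (of_real s + e n))) \<longlonglongrightarrow>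
    (LINT s|lborel. indicat_real {0<..} s *\<^sub>R (of_real (s powr (a - 1)) / (of_real s + w)))"
  proof (rule integral_dominated_convergence)
    show "integrable lborel (\<lambda>s. norm (indicat_real {0<..} s *\<^sub>R (of_real (s powr (a - 1)) / (of_real s + w))))"
      using Stieltjes_set_integrable[OF a w] unfolding set_integrable_def by (rule integrable_norm)
    have nz: "of_real s + w \<noteq> 0" if "s > 0" for s using w that by (auto simp: complex_eq_iff)
    show "AE s in lborel. (\<lambda>n. indicat_real {0<..} s *\<^sub>R (of_real (s powr (a - 1)) / (of_real s + e n))) \<longlonglongrightarrow>
       indicat_real {0<..} s *\<^sub>R (of_real (s powr (a - 1)) / (of_real s + w))"
      using el nz by (intro AE_I2) (auto simp: indicator_def intro!: tendsto_intros)
    show "AE s in lborel. norm (indicat_real {0<..} s *\<^sub>R (of_real (s powr (a - 1)) / (of_real s + e n))) \<le>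
       norm (indicat_real {0<..} s *\<^sub>R (of_real (s powr (a - 1)) / (of_real s + w)))" for n
    proof (rule AE_I2)
      fix s :: real
      have "norm (of_real s + w) \<le> norm (of_real s + e n)" if "s > 0"
        using power_mono[of "s + Re w" "s + Re (e n)" 2] that w by (simp add: cmod_def e_def)
      then show "norm (indicat_real {0<..} s *\<^sub>R (of_real (s powr (a - 1)) / (of_real s + e n))) \<le>
       norm (indicat_real {0<..} s *\<^sub>R (of_real (s powr (a - 1)) / (of_real s + w)))"
        using nz[of s] by (auto simp: indicator_def norm_divide intro!: divide_left_mono mult_pos_pos)
    qed
  qed measurable
  then have "(\<lambda>n. of_real (Gamma a * Gamma (1 - a)) * e n powr (of_real (a - 1))) \<longlonglongrightarrow>
    (LINT s:{0<..}|lborel. of_real (s powr (a - 1)) / (of_real s + w))"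
    using Stieltjes_integral_right_half_plane[OF a e] by (simp add: set_lebesgue_integral_def)
  moreover have "(\<lambda>n. of_real (Gamma a * Gamma (1 - a)) * e n powr (of_real (a - 1))) \<longlonglongrightarrow> of_real (Gamma a * Gamma (1 - a)) * w powr (of_real (a - 1))"
  proof (intro tendsto_mult_left tendsto_powr_complex tendsto_const)
    show "e \<longlonglongrightarrow> w" using el by simp
    show "w \<notin> \<real>\<^sub>\<le>\<^sub>0" using w by (auto simp: complex_nonpos_Reals_iff complex_eq_iff)
  qed
  ultimately show ?thesis using LIMSEQ_unique by blast
qed

section \<open>Extremal stable densities\<close>

locale stable_index =
  fixes g :: real
  assumes g1: "1 < g" and g2: "g < 2"
begin

text \<open>For \<open>\<mu>(ds) = d (rate * s\<^sup>g)\<close> one has \<open>(iy)\<^sup>g = \<integral> (iy/s - Ln (1 + iy/s)) \<mu>(ds)\<close>, and \<open>node N\<close> cuts the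
  half-line into cells of mass \<open>1/N\<close>. A unit pole at \<open>node N (k * N)\<close> together with zeros at \<open>node N (j + 1)\<close> and
  poles at \<open>pole N j\<close> approximates this integral: \<open>level\<close> restores the fractional part of the mass
  that the unit poles omit.\<close>

definition rate :: real where "rate = 1 / (Gamma (g - 1) * Gamma (2 - g))"

definition node :: "nat \<Rightarrow> nat \<Rightarrow> real" where
  "node N m = (real m / (rate * real N)) powr (1 / g)"

definition level :: "nat \<Rightarrow> nat \<Rightarrow> real" where
  "level N j = real (j mod N) / real N"

definition pole :: "nat \<Rightarrow> nat \<Rightarrow> real" where
  "pole N j = node N (Suc j) - level N j * (node N (Suc j) - node N j)"

text \<open>Minus the derivative of \<open>log_factor y\<close> in its second argument, simplified.
  Integration by parts against the measure \<open>d (rate * s powr g)\<close> turns the stable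
  exponent into the integral of \<open>rate * s powr g\<close> times this kernel.\<close>

definition kernel :: "real \<Rightarrow> real \<Rightarrow> complex" where
  "kernel y s = - (of_real (y\<^sup>2)) / ((of_real s)\<^sup>2 * (of_real s + \<i> * of_real y))"

text \<open>For positive \<open>p\<close>, a logarithm of the characteristic function of
  \<open>1 / p - Y\<close> with \<open>Y\<close> exponential of rate \<open>p\<close>. The linear
  term is the centring.\<close>

definition log_factor :: "real \<Rightarrow> real \<Rightarrow> complex" where
  "log_factor y p = \<i> * of_real y / of_real p - Ln (1 + \<i> * of_real y / of_real p)"

lemma rate_pos: "0 < rate"
  using g1 g2 Gamma_real_pos[of "g - 1"] Gamma_real_pos[of "2 - g"] by (simp add: rate_def)

lemma node_0 [simp]: "node N 0 = 0" by (simp add: node_def)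

lemma node_mono: "m < m' \<Longrightarrow> 0 < N \<Longrightarrow> node N m < node N m'"
  unfolding node_def using rate_pos g1 by (intro powr_less_mono2) (auto simp: divide_strict_right_mono)

lemma node_nonneg: "0 \<le> node N m" by (simp add: node_def)

lemma node_less_iff:
  assumes s: "0 < s" and N: "0 < N"
  shows "node N m < s \<longleftrightarrow> real m < rate * real N * s powr g"
proof -
  have sg: "(s powr g) powr (1 / g) = s" using s g1 by (simp add: powr_powr)
  have "node N m < s \<longleftrightarrow> (real m / (rate * real N)) powr (1 / g) < (s powr g) powr (1 / g)"
    by (simp add: node_def sg)
  also have "\<dots> \<longleftrightarrow> real m / (rate * real N) < s powr g"
    using powr_less_mono2[of "1 / g" "real m / (rate * real N)" "s powr g"] powr_mono2[of "1 / g" "s powr g" "real m / (rate * real N)"]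
      s g1 rate_pos by (force simp: not_less zero_le_divide_iff)
  also have "\<dots> \<longleftrightarrow> real m < rate * real N * s powr g"
    using rate_pos N by (simp add: field_simps)
  finally show ?thesis .
qed

lemma level_bounds: "0 < N \<Longrightarrow> 0 \<le> level N j" "0 < N \<Longrightarrow> level N j < 1"
  by (auto simp: level_def)

lemma pole_bounds:
  assumes N: "0 < N" shows "node N j < pole N j" "pole N j \<le> node N (Suc j)" "0 < pole N j"
proof -
  have d: "0 < node N (Suc j) - node N j" using node_mono[of j "Suc j" N] N by simp
  have "level N j * (node N (Suc j) - node N j) < 1 * (node N (Suc j) - node N j)"
    using d level_bounds[OF N] by (intro mult_strict_right_mono) auto
  then show "node N j < pole N j" by (simp add: pole_def)
  then show "0 < pole N j" using node_nonneg[of N j] by linarith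
  show "pole N j \<le> node N (Suc j)" using d level_bounds(1)[OF N] by (simp add: pole_def)
qed

lemma kernel_eq:
  assumes "0 < s"
  shows "of_real (rate * s powr g) * kernel y s = - of_real (rate * y\<^sup>2) * (of_real (s powr ((g - 1) - 1)) / (of_real s + \<i> * of_real y))"
proof -
  have "s powr g = s\<^sup>2 * s powr ((g - 1) - 1)"
    using assms by (simp add: powr_diff power2_eq_square)
  then show ?thesis using assms by (simp add: kernel_def)
qed

text \<open>\<open>kernel_eq\<close> reduces this to the Stieltjes integral with exponent
  \<open>g - 1\<close> at \<open>w = \<i> * of_real y\<close>; \<open>rate\<close> is the constant
  that normalises its value to \<open>(\<i> * of_real y) powr of_real g\<close>. The same function
  will dominate all approximations of the exponent.\<close>

lemma kernel_majorant:
  assumes "y \<noteq> 0"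
  shows "set_integrable lborel {0<..} (\<lambda>s. of_real (rate * s powr g) * kernel y s)"
    "(LINT s:{0<..}|lborel. of_real (rate * s powr g) * kernel y s) = (\<i> * of_real y) powr of_real g"
proof -
  have a: "0 < g - 1" "g - 1 < 1" using g1 g2 by auto
  have w: "0 \<le> Re (\<i> * of_real y)" "\<i> * of_real y \<noteq> 0" using assms by auto
  have eq: "indicat_real {0<..} s *\<^sub>R (of_real (rate * s powr g) * kernel y s) =
    - of_real (rate * y\<^sup>2) * (indicat_real {0<..} s *\<^sub>R (of_real (s powr ((g - 1) - 1)) / (of_real s + \<i> * of_real y)))" for s
    using kernel_eq[of s y] by (auto simp: indicator_def)
  show "set_integrable lborel {0<..} (\<lambda>s. of_real (rate * s powr g) * kernel y s)"
    unfolding set_integrable_def eq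
    using Stieltjes_set_integrable[OF a w] unfolding set_integrable_def by (intro integrable_mult_right)
  have "(LINT s:{0<..}|lborel. of_real (rate * s powr g) * kernel y s) =
     - of_real (rate * y\<^sup>2) * (LINT s:{0<..}|lborel. of_real (s powr ((g - 1) - 1)) / (of_real s + \<i> * of_real y))"
    unfolding set_lebesgue_integral_def eq by (rule integral_mult_right_zero)
  also have "\<dots> = - of_real (rate * y\<^sup>2) * (of_real (Gamma (g - 1) * Gamma (1 - (g - 1))) * (\<i> * of_real y) powr (of_real ((g - 1) - 1)))"
    by (subst Stieltjes_integral[OF a w]) simp
  also have "\<dots> = of_real (rate * (Gamma (g - 1) * Gamma (2 - g))) * ((\<i> * of_real y)\<^sup>2 * (\<i> * of_real y) powr (of_real ((g - 1) - 1)))"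
    by (simp add: power_mult_distrib)
  also have "rate * (Gamma (g - 1) * Gamma (2 - g)) = 1"
    using rate_pos by (auto simp: rate_def)
  also have "(\<i> * complex_of_real y)\<^sup>2 = (\<i> * of_real y) powr 2"
    using assms by (simp add: powr_numeral)
  also have "(\<i> * of_real y) powr 2 * (\<i> * of_real y) powr (of_real ((g - 1) - 1)) = (\<i> * of_real y) powr of_real g"
    unfolding powr_add[symmetric] by simp
  finally show "(LINT s:{0<..}|lborel. of_real (rate * s powr g) * kernel y s) = (\<i> * of_real y) powr of_real g"
    by simp
qed

lemma kernel_antimono:
  assumes "0 < s" "s \<le> t"
  shows "norm (kernel y t) \<le> norm (kernel y s)"
proof -
  have "norm (of_real s + \<i> * of_real y) \<le> norm (of_real t + \<i> * of_real y)"
    using power_mono[of s t 2] assms by (simp add: cmod_def)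
  moreover have "s\<^sup>2 \<le> t\<^sup>2" using assms by (intro power_mono) auto
  moreover have "0 < norm (of_real s + \<i> * of_real y)" using assms by (auto simp: complex_eq_iff)
  ultimately have "s\<^sup>2 * norm (of_real s + \<i> * of_real y) \<le> t\<^sup>2 * norm (of_real t + \<i> * of_real y)"
    "0 < s\<^sup>2 * norm (of_real s + \<i> * of_real y)"
    using assms by (auto intro!: mult_mono)
  then show ?thesis unfolding kernel_def norm_divide norm_mult norm_minus_cancel norm_of_real norm_power
    by (intro divide_left_mono) (auto intro: mult_pos_pos)
qed

lemma kernel_cont: "0 < s \<Longrightarrow> isCont (kernel y) s"
  unfolding kernel_def[abs_def] by (intro continuous_intros) (auto simp: complex_eq_iff)

lemma kernel_measurable [measurable]: "kernel y \<in> borel_measurable borel"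
  unfolding kernel_def[abs_def] by measurable

lemma exp_log_factor: "0 < p \<Longrightarrow> exp (log_factor y p) = exp (\<i> * of_real y / of_real p) / (1 + \<i> * of_real y / of_real p)"
  unfolding log_factor_def exp_diff by (subst exp_Ln) (auto simp: complex_eq_iff)

lemma log_factor_integral:
  assumes y: "y \<noteq> 0" and p: "0 < p"
  shows "set_integrable lborel {p<..} (kernel y)" "(LINT s:{p<..}|lborel. kernel y s) = log_factor y p"
proof -
  define w where "w = \<i> * complex_of_real y"
  have mm: "set_integrable lborel {0<..} (\<lambda>s. of_real (1 / (rate * p powr g)) * (of_real (rate * s powr g) * kernel y s))"
    using kernel_majorant(1)[OF y] by (intro set_integrable_mult_right)
  show int: "set_integrable lborel {p<..} (kernel y)"
    using mm unfolding set_integrable_def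
  proof (rule Bochner_Integration.integrable_bound)
    show "AE s in lborel. norm (indicat_real {p<..} s *\<^sub>R kernel y s)
       \<le> norm (indicat_real {0<..} s *\<^sub>R (of_real (1 / (rate * p powr g)) * (of_real (rate * s powr g) * kernel y s)))"
    proof (rule AE_I2)
      fix s :: real
      have "norm (kernel y s) \<le> s powr g / p powr g * norm (kernel y s)" if "p < s"
        using that p g1 powr_mono2[of g p s] mult_right_mono[of 1 "s powr g / p powr g" "norm (kernel y s)"] by simp
      then show "norm (indicat_real {p<..} s *\<^sub>R kernel y s)
       \<le> norm (indicat_real {0<..} s *\<^sub>R (of_real (1 / (rate * p powr g)) * (of_real (rate * s powr g) * kernel y s)))"
        using p rate_pos by (auto simp: indicator_def norm_mult norm_divide)
    qed
  qed measurable
  have "(LBINT s=ereal p..\<infinity>. kernel y s) = 0 - (- log_factor y p)"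
  proof (rule interval_integral_FTC_integrable)
    fix s assume "ereal p < ereal s"
    then have s: "0 < s" using p by simp
    have nz: "of_real s + w \<noteq> 0" "1 + w / of_real s \<notin> \<real>\<^sub>\<le>\<^sub>0"
      using s by (auto simp: w_def complex_eq_iff complex_nonpos_Reals_iff)
    have D: "((\<lambda>z. - (w / z - Ln (1 + w / z))) has_field_derivative (w / (of_real s)\<^sup>2 - (w / (of_real s)\<^sup>2) / (1 + w / of_real s))) (at (of_real s))"
      using s nz by (auto intro!: derivative_eq_intros simp: power2_eq_square field_simps)
    have eq: "w / (of_real s)\<^sup>2 - (w / (of_real s)\<^sup>2) / (1 + w / of_real s) = kernel y s"
    proof -
      have "1 + w / of_real s = (of_real s + w) / of_real s" using s by (simp add: field_simps)
      moreover have "w\<^sup>2 = - of_real (y\<^sup>2)" by (simp add: w_def power_mult_distrib)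
      ultimately show ?thesis using s nz unfolding kernel_def w_def[symmetric]
        by (simp add: divide_simps) (simp add: algebra_simps power2_eq_square)
    qed
    show "((\<lambda>s. - log_factor y s) has_vector_derivative kernel y s) (at s)"
      using has_vector_derivative_real_field[OF D[unfolded eq]] by (simp add: log_factor_def w_def)
    show "isCont (kernel y) s" using kernel_cont[OF s] .
  next
    show "set_integrable lborel (einterval (ereal p) \<infinity>) (kernel y)" using int by simp
    have "isCont (\<lambda>s. - log_factor y s) p"
      unfolding log_factor_def using p by (intro continuous_intros) (auto simp: complex_nonpos_Reals_iff)
    then show "(((\<lambda>s. - log_factor y s) \<circ> real_of_ereal) \<longlongrightarrow> - log_factor y p) (at_right (ereal p))"
      by (auto simp: ereal_tendsto_simps1 isCont_def intro: tendsto_within_subset)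
    have "((\<lambda>s. complex_of_real (inverse s)) \<longlongrightarrow> of_real 0) at_top"
      by (intro tendsto_of_real tendsto_inverse_0_at_top filterlim_ident)
    then have i0: "((\<lambda>s. \<i> * of_real y / of_real s) \<longlongrightarrow> 0) at_top"
      using tendsto_mult_right_zero[of "\<lambda>s. complex_of_real (inverse s)" at_top w] by (simp add: w_def divide_inverse of_real_inverse)
    have "((\<lambda>s. - (\<i> * of_real y / of_real s - Ln (1 + \<i> * of_real y / of_real s))) \<longlongrightarrow> - (0 - Ln (1 + 0))) at_top"
      by (intro tendsto_minus tendsto_diff tendsto_Ln tendsto_add tendsto_const i0) auto
    then show "(((\<lambda>s. - log_factor y s) \<circ> real_of_ereal) \<longlongrightarrow> 0) (at_left \<infinity>)"
      by (simp add: ereal_tendsto_simps1 log_factor_def)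
  qed simp
  then show "(LINT s:{p<..}|lborel. kernel y s) = log_factor y p"
    by (simp add: interval_lebesgue_integral_def)
qed

end

section \<open>Riemann sums for the stable exponent\<close>

context stable_index begin

text \<open>Affine map of the cell between two consecutive nodes onto the piece from
  \<open>pole N j\<close> to the right node. Its slope \<open>level N j\<close> becomes the weight
  in \<open>cell_kernel\<close>.\<close>

definition tau :: "nat \<Rightarrow> nat \<Rightarrow> real \<Rightarrow> real" where
  "tau N j s = node N (Suc j) - level N j * (node N (Suc j) - s)"

definition cell_kernel :: "real \<Rightarrow> nat \<Rightarrow> nat \<Rightarrow> real \<Rightarrow> complex" where
  "cell_kernel y N j s = indicat_real {node N j<..node N (Suc j)} s *\<^sub>R (of_real (level N j) * kernel y (tau N j s))"

definition tail_kernel :: "real \<Rightarrow> nat \<Rightarrow> nat \<Rightarrow> real \<Rightarrow> complex" where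
  "tail_kernel y N k s = indicat_real {node N (k * N)<..} s *\<^sub>R kernel y s"

text \<open>Designed so that its integral is the exponent of a finite product of zeros and poles,
  while at fixed \<open>s\<close> it is close to \<open>rate * s powr g\<close> times the kernel:
  the cell through \<open>s\<close> contributes the fractional part of the mass below
  \<open>s\<close>, the tails contribute its integer part.\<close>

definition integrand :: "real \<Rightarrow> nat \<Rightarrow> real \<Rightarrow> complex" where
  "integrand y N s = (\<Sum>j<N * N. cell_kernel y N j s) + (\<Sum>k=1..N. tail_kernel y N k s)"

lemma cell_integral:
  assumes y: "y \<noteq> 0" and N: "0 < N"
  shows "integrable lborel (cell_kernel y N j)"
    "(LINT s|lborel. cell_kernel y N j s) = log_factor y (pole N j) - log_factor y (node N (Suc j))"
proof -
  define p q th where "p = pole N j" and "q = node N (Suc j)" and "th = level N j"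
  have pq: "0 < p" "p \<le> q" using pole_bounds[OF N, of j] by (auto simp: p_def q_def)
  have *: "integrable lborel (cell_kernel y N j) \<and> (LINT s|lborel. cell_kernel y N j s) = log_factor y p - log_factor y q"
  proof (cases "th = 0")
    \<comment> \<open>At level \<open>0\<close> the pole coincides with the zero, and the cell
      contributes nothing.\<close>
    case True
    then have "p = q" by (simp add: p_def q_def th_def pole_def)
    then show ?thesis using True by (simp add: cell_kernel_def[abs_def] th_def)
  next
    case False
    then have th: "0 < th" using level_bounds[OF N, of j] by (simp add: th_def)
    have ip: "set_integrable lborel {p<..q} (kernel y)"
      by (rule set_integrable_subset[OF log_factor_integral(1)[OF y pq(1)]]) auto
    have iq: "set_integrable lborel {q<..} (kernel y)"
      by (rule log_factor_integral(1)[OF y]) (use pq in auto)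
    have un: "{p<..} = {p<..q} \<union> {q<..}" using pq by auto
    have d: "(LINT s:{p<..q}|lborel. kernel y s) = log_factor y p - log_factor y q"
      using set_integral_Un[OF _ ip iq] log_factor_integral(2)[OF y pq(1)] log_factor_integral(2)[OF y, of q] pq
      unfolding un by (simp add: disjoint_iff)
    define f where "f = (\<lambda>s. indicat_real {p<..q} s *\<^sub>R kernel y s)"
    have fi: "integrable lborel f" using ip by (simp add: f_def set_integrable_def)
    have iff: "p < (q - th * q) + th * s \<and> (q - th * q) + th * s \<le> q \<longleftrightarrow> node N j < s \<and> s \<le> node N (Suc j)" for s
    proof -
      have "p = (q - th * q) + th * node N j" by (simp add: p_def q_def th_def pole_def algebra_simps)
      then have "p < (q - th * q) + th * s \<longleftrightarrow> th * node N j < th * s" by simp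
      moreover have "(q - th * q) + th * s \<le> q \<longleftrightarrow> th * s \<le> th * q" by auto
      ultimately show ?thesis using th by (simp add: q_def)
    qed
    have eq: "th *\<^sub>R f ((q - th * q) + th * s) = cell_kernel y N j s" for s
    proof -
      have "(q - th * q) + th * s = tau N j s" by (simp add: q_def th_def tau_def algebra_simps)
      then show ?thesis using iff[of s]
        by (auto simp: f_def cell_kernel_def indicator_def scaleR_conv_of_real th_def)
    qed
    have "integrable lborel (\<lambda>s. f ((q - th * q) + th * s))"
      using lborel_integrable_real_affine[OF fi, of th "q - th * q"] th by simp
    then have "integrable lborel (\<lambda>s. th *\<^sub>R f ((q - th * q) + th * s))" by simp
    moreover have "(LINT s|lborel. f s) = (LINT s|lborel. th *\<^sub>R f ((q - th * q) + th * s))"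
      using lborel_integral_real_affine[of th f "q - th * q"] th by simp
    ultimately show ?thesis unfolding eq using d by (simp add: f_def set_lebesgue_integral_def)
  qed
  then show "integrable lborel (cell_kernel y N j)"
    "(LINT s|lborel. cell_kernel y N j s) = log_factor y (pole N j) - log_factor y (node N (Suc j))"
    by (auto simp: p_def q_def)
qed

lemma tail_integral:
  assumes y: "y \<noteq> 0" and N: "0 < N" and k: "0 < k"
  shows "integrable lborel (tail_kernel y N k)" "(LINT s|lborel. tail_kernel y N k s) = log_factor y (node N (k * N))"
proof -
  have "0 < node N (k * N)" using node_mono[of 0 "k * N" N] N k by simp
  from log_factor_integral[OF y this] show "integrable lborel (tail_kernel y N k)"
     "(LINT s|lborel. tail_kernel y N k s) = log_factor y (node N (k * N))"
    by (auto simp: tail_kernel_def[abs_def] set_integrable_def set_lebesgue_integral_def)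
qed

lemma integrand_integral:
  assumes y: "y \<noteq> 0" and N: "0 < N"
  shows "integrable lborel (integrand y N)"
    "(LINT s|lborel. integrand y N s) = (\<Sum>j<N * N. log_factor y (pole N j) - log_factor y (node N (Suc j))) + (\<Sum>k=1..N. log_factor y (node N (k * N)))"
proof -
  have 1: "integrable lborel (\<lambda>s. \<Sum>j<N * N. cell_kernel y N j s)" using cell_integral[OF y N] by auto
  have 2: "integrable lborel (\<lambda>s. \<Sum>k=1..N. tail_kernel y N k s)" using tail_integral[OF y N] by auto
  show "integrable lborel (integrand y N)" unfolding integrand_def[abs_def] using 1 2 by simp
  show "(LINT s|lborel. integrand y N s) = (\<Sum>j<N * N. log_factor y (pole N j) - log_factor y (node N (Suc j))) + (\<Sum>k=1..N. log_factor y (node N (k * N)))"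
    unfolding integrand_def using 1 2 cell_integral[OF y N] tail_integral[OF y N]
    by (simp add: Bochner_Integration.integral_add Bochner_Integration.integral_sum)
qed

text \<open>The ceiling minus one puts \<open>s\<close> into a cell that is open on the left and
  closed on the right, as in the indicator of \<open>cell_kernel\<close>.\<close>

definition cell_index :: "nat \<Rightarrow> real \<Rightarrow> nat" where
  "cell_index N s = nat (\<lceil>rate * real N * s powr g\<rceil> - 1)"

lemma cell_index_bounds:
  assumes "0 < s" "0 < N"
  shows "real (cell_index N s) < rate * real N * s powr g" "rate * real N * s powr g \<le> real (Suc (cell_index N s))"
proof -
  have "0 < rate * real N * s powr g" using assms rate_pos by simp
  then have "0 < \<lceil>rate * real N * s powr g\<rceil>" by simp
  then have "real (cell_index N s) = of_int \<lceil>rate * real N * s powr g\<rceil> - 1" by (simp add: cell_index_def)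
  then show "real (cell_index N s) < rate * real N * s powr g" "rate * real N * s powr g \<le> real (Suc (cell_index N s))"
    by linarith+
qed

lemma node_less_iff_index:
  assumes "0 < s" "0 < N"
  shows "node N m < s \<longleftrightarrow> m \<le> cell_index N s"
  using cell_index_bounds[OF assms] node_less_iff[OF assms, of m] by linarith

text \<open>A point lies in exactly one cell and to the right of \<open>J div N\<close> of the unit
  poles. The truncations at \<open>N * N\<close> cells and \<open>N\<close> tails show up as the
  case distinction and the minimum.\<close>

lemma integrand_eq:
  assumes s: "0 < s" and N: "0 < N"
  defines "J \<equiv> cell_index N s"
  shows "integrand y N s = (if J < N * N then of_real (level N J) * kernel y (tau N J s) else 0) + of_nat (min N (J div N)) * kernel y s"
proof -
  have cell: "node N j < s \<and> s \<le> node N (Suc j) \<longleftrightarrow> j = J" for j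
    using node_less_iff_index[OF s N, of j] node_less_iff_index[OF s N, of "Suc j"] by (auto simp: J_def)
  have "(\<Sum>j<N * N. cell_kernel y N j s) = (\<Sum>j<N * N. if j = J then of_real (level N J) * kernel y (tau N J s) else 0)"
    using cell by (intro sum.cong) (auto simp: cell_kernel_def indicator_def)
  also have "\<dots> = (if J < N * N then of_real (level N J) * kernel y (tau N J s) else 0)" by auto
  finally have 1: "(\<Sum>j<N * N. cell_kernel y N j s) = (if J < N * N then of_real (level N J) * kernel y (tau N J s) else 0)" .
  have "(\<Sum>k=1..N. tail_kernel y N k s) = (\<Sum>k=1..N. if k \<le> J div N then kernel y s else 0)"
    using node_less_iff_index[OF s N] N
    by (intro sum.cong) (auto simp: tail_kernel_def indicator_def J_def[symmetric] less_eq_div_iff_mult_less_eq)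
  also have "\<dots> = (\<Sum>k\<in>{1..min N (J div N)}. kernel y s)"
    by (rule sum.mono_neutral_cong_right) auto
  finally show ?thesis using 1 by (simp add: integrand_def)
qed

lemma level_div: "0 < N \<Longrightarrow> level N J + real (J div N) = real J / real N"
proof -
  assume N: "0 < N"
  have "real J = real (J div N) * real N + real (J mod N)"
    by (metis div_mult_mod_eq of_nat_add of_nat_mult)
  then show ?thesis using N by (simp add: level_def field_simps)
qed

lemma tau_bounds:
  assumes s: "0 < s" and N: "0 < N"
  shows "s \<le> tau N (cell_index N s) s" "tau N (cell_index N s) s \<le> node N (Suc (cell_index N s))"
proof -
  let ?q = "node N (Suc (cell_index N s))" and ?t = "level N (cell_index N s)"
  have "s \<le> ?q" using node_less_iff_index[OF s N, of "Suc (cell_index N s)"] by auto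
  moreover have "?t * (?q - s) \<le> 1 * (?q - s)" "0 \<le> ?t * (?q - s)"
    using \<open>s \<le> ?q\<close> level_bounds[OF N, of "cell_index N s"] mult_right_mono[of ?t 1 "?q - s"] by auto
  ultimately show "s \<le> tau N (cell_index N s) s" "tau N (cell_index N s) s \<le> ?q" by (auto simp: tau_def)
qed

text \<open>\<open>tau\<close> moves the argument to the right, where the kernel is smaller by
  \<open>kernel_antimono\<close>, and the two weights add up to at most \<open>J / N\<close>, which
  is below \<open>rate * s powr g\<close>. This gives one majorant for all \<open>N\<close>.\<close>

lemma integrand_norm_le:
  assumes N: "0 < N"
  shows "norm (integrand y N s) \<le> norm (indicat_real {0<..} s *\<^sub>R (of_real (rate * s powr g) * kernel y s))"
proof (cases "0 < s")
  case False
  have "node N j \<ge> s" for j using node_nonneg[of N j] False by simp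
  then have "cell_kernel y N j s = 0" "tail_kernel y N k s = 0" for j k
    unfolding cell_kernel_def tail_kernel_def using not_less by (auto simp: indicator_def)
  then show ?thesis by (simp add: integrand_def)
next
  case True
  define J where "J = cell_index N s"
  have "norm (integrand y N s) \<le> level N J * norm (kernel y s) + real (min N (J div N)) * norm (kernel y s)"
    unfolding integrand_eq[OF True N] J_def[symmetric]
  proof (rule order_trans[OF norm_triangle_ineq], rule add_mono)
    show "norm (if J < N * N then complex_of_real (level N J) * kernel y (tau N J s) else 0) \<le> level N J * norm (kernel y s)"
      using level_bounds[OF N, of J] kernel_antimono[OF True tau_bounds(1)[OF True N]]
      by (auto simp: norm_mult J_def intro!: mult_left_mono)
  qed (simp add: norm_mult)
  also have "\<dots> \<le> (level N J + real (J div N)) * norm (kernel y s)"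
    by (simp add: distrib_right mult_right_mono)
  also have "\<dots> \<le> (rate * s powr g) * norm (kernel y s)"
    unfolding level_div[OF N] using cell_index_bounds(1)[OF True N] N
    by (intro mult_right_mono) (auto simp: J_def field_simps)
  finally show ?thesis using True rate_pos by (simp add: norm_mult)
qed

lemma cell_index_limit:
  assumes s: "0 < s"
  shows "(\<lambda>N. real (cell_index N s) / real N) \<longlonglongrightarrow> rate * s powr g"
    "(\<lambda>N. real (Suc (cell_index N s)) / real N) \<longlonglongrightarrow> rate * s powr g"
proof -
  have b: "rate * s powr g - 1 / real N \<le> real (cell_index N s) / real N \<and> real (cell_index N s) / real N \<le> rate * s powr g
    \<and> rate * s powr g \<le> real (Suc (cell_index N s)) / real N \<and> real (Suc (cell_index N s)) / real N \<le> rate * s powr g + 1 / real N" if N: "0 < N" for N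
  proof -
    define x where "x = rate * real N * s powr g"
    have "rate * s powr g = x / real N" using N by (simp add: x_def)
    then show ?thesis using cell_index_bounds[OF s N] N
      unfolding x_def[symmetric] by (auto simp: diff_divide_distrib[symmetric] add_divide_distrib[symmetric] intro!: divide_right_mono)
  qed
  have l: "(\<lambda>N. rate * s powr g - 1 / real N) \<longlonglongrightarrow> rate * s powr g - 0"
    "(\<lambda>N. rate * s powr g + 1 / real N) \<longlonglongrightarrow> rate * s powr g + 0"
    by (intro tendsto_intros lim_1_over_n)+
  show "(\<lambda>N. real (cell_index N s) / real N) \<longlonglongrightarrow> rate * s powr g"
  proof (rule tendsto_sandwich)
    show "(\<lambda>N. rate * s powr g - 1 / real N) \<longlonglongrightarrow> rate * s powr g" using l by simp
    show "(\<lambda>N. rate * s powr g) \<longlonglongrightarrow> rate * s powr g" by simp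
  qed (auto intro!: eventually_sequentiallyI[of 1] simp: b)
  show "(\<lambda>N. real (Suc (cell_index N s)) / real N) \<longlonglongrightarrow> rate * s powr g"
  proof (rule tendsto_sandwich)
    show "(\<lambda>N. rate * s powr g) \<longlonglongrightarrow> rate * s powr g" by simp
    show "(\<lambda>N. rate * s powr g + 1 / real N) \<longlonglongrightarrow> rate * s powr g" using l by simp
  qed (use b in \<open>auto intro!: eventually_sequentiallyI[of 1] simp del: of_nat_Suc\<close>)
qed

text \<open>For large \<open>N\<close> both truncations are inactive at \<open>s\<close>, the total
  weight is \<open>J / N\<close>, and the cell around \<open>s\<close> shrinks, so
  \<open>tau\<close> is squeezed to \<open>s\<close>.\<close>

lemma integrand_limit:
  assumes s: "0 < s"
  shows "(\<lambda>N. integrand y N s) \<longlonglongrightarrow> of_real (rate * s powr g) * kernel y s"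
proof -
  have sg: "(s powr g) powr (1 / g) = s" using s g1 by (simp add: powr_powr)
  have "(\<lambda>N. (real (Suc (cell_index N s)) / real N / rate) powr (1 / g)) \<longlonglongrightarrow> (rate * s powr g / rate) powr (1 / g)"
    using s rate_pos g1 by (intro tendsto_powr tendsto_divide cell_index_limit(2)[OF s] tendsto_const) auto
  then have q: "(\<lambda>N. node N (Suc (cell_index N s))) \<longlonglongrightarrow> s"
    using rate_pos sg by (simp add: node_def mult.commute del: of_nat_Suc)
  have t: "(\<lambda>N. tau N (cell_index N s) s) \<longlonglongrightarrow> s"
    by (rule tendsto_sandwich[OF _ _ tendsto_const q])
       (auto intro!: eventually_sequentiallyI[of 1] tau_bounds s)
  have k: "(\<lambda>N. kernel y (tau N (cell_index N s) s) - kernel y s) \<longlonglongrightarrow> 0"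
    using isCont_tendsto_compose[OF kernel_cont[OF s, of y] t] LIM_zero by blast
  have lk: "(\<lambda>N. of_real (level N (cell_index N s)) * (kernel y (tau N (cell_index N s) s) - kernel y s)) \<longlonglongrightarrow> 0"
  proof (rule Lim_null_comparison)
    show "(\<lambda>N. norm (kernel y (tau N (cell_index N s) s) - kernel y s)) \<longlonglongrightarrow> 0" using tendsto_norm[OF k] by simp
    show "\<forall>\<^sub>F N in sequentially. norm (of_real (level N (cell_index N s)) * (kernel y (tau N (cell_index N s) s) - kernel y s)) \<le> norm (kernel y (tau N (cell_index N s) s) - kernel y s)"
    proof (rule eventually_sequentiallyI[of 1])
      fix N :: nat assume "1 \<le> N"
      then have N: "0 < N" by simp
      have "\<bar>level N (cell_index N s)\<bar> * norm (kernel y (tau N (cell_index N s) s) - kernel y s) \<le> 1 * norm (kernel y (tau N (cell_index N s) s) - kernel y s)"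
        using level_bounds[OF N, of "cell_index N s"] by (intro mult_right_mono) auto
      then show "norm (of_real (level N (cell_index N s)) * (kernel y (tau N (cell_index N s) s) - kernel y s)) \<le> norm (kernel y (tau N (cell_index N s) s) - kernel y s)"
        by (simp add: norm_mult)
    qed
  qed
  have "(\<lambda>N. of_real (level N (cell_index N s)) * (kernel y (tau N (cell_index N s) s) - kernel y s) + of_real (real (cell_index N s) / real N) * kernel y s)
     \<longlonglongrightarrow> 0 + of_real (rate * s powr g) * kernel y s"
    by (intro tendsto_add lk tendsto_mult_right tendsto_of_real cell_index_limit(1)[OF s])
  moreover have "\<forall>\<^sub>F N in sequentially. of_real (level N (cell_index N s)) * (kernel y (tau N (cell_index N s) s) - kernel y s) + of_real (real (cell_index N s) / real N) * kernel y s = integrand y N s"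
  proof -
    obtain m :: nat where m: "rate * s powr g < real m" using reals_Archimedean2[of "rate * s powr g"] by auto
    show ?thesis
    proof (rule eventually_sequentiallyI[of "max 1 m"])
      fix N assume N: "max 1 m \<le> N"
      then have N0: "0 < N" by simp
      define J where "J = cell_index N s"
      have "real J < rate * real N * s powr g" using cell_index_bounds(1)[OF s N0] by (simp add: J_def)
      also have "\<dots> = (rate * s powr g) * real N" by simp
      also have "\<dots> \<le> real N * real N" using m N by (intro mult_right_mono) auto
      finally have J: "J < N * N" by (metis of_nat_less_iff of_nat_mult)
      then have "J div N < N" by (simp add: less_mult_imp_div_less)
      then have I: "integrand y N s = of_real (level N J) * kernel y (tau N J s) + of_nat (J div N) * kernel y s"
        using integrand_eq[OF s N0, of y] J by (simp add: J_def)
      have "complex_of_real (real J / real N) = of_real (level N J) + of_nat (J div N)"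
        unfolding level_div[OF N0, symmetric] by simp
      then show "of_real (level N (cell_index N s)) * (kernel y (tau N (cell_index N s) s) - kernel y s) + of_real (real (cell_index N s) / real N) * kernel y s = integrand y N s"
        unfolding J_def[symmetric] I by (simp add: algebra_simps)
    qed
  qed
  ultimately show ?thesis by (simp add: Lim_transform_eventually)
qed

lemma integrand_integral_limit:
  assumes y: "y \<noteq> 0"
  shows "(\<lambda>N. LINT s|lborel. integrand y (Suc N) s) \<longlonglongrightarrow> (\<i> * of_real y) powr of_real g"
  unfolding kernel_majorant(2)[OF y, symmetric] set_lebesgue_integral_def
proof (rule integral_dominated_convergence)
  show "integrable lborel (\<lambda>s. norm (indicat_real {0<..} s *\<^sub>R (of_real (rate * s powr g) * kernel y s)))"
    using kernel_majorant(1)[OF y] unfolding set_integrable_def by (rule integrable_norm)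
  show "AE s in lborel. norm (integrand y (Suc N) s) \<le> norm (indicat_real {0<..} s *\<^sub>R (of_real (rate * s powr g) * kernel y s))" for N
    by (intro AE_I2 integrand_norm_le) simp
  show "integrand y (Suc N) \<in> borel_measurable lborel" for N
    using integrand_integral(1)[OF y, of "Suc N"] by auto
  show "AE s in lborel. (\<lambda>N. integrand y (Suc N) s) \<longlonglongrightarrow> indicat_real {0<..} s *\<^sub>R (of_real (rate * s powr g) * kernel y s)"
  proof (rule AE_I2)
    fix s :: real
    show "(\<lambda>N. integrand y (Suc N) s) \<longlonglongrightarrow> indicat_real {0<..} s *\<^sub>R (of_real (rate * s powr g) * kernel y s)"
    proof (cases "0 < s")
      case True
      then show ?thesis using LIMSEQ_Suc[OF integrand_limit[OF True, of y]] by simp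
    next
      case False
      then have "integrand y (Suc N) s = 0" for N using integrand_norm_le[of "Suc N" y s] by simp
      then show ?thesis using False by simp
    qed
  qed
qed measurable

end

lemma norm_one_plus_imaginary: "norm (1 + \<i> * of_real y / of_real p) = sqrt (1 + (y / p)\<^sup>2)"
proof -
  have "1 + \<i> * complex_of_real y / of_real p = Complex 1 (y / p)" by (auto simp: complex_eq_iff)
  then show ?thesis by (simp add: cmod_def)
qed

lemma measure_density_singleton:
  fixes h :: "real \<Rightarrow> real"
  assumes [measurable]: "h \<in> borel_measurable borel"
  shows "measure (density lborel (\<lambda>x. ennreal (h x))) {x} = 0"
proof -
  have "emeasure (density lborel (\<lambda>x. ennreal (h x))) {x} = (\<integral>\<^sup>+t. ennreal (h t) * indicator {x} t \<partial>lborel)"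
    by (rule emeasure_density) auto
  also have "\<dots> = 0" by (rule nn_integral_null_set) auto
  finally show ?thesis by (simp add: measure_def)
qed

lemma integrable_inverse_quadratic:
  fixes b :: real
  assumes b: "0 < b"
  shows "integrable lborel (\<lambda>y. 1 / (1 + (y / b)\<^sup>2))"
proof -
  define f where "f = (\<lambda>y. 1 / (1 + (y / b)\<^sup>2))"
  have pos: "0 < 1 + (y / b)\<^sup>2" for y by (intro add_pos_nonneg) auto
  have fm [measurable]: "f \<in> borel_measurable borel" unfolding f_def by measurable
  have half: "(\<integral>\<^sup>+y\<in>{0..}. ennreal (f y) \<partial>lborel) = ennreal (b * (pi / 2) - b * arctan (0 / b))"
  proof (rule nn_integral_FTC_atLeast)
    fix y :: real
    show "((\<lambda>y. b * arctan (y / b)) has_real_derivative f y) (at y)"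
    proof -
      have "((\<lambda>y. b * arctan (y / b)) has_real_derivative b * (inverse (1 + (y / b)\<^sup>2) * (1 / b))) (at y)"
        by (rule DERIV_cmult, rule DERIV_chain2[OF DERIV_arctan]) (use b in \<open>auto intro!: derivative_eq_intros\<close>)
      moreover have "b * (inverse (1 + (y / b)\<^sup>2) * (1 / b)) = f y"
      proof -
        have "b * (i * (1 / b)) = i" for i using b by simp
        then show ?thesis by (simp only: f_def divide_inverse mult_1_left)
      qed
      ultimately show ?thesis by (simp only:)
    qed
    show "0 \<le> f y" using pos[of y] by (simp add: f_def)
  next
    have "filterlim (\<lambda>y. inverse b * y) at_top at_top"
      by (rule filterlim_tendsto_pos_mult_at_top[OF tendsto_const _ filterlim_ident]) (use b in simp)
    then have "((\<lambda>y. b * arctan (inverse b * y)) \<longlongrightarrow> b * (pi / 2)) at_top"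
      by (intro tendsto_mult_left filterlim_compose[OF tendsto_arctan_at_top])
    then show "((\<lambda>y. b * arctan (y / b)) \<longlongrightarrow> b * (pi / 2)) at_top" by (simp only: divide_inverse mult.commute[of _ "inverse b"])
  qed (rule fm)
  have "(\<integral>\<^sup>+y. ennreal (f y) \<partial>lborel) \<le> (\<integral>\<^sup>+y. (ennreal (f y) * indicator {0..} y + ennreal (f y) * indicator {..0} y) \<partial>lborel)"
    by (intro nn_integral_mono) (auto simp: indicator_def)
  also have "\<dots> = (\<integral>\<^sup>+y\<in>{0..}. ennreal (f y) \<partial>lborel) + (\<integral>\<^sup>+y\<in>{..0}. ennreal (f y) \<partial>lborel)"
    by (rule nn_integral_add) auto
  also have "(\<integral>\<^sup>+y\<in>{..0}. ennreal (f y) \<partial>lborel) = (\<integral>\<^sup>+y\<in>{0..}. ennreal (f y) \<partial>lborel)"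
    by (subst nn_integral_real_affine[where c = "-1" and t = 0]) (auto intro!: nn_integral_cong simp: indicator_def f_def)
  finally have le: "(\<integral>\<^sup>+y. ennreal (f y) \<partial>lborel) \<le> (\<integral>\<^sup>+y\<in>{0..}. ennreal (f y) \<partial>lborel) + (\<integral>\<^sup>+y\<in>{0..}. ennreal (f y) \<partial>lborel)" .
  have "(\<integral>\<^sup>+y. ennreal (f y) \<partial>lborel) < \<infinity>" by (rule order_le_less_trans[OF le]) (simp add: half)
  then have "integrable lborel f" by (intro integrableI_nonneg) (use pos in \<open>auto simp: f_def less_imp_le\<close>)
  then show ?thesis by (simp add: f_def)
qed

section \<open>Approximants of the stable law\<close>

context stable_index begin

definition stable_char :: "real \<Rightarrow> complex" where
  "stable_char y = exp ((\<i> * of_real y) powr of_real g)"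

definition stable_density :: "real \<Rightarrow> real" where
  "stable_density = inverse_fourier stable_char"

text \<open>The last clause is a majorant integrable in \<open>y\<close> and the same for every
  \<open>N\<close>: its scale \<open>(2 / rate) powr (1 / g)\<close> is the position of the second
  unit pole, which does not move with \<open>N\<close>.\<close>

definition approximates :: "nat \<Rightarrow> (real \<Rightarrow> real) \<Rightarrow> real \<Rightarrow> bool" where
  "approximates N v c \<longleftrightarrow> nice v \<and> slope_valley v \<and> laplace v 0 = 1 \<and>
    (\<forall>y. y \<noteq> 0 \<longrightarrow> iexp (y * c) * laplace v (\<i> * of_real y) = exp (LINT s|lborel. integrand y N s)) \<and>
    (\<forall>y. norm (laplace v (\<i> * of_real y)) \<le> 1 / (1 + (y / (2 / rate) powr (1 / g))\<^sup>2))"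

text \<open>Two unit poles give the quadratic decay of the transform, hence
  \<open>2 \<le> N\<close>. The first of them is the opening convolution that absorbs the atom of
  the interlacing product; the others are appended to it.\<close>

lemma approximant:
  assumes N: "2 \<le> N"
  shows "\<exists>v c. approximates N v c"
proof -
  have N0: "0 < N" using N by simp
  define q where "q j = node N (Suc j)" for j
  define a where "a k = node N (k * N)" for k
  have qpos: "0 < q j" for j using node_mono[of 0 "Suc j" N] N0 by (simp add: q_def)
  have apos: "0 < a k" if "0 < k" for k using node_mono[of 0 "k * N" N] N0 that by (simp add: a_def)
  have a_mono: "a 1 \<le> a 2" using node_mono[of "1 * N" "2 * N" N] N0 by (simp add: a_def less_imp_le)
  have a2: "a 2 = (2 / rate) powr (1 / g)"
    using N0 rate_pos by (simp add: a_def node_def field_simps)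
  have "\<exists>v. nice v \<and> slope_valley v \<and> (\<forall>z. Re z \<ge> 0 \<longrightarrow> laplace v z =
    (\<Prod>i<N * N. (1 + z / of_real (q i)) / (1 + z / of_real (pole N i))) / (\<Prod>a\<leftarrow>a 1 # map a [2..<Suc N]. 1 + z / of_real a))"
    by (rule interlacing_slope_valley) (use pole_bounds[OF N0] apos in \<open>auto simp: q_def\<close>)
  then obtain v where v: "nice v" "slope_valley v"
    and lv: "\<And>z. Re z \<ge> 0 \<Longrightarrow> laplace v z =
    (\<Prod>i<N * N. (1 + z / of_real (q i)) / (1 + z / of_real (pole N i))) / (\<Prod>a\<leftarrow>a 1 # map a [2..<Suc N]. 1 + z / of_real a)"
    by blast
  have "a 1 # map a [2..<Suc N] = map a [1..<Suc N]" using N by (simp add: upt_conv_Cons numeral_2_eq_2 del: upt_Suc)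
  moreover have "(\<Prod>a\<leftarrow>map a [1..<Suc N]. 1 + z / of_real a) = (\<Prod>k=1..N. 1 + z / of_real (a k))" for z :: complex
  proof -
    have "(\<Prod>a\<leftarrow>map a [1..<Suc N]. 1 + z / of_real a) = prod_list (map (\<lambda>k. 1 + z / of_real (a k)) [1..<Suc N])"
      by (simp add: o_def del: upt_Suc)
    also have "\<dots> = (\<Prod>k\<in>set [1..<Suc N]. 1 + z / of_real (a k))"
      by (rule prod.distinct_set_conv_list[symmetric]) simp
    also have "set [1..<Suc N] = {1..N}" by auto
    finally show ?thesis .
  qed
  ultimately have pl: "(\<Prod>a\<leftarrow>a 1 # map a [2..<Suc N]. 1 + z / of_real a) = (\<Prod>k=1..N. 1 + z / of_real (a k))" for z :: complex
    by (simp only:)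
  note lv = lv[unfolded pl]
  \<comment> \<open>The shift collects the linear terms of all the \<open>log_factor\<close>
    contributions.\<close>
  define c where "c = (\<Sum>j<N * N. 1 / pole N j - 1 / q j) + (\<Sum>k=1..N. 1 / a k)"
  have one: "laplace v 0 = 1" by (simp add: lv)
  have ch: "iexp (y * c) * laplace v (\<i> * of_real y) = exp (LINT s|lborel. integrand y N s)" if y: "y \<noteq> 0" for y
  proof -
    have "exp (LINT s|lborel. integrand y N s) =
      (\<Prod>j<N * N. exp (log_factor y (pole N j) - log_factor y (q j))) * (\<Prod>k=1..N. exp (log_factor y (a k)))"
      unfolding integrand_integral(2)[OF y N0] exp_add by (simp add: exp_sum q_def a_def)
    also have "(\<Prod>j<N * N. exp (log_factor y (pole N j) - log_factor y (q j))) =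
       (\<Prod>j<N * N. exp (\<i> * of_real y * of_real (1 / pole N j - 1 / q j)) * ((1 + \<i> * of_real y / of_real (q j)) / (1 + \<i> * of_real y / of_real (pole N j))))"
    proof (intro prod.cong refl)
      fix j
      have "exp (\<i> * of_real y / of_real (pole N j)) / exp (\<i> * of_real y / of_real (q j)) = exp (\<i> * of_real y * of_real (1 / pole N j - 1 / q j))"
        by (simp add: exp_diff[symmetric] algebra_simps)
      then show "exp (log_factor y (pole N j) - log_factor y (q j)) = exp (\<i> * of_real y * of_real (1 / pole N j - 1 / q j)) * ((1 + \<i> * of_real y / of_real (q j)) / (1 + \<i> * of_real y / of_real (pole N j)))"
        unfolding exp_diff exp_log_factor[OF pole_bounds(3)[OF N0]] exp_log_factor[OF qpos] by (simp add: divide_simps) (simp add: algebra_simps)?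
    qed
    also have "\<dots> = exp (\<i> * of_real y * of_real (\<Sum>j<N * N. 1 / pole N j - 1 / q j)) * (\<Prod>j<N * N. (1 + \<i> * of_real y / of_real (q j)) / (1 + \<i> * of_real y / of_real (pole N j)))"
      unfolding prod.distrib of_real_sum sum_distrib_left by (subst exp_sum) auto
    also have "(\<Prod>k=1..N. exp (log_factor y (a k))) = (\<Prod>k=1..N. exp (\<i> * of_real y * of_real (1 / a k)) / (1 + \<i> * of_real y / of_real (a k)))"
      by (intro prod.cong refl, subst exp_log_factor) (auto intro: apos)
    also have "\<dots> = exp (\<i> * of_real y * of_real (\<Sum>k=1..N. 1 / a k)) / (\<Prod>k=1..N. 1 + \<i> * of_real y / of_real (a k))"
      unfolding prod_dividef of_real_sum sum_distrib_left by (subst exp_sum) auto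
    also have "exp (\<i> * of_real y * of_real (\<Sum>j<N * N. 1 / pole N j - 1 / q j)) * (\<Prod>j<N * N. (1 + \<i> * of_real y / of_real (q j)) / (1 + \<i> * of_real y / of_real (pole N j))) *
       (exp (\<i> * of_real y * of_real (\<Sum>k=1..N. 1 / a k)) / (\<Prod>k=1..N. 1 + \<i> * of_real y / of_real (a k))) = iexp (y * c) * laplace v (\<i> * of_real y)"
      by (simp add: lv c_def exp_add distrib_left mult_ac)
    finally show ?thesis by simp
  qed
  have bnd: "norm (laplace v (\<i> * of_real y)) \<le> 1 / (1 + (y / (2 / rate) powr (1 / g))\<^sup>2)" for y
  proof -
    \<comment> \<open>Each zero lies at or beyond its pole, so each quotient has norm at most one on
      the imaginary axis.\<close>
    have A: "(\<Prod>j<N * N. norm ((1 + \<i> * of_real y / of_real (q j)) / (1 + \<i> * of_real y / of_real (pole N j)))) \<le> 1"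
    proof (rule prod_le_1)
      fix j
      have "(y / q j)\<^sup>2 \<le> (y / pole N j)\<^sup>2"
        using pole_bounds[OF N0, of j] by (auto simp: q_def power_divide intro!: divide_left_mono power_mono mult_pos_pos)
      moreover have "0 < sqrt (1 + (y / pole N j)\<^sup>2)" by (simp add: add_pos_nonneg)
      ultimately show "0 \<le> norm ((1 + \<i> * of_real y / of_real (q j)) / (1 + \<i> * of_real y / of_real (pole N j))) \<and>
         norm ((1 + \<i> * of_real y / of_real (q j)) / (1 + \<i> * of_real y / of_real (pole N j))) \<le> 1"
        unfolding norm_divide norm_one_plus_imaginary by (simp add: divide_le_eq_1)
    qed
    \<comment> \<open>Only the two smallest unit poles are kept; replacing \<open>a 1\<close> by the
      larger \<open>a 2\<close> makes the product of the two square roots a square.\<close>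
    have B: "1 + (y / a 2)\<^sup>2 \<le> (\<Prod>k=1..N. norm (1 + \<i> * of_real y / of_real (a k)))"
    proof -
      have "{1..N} = {1, 2} \<union> {3..N}" using N by auto
      then have "(\<Prod>k=1..N. norm (1 + \<i> * of_real y / of_real (a k))) =
        (\<Prod>k\<in>{1,2}. norm (1 + \<i> * of_real y / of_real (a k))) * (\<Prod>k=3..N. norm (1 + \<i> * of_real y / of_real (a k)))"
        by (simp only:, intro prod.union_disjoint) auto
      moreover have "1 \<le> (\<Prod>k=3..N. norm (1 + \<i> * of_real y / of_real (a k)))"
        unfolding norm_one_plus_imaginary by (intro prod_ge_1) simp
      moreover have "1 + (y / a 2)\<^sup>2 \<le> (\<Prod>k\<in>{1,2}. norm (1 + \<i> * of_real y / of_real (a k)))"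
      proof -
        have "sqrt (1 + (y / a 2)\<^sup>2) \<le> sqrt (1 + (y / a 1)\<^sup>2)"
          using a_mono apos[of 1] by (auto simp: power_divide intro!: divide_left_mono power_mono mult_pos_pos)
        then have "sqrt (1 + (y / a 2)\<^sup>2) * sqrt (1 + (y / a 2)\<^sup>2) \<le> sqrt (1 + (y / a 1)\<^sup>2) * sqrt (1 + (y / a 2)\<^sup>2)"
          by (intro mult_right_mono) auto
        moreover have "sqrt (1 + (y / a 2)\<^sup>2) * sqrt (1 + (y / a 2)\<^sup>2) = 1 + (y / a 2)\<^sup>2" by simp
        ultimately show ?thesis unfolding norm_one_plus_imaginary by simp
      qed
      ultimately show ?thesis
        using mult_mono[of "1 + (y / a 2)\<^sup>2" "\<Prod>k\<in>{1,2}. norm (1 + \<i> * of_real y / of_real (a k))" 1 "\<Prod>k=3..N. norm (1 + \<i> * of_real y / of_real (a k))"]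
        by (simp add: prod_nonneg)
    qed
    have C: "norm (laplace v (\<i> * of_real y)) = (\<Prod>j<N * N. norm ((1 + \<i> * of_real y / of_real (q j)) / (1 + \<i> * of_real y / of_real (pole N j)))) /
       (\<Prod>k=1..N. norm (1 + \<i> * of_real y / of_real (a k)))"
    proof -
      define P where "P = (\<Prod>j<N * N. (1 + \<i> * of_real y / of_real (q j)) / (1 + \<i> * of_real y / of_real (pole N j)))"
      define Q where "Q = (\<Prod>k=1..N. 1 + \<i> * of_real y / of_real (a k))"
      have "laplace v (\<i> * of_real y) = P / Q" unfolding P_def Q_def by (rule lv) simp
      then have "norm (laplace v (\<i> * of_real y)) = norm P / norm Q" using norm_divide[of P Q] by simp
      then show ?thesis unfolding P_def Q_def prod_norm[symmetric] .
    qed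
    have "0 < 1 + (y / a 2)\<^sup>2" by (intro add_pos_nonneg) auto
    then show ?thesis unfolding a2[symmetric] C by (rule frac_le[OF zero_le_one A _ B])
  qed
  have "approximates N v c" unfolding approximates_def using v one ch bnd by simp
  then show ?thesis by blast
qed

text \<open>The approximants may alternate between the two cases of
  \<open>slope_valley_four_points\<close>. If the first case recurs infinitely often, it passes to
  the limit on the positive half-line; otherwise the second one holds eventually and passes to the
  limit on the negative half-line.\<close>

theorem stable_density_dichotomy:
  shows "integrable lborel stable_char" and "0 \<le> stable_density x"
    and "(\<forall>x r r' t. 0 < x \<longrightarrow> x < r \<longrightarrow> x < r' \<longrightarrow> r + r' = x + t \<longrightarrow> stable_density x * stable_density t \<le> stable_density r * stable_density r') \<or>
      (\<forall>x h. 0 < h \<longrightarrow> x + h < 0 \<longrightarrow> stable_density x * stable_density x \<le> stable_density (x - h) * stable_density (x + h))"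
proof -
  have "\<forall>n. \<exists>vc. approximates (n + 2) (fst vc) (snd vc)" using approximant by simp
  from choice[OF this] obtain vc where vc: "approximates (n + 2) (fst (vc n)) (snd (vc n))" for n by auto
  define v where "v n = fst (vc n)" for n
  define c where "c n = snd (vc n)" for n
  have v: "\<And>n. nice (v n)" "\<And>n. slope_valley (v n)" "\<And>n. laplace (v n) 0 = 1"
    and ch: "\<And>n y. y \<noteq> 0 \<Longrightarrow> iexp (y * c n) * laplace (v n) (\<i> * of_real y) = exp (LINT s|lborel. integrand y (n + 2) s)"
    and bnd: "\<And>n y. norm (laplace (v n) (\<i> * of_real y)) \<le> 1 / (1 + (y / (2 / rate) powr (1 / g))\<^sup>2)"
    using vc by (simp_all add: approximates_def v_def c_def)
  define h where "h n = reflected (v n) (c n)" for n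
  define \<mu> where "\<mu> n = density lborel (\<lambda>x. ennreal (h n x))" for n
  have \<mu>: "real_distribution (\<mu> n)" and char: "char (\<mu> n) y = iexp (y * c n) * laplace (v n) (\<i> * of_real y)" for n y
    unfolding \<mu>_def h_def using reflected_real_distribution[OF v(1,3)] by auto
  have hm: "h n \<in> borel_measurable borel" "0 \<le> h n x" for n x
    unfolding h_def by (auto intro: reflected_measurable reflected_nonneg v)
  have na: "measure (\<mu> n) {x} = 0" for n x
    unfolding \<mu>_def by (rule measure_density_singleton) (rule hm)
  have lim: "(\<lambda>n. char (\<mu> n) y) \<longlonglongrightarrow> stable_char y" for y
  proof (cases "y = 0")
    case True
    then show ?thesis by (simp add: char v stable_char_def)
  next
    case False
    have "(\<lambda>n. exp (LINT s|lborel. integrand y (Suc (n + 1)) s)) \<longlonglongrightarrow> stable_char y"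
      unfolding stable_char_def
      by (intro tendsto_exp) (rule LIMSEQ_ignore_initial_segment[OF integrand_integral_limit[OF False]])
    then show ?thesis using ch[OF False] by (simp add: char)
  qed
  have b: "0 < (2 / rate) powr (1 / g)" using rate_pos by simp
  have cb: "norm (char (\<mu> n) y) \<le> 1 / (1 + (y / (2 / rate) powr (1 / g))\<^sup>2)" for n y
    unfolding char norm_mult using bnd[of n y] by simp
  show int: "integrable lborel stable_char"
    by (rule measure_interval_limit_from_char(1)[OF \<mu> na integrable_inverse_quadratic[OF b] cb lim, of 0 1]) simp
  define F where "F = inverse_fourier_primitive stable_char"
  have D: "(F has_real_derivative stable_density x) (at x)" for x
    unfolding F_def stable_density_def by (rule inverse_fourier_primitive_deriv[OF int])
  have mlim: "(\<lambda>n. measure (\<mu> n) {a<..b}) \<longlonglongrightarrow> F b - F a" if "a < b" for a b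
    unfolding F_def by (rule measure_interval_limit_from_char(2)[OF \<mu> na integrable_inverse_quadratic[OF b] cb lim that])
  show "0 \<le> stable_density x"
  proof (rule tendsto_lowerbound)
    show "((\<lambda>e. (F (x + e) - F x) / e) \<longlongrightarrow> stable_density x) (at_right 0)"
      using D[of x] unfolding DERIV_def by (rule filterlim_mono) (auto simp: at_le)
    show "\<forall>\<^sub>F e in at_right 0. 0 \<le> (F (x + e) - F x) / e"
      using eventually_at_right_less[of 0]
    proof eventually_elim
      case (elim e)
      have "0 \<le> F (x + e) - F x" by (rule LIMSEQ_le_const[OF mlim]) (use elim in auto)
      then show ?case using elim by simp
    qed
  qed simp
  have fin: "finite_measure (density lborel (\<lambda>x. ennreal (h n x)))" for n
    using \<mu>[of n] unfolding \<mu>_def real_distribution_def by (simp add: prob_space.finite_measure)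
  note fpl = four_points_limit[of h F stable_density, OF hm fin mlim[unfolded \<mu>_def] D]
  define A where "A n \<longleftrightarrow> (\<forall>p t r r'. 0 < p \<longrightarrow> p \<le> r \<longrightarrow> p \<le> r' \<longrightarrow> r + r' = p + t \<longrightarrow> t \<le> c n \<longrightarrow> v n p * v n t \<le> v n r * v n r')" for n
  show "(\<forall>x r r' t. 0 < x \<longrightarrow> x < r \<longrightarrow> x < r' \<longrightarrow> r + r' = x + t \<longrightarrow> stable_density x * stable_density t \<le> stable_density r * stable_density r') \<or>
      (\<forall>x h. 0 < h \<longrightarrow> x + h < 0 \<longrightarrow> stable_density x * stable_density x \<le> stable_density (x - h) * stable_density (x + h))"
  proof (cases "\<exists>\<^sub>F n in sequentially. A n")
    case True
    have "stable_density x * stable_density t \<le> stable_density r1 * stable_density r2"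
      if x: "0 < x" "x < r1" "x < r2" "r1 + r2 = x + t" for x r1 r2 t
    proof -
      \<comment> \<open>With offsets up to \<open>d\<close> the outer two points remain the outer
        ones, so the perturbed quadruples still have the required order.\<close>
      define d where "d = min (r1 - x) (r2 - x)"
      have d: "0 < d" "d \<le> r1 - x" "d \<le> r2 - x" using x by (auto simp: d_def)
      show ?thesis
      proof (rule fpl[OF _ d(1)])
        show "\<exists>\<^sub>F n in sequentially. \<forall>s r. 0 < s \<longrightarrow> s \<le> d \<longrightarrow> 0 < r \<longrightarrow> r \<le> d \<longrightarrow> h n (x + s) * h n (t + r) \<le> h n (r1 + s) * h n (r2 + r)"
          using True
        proof (rule frequently_elim1, intro allI impI)
          fix n s r assume A: "A n" and sr: "0 < s" "s \<le> d" "0 < r" "r \<le> d"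
          show "h n (x + s) * h n (t + r) \<le> h n (r1 + s) * h n (r2 + r)"
          proof (cases "t + r < c n")
            case True
            have "v n (c n - (t + r)) * v n (c n - (x + s)) \<le> v n (c n - (r1 + s)) * v n (c n - (r2 + r))"
              using A[unfolded A_def, rule_format, of "c n - (t + r)" "c n - (r1 + s)" "c n - (r2 + r)" "c n - (x + s)"] True sr d x by auto
            then show ?thesis using True sr d x by (simp add: h_def reflected_def mult.commute)
          next
            case False
            then have "h n (t + r) = 0" by (simp add: h_def reflected_def)
            then show ?thesis using hm(2) by simp
          qed
        qed
      qed simp
    qed
    then show ?thesis by blast
  next
    case False
    then have ev: "\<forall>\<^sub>F n in sequentially. \<not> A n" by (simp add: frequently_def)
    have "stable_density x * stable_density x \<le> stable_density (x - e) * stable_density (x + e)" if e: "0 < e" "x + e < 0" for x e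
    proof -
      define d where "d = min e (- (x + e))"
      have d: "0 < d" "d \<le> e" "x + e + d \<le> 0" using e by (auto simp: d_def)
      show ?thesis
      proof (rule fpl[OF _ d(1)])
        show "\<exists>\<^sub>F n in sequentially. \<forall>s r. 0 < s \<longrightarrow> s \<le> d \<longrightarrow> 0 < r \<longrightarrow> r \<le> d \<longrightarrow> h n (x + s) * h n (x + r) \<le> h n (x - e + s) * h n (x + e + r)"
          using eventually_frequently[OF sequentially_bot ev]
        proof (rule frequently_elim1, intro allI impI)
          fix n s r assume A: "\<not> A n" and sr: "0 < s" "s \<le> d" "0 < r" "r \<le> d"
          \<comment> \<open>A violation of \<open>A n\<close> supplies points with
            \<open>0 < p\<close>, \<open>p \<le> t\<close> and \<open>t \<le> c n\<close>.\<close>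
          have c: "0 < c n" using A unfolding A_def by (smt (verit))
          have "v n (c n - (x + s)) * v n (c n - (x + r)) \<le> v n (c n - (x + e + r)) * v n (c n - (x - e + s))"
          proof -
            have *: "\<forall>p t r r'. 0 < p \<longrightarrow> c n \<le> p \<longrightarrow> p \<le> r \<longrightarrow> p \<le> r' \<longrightarrow> r + r' = p + t \<longrightarrow> v n r * v n r' \<le> v n p * v n t"
            proof -
              have "A n \<or> (\<forall>p t r r'. 0 < p \<longrightarrow> c n \<le> p \<longrightarrow> p \<le> r \<longrightarrow> p \<le> r' \<longrightarrow> r + r' = p + t \<longrightarrow> v n r * v n r' \<le> v n p * v n t)"
                unfolding A_def by (rule slope_valley_four_points[OF v(1,2)])
              then show ?thesis using A by (simp only: simp_thms)
            qed
            show ?thesis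
              using *[rule_format, of "c n - (x + e + r)" "c n - (x + s)" "c n - (x + r)" "c n - (x - e + s)"] c sr d by auto
          qed
          then show "h n (x + s) * h n (x + r) \<le> h n (x - e + s) * h n (x + e + r)"
            using c sr d e by (simp add: h_def reflected_def mult.commute)
        qed
      qed simp
    qed
    then show ?thesis by blast
  qed
qed

end

section \<open>The Mittag-Leffler law\<close>

definition exp_law :: "real measure" where
  "exp_law = density lborel (\<lambda>t. ennreal (exp (- t)) * indicator {0<..} t)"

lemma sets_exp_law [simp, measurable_cong]: "sets exp_law = sets borel"
  and space_exp_law [simp]: "space exp_law = UNIV"
  by (simp_all add: exp_law_def)

lemma nn_integral_exp_law:
  assumes [measurable]: "g \<in> borel_measurable borel"
  shows "(\<integral>\<^sup>+t. g t \<partial>exp_law) = (\<integral>\<^sup>+t. ennreal (exp (- t)) * indicator {0<..} t * g t \<partial>lborel)"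
  unfolding exp_law_def by (rule nn_integral_density) auto

lemma AE_exp_law_pos: "AE t in exp_law. 0 < t"
  unfolding exp_law_def by (subst AE_density) (auto simp: indicator_def split: if_splits)

lemma nn_integral_exp_law_powr:
  assumes "- 1 < w"
  shows "(\<integral>\<^sup>+t. ennreal (t powr w) \<partial>exp_law) = ennreal (Gamma (1 + w))"
proof -
  have "(\<integral>\<^sup>+t. ennreal (t powr w) \<partial>exp_law) = (\<integral>\<^sup>+t\<in>{0<..}. ennreal (t powr ((1 + w) - 1) * exp (- 1 * t)) \<partial>lborel)"
    by (subst nn_integral_exp_law) (auto intro!: nn_integral_cong simp: indicator_def ennreal_mult[symmetric] mult.commute)
  also have "\<dots> = ennreal (Gamma (1 + w) * 1 powr - (1 + w))" by (rule nn_integral_Gamma) (use assms in auto)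
  finally show ?thesis by simp
qed

lemma nn_integral_exp_law_exp:
  assumes "l < 1"
  shows "(\<integral>\<^sup>+t. ennreal (exp (l * t)) \<partial>exp_law) = ennreal (1 / (1 - l))"
proof -
  have "(\<integral>\<^sup>+t. ennreal (exp (l * t)) \<partial>exp_law) = (\<integral>\<^sup>+t\<in>{0<..}. ennreal (t powr (1 - 1) * exp (- (1 - l) * t)) \<partial>lborel)"
    by (subst nn_integral_exp_law)
       (auto intro!: nn_integral_cong simp: indicator_def ennreal_mult[symmetric] exp_add[symmetric] algebra_simps)
  also have "\<dots> = ennreal (Gamma 1 * (1 - l) powr - 1)" by (rule nn_integral_Gamma) (use assms in auto)
  finally show ?thesis using assms by (simp add: powr_minus divide_inverse)
qed

lemma prob_space_exp_law: "prob_space exp_law"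
  using nn_integral_exp_law_exp[of 0] by (intro prob_spaceI) simp

lemma integral_exp_law_iexp_ln:
  "(CLINT t|exp_law. iexp (y * ln t)) = Gamma (1 + \<i> * of_real y)"
proof -
  let ?z = "1 + \<i> * complex_of_real y"
  have eq: "of_real t powr (?z - 1) / of_real (exp t) = exp (- t) *\<^sub>R iexp (y * ln t)" if "0 < t" for t
    using that by (simp add: powr_def Ln_of_real exp_of_real[symmetric] scaleR_conv_of_real exp_minus divide_inverse mult_ac of_real_inverse)
  have "set_integrable lborel {0<..} (\<lambda>t::real. exp (- 1 * t))" by (rule set_integrable_exp_decay) simp
  then have int: "set_integrable lborel {0<..} (\<lambda>t. exp (- t) *\<^sub>R iexp (y * ln t))"
    unfolding set_integrable_def
    by (rule Bochner_Integration.integrable_bound) (auto simp: indicator_def)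
  have "(CLINT t|exp_law. iexp (y * ln t)) = (CLINT t|density lborel (\<lambda>t. ennreal (indicator {0<..} t * exp (- t))). iexp (y * ln t))"
    unfolding exp_law_def by (intro Bochner_Integration.integral_cong density_cong) (auto simp: indicator_def)
  also have "\<dots> = (LINT t:{0<..}|lborel. exp (- t) *\<^sub>R iexp (y * ln t))"
    unfolding set_lebesgue_integral_def
    by (subst integral_density) (auto intro!: Bochner_Integration.integral_cong simp: indicator_def)
  also have "\<dots> = integral {0<..} (\<lambda>t. exp (- t) *\<^sub>R iexp (y * ln t))"
    by (rule set_borel_integral_eq_integral(2)[OF int])
  also have "\<dots> = integral {0<..} (\<lambda>t. of_real t powr (?z - 1) / of_real (exp t))"
    by (rule Henstock_Kurzweil_Integration.integral_cong, rule eq[symmetric]) simp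
  also have "\<dots> = integral {0..} (\<lambda>t. of_real t powr (?z - 1) / of_real (exp t))"
  proof (rule integral_subset_negligible)
    have "{0..} - {0<..} = {0::real}" by auto
    then show "negligible ({0..} - {0<..} :: real set)" by simp
  qed auto
  also have "\<dots> = Gamma ?z" by (rule integral_unique[OF Gamma_integral_complex]) simp
  finally show ?thesis .
qed

text \<open>Only the part of the Gamma integral beyond \<open>T\<close> is kept, with
  \<open>t powr a\<close> replaced by its smallest value there.\<close>

lemma Gamma_lower_bound:
  fixes a T :: real
  assumes "0 \<le> a" "0 < T"
  shows "T powr a * exp (- T) \<le> Gamma (1 + a)"
proof -
  have "ennreal (T powr a * exp (- T)) = (\<integral>\<^sup>+t\<in>{T..}. ennreal (T powr a * exp (- t)) \<partial>lborel)"
  proof -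
    have "(\<integral>\<^sup>+t\<in>{T..}. ennreal (T powr a * exp (- t)) \<partial>lborel) = ennreal (0 - - (T powr a * exp (- T)))"
    proof (rule nn_integral_FTC_atLeast[where F = "\<lambda>t. - (T powr a * exp (- t))" and T = 0])
      have "((\<lambda>t. - (T powr a * exp (- t))) \<longlongrightarrow> - (T powr a * 0)) at_top"
        by (intro tendsto_minus tendsto_mult_left filterlim_compose[OF exp_at_bot] filterlim_uminus_at_bot_at_top)
      then show "((\<lambda>t. - (T powr a * exp (- t))) \<longlongrightarrow> 0) at_top" by simp
    qed (auto intro!: derivative_eq_intros)
    then show ?thesis by simp
  qed
  also have "\<dots> \<le> (\<integral>\<^sup>+t\<in>{0<..}. ennreal (t powr ((1 + a) - 1) * exp (- 1 * t)) \<partial>lborel)"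
    using assms by (intro nn_integral_mono) (auto simp: indicator_def intro!: ennreal_leI mult_right_mono powr_mono2)
  also have "\<dots> = ennreal (Gamma (1 + a) * 1 powr - (1 + a))" by (rule nn_integral_Gamma) (use assms in auto)
  finally show ?thesis using assms Gamma_real_pos[of "1 + a"] by (simp add: ennreal_le_iff)
qed

lemma summable_mittag_leffler:
  fixes l a :: real
  assumes a: "0 < a" and l: "0 < l"
  shows "summable (\<lambda>n. l ^ n * rGamma (1 + a * real n))"
proof (rule summable_comparison_test')
  \<comment> \<open>The choice \<open>T powr a = 2 * l\<close> makes the lower bound for
    \<open>Gamma\<close> outgrow \<open>l ^ n\<close> by the factor \<open>2 ^ n\<close>.\<close>
  define T where "T = (2 * l) powr (1 / a)"
  have T: "0 < T" "T powr a = 2 * l" using a l by (auto simp: T_def powr_powr)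
  show "summable (\<lambda>n. exp T * (1 / 2) ^ n)" by (intro summable_mult summable_geometric) simp
  fix n
  have pos: "0 < Gamma (1 + a * real n)" using a by (intro Gamma_real_pos) (simp add: add_pos_nonneg)
  have "T powr (a * real n) * exp (- T) \<le> Gamma (1 + a * real n)"
    by (rule Gamma_lower_bound) (use a T in auto)
  moreover have "T powr (a * real n) = (2 * l) ^ n" using T l by (simp add: powr_powr[symmetric] powr_realpow)
  ultimately have "rGamma (1 + a * real n) \<le> 1 / ((2 * l) ^ n * exp (- T))"
    unfolding rGamma_inverse_Gamma inverse_eq_divide using l pos by (intro divide_left_mono) auto
  then have "l ^ n * rGamma (1 + a * real n) \<le> l ^ n * (1 / ((2 * l) ^ n * exp (- T)))"
    using l by (intro mult_left_mono) auto
  also have "\<dots> = exp T * (1 / 2) ^ n"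
    using l by (simp add: power_mult_distrib exp_minus power_divide field_simps)
  finally show "norm (l ^ n * rGamma (1 + a * real n)) \<le> exp T * (1 / 2) ^ n"
    using l pos by (simp add: rGamma_inverse_Gamma abs_mult)
qed

locale mittag_leffler_law = real_distribution L for L +
  fixes a :: real
  assumes a0: "0 < a" and a1: "a < 1"
    and L_pos: "AE x in L. 0 < x"
    and L_mgf: "\<And>l. 0 < l \<Longrightarrow> (\<integral>\<^sup>+x. ennreal (exp (l * x)) \<partial>L) = ennreal (\<Sum>n. l ^ n * rGamma (1 + a * real n))"
begin

lemma pair: "pair_sigma_finite exp_law L" "pair_prob_space exp_law L"
proof -
  interpret E: prob_space exp_law by (rule prob_space_exp_law)
  show "pair_prob_space exp_law L" ..
  then show "pair_sigma_finite exp_law L" by (simp add: pair_prob_space_def)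
qed

text \<open>The exponential law has the moments \<open>\<Gamma>(1 + a n)\<close> against \<open>t powr (a n)\<close>, which turns the Mittag-Leffler
  series into a geometric one; so \<open>W\<close> is again exponential, and this identifies the moments of \<open>L\<close>.\<close>

definition W :: "real measure" where
  "W = distr (exp_law \<Otimes>\<^sub>M L) borel (\<lambda>(t, x). t powr a * x)"

lemma nn_integral_W:
  assumes [measurable]: "g \<in> borel_measurable borel"
  shows "(\<integral>\<^sup>+w. g w \<partial>W) = (\<integral>\<^sup>+t. (\<integral>\<^sup>+x. g (t powr a * x) \<partial>L) \<partial>exp_law)"
proof -
  have "(\<integral>\<^sup>+w. g w \<partial>W) = (\<integral>\<^sup>+p. g (fst p powr a * snd p) \<partial>(exp_law \<Otimes>\<^sub>M L))"
    unfolding W_def by (subst nn_integral_distr) (auto simp: split_def)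
  also have "\<dots> = (\<integral>\<^sup>+t. (\<integral>\<^sup>+x. g (t powr a * x) \<partial>L) \<partial>exp_law)"
    by (subst nn_integral_fst[symmetric]) auto
  finally show ?thesis .
qed

lemma W_eq: "W = exp_law"
proof (rule bilateral_laplace_unique[of _ _ 0 1])
  show "sets W = sets borel" by (simp add: W_def)
  fix l :: real assume l: "0 < l" "l < 1"
  have "(\<integral>\<^sup>+w. ennreal (exp (l * w)) \<partial>W) = (\<integral>\<^sup>+t. (\<integral>\<^sup>+x. ennreal (exp (l * (t powr a * x))) \<partial>L) \<partial>exp_law)"
    by (rule nn_integral_W) simp
  also have "\<dots> = (\<integral>\<^sup>+t. (\<Sum>n. ennreal (l ^ n * rGamma (1 + a * real n)) * ennreal (t powr (a * real n))) \<partial>exp_law)"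
  proof (rule nn_integral_cong_AE, rule AE_mp[OF AE_exp_law_pos], rule AE_I2, rule impI)
    fix t :: real assume t: "0 < t"
    have s: "0 < l * t powr a" using l t by simp
    have pos: "0 \<le> rGamma (1 + a * real n)" for n
    proof -
      have "0 < 1 + a * real n" using a0 by (intro add_pos_nonneg) auto
      then have "0 < Gamma (1 + a * real n)" by (rule Gamma_real_pos)
      then show ?thesis by (simp add: rGamma_inverse_Gamma)
    qed
    have "(\<integral>\<^sup>+x. ennreal (exp (l * (t powr a * x))) \<partial>L) = ennreal (\<Sum>n. (l * t powr a) ^ n * rGamma (1 + a * real n))"
      using L_mgf[OF s] by (simp add: mult.assoc)
    also have "\<dots> = (\<Sum>n. ennreal ((l * t powr a) ^ n * rGamma (1 + a * real n)))"
      using s pos by (intro suminf_ennreal2[symmetric] summable_mittag_leffler a0) auto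
    also have "(\<lambda>n. ennreal ((l * t powr a) ^ n * rGamma (1 + a * real n))) = (\<lambda>n. ennreal (l ^ n * rGamma (1 + a * real n)) * ennreal (t powr (a * real n)))"
    proof
      fix n
      have "t powr (a * real n) = (t powr a) ^ n" using t by (simp add: powr_powr[symmetric] powr_realpow)
      then show "ennreal ((l * t powr a) ^ n * rGamma (1 + a * real n)) = ennreal (l ^ n * rGamma (1 + a * real n)) * ennreal (t powr (a * real n))"
        using pos[of n] l by (simp add: ennreal_mult[symmetric] power_mult_distrib mult_ac)
    qed
    finally show "(\<integral>\<^sup>+x. ennreal (exp (l * (t powr a * x))) \<partial>L) = (\<Sum>n. ennreal (l ^ n * rGamma (1 + a * real n)) * ennreal (t powr (a * real n)))" .
  qed
  also have "\<dots> = (\<Sum>n. \<integral>\<^sup>+t. ennreal (l ^ n * rGamma (1 + a * real n)) * ennreal (t powr (a * real n)) \<partial>exp_law)"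
    by (rule nn_integral_suminf) simp
  also have "(\<lambda>n. \<integral>\<^sup>+t. ennreal (l ^ n * rGamma (1 + a * real n)) * ennreal (t powr (a * real n)) \<partial>exp_law) = (\<lambda>n. ennreal (l ^ n))"
  proof
    fix n
    have g: "0 < Gamma (1 + a * real n)" using a0 by (intro Gamma_real_pos) (simp add: add_pos_nonneg)
    have "(\<integral>\<^sup>+t. ennreal (l ^ n * rGamma (1 + a * real n)) * ennreal (t powr (a * real n)) \<partial>exp_law) =
       ennreal (l ^ n * rGamma (1 + a * real n)) * ennreal (Gamma (1 + a * real n))"
    proof -
      have "- 1 < a * real n" by (rule less_le_trans[of _ 0]) (use a0 in auto)
      then show ?thesis by (subst nn_integral_cmult) (auto simp: nn_integral_exp_law_powr)
    qed
    then show "(\<integral>\<^sup>+t. ennreal (l ^ n * rGamma (1 + a * real n)) * ennreal (t powr (a * real n)) \<partial>exp_law) = ennreal (l ^ n)"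
      using g l by (simp add: ennreal_mult[symmetric] rGamma_inverse_Gamma)
  qed
  also have "(\<Sum>n. ennreal (l ^ n)) = ennreal (\<Sum>n. l ^ n)"
    using l by (intro suminf_ennreal2 summable_geometric) auto
  also have "(\<Sum>n. l ^ n) = 1 / (1 - l)" using l by (intro suminf_geometric) auto
  finally have W: "(\<integral>\<^sup>+w. ennreal (exp (l * w)) \<partial>W) = ennreal (1 / (1 - l))" .
  show "(\<integral>\<^sup>+w. ennreal (exp (l * w)) \<partial>W) = (\<integral>\<^sup>+w. ennreal (exp (l * w)) \<partial>exp_law)"
    unfolding W using l by (simp add: nn_integral_exp_law_exp)
  show "(\<integral>\<^sup>+w. ennreal (exp (l * w)) \<partial>W) < \<infinity>" unfolding W by simp
qed auto

text \<open>By \<open>W_eq\<close> the product of the independent factors \<open>t powr a\<close>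
  and \<open>x\<close> is exponential, so the moments multiply and that of \<open>L\<close> is a
  quotient of two Gamma values. Since \<open>a < 1\<close>, the range of \<open>w\<close> also keeps
  \<open>a * w\<close> above \<open>-1\<close>.\<close>

lemma moment:
  assumes w: "- 1 < w"
  shows "(\<integral>\<^sup>+x. ennreal (x powr w) \<partial>L) = ennreal (Gamma (1 + w) / Gamma (1 + a * w))"
proof -
  have aw: "- 1 < a * w"
  proof (cases "0 \<le> w")
    case True
    then have "0 \<le> a * w" using a0 by simp
    then show ?thesis by linarith
  next
    case False
    then have "1 * w < a * w" using a1 by (intro mult_strict_right_mono_neg) auto
    then show ?thesis using w by linarith
  qed
  have pos: "0 < Gamma (1 + a * w)" "0 < Gamma (1 + w)" using aw w by (auto intro!: Gamma_real_pos)
  have "ennreal (Gamma (1 + w)) = (\<integral>\<^sup>+t. ennreal (t powr w) \<partial>W)"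
    unfolding W_eq using w by (simp add: nn_integral_exp_law_powr)
  also have "\<dots> = (\<integral>\<^sup>+t. (\<integral>\<^sup>+x. ennreal ((t powr a * x) powr w) \<partial>L) \<partial>exp_law)"
    by (rule nn_integral_W) simp
  also have "\<dots> = (\<integral>\<^sup>+t. ennreal (t powr (a * w)) * (\<integral>\<^sup>+x. ennreal (x powr w) \<partial>L) \<partial>exp_law)"
  proof (rule nn_integral_cong_AE, rule AE_mp[OF AE_exp_law_pos], rule AE_I2, rule impI)
    fix t :: real assume t: "0 < t"
    have "(\<integral>\<^sup>+x. ennreal ((t powr a * x) powr w) \<partial>L) = (\<integral>\<^sup>+x. ennreal (t powr (a * w)) * ennreal (x powr w) \<partial>L)"
      by (rule nn_integral_cong_AE, rule AE_mp[OF L_pos], rule AE_I2)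
         (use t in \<open>auto simp: powr_mult powr_powr ennreal_mult\<close>)
    also have "\<dots> = ennreal (t powr (a * w)) * (\<integral>\<^sup>+x. ennreal (x powr w) \<partial>L)"
      by (rule nn_integral_cmult) simp
    finally show "(\<integral>\<^sup>+x. ennreal ((t powr a * x) powr w) \<partial>L) = ennreal (t powr (a * w)) * (\<integral>\<^sup>+x. ennreal (x powr w) \<partial>L)" .
  qed
  also have "\<dots> = ennreal (Gamma (1 + a * w)) * (\<integral>\<^sup>+x. ennreal (x powr w) \<partial>L)"
    by (subst nn_integral_multc) (auto simp: nn_integral_exp_law_powr aw)
  finally have eq: "ennreal (Gamma (1 + w)) = ennreal (Gamma (1 + a * w)) * (\<integral>\<^sup>+x. ennreal (x powr w) \<partial>L)" .
  have "ennreal (Gamma (1 + w) / Gamma (1 + a * w)) = ennreal (1 / Gamma (1 + a * w)) * ennreal (Gamma (1 + w))"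
    using pos by (simp add: ennreal_mult[symmetric] divide_inverse mult.commute)
  also have "\<dots> = ennreal (1 / Gamma (1 + a * w)) * ennreal (Gamma (1 + a * w)) * (\<integral>\<^sup>+x. ennreal (x powr w) \<partial>L)"
    unfolding eq by (simp only: mult.assoc)
  also have "ennreal (1 / Gamma (1 + a * w)) * ennreal (Gamma (1 + a * w)) = 1"
    using pos by (simp add: ennreal_mult[symmetric])
  finally show ?thesis by simp
qed

lemma char_ln: "char (distr L borel ln) y = Gamma (1 + \<i> * of_real y) / Gamma (1 + \<i> * of_real (a * y))"
proof -
  interpret P: pair_prob_space exp_law L by (rule pair)
  have int: "integrable (exp_law \<Otimes>\<^sub>M L) (\<lambda>(t, x). iexp (y * a * ln t) * iexp (y * ln x))"
    by (rule P.P.integrable_const_bound[of _ 1]) (auto simp: norm_mult)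
  have "Gamma (1 + \<i> * of_real y) = (CLINT w|W. iexp (y * ln w))"
    unfolding W_eq by (rule integral_exp_law_iexp_ln[symmetric])
  also have "\<dots> = (CLINT p|exp_law \<Otimes>\<^sub>M L. iexp (y * ln (fst p powr a * snd p)))"
    unfolding W_def by (subst integral_distr) (auto simp: split_def)
  also have "\<dots> = (CLINT p|exp_law \<Otimes>\<^sub>M L. (case p of (t, x) \<Rightarrow> iexp (y * a * ln t) * iexp (y * ln x)))"
  proof (rule integral_cong_AE)
    have "AE p in exp_law \<Otimes>\<^sub>M L. 0 < fst p \<and> 0 < snd p"
    proof (rule P.AE_pair_measure)
      show "{p \<in> space (exp_law \<Otimes>\<^sub>M L). 0 < fst p \<and> 0 < snd p} \<in> sets (exp_law \<Otimes>\<^sub>M L)" by measurable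
      show "AE t in exp_law. AE x in L. 0 < fst (t, x) \<and> 0 < snd (t, x)"
        by (rule AE_mp[OF AE_exp_law_pos], rule AE_I2, rule impI, rule AE_mp[OF L_pos], rule AE_I2) simp
    qed
    then show "AE p in exp_law \<Otimes>\<^sub>M L. iexp (y * ln (fst p powr a * snd p)) = (case p of (t, x) \<Rightarrow> iexp (y * a * ln t) * iexp (y * ln x))"
      by (rule AE_mp) (auto intro!: AE_I2 simp: ln_mult ln_powr exp_add[symmetric] algebra_simps)
  qed measurable
  also have "\<dots> = (CLINT t|exp_law. CLINT x|L. iexp (y * a * ln t) * iexp (y * ln x))"
    by (rule P.integral_fst[symmetric, OF int])
  also have "\<dots> = (CLINT t|exp_law. iexp (y * a * ln t)) * (CLINT x|L. iexp (y * ln x))"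
    by simp
  also have "(CLINT t|exp_law. iexp (y * a * ln t)) = Gamma (1 + \<i> * of_real (a * y))"
    using integral_exp_law_iexp_ln[of "a * y"] by (simp add: mult_ac)
  also have "(CLINT x|L. iexp (y * ln x)) = char (distr L borel ln) y"
    unfolding char_def by (subst integral_distr) auto
  finally have "Gamma (1 + \<i> * of_real y) = Gamma (1 + \<i> * of_real (a * y)) * char (distr L borel ln) y" .
  moreover have "Gamma (1 + \<i> * complex_of_real (a * y)) \<noteq> 0"
    by (simp add: Gamma_eq_zero_iff) (auto elim!: nonpos_Ints_cases simp: complex_eq_iff)
  ultimately show ?thesis by simp
qed

end

text \<open>Compare \<open>g\<close> with its chord. At the leftmost minimum of the difference
  \<open>D\<close> a negative value is impossible: the symmetric point on the left is strictly
  higher and the one on the right is not lower, against the midpoint inequality.\<close>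

lemma concave_on_midpoint:
  fixes g :: "real \<Rightarrow> real"
  assumes cont: "continuous_on {0<..} g"
    and mid: "\<And>x h. 0 < h \<Longrightarrow> h < x \<Longrightarrow> g (x - h) + g (x + h) \<le> 2 * g x"
  shows "concave_on {0<..} g"
  unfolding concave_on_def
proof (rule convex_on_linorderI)
  fix l x y :: real
  assume l: "0 < l" "l < 1" and xy: "x \<in> {0<..}" "y \<in> {0<..}" "x < y"
  define D where "D t = g t - (g x + (t - x) / (y - x) * (g y - g x))" for t
  have Dxy: "D x = 0" "D y = 0" using xy by (auto simp: D_def)
  have Dc: "continuous_on {x..y} D"
    unfolding D_def using xy by (intro continuous_intros continuous_on_subset[OF cont]) auto
  obtain m where m: "m \<in> {x..y}" "\<And>t. t \<in> {x..y} \<Longrightarrow> D m \<le> D t"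
    using continuous_attains_inf[of "{x..y}" D] Dc xy by auto
  have "0 \<le> D m"
  proof (rule ccontr)
    assume neg: "\<not> 0 \<le> D m"
    define S where "S = {t \<in> {x..y}. D t = D m}"
    have "closed S" unfolding S_def by (rule continuous_closed_preimage_constant[OF Dc]) simp
    moreover have "bounded S" by (rule bounded_subset[of "{x..y}"]) (auto simp: S_def)
    moreover have "S \<noteq> {}" using m by (auto simp: S_def)
    ultimately obtain t where t: "t \<in> S" "\<And>s. s \<in> S \<Longrightarrow> t \<le> s"
      by (metis bounded_imp_bdd_below closed_contains_Inf cInf_lower)
    have txy: "x < t" "t < y"
      using t(1) neg Dxy by (auto simp: S_def less_le)
    define h where "h = min (t - x) (y - t)"
    have h: "0 < h" "x \<le> t - h" "t + h \<le> y" "h < t" using txy xy by (auto simp: h_def min_def)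
    have "D (t - h) + D (t + h) \<le> 2 * D t"
    proof -
      have "(t - h - x) / (y - x) + (t + h - x) / (y - x) = 2 * ((t - x) / (y - x))"
        by (simp add: add_divide_distrib[symmetric])
      then have "(t - h - x) / (y - x) * (g y - g x) + (t + h - x) / (y - x) * (g y - g x) = 2 * ((t - x) / (y - x) * (g y - g x))"
        by (metis distrib_right mult.assoc)
      then show ?thesis using mid[OF h(1,4)] unfolding D_def by argo
    qed
    moreover have "D m \<le> D (t + h)" using m(2)[of "t + h"] h txy by simp
    moreover have "D t = D m" using t by (simp add: S_def)
    moreover have "D m < D (t - h)"
    proof -
      have "t - h \<notin> S" using t(2)[of "t - h"] h by auto
      then have "D (t - h) \<noteq> D m" using h txy by (auto simp: S_def)
      then show ?thesis using m(2)[of "t - h"] h txy by auto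
    qed
    ultimately show False by linarith
  qed
  moreover have pt: "(1 - l) * x + l * y \<in> {x..y}"
  proof -
    have "(1 - l) * x + l * y = x + l * (y - x)" "(1 - l) * x + l * y = y - (1 - l) * (y - x)" by (simp_all add: algebra_simps)
    moreover have "0 \<le> l * (y - x)" "0 \<le> (1 - l) * (y - x)" using l xy by auto
    ultimately show ?thesis by (smt (verit) atLeastAtMost_iff)
  qed
  ultimately have "0 \<le> D ((1 - l) * x + l * y)" using m(2) by (meson order_trans)
  moreover have "((1 - l) * x + l * y - x) / (y - x) = l"
    using xy by (simp add: field_simps)
  ultimately have "0 \<le> g ((1 - l) * x + l * y) - (g x + l * (g y - g x))"
    by (simp only: D_def)
  then have "(1 - l) * g x + l * g y \<le> g ((1 - l) * x + l * y)"
    by (simp add: algebra_simps)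
  then show "- g ((1 - l) *\<^sub>R x + l *\<^sub>R y) \<le> (1 - l) * (- g x) + l * (- g y)"
    by simp
qed simp

section \<open>The self-similar family of densities and its Laplace transform\<close>

locale mittag_leffler_density = mittag_leffler_law L a for L a +
  fixes f :: "real \<Rightarrow> real"
  assumes f_nonneg: "\<And>x. 0 \<le> f x" and f_meas [measurable]: "f \<in> borel_measurable borel"
    and f_cont: "continuous_on {0<..} f"
    and L_density: "L = density lborel (\<lambda>x. ennreal (f x))"
begin

text \<open>For fixed \<open>t\<close> this is the density of \<open>t powr a\<close> times a
  variable of law \<open>L\<close>, the law of the inverse stable subordinator at time
  \<open>t\<close>.\<close>

definition u :: "real \<Rightarrow> real \<Rightarrow> real" where
  "u t x = t powr - a * f (x * t powr - a)"

lemma u_measurable [measurable]: "(\<lambda>t. u t x) \<in> borel_measurable borel" "(\<lambda>p. u (fst p) (snd p)) \<in> borel_measurable (borel \<Otimes>\<^sub>M borel)"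
  unfolding u_def by measurable

lemma u_nonneg: "0 \<le> u t x" by (simp add: u_def f_nonneg)

lemma nn_integral_L:
  assumes [measurable]: "g \<in> borel_measurable borel"
  shows "(\<integral>\<^sup>+x. g x \<partial>L) = (\<integral>\<^sup>+x. ennreal (f x) * g x \<partial>lborel)"
  unfolding L_density by (rule nn_integral_density) auto

definition j :: "real \<Rightarrow> ennreal" where
  "j \<xi> = (\<integral>\<^sup>+t. ennreal (exp (- t) * u t \<xi>) * indicator {0<..} t \<partial>lborel)"

lemma j_measurable [measurable]: "j \<in> borel_measurable borel"
  unfolding j_def u_def by measurable

text \<open>Mixing \<open>u t\<close> over an exponential time \<open>t\<close> gives a density of
  \<open>W\<close>. \<open>W_eq\<close> then identifies \<open>j\<close>, but only almost
  everywhere.\<close>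

lemma j_AE: "AE \<xi> in lborel. j \<xi> = ennreal (exp (- \<xi>)) * indicator {0<..} \<xi>"
proof (rule sigma_finite_measure.density_unique[OF sigma_finite_lborel])
  have "density lborel j = W"
  proof (rule measure_eqI)
    show "sets (density lborel j) = sets W" by (simp add: W_def)
    fix A assume "A \<in> sets (density lborel j)"
    then have [measurable]: "A \<in> sets borel" by simp
    have "emeasure W A = (\<integral>\<^sup>+w. indicator A w \<partial>W)" by (simp add: W_def)
    also have "\<dots> = (\<integral>\<^sup>+t. (\<integral>\<^sup>+x. indicator A (t powr a * x) \<partial>L) \<partial>exp_law)" by (rule nn_integral_W) simp
    also have "\<dots> = (\<integral>\<^sup>+t. ennreal (exp (- t)) * indicator {0<..} t * (\<integral>\<^sup>+x. ennreal (f x) * indicator A (t powr a * x) \<partial>lborel) \<partial>lborel)"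
      by (simp add: nn_integral_L nn_integral_exp_law)
    also have "\<dots> = (\<integral>\<^sup>+t. (\<integral>\<^sup>+\<xi>. ennreal (exp (- t) * u t \<xi>) * indicator {0<..} t * indicator A \<xi> \<partial>lborel) \<partial>lborel)"
    proof (intro nn_integral_cong)
      fix t :: real
      show "ennreal (exp (- t)) * indicator {0<..} t * (\<integral>\<^sup>+x. ennreal (f x) * indicator A (t powr a * x) \<partial>lborel) =
        (\<integral>\<^sup>+\<xi>. ennreal (exp (- t) * u t \<xi>) * indicator {0<..} t * indicator A \<xi> \<partial>lborel)"
      proof (cases "0 < t")
        case True
        have "(\<integral>\<^sup>+x. ennreal (f x) * indicator A (t powr a * x) \<partial>lborel) =
          ennreal \<bar>t powr - a\<bar> * (\<integral>\<^sup>+\<xi>. ennreal (f (0 + t powr - a * \<xi>)) * indicator A (t powr a * (0 + t powr - a * \<xi>)) \<partial>lborel)"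
          by (rule nn_integral_real_affine) (use True in auto)
        also have "\<dots> = (\<integral>\<^sup>+\<xi>. ennreal (t powr - a) * (ennreal (f (t powr - a * \<xi>)) * indicator A \<xi>) \<partial>lborel)"
          using True by (subst nn_integral_cmult[symmetric]) (auto simp: mult.assoc[symmetric] powr_add[symmetric])
        finally have "(\<integral>\<^sup>+x. ennreal (f x) * indicator A (t powr a * x) \<partial>lborel) = (\<integral>\<^sup>+\<xi>. ennreal (t powr - a) * (ennreal (f (t powr - a * \<xi>)) * indicator A \<xi>) \<partial>lborel)" .
        then have "ennreal (exp (- t)) * indicator {0<..} t * (\<integral>\<^sup>+x. ennreal (f x) * indicator A (t powr a * x) \<partial>lborel) =
           (\<integral>\<^sup>+\<xi>. ennreal (exp (- t)) * (ennreal (t powr - a) * (ennreal (f (t powr - a * \<xi>)) * indicator A \<xi>)) \<partial>lborel)"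
          using True by (simp add: nn_integral_cmult)
        also have "\<dots> = (\<integral>\<^sup>+\<xi>. ennreal (exp (- t) * u t \<xi>) * indicator {0<..} t * indicator A \<xi> \<partial>lborel)"
          using True by (intro nn_integral_cong) (auto simp: u_def ennreal_mult f_nonneg mult_ac)
        finally show ?thesis .
      qed simp
    qed
    also have "\<dots> = (\<integral>\<^sup>+\<xi>. (\<integral>\<^sup>+t. ennreal (exp (- t) * u t \<xi>) * indicator {0<..} t * indicator A \<xi> \<partial>lborel) \<partial>lborel)"
      by (rule lborel_pair.Fubini') (unfold u_def, measurable)
    also have "\<dots> = (\<integral>\<^sup>+\<xi>. j \<xi> * indicator A \<xi> \<partial>lborel)"
      unfolding j_def by (intro nn_integral_cong nn_integral_multc) simp
    also have "\<dots> = emeasure (density lborel j) A" by (rule emeasure_density[symmetric]) auto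
    finally show "emeasure (density lborel j) A = emeasure W A" ..
  qed
  then show "density lborel j = density lborel (\<lambda>\<xi>. ennreal (exp (- \<xi>)) * indicator {0<..} \<xi>)"
    using W_eq by (simp add: exp_law_def)
qed auto

definition lap :: "real \<Rightarrow> real \<Rightarrow> ennreal" where
  "lap x s = (\<integral>\<^sup>+t. ennreal (exp (- s * t) * u t x) * indicator {0<..} t \<partial>lborel)"

text \<open>The substitution \<open>t / s\<close> and the self-similarity of \<open>u\<close> reduce
  every \<open>s\<close> to the case \<open>s = 1\<close>, which is \<open>j\<close>.\<close>

lemma lap_scaling:
  assumes s: "0 < s"
  shows "lap x s = ennreal (s powr (a - 1)) * j (x * s powr a)"
proof -
  have "lap x s = ennreal \<bar>1 / s\<bar> * (\<integral>\<^sup>+t. ennreal (exp (- s * (0 + 1 / s * t)) * u (0 + 1 / s * t) x) * indicator {0<..} (0 + 1 / s * t) \<partial>lborel)"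
    unfolding lap_def by (rule nn_integral_real_affine) (use s in auto)
  also have "\<dots> = (\<integral>\<^sup>+t. ennreal (1 / s) * (ennreal (exp (- t) * u (t / s) x) * indicator {0<..} t) \<partial>lborel)"
    using s by (subst nn_integral_cmult[symmetric]) (auto intro!: nn_integral_cong simp: indicator_def zero_less_divide_iff)
  also have "\<dots> = (\<integral>\<^sup>+t. ennreal (s powr (a - 1)) * (ennreal (exp (- t) * u t (x * s powr a)) * indicator {0<..} t) \<partial>lborel)"
  proof (intro nn_integral_cong)
    fix t :: real
    show "ennreal (1 / s) * (ennreal (exp (- t) * u (t / s) x) * indicator {0<..} t) =
      ennreal (s powr (a - 1)) * (ennreal (exp (- t) * u t (x * s powr a)) * indicator {0<..} t)"
    proof (cases "0 < t")
      case True
      have "(t / s) powr - a = t powr - a * s powr a" 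
      proof -
        have "(t / s) powr - a = t powr - a / s powr - a" by (rule powr_divide)
        then show ?thesis by (simp add: powr_minus divide_inverse)
      qed
      then have uu: "u (t / s) x = s powr a * u t (x * s powr a)"
        unfolding u_def by (simp only: mult_ac)
      have "1 / s * (exp (- t) * u (t / s) x) = s powr (a - 1) * (exp (- t) * u t (x * s powr a))"
        unfolding uu powr_diff using s by simp
      then have "ennreal (1 / s) * ennreal (exp (- t) * u (t / s) x) = ennreal (s powr (a - 1)) * ennreal (exp (- t) * u t (x * s powr a))"
        using s by (simp only: ennreal_mult[symmetric] u_nonneg mult_nonneg_nonneg exp_ge_zero powr_ge_zero zero_le_divide_1_iff less_imp_le)
      then show ?thesis using True by simp
    qed simp
  qed
  also have "\<dots> = ennreal (s powr (a - 1)) * j (x * s powr a)"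
    unfolding j_def by (rule nn_integral_cmult) simp
  finally show ?thesis .
qed

lemma lap_antimono: "s \<le> s' \<Longrightarrow> lap x s' \<le> lap x s"
  unfolding lap_def by (intro nn_integral_mono) (auto simp: indicator_def u_nonneg intro!: ennreal_leI mult_right_mono)

lemma lap_eq_somewhere:
  assumes x: "0 < x" and s: "0 < s" "s < s'"
  shows "\<exists>r>s. r < s' \<and> lap x r = ennreal (r powr (a - 1) * exp (- x * r powr a))"
proof -
  define lo hi where "lo = x * s powr a" and "hi = x * s' powr a"
  have lt: "lo < hi" unfolding lo_def hi_def
    by (rule mult_strict_left_mono[OF powr_less_mono2]) (use assms a0 in auto)
  obtain \<xi> where \<xi>: "lo < \<xi>" "\<xi> < hi" "j \<xi> = ennreal (exp (- \<xi>)) * indicator {0<..} \<xi>"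
  proof (rule ccontr)
    assume *: "\<not> thesis"
    have "AE \<xi> in lborel. \<xi> \<notin> {lo<..<hi}"
      by (rule AE_mp[OF j_AE], rule AE_I2) (use that * in auto)
    then have "emeasure lborel {lo<..<hi} = 0"
      by (subst (asm) AE_iff_null_sets[symmetric]) (auto simp: null_sets_def)
    then show False using lt by simp
  qed
  have \<xi>0: "0 < \<xi>"
  proof -
    have "0 \<le> lo" using x by (simp add: lo_def)
    then show ?thesis using \<xi>(1) by linarith
  qed
  define r where "r = (\<xi> / x) powr (1 / a)"
  have r0: "0 < r" using \<xi>0 x by (simp add: r_def)
  have ra: "x * r powr a = \<xi>" using \<xi>0 x a0 by (simp add: r_def powr_powr)
  have "s < r"
  proof (rule ccontr)
    assume "\<not> s < r"
    then have "r powr a \<le> s powr a" using r0 a0 by (intro powr_mono2) auto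
    then show False using \<xi>(1)[unfolded lo_def] ra x mult_left_mono[of "r powr a" "s powr a" x] by linarith
  qed
  moreover have "r < s'"
  proof (rule ccontr)
    assume "\<not> r < s'"
    then have "s' powr a \<le> r powr a" using s a0 by (intro powr_mono2) auto
    then show False using \<xi>(2)[unfolded hi_def] ra x mult_left_mono[of "s' powr a" "r powr a" x] by linarith
  qed
  moreover have "lap x r = ennreal (r powr (a - 1) * exp (- x * r powr a))"
    using lap_scaling[OF r0, of x] \<xi>(3) \<xi>0 by (simp add: ra ennreal_mult)
  ultimately show ?thesis by blast
qed

text \<open>\<open>lap_eq_somewhere\<close> finds the formula at points arbitrarily close to
  \<open>s\<close> on either side. Monotonicity of \<open>lap x\<close> and continuity of the
  formula remove the exceptional set.\<close>

lemma lap_eq: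
  assumes x: "0 < x" and s: "0 < s"
  shows "lap x s = ennreal (s powr (a - 1) * exp (- x * s powr a))"
proof (rule antisym)
  let ?F = "\<lambda>s. ennreal (s powr (a - 1) * exp (- x * s powr a))"
  have cont: "(\<lambda>n. ?F (r n)) \<longlonglongrightarrow> ?F s" if "r \<longlonglongrightarrow> s" for r
    using s that by (intro tendsto_ennrealI tendsto_intros) auto
  have lim0: "(\<lambda>n. s / (real n + 2)) \<longlonglongrightarrow> 0"
    using LIMSEQ_ignore_initial_segment[OF lim_const_over_n[of s], of 2] by (simp add: add.commute)
  have d: "0 < s / (real n + 2)" "s / (real n + 2) < s" for n
    using s by (auto simp: divide_less_eq)
  have "\<forall>n. \<exists>r. s - s / (real n + 2) < r \<and> r < s \<and> lap x r = ?F r"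
    using lap_eq_somewhere[OF x, of "s - s / (real n + 2)" s for n] d by auto
  from choice[OF this] obtain r where r: "\<And>n. s - s / (real n + 2) < r n" "\<And>n. r n < s" "\<And>n. lap x (r n) = ?F (r n)" by auto
  have "(\<lambda>n. s - s / (real n + 2)) \<longlonglongrightarrow> s - 0"
    by (intro tendsto_diff tendsto_const lim0)
  then have "r \<longlonglongrightarrow> s"
    using r by (intro tendsto_sandwich[of "\<lambda>n. s - s / (real n + 2)" r _ "\<lambda>_. s"]) (auto intro!: always_eventually less_imp_le)
  from cont[OF this] show "lap x s \<le> ?F s"
    by (rule LIMSEQ_le_const) (use r lap_antimono[of _ s x] in \<open>metis less_imp_le\<close>)
  have "\<forall>n. \<exists>r. s < r \<and> r < s + s / (real n + 2) \<and> lap x r = ?F r"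
    using lap_eq_somewhere[OF x, of s "s + s / (real n + 2)" for n] d s by auto
  from choice[OF this] obtain r where r: "\<And>n. s < r n" "\<And>n. r n < s + s / (real n + 2)" "\<And>n. lap x (r n) = ?F (r n)" by auto
  have "(\<lambda>n. s + s / (real n + 2)) \<longlonglongrightarrow> s + 0"
    by (intro tendsto_add tendsto_const lim0)
  then have "r \<longlonglongrightarrow> s"
    using r by (intro tendsto_sandwich[of "\<lambda>_. s" r _ "\<lambda>n. s + s / (real n + 2)"]) (auto intro!: always_eventually less_imp_le)
  from cont[OF this] show "?F s \<le> lap x s"
    by (rule LIMSEQ_le_const2) (use r lap_antimono[of s _ x] in \<open>metis less_imp_le\<close>)
qed

end

section \<open>Log-concavity up to index one half\<close>

lemma filterlim_powr_at_top:
  assumes "0 < (a::real)"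
  shows "filterlim (\<lambda>x. x powr a) at_top at_top"
proof (rule filterlim_mono_eventually)
  show "filterlim (\<lambda>x. exp (a * ln x)) at_top at_top"
    by (intro filterlim_compose[OF exp_at_top] filterlim_tendsto_pos_mult_at_top[OF tendsto_const assms ln_at_top])
  show "\<forall>\<^sub>F x in at_top. exp (a * ln x) = x powr a"
    using eventually_gt_at_top[of 0] by eventually_elim (simp add: powr_def)
qed auto

section \<open>Positivity of the density and the shift by hitting times\<close>

context mittag_leffler_density begin

lemma lap_finite: "0 < x \<Longrightarrow> 0 < s \<Longrightarrow> lap x s < \<infinity>"
  by (simp add: lap_eq)

text \<open>If \<open>f\<close> vanished beyond \<open>c\<close>, then \<open>u t 1\<close> would
  vanish for \<open>t < e\<close>, and \<open>lap 1 s\<close> would decay at least like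
  \<open>exp (- e * s)\<close>. By \<open>lap_eq\<close> it decays only like
  \<open>exp (- (s powr a))\<close> up to a power, with \<open>a < 1\<close>.\<close>

lemma not_eventually_zero:
  assumes c: "0 < c" shows "\<exists>x>c. f x \<noteq> 0"
proof (rule ccontr)
  assume "\<not> ?thesis"
  then have z: "f x = 0" if "c < x" for x using that by blast
  define e where "e = c powr (- 1 / a)"
  have e: "0 < e" "e powr - a = c" using c a0 by (auto simp: e_def powr_powr)
  have ut: "u t 1 = 0" if "0 < t" "t < e" for t
  proof -
    have "e powr - a < t powr - a" using that a0 by (intro powr_less_mono2_neg) auto
    then show ?thesis using z e by (simp add: u_def)
  qed
  have bound: "s powr (a - 1) * exp (- (s powr a)) \<le> exp (- (s - 1) * e) * exp (- 1)" if s: "1 \<le> s" for s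
  proof -
    have "lap 1 s \<le> (\<integral>\<^sup>+t. ennreal (exp (- (s - 1) * e)) * (ennreal (exp (- 1 * t) * u t 1) * indicator {0<..} t) \<partial>lborel)"
      unfolding lap_def
    proof (rule nn_integral_mono)
      fix t :: real
      show "ennreal (exp (- s * t) * u t 1) * indicator {0<..} t \<le> ennreal (exp (- (s - 1) * e)) * (ennreal (exp (- 1 * t) * u t 1) * indicator {0<..} t)"
      proof (cases "0 < t \<and> e \<le> t")
        case True
        have "(s - 1) * e \<le> (s - 1) * t" using s True by (intro mult_left_mono) auto
        then have "exp (- s * t) \<le> exp (- (s - 1) * e) * exp (- 1 * t)"
          by (simp add: exp_add[symmetric] algebra_simps)
        then have "exp (- s * t) * u t 1 \<le> exp (- (s - 1) * e) * exp (- 1 * t) * u t 1"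
          by (intro mult_right_mono u_nonneg)
        then show ?thesis using True by (simp add: ennreal_mult[symmetric] u_nonneg mult.assoc ennreal_leI)
      next
        case False
        then show ?thesis using ut[of t] by (auto simp: indicator_def)
      qed
    qed
    also have "\<dots> = ennreal (exp (- (s - 1) * e)) * lap 1 1"
      unfolding lap_def by (rule nn_integral_cmult) simp
    also have "\<dots> = ennreal (exp (- (s - 1) * e) * exp (- 1))"
      by (simp add: lap_eq ennreal_mult)
    finally show ?thesis using s by (simp add: lap_eq ennreal_le_iff)
  qed
  have le: "e \<le> (1 - a) * (ln s / s) + s powr (a - 1) + e * inverse s" if s: "1 < s" for s
  proof -
    have "ln (s powr (a - 1) * exp (- (s powr a))) \<le> ln (exp (- (s - 1) * e) * exp (- 1))"
      using bound[of s] s by (intro ln_mono) auto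
    then have "(a - 1) * ln s - (s powr a) \<le> - (s - 1) * e - 1"
      using s by (simp add: ln_mult ln_powr exp_add[symmetric])
    then have "e * s \<le> (1 - a) * ln s + s powr a + e" by (simp add: algebra_simps)
    then have "e * s / s \<le> ((1 - a) * ln s + s powr a + e) / s" using s by (intro divide_right_mono) auto
    then show ?thesis using s by (simp add: add_divide_distrib powr_diff divide_inverse[of e])
  qed
  have "((\<lambda>s. (1 - a) * (ln s / s) + s powr (a - 1) + e * inverse s) \<longlongrightarrow> (1 - a) * 0 + 0 + e * 0) at_top"
    using a1 by (intro tendsto_add tendsto_mult_left ln_x_over_x_tendsto_0 tendsto_neg_powr tendsto_inverse_0_at_top filterlim_ident) auto
  then have "e \<le> (1 - a) * 0 + 0 + e * 0"
    by (rule tendsto_lowerbound) (rule eventually_mono[OF eventually_gt_at_top[of 1]], rule le, auto)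
  then show False using e by simp
qed

text \<open>If \<open>f\<close> vanished near \<open>0\<close>, then \<open>u t 1\<close> would
  vanish for large \<open>t\<close>, and \<open>lap 1 s\<close> would stay bounded as
  \<open>s\<close> tends to \<open>0\<close>, whereas \<open>s powr (a - 1)\<close> does
  not.\<close>

lemma not_initially_zero:
  assumes c: "0 < c" shows "\<exists>x. 0 < x \<and> x < c \<and> f x \<noteq> 0"
proof (rule ccontr)
  assume "\<not> ?thesis"
  then have z: "f x = 0" if "0 < x" "x < c" for x using that by blast
  define T where "T = c powr (- 1 / a)"
  have T: "0 < T" "T powr - a = c" using c a0 by (auto simp: T_def powr_powr)
  have ut: "u t 1 = 0" if "T < t" for t
  proof -
    have "t powr - a < T powr - a" using that a0 T by (intro powr_less_mono2_neg) auto
    then show ?thesis using z T that by (simp add: u_def)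
  qed
  have bound: "s powr (a - 1) * exp (- (s powr a)) \<le> exp T * exp (- 1)" if s: "0 < s" "s < 1" for s
  proof -
    have "lap 1 s \<le> (\<integral>\<^sup>+t. ennreal (exp T) * (ennreal (exp (- 1 * t) * u t 1) * indicator {0<..} t) \<partial>lborel)"
      unfolding lap_def
    proof (rule nn_integral_mono)
      fix t :: real
      show "ennreal (exp (- s * t) * u t 1) * indicator {0<..} t \<le> ennreal (exp T) * (ennreal (exp (- 1 * t) * u t 1) * indicator {0<..} t)"
      proof (cases "0 < t \<and> t \<le> T")
        case True
        have "0 \<le> s * t" using s True by simp
        then have "exp (- s * t) \<le> exp T * exp (- 1 * t)"
          using True by (simp add: exp_add[symmetric])
        then have "exp (- s * t) * u t 1 \<le> exp T * exp (- 1 * t) * u t 1"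
          by (intro mult_right_mono u_nonneg)
        then show ?thesis using True by (simp add: ennreal_mult[symmetric] u_nonneg mult.assoc ennreal_leI)
      next
        case False
        then show ?thesis using ut[of t] by (auto simp: indicator_def)
      qed
    qed
    also have "\<dots> = ennreal (exp T) * lap 1 1"
      unfolding lap_def by (rule nn_integral_cmult) simp
    also have "\<dots> = ennreal (exp T * exp (- 1))"
      by (simp add: lap_eq ennreal_mult)
    finally show ?thesis using s by (simp add: lap_eq ennreal_le_iff)
  qed
  \<comment> \<open>Chosen so that \<open>s powr (a - 1) = exp (T + 1)\<close>, which exceeds the
    bound even after the loss of a factor \<open>exp (- 1)\<close>.\<close>
  define s where "s = exp (- (T + 1) / (1 - a))"
  have s: "0 < s" "s < 1" using a1 T by (auto simp: s_def divide_neg_pos)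
  have ls: "(a - 1) * ln s = T + 1"
  proof -
    have "ln s = - (T + 1) / (1 - a)" by (simp add: s_def)
    then show ?thesis using a1 by (simp add: field_simps)
  qed
  have "s powr (a - 1) = exp (T + 1)"
    using s ls by (simp add: powr_def)
  then have b: "exp (T + 1) * exp (- (s powr a)) \<le> exp T * exp (- 1)"
    using bound[OF s] by (simp only:)
  have "s powr a \<le> 1" using s a0 powr_mono2[of a s 1] by simp
  then have "exp (- 1) \<le> exp (- (s powr a))" by simp
  then have "exp (T + 1) * exp (- 1) \<le> exp (T + 1) * exp (- (s powr a))" by (intro mult_left_mono) auto
  with b have "exp (T + 1) * exp (- 1) \<le> exp T * exp (- 1)" by (rule order_trans[rotated])
  then show False by (simp add: exp_add[symmetric])
qed

text \<open>Positivity comes first, since the logarithm depends on it: a zero of \<open>f\<close>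
  between two points where \<open>f\<close> does not vanish contradicts the four-point inequality.
  The rest is midpoint concavity.\<close>

lemma log_concave_from_four_points:
  assumes four: "\<And>x r r' t. 0 < x \<Longrightarrow> x < r \<Longrightarrow> x < r' \<Longrightarrow> r + r' = x + t \<Longrightarrow> f x * f t \<le> f r * f r'"
  shows "log_concave f"
proof -
  have pos: "0 < f z" if z: "0 < z" for z
  proof (rule ccontr)
    assume "\<not> 0 < f z"
    then have fz: "f z = 0" using f_nonneg[of z] by simp
    obtain x where x: "0 < x" "x < z" "f x \<noteq> 0" using not_initially_zero[OF z] by blast
    obtain t where t: "z < t" "f t \<noteq> 0" using not_eventually_zero[OF z] by blast
    have "f x * f t \<le> f z * f (x + t - z)" by (rule four) (use x t in auto)
    then show False using fz x t f_nonneg[of x] f_nonneg[of t] by (simp add: mult_le_0_iff)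
  qed
  have "concave_on {0<..} (\<lambda>x. ln (f x))"
  proof (rule concave_on_midpoint)
    show "continuous_on {0<..} (\<lambda>x. ln (f x))"
      by (intro continuous_intros f_cont) (use pos in \<open>auto simp: less_imp_neq[symmetric]\<close>)
    fix x h :: real assume h: "0 < h" "h < x"
    have "f (x - h) * f (x + h) \<le> f x * f x" by (rule four) (use h in auto)
    then have "ln (f (x - h)) + ln (f (x + h)) \<le> ln (f x) + ln (f x)"
      using h pos by (subst four_points_exp) auto
    then show "ln (f (x - h)) + ln (f (x + h)) \<le> 2 * ln (f x)" by simp
  qed
  then show ?thesis using pos by (simp add: log_concave_def)
qed

text \<open>The hitting-time density of the stable subordinator; its convolution semigroup moves
  \<open>u _ x\<close> to \<open>u _ (x + h)\<close>, which turns total positivity of \<open>u\<close> into log-concavity of \<open>f\<close>.\<close>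

definition hit :: "real \<Rightarrow> real \<Rightarrow> real" where
  "hit h t = a * h / t * u t h"

lemma hit_nonneg: "0 < h \<Longrightarrow> 0 < t \<Longrightarrow> 0 \<le> hit h t"
  using a0 by (simp add: hit_def u_nonneg)

lemma hit_measurable [measurable]: "hit h \<in> borel_measurable borel"
  unfolding hit_def[abs_def] by measurable

text \<open>The factor \<open>1 / t\<close> in \<open>hit\<close> arises from integrating
  \<open>exp (- \<sigma> * t)\<close> over \<open>\<sigma> \<ge> s\<close>. So the transform is an
  integral of \<open>lap h\<close>, whose integrand is the exact derivative of
  \<open>- exp (- h * \<sigma> powr a)\<close>.\<close>

lemma hit_laplace:
  assumes h: "0 < h" and s: "0 < s"
  shows "(\<integral>\<^sup>+t. ennreal (exp (- s * t) * hit h t) * indicator {0<..} t \<partial>lborel) = ennreal (exp (- h * s powr a))"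
proof -
  have inner: "(\<integral>\<^sup>+\<sigma>\<in>{s..}. ennreal (exp (- \<sigma> * t)) \<partial>lborel) = ennreal (exp (- s * t) / t)" if t: "0 < t" for t
  proof -
    have "(\<integral>\<^sup>+\<sigma>\<in>{s..}. ennreal (exp (- \<sigma> * t)) \<partial>lborel) = ennreal (0 - - (exp (- s * t) / t))"
    proof (rule nn_integral_FTC_atLeast[where F = "\<lambda>\<sigma>. - (exp (- \<sigma> * t) / t)" and T = 0])
      have "filterlim (\<lambda>\<sigma>. - t * \<sigma>) at_bot at_top"
        by (rule filterlim_tendsto_neg_mult_at_bot[OF tendsto_const _ filterlim_ident]) (use t in simp)
      then have "((\<lambda>\<sigma>. - (exp (- t * \<sigma>) / t)) \<longlongrightarrow> - (0 / t)) at_top"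
        by (intro tendsto_minus tendsto_divide tendsto_const filterlim_compose[OF exp_at_bot]) (use t in auto)
      then show "((\<lambda>\<sigma>. - (exp (- \<sigma> * t) / t)) \<longlongrightarrow> 0) at_top" by (simp add: mult.commute)
    qed (use t in \<open>auto intro!: derivative_eq_intros\<close>)
    then show ?thesis by simp
  qed
  have "(\<integral>\<^sup>+t. ennreal (exp (- s * t) * hit h t) * indicator {0<..} t \<partial>lborel) =
    (\<integral>\<^sup>+t. (\<integral>\<^sup>+\<sigma>. ennreal (a * h) * (ennreal (exp (- \<sigma> * t) * u t h) * indicator {0<..} t * indicator {s..} \<sigma>) \<partial>lborel) \<partial>lborel)"
  proof (intro nn_integral_cong)
    fix t :: real
    show "ennreal (exp (- s * t) * hit h t) * indicator {0<..} t =
      (\<integral>\<^sup>+\<sigma>. ennreal (a * h) * (ennreal (exp (- \<sigma> * t) * u t h) * indicator {0<..} t * indicator {s..} \<sigma>) \<partial>lborel)"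
    proof (cases "0 < t")
      case True
      have "(\<integral>\<^sup>+\<sigma>. ennreal (a * h) * (ennreal (exp (- \<sigma> * t) * u t h) * indicator {0<..} t * indicator {s..} \<sigma>) \<partial>lborel) =
        (\<integral>\<^sup>+\<sigma>. ennreal (a * h * u t h) * (ennreal (exp (- \<sigma> * t)) * indicator {s..} \<sigma>) \<partial>lborel)"
        using True a0 h u_nonneg[of t h] by (intro nn_integral_cong) (auto simp: ennreal_mult mult_ac)
      also have "\<dots> = ennreal (a * h * u t h) * ennreal (exp (- s * t) / t)"
        by (subst nn_integral_cmult, simp, subst inner[OF True], rule refl)
      also have "\<dots> = ennreal (exp (- s * t) * hit h t)"
        using True a0 h u_nonneg[of t h] by (subst ennreal_mult[symmetric]) (auto simp: hit_def mult_ac)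
      finally show ?thesis using True by simp
    qed simp
  qed
  also have "\<dots> = (\<integral>\<^sup>+\<sigma>. (\<integral>\<^sup>+t. ennreal (a * h) * (ennreal (exp (- \<sigma> * t) * u t h) * indicator {0<..} t * indicator {s..} \<sigma>) \<partial>lborel) \<partial>lborel)"
    by (rule lborel_pair.Fubini') (unfold u_def, measurable)
  also have "\<dots> = (\<integral>\<^sup>+\<sigma>\<in>{s..}. ennreal (a * h * \<sigma> powr (a - 1) * exp (- h * \<sigma> powr a)) \<partial>lborel)"
  proof (intro nn_integral_cong)
    fix \<sigma> :: real
    show "(\<integral>\<^sup>+t. ennreal (a * h) * (ennreal (exp (- \<sigma> * t) * u t h) * indicator {0<..} t * indicator {s..} \<sigma>) \<partial>lborel) =
      ennreal (a * h * \<sigma> powr (a - 1) * exp (- h * \<sigma> powr a)) * indicator {s..} \<sigma>"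
    proof (cases "s \<le> \<sigma>")
      case True
      have "(\<integral>\<^sup>+t. ennreal (a * h) * (ennreal (exp (- \<sigma> * t) * u t h) * indicator {0<..} t * indicator {s..} \<sigma>) \<partial>lborel) = ennreal (a * h) * lap h \<sigma>"
        using True unfolding lap_def by (subst nn_integral_cmult) auto
      then show ?thesis using True s h a0 by (simp add: lap_eq ennreal_mult[symmetric] mult.assoc)
    qed simp
  qed
  also have "\<dots> = ennreal (0 - - exp (- h * s powr a))"
  proof (rule nn_integral_FTC_atLeast[where F = "\<lambda>\<sigma>. - exp (- h * \<sigma> powr a)" and T = 0])
    fix \<sigma> assume "s \<le> \<sigma>"
    then show "((\<lambda>\<sigma>. - exp (- h * \<sigma> powr a)) has_real_derivative a * h * \<sigma> powr (a - 1) * exp (- h * \<sigma> powr a)) (at \<sigma>)"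
      using s by (auto intro!: derivative_eq_intros simp: powr_diff)
    show "0 \<le> a * h * \<sigma> powr (a - 1) * exp (- h * \<sigma> powr a)" using a0 h by simp
  next
    have "filterlim (\<lambda>\<sigma>. - h * \<sigma> powr a) at_bot at_top"
      by (rule filterlim_tendsto_neg_mult_at_bot[OF tendsto_const _ filterlim_powr_at_top[OF a0]]) (use h in simp)
    then have "((\<lambda>\<sigma>. - exp (- h * \<sigma> powr a)) \<longlongrightarrow> - 0) at_top"
      by (intro tendsto_minus filterlim_compose[OF exp_at_bot])
    then show "((\<lambda>\<sigma>. - exp (- h * \<sigma> powr a)) \<longlongrightarrow> 0) at_top" by simp
  qed simp
  finally show ?thesis by simp
qed

text \<open>Decomposition by the time \<open>\<tau>\<close> spent on the first part \<open>h\<close>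
  of the way, followed by the remaining \<open>t - \<tau>\<close> for the part
  \<open>x\<close>.\<close>

definition hit_conv :: "real \<Rightarrow> real \<Rightarrow> real \<Rightarrow> ennreal" where
  "hit_conv x h t = (\<integral>\<^sup>+\<tau>. ennreal (u (t - \<tau>) x) * indicator {0<..} (t - \<tau>) * (ennreal (hit h \<tau>) * indicator {0<..} \<tau>) \<partial>lborel)"

lemma hit_conv_measurable [measurable]: "hit_conv x h \<in> borel_measurable borel"
  unfolding hit_conv_def[abs_def] u_def by measurable

lemma hit_conv_laplace:
  assumes x: "0 < x" and h: "0 < h" and s: "0 < s"
  shows "(\<integral>\<^sup>+t. ennreal (exp (- s * t)) * hit_conv x h t \<partial>lborel) = lap (x + h) s"
proof -
  have "(\<integral>\<^sup>+t. ennreal (exp (- s * t)) * hit_conv x h t \<partial>lborel) =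
    (\<integral>\<^sup>+t. (\<integral>\<^sup>+\<tau>. ennreal (exp (- s * t)) * (ennreal (u (t - \<tau>) x) * indicator {0<..} (t - \<tau>) * (ennreal (hit h \<tau>) * indicator {0<..} \<tau>)) \<partial>lborel) \<partial>lborel)"
    unfolding hit_conv_def by (intro nn_integral_cong nn_integral_cmult[symmetric]) (unfold u_def, measurable)
  also have "\<dots> = (\<integral>\<^sup>+\<tau>. (\<integral>\<^sup>+t. ennreal (exp (- s * t)) * (ennreal (u (t - \<tau>) x) * indicator {0<..} (t - \<tau>) * (ennreal (hit h \<tau>) * indicator {0<..} \<tau>)) \<partial>lborel) \<partial>lborel)"
    by (rule lborel_pair.Fubini') (unfold u_def, measurable)
  also have "\<dots> = (\<integral>\<^sup>+\<tau>. lap x s * (ennreal (exp (- s * \<tau>) * hit h \<tau>) * indicator {0<..} \<tau>) \<partial>lborel)"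
  proof (intro nn_integral_cong)
    fix \<tau> :: real
    show "(\<integral>\<^sup>+t. ennreal (exp (- s * t)) * (ennreal (u (t - \<tau>) x) * indicator {0<..} (t - \<tau>) * (ennreal (hit h \<tau>) * indicator {0<..} \<tau>)) \<partial>lborel)
      = lap x s * (ennreal (exp (- s * \<tau>) * hit h \<tau>) * indicator {0<..} \<tau>)"
    proof (cases "0 < \<tau>")
      case True
      have "(\<integral>\<^sup>+t. ennreal (exp (- s * t)) * (ennreal (u (t - \<tau>) x) * indicator {0<..} (t - \<tau>) * (ennreal (hit h \<tau>) * indicator {0<..} \<tau>)) \<partial>lborel)
        = ennreal \<bar>1\<bar> * (\<integral>\<^sup>+t. ennreal (exp (- s * (\<tau> + 1 * t))) * (ennreal (u ((\<tau> + 1 * t) - \<tau>) x) * indicator {0<..} ((\<tau> + 1 * t) - \<tau>) * (ennreal (hit h \<tau>) * indicator {0<..} \<tau>)) \<partial>lborel)"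
        by (rule nn_integral_real_affine) (unfold u_def, auto)
      also have "\<dots> = (\<integral>\<^sup>+t. (ennreal (exp (- s * t) * u t x) * indicator {0<..} t) * ennreal (exp (- s * \<tau>) * hit h \<tau>) \<partial>lborel)"
      proof -
        have e: "exp (- s * (\<tau> + t)) = exp (- s * t) * exp (- s * \<tau>)" for t
          by (simp add: exp_add[symmetric] algebra_simps)
        show ?thesis unfolding e abs_one ennreal_1 mult_1_left
          using True h by (intro nn_integral_cong) (simp add: ennreal_mult u_nonneg hit_nonneg mult_ac)
      qed
      also have "\<dots> = lap x s * ennreal (exp (- s * \<tau>) * hit h \<tau>)"
        unfolding lap_def by (rule nn_integral_multc) simp
      finally show ?thesis using True by simp
    qed simp
  qed
  also have "\<dots> = lap x s * ennreal (exp (- h * s powr a))"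
    by (subst nn_integral_cmult, simp, subst hit_laplace[OF h s], rule refl)
  also have "\<dots> = lap (x + h) s"
    using x h s by (simp add: lap_eq ennreal_mult[symmetric] exp_add[symmetric] algebra_simps)
  finally show ?thesis .
qed

text \<open>Both sides have the transform \<open>lap (x + h)\<close>, because adding
  \<open>h\<close> multiplies the transform by \<open>exp (- h * s powr a)\<close>. Uniqueness holds
  up to a null set of times.\<close>

lemma u_shift_AE:
  assumes x: "0 < x" and h: "0 < h"
  shows "AE t in lborel. 0 < t \<longrightarrow> ennreal (u t (x + h)) = hit_conv x h t"
proof -
  define U where "U = (\<lambda>t. ennreal (u t (x + h)) * indicator {0<..} t)"
  have [measurable]: "U \<in> borel_measurable borel" unfolding U_def by measurable
  have eq: "(\<integral>\<^sup>+t. ennreal (exp (w * t)) \<partial>density lborel U) = lap (x + h) (- w)"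
    "(\<integral>\<^sup>+t. ennreal (exp (w * t)) \<partial>density lborel (hit_conv x h)) = lap (x + h) (- w)" if w: "w < 0" for w
  proof -
    have "(\<integral>\<^sup>+t. ennreal (exp (w * t)) \<partial>density lborel U) = (\<integral>\<^sup>+t. U t * ennreal (exp (w * t)) \<partial>lborel)"
      by (rule nn_integral_density) auto
    then show "(\<integral>\<^sup>+t. ennreal (exp (w * t)) \<partial>density lborel U) = lap (x + h) (- w)"
      unfolding lap_def by (auto intro!: nn_integral_cong simp: U_def ennreal_mult u_nonneg mult_ac)
    have "(\<integral>\<^sup>+t. ennreal (exp (w * t)) \<partial>density lborel (hit_conv x h)) = (\<integral>\<^sup>+t. hit_conv x h t * ennreal (exp (w * t)) \<partial>lborel)"
      by (rule nn_integral_density) auto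
    then show "(\<integral>\<^sup>+t. ennreal (exp (w * t)) \<partial>density lborel (hit_conv x h)) = lap (x + h) (- w)"
      using hit_conv_laplace[OF x h, of "- w"] w by (simp add: mult.commute)
  qed
  have "density lborel U = density lborel (hit_conv x h)"
    by (rule bilateral_laplace_unique[of _ _ "- 2" "- 1"]) (use eq x h lap_finite in auto)
  then have "AE t in lborel. U t = hit_conv x h t"
    by (intro sigma_finite_measure.density_unique[OF sigma_finite_lborel]) auto
  then show ?thesis by (rule AE_mp) (auto simp: U_def)
qed

theorem log_concave_if_multiplicatively:
  assumes m: "\<And>A B C D. 0 < A \<Longrightarrow> A \<le> B \<Longrightarrow> A \<le> C \<Longrightarrow> A * D = B * C \<Longrightarrow> f A * f D \<le> f B * f C"
  shows "log_concave f"
proof -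
  \<comment> \<open>The hypothesis at \<open>A = x * t powr - a\<close> and
    \<open>D = x' * r powr - a\<close> is total positivity of order two of \<open>u\<close> in time
    and space.\<close>
  have tp: "u r x' * u t x \<le> u r x * u t x'" if "0 < x" "x \<le> x'" "0 < r" "r \<le> t" for x x' r t
  proof -
    have rt: "0 < t powr - a" "t powr - a \<le> r powr - a" using that a0 by (auto intro: powr_mono2')
    have "f (x * t powr - a) * f (x' * r powr - a) \<le> f (x * r powr - a) * f (x' * t powr - a)"
      by (rule m) (use that rt in \<open>auto intro: mult_mono\<close>)
    then have "(r powr - a * t powr - a) * (f (x * t powr - a) * f (x' * r powr - a)) \<le> (r powr - a * t powr - a) * (f (x * r powr - a) * f (x' * t powr - a))"
      by (intro mult_left_mono) auto
    then show ?thesis by (simp add: u_def mult_ac)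
  qed
  \<comment> \<open>The shift by \<open>h\<close> integrates over earlier times
    \<open>t - \<tau>\<close>, so \<open>tp\<close> with \<open>r = t - \<tau>\<close> applies under
    the integral.\<close>
  have u1: "u t (x' + h) * u t x \<le> u t (x + h) * u t x'"
    if x: "0 < x" "x \<le> x'" and h: "0 < h" and t: "0 < t"
      and g: "ennreal (u t (x' + h)) = hit_conv x' h t" "ennreal (u t (x + h)) = hit_conv x h t" for x x' h t
  proof -
    have mc: "hit_conv z h t * ennreal c = (\<integral>\<^sup>+\<tau>. ennreal (u (t - \<tau>) z) * indicator {0<..} (t - \<tau>) * (ennreal (hit h \<tau>) * indicator {0<..} \<tau>) * ennreal c \<partial>lborel)" for z c
      unfolding hit_conv_def by (rule nn_integral_multc[symmetric]) (unfold u_def, measurable)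
    have "ennreal (u t (x' + h)) * ennreal (u t x) \<le> ennreal (u t (x + h)) * ennreal (u t x')"
      unfolding g mc
    proof (rule nn_integral_mono)
      fix \<tau> :: real
      show "ennreal (u (t - \<tau>) x') * indicator {0<..} (t - \<tau>) * (ennreal (hit h \<tau>) * indicator {0<..} \<tau>) * ennreal (u t x)
        \<le> ennreal (u (t - \<tau>) x) * indicator {0<..} (t - \<tau>) * (ennreal (hit h \<tau>) * indicator {0<..} \<tau>) * ennreal (u t x')"
      proof (cases "0 < \<tau> \<and> \<tau> < t")
        case True
        have "u (t - \<tau>) x' * u t x \<le> u (t - \<tau>) x * u t x'" by (rule tp) (use x True in auto)
        then have "hit h \<tau> * (u (t - \<tau>) x' * u t x) \<le> hit h \<tau> * (u (t - \<tau>) x * u t x')"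
          using hit_nonneg[OF h] True by (intro mult_left_mono) auto
        then have "u (t - \<tau>) x' * hit h \<tau> * u t x \<le> u (t - \<tau>) x * hit h \<tau> * u t x'"
          by (simp only: mult_ac)
        then show ?thesis using True hit_nonneg[OF h, of \<tau>]
          by (simp add: ennreal_mult[symmetric] u_nonneg ennreal_leI)
      qed (auto simp: indicator_def)
    qed
    then show ?thesis by (simp add: ennreal_mult[symmetric] u_nonneg ennreal_le_iff)
  qed
  have "f x * f t \<le> f r * f r'" if x: "0 < x" "x < r" "x < r'" "r + r' = x + t" for x r r' t
  proof -
    define h where "h = r' - x"
    have h: "0 < h" "x + h = r'" "r + h = t" using x by (auto simp: h_def)
    have ae: "AE t in lborel. 0 < t \<longrightarrow> u t (r + h) * u t x \<le> u t (x + h) * u t r"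
      using u_shift_AE[of r h] u_shift_AE[of x h] x h(1)
      by (rule_tac AE_mp[OF u_shift_AE[of r h]], simp, simp, rule_tac AE_mp[OF u_shift_AE[of x h]]) (auto intro!: AE_I2 u1)
    \<comment> \<open>\<open>u 1\<close> is \<open>f\<close>, but the shift formula may fail at time
      \<open>1\<close>; good times \<open>q n\<close> tending to \<open>1\<close> are chosen and
      continuity of \<open>f\<close> finishes.\<close>
    have "\<exists>q. \<forall>n. 1 < q n \<and> q n < 1 + 1 / (real n + 1) \<and> u (q n) (r + h) * u (q n) x \<le> u (q n) (x + h) * u (q n) r"
    proof (rule choice, rule allI, rule ccontr)
      fix n :: nat
      define hi where "hi = 1 + 1 / (real n + 1)"
      assume *: "\<nexists>q. 1 < q \<and> q < 1 + 1 / (real n + 1) \<and> u q (r + h) * u q x \<le> u q (x + h) * u q r"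
      have "AE q in lborel. q \<notin> {1<..<hi}"
        by (rule AE_mp[OF ae], rule AE_I2) (use * in \<open>auto simp: hi_def\<close>)
      then have "emeasure lborel {1<..<hi} = 0"
        by (subst (asm) AE_iff_null_sets[symmetric]) (auto simp: null_sets_def)
      then show False by (simp add: hi_def)
    qed
    then obtain q where q: "\<And>n. 1 < q n" "\<And>n. q n < 1 + 1 / (real n + 1)"
      "\<And>n. u (q n) (r + h) * u (q n) x \<le> u (q n) (x + h) * u (q n) r" by auto
    have "(\<lambda>n. 1 + 1 / (real n + 1)) \<longlonglongrightarrow> 1 + 0"
      using LIMSEQ_inverse_real_of_nat by (intro tendsto_add tendsto_const) (simp add: inverse_eq_divide add.commute)
    then have ql: "q \<longlonglongrightarrow> 1"
      using q by (intro tendsto_sandwich[of "\<lambda>_. 1" q _ "\<lambda>n. 1 + 1 / (real n + 1)"]) (auto intro!: always_eventually less_imp_le)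
    have ul: "(\<lambda>n. u (q n) y) \<longlonglongrightarrow> f y" if "0 < y" for y
    proof -
      have l1: "(\<lambda>n. q n powr - a) \<longlonglongrightarrow> 1 powr - a" by (intro tendsto_powr ql tendsto_const) auto
      then have "(\<lambda>n. y * q n powr - a) \<longlonglongrightarrow> y * 1 powr - a" by (rule tendsto_mult_left)
      then have l2: "(\<lambda>n. y * q n powr - a) \<longlonglongrightarrow> y" by simp
      have "isCont f y" using f_cont that by (simp add: continuous_on_eq_continuous_at)
      then have "(\<lambda>n. f (y * q n powr - a)) \<longlonglongrightarrow> f y" by (rule isCont_tendsto_compose[OF _ l2])
      from tendsto_mult[OF l1 this] show ?thesis by (simp add: u_def)
    qed
    have "f (r + h) * f x \<le> f (x + h) * f r"
      by (rule LIMSEQ_le[OF tendsto_mult[OF ul ul] tendsto_mult[OF ul ul]]) (use q x h in auto)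
    then show ?thesis using h by (simp add: mult.commute)
  qed
  then show ?thesis by (rule log_concave_from_four_points)
qed

end

section \<open>Gamma quotients as limits of interlacing products\<close>

lemma Gamma_product_limit:
  fixes y :: real
  assumes y: "y \<noteq> 0"
  shows "(\<lambda>n. (\<Prod>k=1..n. 1 + \<i> * of_real y / of_nat k) * iexp (- (y * ln (real n)))) \<longlonglongrightarrow> rGamma (1 + \<i> * of_real y)"
proof -
  define z where "z = \<i> * complex_of_real y"
  have z: "z \<noteq> 0" using y by (simp add: z_def)
  have poch: "pochhammer z (n + 1) = z * (fact n * (\<Prod>k=1..n. 1 + z / of_nat k))" for n
  proof (induction n)
    case (Suc n)
    have "pochhammer z (Suc n + 1) = pochhammer z (n + 1) * (z + of_nat (Suc n))"
      by (simp add: pochhammer_Suc)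
    also have "z + of_nat (Suc n) = of_nat (Suc n) * (1 + z / of_nat (Suc n))"
      by (simp add: field_simps del: of_nat_Suc)
    finally show ?case unfolding Suc by (simp add: mult_ac del: of_nat_Suc)
  qed simp
  \<comment> \<open>Dividing by \<open>z\<close> removes the first factor of the product and shifts
    the argument from \<open>z\<close> to \<open>1 + z\<close>.\<close>
  have "(\<lambda>n. rGamma_series z n / z) \<longlonglongrightarrow> rGamma z / z"
    by (intro tendsto_divide rGamma_series_LIMSEQ tendsto_const z)
  moreover have "rGamma_series z n / z = (\<Prod>k=1..n. 1 + z / of_nat k) * iexp (- (y * ln (real n)))" for n
  proof -
    have "exp (z * of_real (ln (real n))) * iexp (- (y * ln (real n))) = 1"
      by (simp add: z_def exp_add[symmetric] algebra_simps)
    then have "1 / exp (z * of_real (ln (real n))) = iexp (- (y * ln (real n)))"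
      by (simp add: divide_eq_eq mult.commute)
    moreover have "rGamma_series z n / z = (\<Prod>k=1..n. 1 + z / of_nat k) * (1 / exp (z * of_real (ln (real n))))"
      unfolding rGamma_series_def poch using z by simp
    ultimately show ?thesis by simp
  qed
  moreover have "rGamma z / z = rGamma (1 + z)"
    using z rGamma_plus1[of z] by (metis nonzero_mult_div_cancel_left add.commute)
  ultimately show ?thesis by (simp add: z_def)
qed

text \<open>The integer pole of \<open>\<Gamma>(1 + z)\<close> that is paired with the zero
  \<open>(i + 1) / a\<close> of \<open>1 / \<Gamma>(1 + a z)\<close>, both up to sign.\<close>

definition floor_pole :: "real \<Rightarrow> nat \<Rightarrow> nat" where
  "floor_pole a i = nat \<lfloor>real (Suc i) / a\<rfloor>"

lemma floor_pole_bounds: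
  assumes "0 < a"
  shows "real (floor_pole a i) \<le> real (Suc i) / a" "real (Suc i) / a < real (floor_pole a i) + 1"
proof -
  have "0 \<le> \<lfloor>real (Suc i) / a\<rfloor>" using assms by simp
  then have "real (floor_pole a i) = of_int \<lfloor>real (Suc i) / a\<rfloor>" by (simp add: floor_pole_def)
  then show "real (floor_pole a i) \<le> real (Suc i) / a" "real (Suc i) / a < real (floor_pole a i) + 1" by linarith+
qed

text \<open>For \<open>a \<le> 1 / 2\<close> consecutive zeros are at least two apart and the first
  one is at least \<open>2\<close>, so rounding down keeps the interlacing and leaves the pole
  \<open>1\<close> unpaired.\<close>

lemma floor_pole_gap:
  assumes a: "0 < a" "a \<le> 1 / 2"
  shows "real (Suc i) / a < real (floor_pole a (Suc i))" "2 \<le> floor_pole a i"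
    "i < j \<Longrightarrow> floor_pole a i < floor_pole a j"
proof -
  have g: "2 \<le> 1 / a" using a by (simp add: field_simps)
  have 1: "real (Suc i) / a < real (floor_pole a (Suc i))" for i
  proof -
    have "real (Suc (Suc i)) / a = real (Suc i) / a + 1 / a" by (simp add: add_divide_distrib)
    then show ?thesis using floor_pole_bounds(2)[OF a(1), of "Suc i"] g by linarith
  qed
  show "real (Suc i) / a < real (floor_pole a (Suc i))" by (rule 1)
  show "2 \<le> floor_pole a i"
  proof -
    have "1 / a \<le> real (Suc i) / a" using a by (intro divide_right_mono) auto
    then show ?thesis using floor_pole_bounds(2)[OF a(1), of i] g by linarith
  qed
  show "floor_pole a i < floor_pole a j" if "i < j"
    using that
  proof (induction rule: less_Suc_induct)
    case (1 i)
    then show ?case using \<open>real (Suc i) / a < real (floor_pole a (Suc i))\<close> floor_pole_bounds(1)[OF a(1), of i] \<open>\<And>i. real (Suc i) / a < real (floor_pole a (Suc i))\<close>[of i] by linarith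
  next
    case (2 i j k)
    then show ?case by simp
  qed
qed

text \<open>The pole \<open>1\<close> lies below all paired poles and is the rate of the opening
  convolution that \<open>interlacing_slope_falling\<close> demands. The integers in
  \<open>R\<close>, paired with no zero, are the further exponential factors.\<close>

lemma multiplicative_approximant:
  assumes a: "0 < a" "a \<le> 1 / 2"
  shows "\<exists>v. nice v \<and> slope_falling v \<and> (\<forall>z. Re z \<ge> 0 \<longrightarrow> laplace v z =
    (\<Prod>n=1..Suc N. 1 + of_real a * z / of_nat n) / (\<Prod>k=1..floor_pole a N. 1 + z / of_nat k))"
proof -
  define p where "p i = real (floor_pole a i)" for i
  define q where "q i = real (Suc i) / a" for i
  define R where "R = {2..floor_pole a N} - floor_pole a ` {..<Suc N}"
  define as where "as = map real (sorted_list_of_set R)"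
  have finR: "finite R" by (simp add: R_def)
  have inj: "inj_on (floor_pole a) {..<Suc N}"
    using floor_pole_gap(3)[OF a] by (intro linorder_inj_onI) (auto simp: less_imp_neq)
  have sub: "floor_pole a ` {..<Suc N} \<subseteq> {2..floor_pole a N}"
  proof
    fix k assume "k \<in> floor_pole a ` {..<Suc N}"
    then obtain i where i: "i < Suc N" "k = floor_pole a i" by auto
    then have "floor_pole a i \<le> floor_pole a N" using floor_pole_gap(3)[OF a, of i N] by (cases "i = N") auto
    then show "k \<in> {2..floor_pole a N}" using floor_pole_gap(2)[OF a, of i] i by auto
  qed
  have "\<exists>v. nice v \<and> slope_falling v \<and> (\<forall>z. Re z \<ge> 0 \<longrightarrow> laplace v z =
    (\<Prod>i<Suc N. (1 + z / of_real (q i)) / (1 + z / of_real (p i))) / (\<Prod>a\<leftarrow>1 # as. 1 + z / of_real a))"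
  proof (rule interlacing_slope_falling)
    show "0 < p i" "1 \<le> p i" for i using floor_pole_gap(2)[OF a, of i] by (auto simp: p_def)
    show "p i \<le> q i" for i using floor_pole_bounds(1)[OF a(1), of i] by (simp add: p_def q_def)
    show "q i < p (Suc i)" for i using floor_pole_gap(1)[OF a, of i] by (simp add: p_def q_def)
    show "\<forall>a\<in>set as. 0 < a" using finR by (auto simp: as_def R_def)
  qed simp
  moreover have "(\<Prod>i<Suc N. (1 + z / of_real (q i)) / (1 + z / of_real (p i))) / (\<Prod>a\<leftarrow>1 # as. 1 + z / of_real a) =
    (\<Prod>n=1..Suc N. 1 + of_real a * z / of_nat n) / (\<Prod>k=1..floor_pole a N. 1 + z / of_nat k)" for z :: complex
  proof -
    have num: "(\<Prod>i<Suc N. 1 + z / of_real (q i)) = (\<Prod>n=1..Suc N. 1 + of_real a * z / of_nat n)"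
    proof -
      have "(\<Prod>n=1..Suc N. 1 + of_real a * z / of_nat n) = (\<Prod>i<Suc N. 1 + of_real a * z / of_nat (Suc i))"
        by (rule prod.reindex_bij_witness[of _ Suc "\<lambda>n. n - 1"]) auto
      then show ?thesis by (simp add: q_def mult.commute del: of_nat_Suc prod.lessThan_Suc)
    qed
    have den: "(\<Prod>i<Suc N. 1 + z / of_real (p i)) * (\<Prod>a\<leftarrow>1 # as. 1 + z / of_real a) = (\<Prod>k=1..floor_pole a N. 1 + z / of_nat k)"
    proof -
      have "(\<Prod>a\<leftarrow>as. 1 + z / of_real a) = prod_list (map (\<lambda>k. 1 + z / of_nat k) (sorted_list_of_set R))"
        by (simp add: as_def o_def)
      also have "\<dots> = (\<Prod>k\<in>set (sorted_list_of_set R). 1 + z / of_nat k)"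
        by (rule prod.distinct_set_conv_list[symmetric]) simp
      finally have l: "(\<Prod>a\<leftarrow>as. 1 + z / of_real a) = (\<Prod>k\<in>R. 1 + z / of_nat k)" using finR by simp
      have "(\<Prod>i<Suc N. 1 + z / of_real (p i)) = (\<Prod>k\<in>floor_pole a ` {..<Suc N}. 1 + z / of_nat k)"
        by (subst prod.reindex[OF inj]) (simp add: p_def o_def)
      moreover have "(\<Prod>k\<in>R. 1 + z / of_nat k) * (\<Prod>k\<in>floor_pole a ` {..<Suc N}. 1 + z / of_nat k) = (\<Prod>k\<in>{2..floor_pole a N}. 1 + z / of_nat k)"
        unfolding R_def by (rule prod.subset_diff[symmetric, OF sub]) simp
      moreover have "(\<Prod>k=1..floor_pole a N. 1 + z / of_nat k) = (1 + z) * (\<Prod>k\<in>{2..floor_pole a N}. 1 + z / of_nat k)"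
      proof -
        have "{1..floor_pole a N} = insert 1 {2..floor_pole a N}" using floor_pole_gap(2)[OF a, of N] by auto
        then show ?thesis by simp
      qed
      ultimately show ?thesis using l by (simp add: mult_ac)
    qed
    show ?thesis unfolding prod_dividef num den[symmetric] by simp
  qed
  ultimately show ?thesis by simp
qed

context mittag_leffler_density begin

lemma ln_law: "real_distribution (distr L borel ln)"
  unfolding real_distribution_def real_distribution_axioms_def by (simp add: prob_space_distr)

lemma interval_primitive:
  "\<exists>F. (\<forall>v. (F has_real_derivative f (exp v) * exp v) (at v)) \<and> (\<forall>p q. p < q \<longrightarrow> measure (distr L borel ln) {p<..q} = F q - F p)"
proof -
  have "\<exists>\<Phi>. \<forall>x::real. ereal 0 < x \<longrightarrow> x < \<infinity> \<longrightarrow> (\<Phi> has_vector_derivative f x) (at x)"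
    by (rule einterval_antiderivative) (use f_cont in \<open>auto simp: continuous_on_eq_continuous_at\<close>)
  then obtain \<Phi> where \<Phi>: "\<And>x. 0 < x \<Longrightarrow> (\<Phi> has_real_derivative f x) (at x)"
    by (auto simp: has_real_derivative_iff_has_vector_derivative)
  define F where "F v = \<Phi> (exp v)" for v
  have D: "(F has_real_derivative f (exp v) * exp v) (at v)" for v
    unfolding F_def by (rule DERIV_chain2[OF \<Phi>]) (auto intro!: derivative_eq_intros)
  have M: "measure (distr L borel ln) {p<..q} = F q - F p" if pq: "p < q" for p q
  proof -
    have "emeasure (distr L borel ln) {p<..q} = (\<integral>\<^sup>+v. indicator {p<..q} v \<partial>distr L borel ln)"
      by simp
    also have "\<dots> = (\<integral>\<^sup>+x. indicator {p<..q} (ln x) \<partial>L)" by (rule nn_integral_distr) auto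
    also have "\<dots> = (\<integral>\<^sup>+x. indicator {exp p<..exp q} x \<partial>L)"
    proof (rule nn_integral_cong_AE, rule AE_mp[OF L_pos], rule AE_I2, rule impI)
      fix x :: real assume "0 < x"
      then have "p < ln x \<longleftrightarrow> exp p < x" "ln x \<le> q \<longleftrightarrow> x \<le> exp q"
        by (metis exp_less_cancel_iff exp_ln, metis exp_le_cancel_iff exp_ln)
      then show "indicator {p<..q} (ln x) = (indicator {exp p<..exp q} x :: ennreal)" by (auto simp: indicator_def)
    qed
    also have "\<dots> = (\<integral>\<^sup>+x. ennreal (f x) * indicator {exp p..exp q} x \<partial>lborel)"
      by (subst nn_integral_L, simp, rule nn_integral_cong_AE, rule AE_mp[OF AE_lborel_singleton[of "exp p"]]) (auto intro!: AE_I2 simp: indicator_def)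
    also have "\<dots> = ennreal (\<Phi> (exp q) - \<Phi> (exp p))"
    proof (rule nn_integral_FTC_Icc[where F = \<Phi>])
      show "exp p \<le> exp q" using pq by simp
      fix x assume "x \<in> {exp p..exp q}"
      then have "0 < x" using less_le_trans[OF exp_gt_zero[of p]] by auto
      then show "(\<Phi> has_real_derivative f x) (at x)"
        by (rule \<Phi>)
      show "0 \<le> f x" by (rule f_nonneg)
    qed simp
    finally have e: "emeasure (distr L borel ln) {p<..q} = ennreal (F q - F p)" by (simp add: F_def)
    have "F p \<le> F q"
    proof (rule DERIV_nonneg_imp_nondecreasing[where f = F and a = p and b = q])
      fix x show "\<exists>y. (F has_real_derivative y) (at x) \<and> 0 \<le> y" using D[of x] f_nonneg by (intro exI conjI) auto
    qed (use pq in simp)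
    then show ?thesis using e by (simp add: measure_def)
  qed
  show ?thesis using D M by blast
qed

theorem multiplicatively_log_concave:
  assumes a2: "a \<le> 1 / 2" and ABCD: "0 < A" "A \<le> B" "A \<le> C" "A * D = B * C"
  shows "f A * f D \<le> f B * f C"
proof (cases "A = B \<or> A = C")
  case True
  then show ?thesis using ABCD by (auto simp: mult.commute)
next
  case False
  then have AB: "A < B" "A < C" using ABCD by auto
  have D0: "0 < D" using ABCD AB by (metis less_trans mult_pos_pos zero_less_mult_pos)
  have "\<forall>N. \<exists>v. nice v \<and> slope_falling v \<and> (\<forall>z. Re z \<ge> 0 \<longrightarrow> laplace v z =
    (\<Prod>n=1..Suc N. 1 + of_real a * z / of_nat n) / (\<Prod>k=1..floor_pole a N. 1 + z / of_nat k))"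
    using multiplicative_approximant[OF a0 a2] by blast
  from choice[OF this] obtain v where v: "\<And>N. nice (v N)" "\<And>N. slope_falling (v N)"
    and lv: "\<And>N z. Re z \<ge> 0 \<Longrightarrow> laplace (v N) z =
    (\<Prod>n=1..Suc N. 1 + of_real a * z / of_nat n) / (\<Prod>k=1..floor_pole a N. 1 + z / of_nat k)" by auto
  have one: "laplace (v N) 0 = 1" for N by (simp add: lv)
  define P where "P = floor_pole a"
  \<comment> \<open>The difference of the centring terms of the two products in
    \<open>Gamma_product_limit\<close>.\<close>
  define c where "c N = ln (real (P N)) - a * ln (real (Suc N))" for N
  define h where "h n = reflected (v n) (c n)" for n
  define \<mu> where "\<mu> n = density lborel (\<lambda>x. ennreal (h n x))" for n
  have \<mu>: "real_distribution (\<mu> n)" and char: "char (\<mu> n) y = iexp (y * c n) * laplace (v n) (\<i> * of_real y)" for n y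
    unfolding \<mu>_def h_def using reflected_real_distribution[OF v(1) one] by auto
  have hm: "h n \<in> borel_measurable borel" "0 \<le> h n x" for n x
    unfolding h_def by (auto intro: reflected_measurable reflected_nonneg v)
  interpret X: real_distribution "distr L borel ln" by (rule ln_law)
  have Pinf: "filterlim P sequentially sequentially"
  proof (rule filterlim_at_top_mono[OF filterlim_ident])
    have "i \<le> P i" for i
    proof (induction i)
      case (Suc i)
      then show ?case using floor_pole_gap(3)[OF a0 a2, of i "Suc i"] by (simp add: P_def)
    qed simp
    then show "\<forall>\<^sub>F n in sequentially. n \<le> P n" by simp
  qed
  have lim: "(\<lambda>n. char (\<mu> n) y) \<longlonglongrightarrow> char (distr L borel ln) y" for y
  proof (cases "y = 0")
    case True
    then show ?thesis using X.char_zero by (simp add: char one)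
  next
    case False
    define G where "G n y = (\<Prod>k=1..n. 1 + \<i> * of_real y / of_nat k) * iexp (- (y * ln (real n)))" for n and y :: real
    have nz: "rGamma (1 + \<i> * complex_of_real y) \<noteq> 0"
      by (simp add: rGamma_eq_zero_iff) (auto elim!: nonpos_Ints_cases simp: complex_eq_iff)
    have 1: "(\<lambda>n. G (Suc n) (a * y)) \<longlonglongrightarrow> rGamma (1 + \<i> * of_real (a * y))"
      unfolding G_def by (rule LIMSEQ_Suc[OF Gamma_product_limit]) (use False a0 in auto)
    have 2: "(\<lambda>n. G (P n) y) \<longlonglongrightarrow> rGamma (1 + \<i> * of_real y)"
      unfolding G_def by (rule filterlim_compose[OF Gamma_product_limit[OF False] Pinf])
    have "(\<lambda>n. G (Suc n) (a * y) / G (P n) y) \<longlonglongrightarrow> rGamma (1 + \<i> * of_real (a * y)) / rGamma (1 + \<i> * of_real y)"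
      by (rule tendsto_divide[OF 1 2 nz])
    moreover have "G (Suc n) (a * y) / G (P n) y = char (\<mu> n) y" for n
    proof -
      have e: "iexp (- (a * y * ln (real (Suc n)))) / iexp (- (y * ln (real (P n)))) = iexp (y * c n)"
        by (simp add: exp_diff[symmetric] c_def algebra_simps del: of_nat_Suc)
      have l: "laplace (v n) (\<i> * of_real y) = (\<Prod>k=1..Suc n. 1 + \<i> * of_real (a * y) / of_nat k) / (\<Prod>k=1..P n. 1 + \<i> * of_real y / of_nat k)"
        by (simp add: lv P_def mult_ac del: of_nat_Suc prod.cl_ivl_Suc)
      have gen: "A * x / (B * w) = x / w * (A / B)" for A B x w :: complex by (simp add: mult.commute)
      show ?thesis unfolding char l G_def e[symmetric] by (rule gen)
    qed
    ultimately show ?thesis by (simp add: char_ln rGamma_inverse_Gamma divide_inverse mult.commute)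
  qed
  have wc: "weak_conv_m \<mu> (distr L borel ln)" by (rule levy_continuity[OF \<mu> ln_law lim])
  obtain F where F: "\<And>v. (F has_real_derivative f (exp v) * exp v) (at v)"
    and FM: "\<And>p q. p < q \<Longrightarrow> measure (distr L borel ln) {p<..q} = F q - F p"
    using interval_primitive by blast
  \<comment> \<open>Weak convergence controls the distribution function at its continuity points.
    Continuity of \<open>F\<close> excludes atoms, so every point is one.\<close>
  have na: "measure (distr L borel ln) {x} = 0" for x
  proof -
    have "measure (distr L borel ln) {x} \<le> F x - F (x - e)" if "0 < e" for e
      using FM[of "x - e" x] that by (metis X.finite_measure_mono add_diff_cancel_right' atLeastAtMost_singleton diff_add_cancel
          empty_subsetI greaterThanAtMost_iff insert_subset less_add_same_cancel1 order_refl sets_distr borel_closed sets.sets_into_space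
          X.events_eq_borel diff_less_eq greaterThanAtMost_borel)
    moreover have "((\<lambda>e. F x - F (x - e)) \<longlongrightarrow> F x - F (x - 0)) (at_right 0)"
    proof -
      have "isCont F x" using F DERIV_isCont by blast
      then show ?thesis by (intro tendsto_diff tendsto_const isCont_tendsto_compose[of "x - 0" F] tendsto_ident_at) auto
    qed
    ultimately have "measure (distr L borel ln) {x} \<le> F x - F (x - 0)"
      by (intro tendsto_lowerbound[of _ _ "at_right 0"]) (auto intro!: eventually_mono[OF eventually_at_right_less[of 0]])
    then show ?thesis using measure_nonneg[of "distr L borel ln" "{x}"] by simp
  qed
  have cdf: "(\<lambda>n. cdf (\<mu> n) x) \<longlonglongrightarrow> cdf (distr L borel ln) x" for x
    using wc na X.isCont_cdf[of x] by (auto simp: weak_conv_m_def weak_conv_def)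
  have mlim: "(\<lambda>n. measure (\<mu> n) {p<..q}) \<longlonglongrightarrow> F q - F p" if "p < q" for p q
  proof -
    have "measure (\<mu> n) {p<..q} = cdf (\<mu> n) q - cdf (\<mu> n) p" for n
    proof -
      interpret M: real_distribution "\<mu> n" by (rule \<mu>)
      show ?thesis using M.cdf_diff_eq[OF that] by simp
    qed
    moreover have "F q - F p = cdf (distr L borel ln) q - cdf (distr L borel ln) p"
      using FM[OF that] X.cdf_diff_eq[OF that] by simp
    ultimately show ?thesis by (simp only:) (intro tendsto_diff cdf)
  qed
  have fin: "finite_measure (density lborel (\<lambda>x. ennreal (h n x)))" for n
    using \<mu>[of n] unfolding \<mu>_def real_distribution_def by (simp add: prob_space.finite_measure)
  define d where "d = min (ln B - ln A) (ln C - ln A)"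
  have d: "0 < d" "d \<le> ln B - ln A" "d \<le> ln C - ln A" using AB ABCD by (auto simp: d_def)
  have sum: "ln A + ln D = ln B + ln C"
  proof -
    have "0 < B" "0 < C" using ABCD AB by auto
    then have "ln (A * D) = ln A + ln D" "ln (B * C) = ln B + ln C" using ABCD(1) D0 by (simp_all add: ln_mult)
    then show ?thesis using ABCD(4) by simp
  qed
  have "f (exp (ln A)) * exp (ln A) * (f (exp (ln D)) * exp (ln D)) \<le> f (exp (ln B)) * exp (ln B) * (f (exp (ln C)) * exp (ln C))"
  proof (rule four_points_limit[of h F "\<lambda>v. f (exp v) * exp v", OF hm fin mlim[unfolded \<mu>_def] F d(1)])
    show "\<exists>\<^sub>F n in sequentially. \<forall>s r. 0 < s \<longrightarrow> s \<le> d \<longrightarrow> 0 < r \<longrightarrow> r \<le> d \<longrightarrow> h n (ln A + s) * h n (ln D + r) \<le> h n (ln B + s) * h n (ln C + r)"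
    proof (rule eventually_frequently[OF sequentially_bot], rule always_eventually, intro allI impI)
      fix n s r assume sr: "0 < s" "s \<le> d" "0 < r" "r \<le> d"
      show "h n (ln A + s) * h n (ln D + r) \<le> h n (ln B + s) * h n (ln C + r)"
      proof (cases "ln D + r < c n")
        case True
        have "v n (c n - (ln D + r)) * v n (c n - (ln A + s)) \<le> v n (c n - (ln B + s)) * v n (c n - (ln C + r))"
          by (rule slope_falling_four_points[OF v(1,2)]) (use True sr d sum in auto)
        then show ?thesis using True sr d sum by (simp add: h_def reflected_def mult.commute)
      next
        case False
        then have "h n (ln D + r) = 0" by (simp add: h_def reflected_def)
        then show ?thesis using hm(2) by simp
      qed
    qed
  qed simp_all
  moreover have "exp (ln A) = A" "exp (ln B) = B" "exp (ln C) = C" "exp (ln D) = D"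
    using ABCD(1) AB D0 by auto
  ultimately have "f A * A * (f D * D) \<le> f B * B * (f C * C)" by (simp only:)
  \<comment> \<open>The Jacobian factors of the logarithmic scale cancel because
    \<open>A * D = B * C\<close>.\<close>
  then have "(A * D) * (f A * f D) \<le> (B * C) * (f B * f C)"
    by (simp only: mult_ac)
  then have "(A * D) * (f A * f D) \<le> (A * D) * (f B * f C)" by (simp only: ABCD(4))
  moreover have "0 < A * D" using ABCD D0 by simp
  ultimately show ?thesis by (simp only: mult_le_cancel_left_pos)
qed

theorem log_concave_half: "a \<le> 1 / 2 \<Longrightarrow> log_concave f"
  by (rule log_concave_if_multiplicatively) (rule multiplicatively_log_concave)

end

section \<open>The critical index\<close>

text \<open>Writing \<open>a = 1 - d\<close>, the functional equation shifts every argument of \<open>rGamma\<close> to a positive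
  number, and the equation compares the increasing function \<open>gamma_ratio\<close> with the decreasing
  function \<open>threshold\<close>.\<close>

definition gamma_ratio :: "real \<Rightarrow> real" where
  "gamma_ratio d = (rGamma (1 + 2 * d))\<^sup>2 / (rGamma (1 + d) * rGamma (1 + 3 * d))"

text \<open>Equals \<open>3 * (2 - 3 * d) * (1 - 3 * d) / (4 * (1 - 2 * d)\<^sup>2)\<close>, the
  quotient of the polynomial factors that the shifts produce; this form makes the monotonicity
  visible.\<close>

definition threshold :: "real \<Rightarrow> real" where
  "threshold d = 27 / 16 - 3 / (16 * (1 - 2 * d)\<^sup>2)"

definition ratio_product :: "nat \<Rightarrow> real \<Rightarrow> real" where
  "ratio_product n d = (\<Prod>k=1..n. (real k + 2 * d)\<^sup>2 / ((real k + d) * (real k + 3 * d)))"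

text \<open>With \<open>m = k + 2 * d\<close> the factors of the product are
  \<open>m\<^sup>2 / (m\<^sup>2 - d\<^sup>2)\<close>, and their tail from \<open>k\<close> on is
  about \<open>1 + d\<^sup>2 / (m - 1 / 2)\<close>. The quotient here is
  \<open>1 + 2 * u / (m - 1 / 2)\<close> to first order, which suggests \<open>u\<close> near
  \<open>d\<^sup>2 / 2\<close>.\<close>

definition tail_bound :: "real \<Rightarrow> real \<Rightarrow> nat \<Rightarrow> real" where
  "tail_bound d u k = (real k + 2 * d - 1 / 2 + u) / (real k + 2 * d - 1 / 2 - u)"

lemma rGamma_pos: "0 < x \<Longrightarrow> 0 < rGamma (x::real)"
  by (simp add: rGamma_inverse_Gamma Gamma_real_pos)

text \<open>Since \<open>(1 + d) + (1 + 3 * d) = 2 * (1 + 2 * d)\<close>, the powers of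
  \<open>n\<close> and the factorials in Euler's limit cancel and only the plain product
  remains.\<close>

lemma ratio_product_limit:
  assumes d: "- 1 / 3 < d"
  shows "(\<lambda>n. ratio_product n d) \<longlonglongrightarrow> gamma_ratio d"
proof -
  have poch: "pochhammer (1 + x) (n + 1) = (\<Prod>k=1..Suc n. real k + x)" for x :: real and n
    by (induction n) (simp_all add: pochhammer_Suc algebra_simps)
  have pos: "0 < rGamma (1 + d)" "0 < rGamma (1 + 3 * d)" using d by (auto intro!: rGamma_pos)
  have "(\<lambda>n. (rGamma_series (1 + 2 * d) n)\<^sup>2 / (rGamma_series (1 + d) n * rGamma_series (1 + 3 * d) n)) \<longlonglongrightarrow> gamma_ratio d"
    unfolding gamma_ratio_def using pos by (intro tendsto_intros rGamma_series_LIMSEQ) auto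
  moreover have "(rGamma_series (1 + 2 * d) n)\<^sup>2 / (rGamma_series (1 + d) n * rGamma_series (1 + 3 * d) n) = ratio_product (Suc n) d" for n
  proof -
    define l where "l = ln (real n)"
    have e: "exp ((1 + d) * l) * exp ((1 + 3 * d) * l) = (exp ((1 + 2 * d) * l))\<^sup>2"
      by (simp add: power2_eq_square exp_add[symmetric] algebra_simps)
    define X Y Z where "X = (\<Prod>k=1..Suc n. real k + 2 * d)" and "Y = (\<Prod>k=1..Suc n. real k + d)" and "Z = (\<Prod>k=1..Suc n. real k + 3 * d)"
    have alg: "(x / (f * e2))\<^sup>2 / (y / (f * e1) * (z / (f * e3))) = x\<^sup>2 / (y * z)"
      if "f \<noteq> 0" "e1 \<noteq> 0" "e3 \<noteq> 0" "e1 * e3 = e2\<^sup>2" "e2 \<noteq> 0" for x y z f e1 e2 e3 :: real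
    proof -
      have "(x / (f * e2))\<^sup>2 / (y / (f * e1) * (z / (f * e3))) = x\<^sup>2 / (f\<^sup>2 * e2\<^sup>2) / (y * z / (f\<^sup>2 * (e1 * e3)))"
        by (simp add: power_mult_distrib power_divide power2_eq_square mult_ac)
      also have "\<dots> = x\<^sup>2 / (y * z)" unfolding that(4) using that by simp
      finally show ?thesis .
    qed
    have "(rGamma_series (1 + 2 * d) n)\<^sup>2 / (rGamma_series (1 + d) n * rGamma_series (1 + 3 * d) n) = X\<^sup>2 / (Y * Z)"
      unfolding rGamma_series_def poch X_def[symmetric] Y_def[symmetric] Z_def[symmetric] l_def[symmetric]
      by (simp only: of_real_eq_id id_apply, rule alg) (use e in auto)
    also have "\<dots> = ratio_product (Suc n) d"
      unfolding ratio_product_def X_def Y_def Z_def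
      by (simp only: prod_dividef prod.distrib prod_power_distrib[symmetric])
    finally show ?thesis .
  qed
  ultimately have "(\<lambda>n. ratio_product (Suc n) d) \<longlonglongrightarrow> gamma_ratio d" by simp
  then show ?thesis by (rule LIMSEQ_imp_Suc)
qed

lemma ratio_factor:
  assumes "- 1 / 3 < d" "1 \<le> k"
  shows "(real k + 2 * d)\<^sup>2 / ((real k + d) * (real k + 3 * d)) = 1 + d\<^sup>2 / ((real k + d) * (real k + 3 * d))"
    "0 < (real k + d) * (real k + 3 * d)"
proof -
  have kd: "0 < real k + d" "0 < real k + 3 * d" using assms by auto
  then show p: "0 < (real k + d) * (real k + 3 * d)" by simp
  have "(real k + 2 * d)\<^sup>2 = (real k + d) * (real k + 3 * d) + d\<^sup>2" by (simp add: power2_eq_square algebra_simps)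
  then show "(real k + 2 * d)\<^sup>2 / ((real k + d) * (real k + 3 * d)) = 1 + d\<^sup>2 / ((real k + d) * (real k + 3 * d))"
    using p kd by (simp add: add_divide_distrib)
qed

lemma ratio_product_Suc:
  "ratio_product (Suc n) d = ratio_product n d * ((real (Suc n) + 2 * d)\<^sup>2 / ((real (Suc n) + d) * (real (Suc n) + 3 * d)))"
  by (simp add: ratio_product_def del: of_nat_Suc)

lemma gamma_ratio_gt_1:
  assumes d: "- 1 / 3 < d" "d \<noteq> 0" shows "1 < gamma_ratio d"
proof -
  have f: "1 \<le> (real (Suc n) + 2 * d)\<^sup>2 / ((real (Suc n) + d) * (real (Suc n) + 3 * d))" for n
    using ratio_factor[OF d(1), of "Suc n"] by (simp del: of_nat_Suc)
  have ge: "ratio_product 1 d \<le> ratio_product (Suc n) d" for n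
  proof (induction n)
    case (Suc n)
    have "0 \<le> ratio_product (Suc n) d"
      unfolding ratio_product_def using ratio_factor(2)[OF d(1)] by (intro prod_nonneg) (auto intro!: divide_nonneg_pos)
    then have "ratio_product (Suc n) d * 1 \<le> ratio_product (Suc (Suc n)) d"
      unfolding ratio_product_Suc[of "Suc n"] by (intro mult_left_mono f)
    then show ?case using Suc by simp
  qed simp
  have "ratio_product 1 d \<le> gamma_ratio d"
    by (rule LIMSEQ_le_const[OF LIMSEQ_Suc[OF ratio_product_limit[OF d(1)]]]) (use ge in auto)
  moreover have "1 < ratio_product 1 d"
    using ratio_factor[OF d(1), of 1] d(2) by (simp add: ratio_product_def)
  ultimately show ?thesis by linarith
qed

text \<open>After division by \<open>d\<^sup>2\<close> the excess of a factor over \<open>1\<close>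
  depends on \<open>k / d\<close> only, and \<open>k / d\<close> decreases in
  \<open>d\<close>.\<close>

lemma gamma_ratio_mono:
  assumes d: "0 < d" "d \<le> d'" shows "gamma_ratio d \<le> gamma_ratio d'"
proof (rule LIMSEQ_le[OF ratio_product_limit ratio_product_limit])
  have "ratio_product n d \<le> ratio_product n d'" for n
    unfolding ratio_product_def
  proof (rule prod_mono)
    fix k assume "k \<in> {1..n}"
    then have k: "1 \<le> k" by simp
    have eq: "d\<^sup>2 / ((real k + d) * (real k + 3 * d)) = 1 / ((real k / d + 1) * (real k / d + 3))" if "0 < d" for d
      using that by (simp add: field_simps power2_eq_square)
    have "real k / d' \<le> real k / d" using d by (intro divide_left_mono) auto
    moreover have "0 \<le> real k / d'" using d by simp
    ultimately have "1 / ((real k / d + 1) * (real k / d + 3)) \<le> 1 / ((real k / d' + 1) * (real k / d' + 3))"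
      by (intro divide_left_mono mult_mono) auto
    then show "0 \<le> (real k + 2 * d)\<^sup>2 / ((real k + d) * (real k + 3 * d)) \<and>
       (real k + 2 * d)\<^sup>2 / ((real k + d) * (real k + 3 * d)) \<le> (real k + 2 * d')\<^sup>2 / ((real k + d') * (real k + 3 * d'))"
      using d ratio_factor[of d k] ratio_factor[of d' k] k eq[of d] eq[of d'] by auto
  qed
  then show "\<exists>N. \<forall>n\<ge>N. ratio_product n d \<le> ratio_product n d'" by blast
qed (use d in auto)

lemma tail_bound_limit: "(\<lambda>n. tail_bound d u n) \<longlonglongrightarrow> 1"
proof -
  have l: "(\<lambda>n. 1 + c / real n) \<longlonglongrightarrow> 1" for c :: real
    using tendsto_add[OF tendsto_const[of "1::real"] lim_const_over_n[of c]] by simp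
  have "(\<lambda>n. (1 + (2 * d - 1 / 2 + u) / real n) / (1 + (2 * d - 1 / 2 - u) / real n)) \<longlonglongrightarrow> 1 / 1"
    by (intro tendsto_divide l) simp
  moreover have "\<forall>\<^sub>F n in sequentially. (1 + (2 * d - 1 / 2 + u) / real n) / (1 + (2 * d - 1 / 2 - u) / real n) = tail_bound d u n"
  proof (rule eventually_sequentiallyI[of 1])
    fix n :: nat assume n: "1 \<le> n"
    have e: "1 + c / real n = (real n + c) / real n" "(x / real n) / (y / real n) = x / y" for c x y
      using n by (simp_all add: field_simps)
    have "tail_bound d u n = (real n + (2 * d - 1 / 2 + u)) / (real n + (2 * d - 1 / 2 - u))"
      by (simp add: tail_bound_def add_diff_eq add.assoc[symmetric])
    then show "(1 + (2 * d - 1 / 2 + u) / real n) / (1 + (2 * d - 1 / 2 - u) / real n) = tail_bound d u n"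
      by (simp only: e)
  qed
  ultimately show ?thesis by (simp add: Lim_transform_eventually)
qed

text \<open>\<open>tail_bound\<close> telescopes against the factors of \<open>ratio_product\<close>, so it bounds the tail of the
  infinite product from above for \<open>u = d\<^sup>2 / 2\<close> and from below for a slightly smaller \<open>u\<close>.\<close>

lemma tail_step:
  fixes d u :: real
  assumes d: "0 < d" "d < 1 / 3" and u: "0 \<le> u" "u < 1 / 2" and k: "1 \<le> k"
  defines "m \<equiv> real k + 2 * d"
  defines "f \<equiv> (real k + 2 * d)\<^sup>2 / ((real k + d) * (real k + 3 * d))"
  shows "0 < tail_bound d u k"
    and "0 \<le> f"
    and "m\<^sup>2 * (d\<^sup>2 - 2 * u) \<le> (1 / 2 - u)\<^sup>2 * d\<^sup>2 \<Longrightarrow> f * tail_bound d u (Suc k) \<le> tail_bound d u k"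
    and "(1 / 2 - u)\<^sup>2 * d\<^sup>2 \<le> m\<^sup>2 * (d\<^sup>2 - 2 * u) \<Longrightarrow> tail_bound d u k \<le> f * tail_bound d u (Suc k)"
proof -
  have m: "1 < m" using d k by (simp add: m_def)
  have f: "f = m\<^sup>2 / (m\<^sup>2 - d\<^sup>2)"
    unfolding f_def m_def by (simp add: power2_eq_square algebra_simps)
  have b: "tail_bound d u k = (m - (1 / 2 - u)) / (m - (1 / 2 + u))" "tail_bound d u (Suc k) = (m + (1 / 2 + u)) / (m + (1 / 2 - u))"
    by (simp_all add: tail_bound_def m_def algebra_simps)
  have pos: "0 < m - (1 / 2 - u)" "0 < m - (1 / 2 + u)" "0 < m + (1 / 2 + u)" "0 < m + (1 / 2 - u)"
    using m u by auto
  have "d\<^sup>2 < m\<^sup>2" using d m by (intro power_strict_mono) auto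
  then have md: "0 < m\<^sup>2 - d\<^sup>2" by simp
  show "0 < tail_bound d u k" unfolding b using pos by simp
  show "0 \<le> f" unfolding f using md by simp
  \<comment> \<open>Cross-multiplication leaves exactly this difference. The choice
    \<open>u = d\<^sup>2 / 2\<close> removes the term in \<open>m\<^sup>2\<close>, and a smaller
    \<open>u\<close> lets that term dominate for large \<open>m\<close>.\<close>
  have key: "(m - (1 / 2 - u)) * ((m\<^sup>2 - d\<^sup>2) * (m + (1 / 2 - u))) - m\<^sup>2 * (m + (1 / 2 + u)) * (m - (1 / 2 + u)) =
     (1 / 2 - u)\<^sup>2 * d\<^sup>2 - m\<^sup>2 * (d\<^sup>2 - 2 * u)"
    by (simp add: power2_eq_square field_simps)
  have e: "f * tail_bound d u (Suc k) = m\<^sup>2 * (m + (1 / 2 + u)) / ((m\<^sup>2 - d\<^sup>2) * (m + (1 / 2 - u)))"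
    unfolding f b by simp
  have den: "0 < (m\<^sup>2 - d\<^sup>2) * (m + (1 / 2 - u))" using md pos by simp
  show "f * tail_bound d u (Suc k) \<le> tail_bound d u k" if "m\<^sup>2 * (d\<^sup>2 - 2 * u) \<le> (1 / 2 - u)\<^sup>2 * d\<^sup>2"
    unfolding e b(1) using frac_le_eq[of "(m\<^sup>2 - d\<^sup>2) * (m + (1 / 2 - u))" "m - (1 / 2 + u)"] key that den pos
    by (subst pos_divide_le_eq[OF den], subst times_divide_eq_left, subst pos_le_divide_eq[OF pos(2)]) linarith
  show "tail_bound d u k \<le> f * tail_bound d u (Suc k)" if "(1 / 2 - u)\<^sup>2 * d\<^sup>2 \<le> m\<^sup>2 * (d\<^sup>2 - 2 * u)"
    unfolding e b(1) using key that den pos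
    by (subst pos_divide_le_eq[OF pos(2)], subst times_divide_eq_left, subst pos_le_divide_eq[OF den]) linarith
qed

lemma gamma_ratio_upper:
  assumes d: "0 < d" "d < 1 / 3"
  shows "gamma_ratio d \<le> ratio_product n d * tail_bound d (d\<^sup>2 / 2) (Suc n)"
proof -
  define u where "u = d\<^sup>2 / 2"
  have "d\<^sup>2 < (1 / 3)\<^sup>2" using d by (intro power_strict_mono) auto
  then have u: "0 \<le> u" "u < 1 / 2" by (auto simp: u_def power2_eq_square)
  have dec: "ratio_product (n + m) d * tail_bound d u (Suc (n + m)) \<le> ratio_product n d * tail_bound d u (Suc n)" for m
  proof (induction m)
    case (Suc m)
    have "0 \<le> ratio_product (n + m) d"
      unfolding ratio_product_def using d by (intro prod_nonneg) auto
    moreover have "(real (Suc (n + m)) + 2 * d)\<^sup>2 / ((real (Suc (n + m)) + d) * (real (Suc (n + m)) + 3 * d)) * tail_bound d u (Suc (Suc (n + m))) \<le> tail_bound d u (Suc (n + m))"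
      by (rule tail_step(3)[OF d u]) (auto simp: u_def)
    ultimately have "ratio_product (n + m) d * ((real (Suc (n + m)) + 2 * d)\<^sup>2 / ((real (Suc (n + m)) + d) * (real (Suc (n + m)) + 3 * d)) * tail_bound d u (Suc (Suc (n + m)))) \<le> ratio_product (n + m) d * tail_bound d u (Suc (n + m))"
      by (rule mult_left_mono[rotated])
    then show ?case using Suc unfolding add_Suc_right ratio_product_Suc mult.assoc by (rule order_trans)
  qed simp
  have "(\<lambda>m. ratio_product m d * tail_bound d u (Suc m)) \<longlonglongrightarrow> gamma_ratio d * 1"
    by (intro tendsto_mult ratio_product_limit LIMSEQ_Suc tail_bound_limit) (use d in auto)
  then have "gamma_ratio d * 1 \<le> ratio_product n d * tail_bound d u (Suc n)"
    by (rule LIMSEQ_le_const2) (use dec in \<open>metis le_Suc_ex\<close>)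
  then show ?thesis by (simp add: u_def)
qed

text \<open>The correction of \<open>u\<close> gives
  \<open>d\<^sup>2 - 2 * u = d\<^sup>2 / (4 * (n + 1)\<^sup>2)\<close>. Multiplied by
  \<open>m\<^sup>2\<close> with \<open>m \<ge> n + 1\<close> this is at least
  \<open>d\<^sup>2 / 4\<close>, hence at least
  \<open>(1 / 2 - u)\<^sup>2 * d\<^sup>2\<close>.\<close>

lemma gamma_ratio_lower:
  fixes d :: real and n :: nat
  assumes d: "0 < d" "d < 1 / 3"
  defines "u \<equiv> d\<^sup>2 / 2 * (1 - 1 / (4 * (real (Suc n))\<^sup>2))"
  shows "ratio_product n d * tail_bound d u (Suc n) \<le> gamma_ratio d"
proof -
  define e where "e = 1 / (4 * (real (Suc n))\<^sup>2)"
  have n1: "1 \<le> (real (Suc n))\<^sup>2" by (simp add: one_le_power del: of_nat_Suc)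
  then have "1 \<le> 4 * (real (Suc n))\<^sup>2" by linarith
  moreover have "0 < 1 / X \<and> 1 / X \<le> 1" if "1 \<le> X" for X :: real using that by (auto simp: divide_le_eq_1)
  ultimately have e: "0 < e" "e \<le> 1" unfolding e_def by blast+
  have "d\<^sup>2 < (1 / 3)\<^sup>2" using d by (intro power_strict_mono) auto
  then have d2: "d\<^sup>2 < 1 / 9" by (simp add: power2_eq_square)
  have ud: "u = d\<^sup>2 / 2 * (1 - e)" by (simp add: u_def e_def)
  have "d\<^sup>2 / 2 * (1 - e) \<le> d\<^sup>2 / 2 * 1" using e by (intro mult_left_mono) auto
  then have u: "0 \<le> u" "u < 1 / 2" using e d2 by (auto simp: ud)
  have inc: "ratio_product n d * tail_bound d u (Suc n) \<le> ratio_product (n + m) d * tail_bound d u (Suc (n + m))" for m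
  proof (induction m)
    case (Suc m)
    have "0 \<le> ratio_product (n + m) d"
      unfolding ratio_product_def using d by (intro prod_nonneg) auto
    moreover have "tail_bound d u (Suc (n + m)) \<le> (real (Suc (n + m)) + 2 * d)\<^sup>2 / ((real (Suc (n + m)) + d) * (real (Suc (n + m)) + 3 * d)) * tail_bound d u (Suc (Suc (n + m)))"
    proof (rule tail_step(4)[OF d u])
      have "(1 / 2 - u)\<^sup>2 \<le> (1 / 2)\<^sup>2" using u by (intro power_mono) auto
      also have "\<dots> = (real (Suc n))\<^sup>2 * e" by (simp add: e_def power2_eq_square del: of_nat_Suc)
      also have "\<dots> \<le> (real (Suc (n + m)) + 2 * d)\<^sup>2 * e" using d e by (intro mult_right_mono power_mono) auto
      finally have "(1 / 2 - u)\<^sup>2 * d\<^sup>2 \<le> (real (Suc (n + m)) + 2 * d)\<^sup>2 * e * d\<^sup>2" by (rule mult_right_mono) simp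
      moreover have "d\<^sup>2 - 2 * u = e * d\<^sup>2" by (simp add: ud field_simps)
      ultimately show "(1 / 2 - u)\<^sup>2 * d\<^sup>2 \<le> (real (Suc (n + m)) + 2 * d)\<^sup>2 * (d\<^sup>2 - 2 * u)" by (simp only: mult.assoc)
    qed simp
    ultimately have "ratio_product (n + m) d * tail_bound d u (Suc (n + m)) \<le> ratio_product (n + m) d * ((real (Suc (n + m)) + 2 * d)\<^sup>2 / ((real (Suc (n + m)) + d) * (real (Suc (n + m)) + 3 * d)) * tail_bound d u (Suc (Suc (n + m))))"
      by (rule mult_left_mono[rotated])
    then show ?case using Suc unfolding add_Suc_right ratio_product_Suc mult.assoc by (rule order_trans[rotated])
  qed simp
  have "(\<lambda>m. ratio_product m d * tail_bound d u (Suc m)) \<longlonglongrightarrow> gamma_ratio d * 1"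
    by (intro tendsto_mult ratio_product_limit LIMSEQ_Suc tail_bound_limit) (use d in auto)
  then have "ratio_product n d * tail_bound d u (Suc n) \<le> gamma_ratio d * 1"
    by (rule LIMSEQ_le_const) (use inc in \<open>metis le_Suc_ex\<close>)
  then show ?thesis by simp
qed

lemma atLeastAtMost_1_20: "{1..20::nat} = {1, 2, 3, 4, 5, 6, 7, 8, 9, 10, 11, 12, 13, 14, 15, 16, 17, 18, 19, 20}"
  by (rule set_eqI) (simp, presburger)

text \<open>Twenty exact factors together with the tail bounds reduce both comparisons to rational
  arithmetic. The two arguments enclose the critical index to six decimals, one estimated from below
  and the other from above.\<close>

lemma gamma_ratio_numeric:
  "threshold (1 - 771667 / 1000000) < gamma_ratio (1 - 771667 / 1000000)"
  "gamma_ratio (1 - 771668 / 1000000) < threshold (1 - 771668 / 1000000)"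
proof -
  have "threshold (228333 / 1000000) < ratio_product 20 (228333 / 1000000) * tail_bound (228333 / 1000000) ((228333 / 1000000)\<^sup>2 / 2 * (1 - 1 / (4 * (real (Suc 20))\<^sup>2))) (Suc 20)"
    unfolding threshold_def ratio_product_def tail_bound_def atLeastAtMost_1_20
    by (simp add: power2_eq_square)
  also have "\<dots> \<le> gamma_ratio (228333 / 1000000)" by (rule gamma_ratio_lower) auto
  finally show "threshold (1 - 771667 / 1000000) < gamma_ratio (1 - 771667 / 1000000)" by simp
  have "gamma_ratio (228332 / 1000000) \<le> ratio_product 20 (228332 / 1000000) * tail_bound (228332 / 1000000) ((228332 / 1000000)\<^sup>2 / 2) (Suc 20)"
    by (rule gamma_ratio_upper) auto
  also have "\<dots> < threshold (228332 / 1000000)"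
    unfolding threshold_def ratio_product_def tail_bound_def atLeastAtMost_1_20
    by (simp add: power2_eq_square)
  finally show "gamma_ratio (1 - 771668 / 1000000) < threshold (1 - 771668 / 1000000)" by simp
qed

section \<open>Sign of the Turan determinant\<close>

definition turan :: "real \<Rightarrow> real" where
  "turan a = (rGamma (1 - 2 * a))\<^sup>2 - rGamma (1 - a) * rGamma (1 - 3 * a)"

text \<open>Up to the positive factor \<open>rGamma (1 - a) * rGamma (1 - 3 * a)\<close> this is
  \<open>gamma_ratio (- a) - 1\<close>.\<close>

lemma turan_pos_small:
  assumes "0 < a" "a < 1 / 3" shows "0 < turan a"
proof -
  have "1 < gamma_ratio (- a)" by (rule gamma_ratio_gt_1) (use assms in auto)
  moreover have "0 < rGamma (1 - a) * rGamma (1 - 3 * a)" using assms by (auto intro!: mult_pos_pos rGamma_pos)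
  ultimately show ?thesis by (simp add: gamma_ratio_def turan_def less_divide_eq_1_pos)
qed

text \<open>The argument \<open>1 - 3 * a\<close> lies between \<open>-1\<close> and
  \<open>0\<close>, where \<open>rGamma\<close> is nonpositive, so the product is nonpositive. The
  square vanishes only at \<open>a = 1 / 2\<close>, where the product is strictly negative.\<close>

lemma turan_pos_middle:
  assumes "1 / 3 \<le> a" "a \<le> 2 / 3" shows "0 < turan a"
proof -
  have rg: "rGamma (1 - 3 * a) = (1 - 3 * a) * rGamma (2 - 3 * a)" using rGamma_plus1[of "1 - 3 * a"] by simp
  have nn: "0 \<le> rGamma (2 - 3 * a)" using assms rGamma_pos[of "2 - 3 * a"] by (cases "2 - 3 * a = 0") (auto simp: less_le)
  have p: "0 < rGamma (1 - a)" using assms by (auto intro!: rGamma_pos)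
  show ?thesis
  proof (cases "a = 1 / 2")
    case True
    then have "2 - 3 * a = 1 / 2" by simp
    then have "0 < rGamma (2 - 3 * a)" by (intro rGamma_pos) linarith
    then have "rGamma (1 - 3 * a) < 0" unfolding rg by (rule mult_neg_pos[rotated]) (use True in linarith)
    then have "rGamma (1 - a) * rGamma (1 - 3 * a) < 0" using p by (simp add: mult_less_0_iff)
    then show ?thesis unfolding turan_def by (smt (verit) zero_le_power2)
  next
    case False
    have "rGamma (1 - 2 * a) \<noteq> 0"
    proof
      assume "rGamma (1 - 2 * a) = 0"
      then have "1 - 2 * a \<in> \<int>\<^sub>\<le>\<^sub>0" by (simp add: rGamma_eq_zero_iff)
      then obtain n where n: "1 - 2 * a = of_int n" by (auto elim!: nonpos_Ints_cases)
      then have "- 1 < real_of_int n" "real_of_int n < 1" using assms by auto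
      then have "n = 0" by linarith
      then show False using n False by simp
    qed
    then have "0 < (rGamma (1 - 2 * a))\<^sup>2" by simp
    moreover have "rGamma (1 - 3 * a) \<le> 0" unfolding rg using nn assms by (auto simp: mult_le_0_iff)
    then have "rGamma (1 - a) * rGamma (1 - 3 * a) \<le> 0" using p by (simp add: mult_le_0_iff)
    ultimately show ?thesis unfolding turan_def by linarith
  qed
qed

text \<open>Two shifts for \<open>1 - 2 * a\<close>, one for \<open>1 - a\<close> and three for
  \<open>1 - 3 * a\<close> bring all arguments above \<open>1\<close>. The polynomial factors that
  come out are gathered in \<open>threshold\<close> and the positive constant.\<close>

lemma turan_large:
  assumes "2 / 3 < a" "a < 1"
  defines "d \<equiv> 1 - a"
  shows "\<exists>c>0. turan a = c * (gamma_ratio d - threshold d)"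
proof -
  have d: "0 < d" "d < 1 / 3" using assms by auto
  have s: "rGamma x = x * rGamma (x + 1)" for x :: real using rGamma_plus1[of x] by simp
  have 1: "rGamma (1 - 2 * a) = (2 * d - 1) * (2 * d) * rGamma (1 + 2 * d)"
  proof -
    have "rGamma (2 * d - 1) = (2 * d - 1) * rGamma (2 * d)" using s[of "2 * d - 1"] by simp
    moreover have "rGamma (2 * d) = 2 * d * rGamma (1 + 2 * d)" using s[of "2 * d"] by (simp add: add.commute)
    moreover have "1 - 2 * a = 2 * d - 1" by (simp add: d_def)
    ultimately show ?thesis by (simp only: mult.assoc)
  qed
  have 2: "rGamma (1 - a) = d * rGamma (1 + d)" using s[of d] by (simp add: d_def algebra_simps)
  have 3: "rGamma (1 - 3 * a) = (3 * d - 2) * (3 * d - 1) * (3 * d) * rGamma (1 + 3 * d)"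
  proof -
    have "rGamma (3 * d - 2) = (3 * d - 2) * rGamma (3 * d - 1)" using s[of "3 * d - 2"] by (simp add: algebra_simps)
    moreover have "rGamma (3 * d - 1) = (3 * d - 1) * rGamma (3 * d)" using s[of "3 * d - 1"] by simp
    moreover have "rGamma (3 * d) = 3 * d * rGamma (1 + 3 * d)" using s[of "3 * d"] by (simp add: add.commute)
    moreover have "1 - 3 * a = 3 * d - 2" by (simp add: d_def)
    ultimately show ?thesis by (simp only: mult.assoc)
  qed
  have pos: "0 < rGamma (1 + d)" "0 < rGamma (1 + 3 * d)" using d by (auto intro!: rGamma_pos)
  define c where "c = 4 * d\<^sup>2 * (1 - 2 * d)\<^sup>2 * (rGamma (1 + d) * rGamma (1 + 3 * d))"
  have "0 < (1 - 2 * d)\<^sup>2" using d by simp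
  then have c: "0 < c" using d pos by (simp add: c_def)
  have g: "(rGamma (1 + 2 * d))\<^sup>2 = gamma_ratio d * (rGamma (1 + d) * rGamma (1 + 3 * d))"
    using pos by (simp add: gamma_ratio_def)
  have t: "4 * (1 - 2 * d)\<^sup>2 * threshold d = 3 * (2 - 3 * d) * (1 - 3 * d)"
  proof -
    have "4 * (1 - 2 * d)\<^sup>2 * threshold d = 27 / 4 * (1 - 2 * d)\<^sup>2 - 3 / 4"
      unfolding threshold_def right_diff_distrib using \<open>0 < (1 - 2 * d)\<^sup>2\<close> by simp
    also have "\<dots> = 3 * (2 - 3 * d) * (1 - 3 * d)" by (simp add: power2_eq_square algebra_simps)
    finally show ?thesis .
  qed
  have "turan a = (2 * d - 1)\<^sup>2 * (2 * d)\<^sup>2 * (gamma_ratio d * (rGamma (1 + d) * rGamma (1 + 3 * d)))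
      - d * rGamma (1 + d) * ((3 * d - 2) * (3 * d - 1) * (3 * d) * rGamma (1 + 3 * d))"
    unfolding turan_def 1 2 3 power_mult_distrib g ..
  also have "\<dots> = d\<^sup>2 * (rGamma (1 + d) * rGamma (1 + 3 * d)) * (4 * (1 - 2 * d)\<^sup>2 * gamma_ratio d - 3 * (2 - 3 * d) * (1 - 3 * d))"
    by (simp add: power2_eq_square algebra_simps)
  also have "\<dots> = c * (gamma_ratio d - threshold d)"
    unfolding t[symmetric] c_def by (simp add: algebra_simps)
  finally show ?thesis using c by blast
qed

lemma threshold_strict_antimono:
  assumes "0 < d" "d < d'" "d' < 1 / 3" shows "threshold d' < threshold d"
proof -
  have "(1 - 2 * d')\<^sup>2 < (1 - 2 * d)\<^sup>2" "0 < (1 - 2 * d')\<^sup>2" using assms by (auto intro!: power_strict_mono)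
  then have "3 / (16 * (1 - 2 * d)\<^sup>2) < 3 / (16 * (1 - 2 * d')\<^sup>2)"
    by (intro divide_strict_left_mono mult_pos_pos) linarith+
  then show ?thesis by (simp add: threshold_def)
qed

theorem turan_root:
  shows "\<exists>\<alpha>. 771667 / 1000000 < \<alpha> \<and> \<alpha> < 771668 / 1000000 \<and> turan \<alpha> = 0 \<and>
    (\<forall>a. 0 < a \<and> a < \<alpha> \<longrightarrow> 0 < turan a) \<and> (\<forall>a. \<alpha> < a \<and> a < 1 \<longrightarrow> turan a < 0)"
proof -
  let ?lo = "771667 / 1000000 :: real" and ?hi = "771668 / 1000000 :: real"
  have lo: "0 < turan ?lo"
    using turan_large[of ?lo] gamma_ratio_numeric(1) by (auto simp del: diff_divide_distrib)
  have hi: "turan ?hi < 0"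
    using turan_large[of ?hi] gamma_ratio_numeric(2) by (auto simp: mult_less_0_iff)
  have "continuous_on {?lo..?hi} turan"
    unfolding turan_def by (intro continuous_intros continuous_on_compose2[OF continuous_on_rGamma[of UNIV]]) auto
  then obtain \<alpha> where \<alpha>: "?lo \<le> \<alpha>" "\<alpha> \<le> ?hi" "turan \<alpha> = 0"
    using IVT2'[of turan ?hi 0 ?lo] lo hi by auto
  have "\<alpha> \<noteq> ?lo" "\<alpha> \<noteq> ?hi" using \<alpha>(3) lo hi by (metis less_irrefl)+
  then have \<alpha>': "?lo < \<alpha>" "\<alpha> < ?hi" using \<alpha> by auto
  have z: "gamma_ratio (1 - \<alpha>) = threshold (1 - \<alpha>)"
    using turan_large[of \<alpha>] \<alpha>' \<alpha>(3) by auto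
  have above: "0 < turan a" if a: "0 < a" "a < \<alpha>" for a
  proof -
    consider "a < 1 / 3" | "1 / 3 \<le> a" "a \<le> 2 / 3" | "2 / 3 < a" by linarith
    then show ?thesis
    proof cases
      case 3
      have "gamma_ratio (1 - \<alpha>) \<le> gamma_ratio (1 - a)" by (rule gamma_ratio_mono) (use a \<alpha>' in auto)
      moreover have "threshold (1 - a) < threshold (1 - \<alpha>)" by (rule threshold_strict_antimono) (use a 3 \<alpha>' in auto)
      ultimately have "0 < gamma_ratio (1 - a) - threshold (1 - a)" using z by simp
      then show ?thesis using turan_large[of a] 3 a \<alpha>' by auto
    qed (use turan_pos_small turan_pos_middle a in auto)
  qed
  have below: "turan a < 0" if a: "\<alpha> < a" "a < 1" for a
  proof -
    have "gamma_ratio (1 - a) \<le> gamma_ratio (1 - \<alpha>)" by (rule gamma_ratio_mono) (use a \<alpha>' in auto)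
    moreover have "threshold (1 - \<alpha>) < threshold (1 - a)" by (rule threshold_strict_antimono) (use a \<alpha>' in auto)
    ultimately have "gamma_ratio (1 - a) - threshold (1 - a) < 0" using z by simp
    then show ?thesis using turan_large[of a] a \<alpha>' by (auto simp: mult_less_0_iff)
  qed
  show ?thesis using \<alpha>' \<alpha>(3) above below by blast
qed

section \<open>Series and Mellin transform of the stable density\<close>

lemma einterval_0_PInfty: "einterval 0 \<infinity> = {0<..}"
  by (auto simp: einterval_def zero_ereal_def)

text \<open>The substitution \<open>y = r powr (1 / g)\<close> leads back to a Gamma integral. The
  complex substitution rule asks for integrability on both sides, so the rule for nonnegative
  functions is applied to the norm \<open>w\<^sub>r\<close> beforehand.\<close>

lemma Gamma_integral_powr:
  fixes s g :: real and c :: complex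
  assumes s: "0 < s" and g: "0 < g" and c: "0 < Re c"
  shows "set_integrable lborel {0<..} (\<lambda>y. of_real (y powr (s - 1)) * exp (- c * of_real (y powr g)))"
    and "(LINT y:{0<..}|lborel. of_real (y powr (s - 1)) * exp (- c * of_real (y powr g))) = of_real (Gamma (s / g) / g) * c powr (- of_real (s / g))"
proof -
  define h where "h = (\<lambda>r::real. r powr (1 / g))"
  define h' where "h' = (\<lambda>r::real. 1 / g * r powr (1 / g - 1))"
  define w where "w c = (\<lambda>y::real. of_real (y powr (s - 1)) * exp (- c * of_real (y powr g)))" for c :: complex
  define w\<^sub>r where "w\<^sub>r = (\<lambda>y::real. y powr (s - 1) * exp (- Re c * (y powr g)))"
  have sg: "0 < s / g" using s g by simp
  have D: "(h has_real_derivative h' r) (at r)" if "ereal 0 < ereal r" for r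
    unfolding h_def h'_def using that by (auto intro!: derivative_eq_intros)
  have h'c: "isCont h' r" if "0 < r" for r unfolding h'_def by (intro continuous_intros) (use that g in auto)
  have h'n: "0 \<le> h' r" for r unfolding h'_def using g by simp
  have A: "((ereal \<circ> h \<circ> real_of_ereal) \<longlongrightarrow> 0) (at_right 0)"
  proof -
    have "(h \<longlongrightarrow> 0) (at_right 0)" unfolding h_def
      using tendsto_powr'[of "\<lambda>r. r" 0 "at_right 0" "\<lambda>_. 1 / g" "1 / g"] g by (auto simp: eventually_at_filter)
    then show ?thesis by (simp add: zero_ereal_def ereal_tendsto_simps)
  qed
  have B: "((ereal \<circ> h \<circ> real_of_ereal) \<longlongrightarrow> \<infinity>) (at_left \<infinity>)"
  proof -
    have "filterlim h at_top at_top" unfolding h_def using g by real_asymp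
    then show ?thesis by (simp add: ereal_tendsto_simps)
  qed
  have wh: "h' r *\<^sub>R w c (h r) = of_real (1 / g) * (of_real (r powr (s / g - 1)) * exp (- c * of_real r))" if "0 < r" for r c
  proof -
    have "(r powr (1 / g)) powr (s - 1) * r powr (1 / g - 1) = r powr (s / g - 1)"
      using that g by (simp add: powr_powr powr_add[symmetric] algebra_simps diff_divide_distrib)
    then have "(of_real (r powr (s / g - 1)) :: complex) = of_real ((r powr (1 / g)) powr (s - 1)) * of_real (r powr (1 / g - 1))"
      by (simp only: of_real_mult[symmetric])
    then show ?thesis using that g by (simp add: w_def h_def h'_def powr_powr scaleR_conv_of_real mult_ac)
  qed
  have whi: "set_integrable lborel {0<..} (\<lambda>r. h' r *\<^sub>R w c (h r))"
  proof -
    have "set_integrable lborel {0<..} (\<lambda>r. of_real (1 / g) * (of_real (r powr (s / g - 1)) * exp (- c * of_real r)))"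
      by (intro set_integrable_mult_right Gamma_integral_rotated(1)[OF sg c])
    then show ?thesis
      by (subst set_integrable_cong[OF refl refl wh]) (simp_all only: greaterThan_iff)
  qed
  have wn: "w\<^sub>r y = norm (w c y)" for y by (simp add: w\<^sub>r_def w_def norm_mult)
  have "set_integrable lborel {0<..} (\<lambda>r. norm (h' r *\<^sub>R w c (h r)))" using whi by (rule set_integrable_norm)
  also have "(\<lambda>r. norm (h' r *\<^sub>R w c (h r))) = (\<lambda>r. w\<^sub>r (h r) * h' r)" using h'n by (simp add: wn mult_ac)
  finally have wri: "set_integrable lborel (einterval 0 \<infinity>) (\<lambda>r. w\<^sub>r (h r) * h' r)" by (simp add: einterval_0_PInfty)
  have hp: "0 < h r" if "0 < r" for r using that by (simp add: h_def)
  have "set_integrable lborel (einterval 0 \<infinity>) w\<^sub>r"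
  proof (rule interval_integral_substitution_nonneg(1)[OF _ _ _ _ _ _ A B wri])
    show "isCont w\<^sub>r (h x)" if "0 < ereal x" for x
      unfolding w\<^sub>r_def by (intro continuous_intros) (use that hp[of x] g in auto)
  qed (use D h'c h'n in \<open>auto simp: w\<^sub>r_def\<close>)
  then have "set_integrable lborel {0<..} w\<^sub>r" by (simp add: einterval_0_PInfty)
  then show wi: "set_integrable lborel {0<..} (\<lambda>y. of_real (y powr (s - 1)) * exp (- c * of_real (y powr g)))"
    unfolding wn w_def set_integrable_def
    by (rule Bochner_Integration.integrable_bound) (auto simp: indicator_def)
  have "(LBINT y=0..\<infinity>. w c y) = (LBINT r=0..\<infinity>. h' r *\<^sub>R w c (h r))"
  proof (rule interval_integral_substitution_integrable[OF _ _ _ _ _ A B])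
    show "isCont (w c) (h x)" if "0 < ereal x" for x
      unfolding w_def by (intro continuous_intros) (use that hp[of x] g in auto)
    show "set_integrable lborel (einterval 0 \<infinity>) (w c)" unfolding w_def einterval_0_PInfty by (rule wi)
  qed (use D h'c h'n whi in \<open>auto simp: einterval_0_PInfty\<close>)
  also have "(LBINT y=0..\<infinity>. w c y) = (LINT y:{0<..}|lborel. w c y)"
    by (simp add: interval_lebesgue_integral_def einterval_0_PInfty)
  also have "(LBINT r=0..\<infinity>. h' r *\<^sub>R w c (h r)) = (LINT r:{0<..}|lborel. h' r *\<^sub>R w c (h r))"
    by (simp add: interval_lebesgue_integral_def einterval_0_PInfty)
  also have "\<dots> = (LINT r:{0<..}|lborel. of_real (1 / g) * (of_real (r powr (s / g - 1)) * exp (- c * of_real r)))"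
    by (rule set_lebesgue_integral_cong) (simp, use wh in blast)
  also have "\<dots> = of_real (1 / g) * (of_real (Gamma (s / g)) * c powr (- of_real (s / g)))"
    by (subst set_integral_mult_right) (simp only: Gamma_integral_rotated(2)[OF sg c])
  finally show "(LINT y:{0<..}|lborel. of_real (y powr (s - 1)) * exp (- c * of_real (y powr g))) = of_real (Gamma (s / g) / g) * c powr (- of_real (s / g))"
    by (simp add: w_def mult_ac)
qed

text \<open>The reflection formula in the shape that turns the sines from imaginary parts into the
  reciprocal Gamma coefficients of the density.\<close>

lemma Gamma_times_sin:
  fixes b :: real assumes "0 < b"
  shows "Gamma b * sin (pi * b) / pi = rGamma (1 - b)"
proof -
  have "rGamma (1 - complex_of_real b) = of_real (rGamma (1 - b))"
    using rGamma_complex_of_real[of "1 - b"] by simp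
  then have "complex_of_real (rGamma b * rGamma (1 - b)) = of_real (sin (pi * b) / pi)"
    using rGamma_reflection_complex[of "of_real b"]
    by (simp add: rGamma_complex_of_real sin_of_real flip: of_real_mult)
  then have "rGamma b * rGamma (1 - b) = sin (pi * b) / pi" by (simp only: of_real_eq_iff)
  moreover have "Gamma b * rGamma b = 1" using Gamma_real_pos[OF assms] by (simp add: rGamma_inverse_Gamma)
  ultimately show ?thesis by (metis mult.assoc mult_1 times_divide_eq_right)
qed

context stable_index begin

text \<open>The angle \<open>pi / 2\<close> gives the Fourier integral of the stable density; slightly smaller
  angles give the same value and make the Mellin transform absolutely convergent.\<close>

definition ray_kernel :: "real \<Rightarrow> real \<Rightarrow> real \<Rightarrow> complex" where
  "ray_kernel \<phi> x y = cis \<phi> * exp (of_real (y powr g) * cis (g * \<phi>)) * exp (- (of_real x * of_real y * cis \<phi>))"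

definition ray_integral :: "real \<Rightarrow> real \<Rightarrow> complex" where
  "ray_integral \<phi> x = (LINT y:{0<..}|lborel. ray_kernel \<phi> x y)"

lemma integrable_exp_minus_powr:
  assumes k: "0 < k"
  shows "set_integrable lborel {0<..} (\<lambda>y. exp (b * y - k * y powr g) :: real)"
proof -
  \<comment> \<open>Beyond this point half of \<open>k * y powr g\<close> exceeds the linear term,
    because \<open>Y powr (g - 1) = 2 * \<bar>b\<bar> / k\<close>.\<close>
  define Y where "Y = (2 * \<bar>b\<bar> / k) powr (1 / (g - 1))"
  have Y0: "0 \<le> Y" by (simp add: Y_def)
  have bound: "b * y \<le> \<bar>b\<bar> * Y + k / 2 * y powr g" if y: "0 < y" for y
  proof (cases "y \<le> Y")
    case True
    have "b * y \<le> \<bar>b\<bar> * y" using y by (intro mult_right_mono) auto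
    also have "\<dots> \<le> \<bar>b\<bar> * Y" using True by (intro mult_left_mono) auto
    finally show ?thesis using k by (smt (verit) mult_nonneg_nonneg powr_ge_zero divide_pos_pos)
  next
    case False
    then have "Y powr (g - 1) \<le> y powr (g - 1)" using Y0 g1 by (intro powr_mono2) auto
    moreover have "Y powr (g - 1) = 2 * \<bar>b\<bar> / k" using g1 k by (simp add: Y_def powr_powr)
    ultimately have "\<bar>b\<bar> \<le> k / 2 * y powr (g - 1)" using k by (simp add: field_simps)
    then have "\<bar>b\<bar> * y \<le> k / 2 * y powr (g - 1) * y" using y by (intro mult_right_mono) auto
    also have "y powr (g - 1) * y = y powr g" using y by (simp add: powr_diff)
    then have "k / 2 * y powr (g - 1) * y = k / 2 * y powr g" by simp
    finally have "\<bar>b\<bar> * y \<le> k / 2 * y powr g" .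
    moreover have "b * y \<le> \<bar>b\<bar> * y" using y by (intro mult_right_mono) auto
    moreover have "0 \<le> \<bar>b\<bar> * Y" using Y0 by simp
    ultimately show ?thesis by linarith
  qed
  have "set_integrable lborel {0<..} (\<lambda>y. of_real (y powr (1 - 1)) * exp (- (of_real (k / 2)) * of_real (y powr g)) :: complex)"
    by (rule Gamma_integral_powr) (use k g1 in auto)
  then have "set_integrable lborel {0<..} (\<lambda>y. of_real (exp (\<bar>b\<bar> * Y)) * (of_real (y powr (1 - 1)) * exp (- (of_real (k / 2)) * of_real (y powr g))) :: complex)"
    by (rule set_integrable_mult_right)
  then show ?thesis unfolding set_integrable_def
  proof (rule Bochner_Integration.integrable_bound)
    show "AE y in lborel. norm (indicat_real {0<..} y *\<^sub>R exp (b * y - k * y powr g)) \<le> norm (indicat_real {0<..} y *\<^sub>R (complex_of_real (exp (\<bar>b\<bar> * Y)) * (complex_of_real (y powr (1 - 1)) * exp (- complex_of_real (k / 2) * complex_of_real (y powr g)))))"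
    proof (rule AE_I2)
      fix y :: real
      have "exp (b * y - k * y powr g) \<le> exp (\<bar>b\<bar> * Y) * exp (- (k / 2) * y powr g)" if "0 < y"
        using bound[OF that] by (simp add: exp_add[symmetric])
      then show "norm (indicat_real {0<..} y *\<^sub>R exp (b * y - k * y powr g)) \<le> norm (indicat_real {0<..} y *\<^sub>R (complex_of_real (exp (\<bar>b\<bar> * Y)) * (complex_of_real (y powr (1 - 1)) * exp (- complex_of_real (k / 2) * complex_of_real (y powr g)))))"
        by (auto simp: indicator_def norm_mult)
    qed
  qed measurable
qed

text \<open>The range of the angle puts \<open>g * \<phi> - pi\<close> into the principal strip of
  the logarithm and \<open>- cis (g * \<phi>)\<close> into the right half-plane, so the latter may
  serve as the rate \<open>c\<close> in \<open>Gamma_integral_powr\<close>.\<close>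

lemma rotation_powr:
  assumes \<phi>: "pi / 2 < g * \<phi>" "g * \<phi> < pi"
  shows "(- cis (g * \<phi>)) powr (- of_real b) = cis (pi * b - g * \<phi> * b)" and "0 < Re (- cis (g * \<phi>))"
proof -
  have e: "- cis (g * \<phi>) = exp (\<i> * of_real (g * \<phi> - pi))"
    unfolding cis_conv_exp[symmetric] cis_divide[symmetric] by simp
  have "Ln (exp (\<i> * of_real (g * \<phi> - pi))) = \<i> * of_real (g * \<phi> - pi)"
    by (rule Ln_exp) (use \<phi> in auto)
  then have "(- cis (g * \<phi>)) powr (- of_real b) = exp (- of_real b * (\<i> * of_real (g * \<phi> - pi)))"
    unfolding e powr_def by simp
  also have "- of_real b * (\<i> * of_real (g * \<phi> - pi)) = \<i> * of_real (pi * b - g * \<phi> * b)"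
    by (simp add: algebra_simps)
  finally show "(- cis (g * \<phi>)) powr (- of_real b) = cis (pi * b - g * \<phi> * b)"
    by (simp only: cis_conv_exp)
  have "cos (g * \<phi>) < cos (pi / 2)" by (rule cos_monotone_0_pi) (use \<phi> in auto)
  then show "0 < Re (- cis (g * \<phi>))" by simp
qed

lemma ray_moment:
  assumes \<phi>: "pi / 2 < g * \<phi>" "g * \<phi> < pi" and s: "0 < s"
  shows "set_integrable lborel {0<..} (\<lambda>y. of_real (y powr (s - 1)) * exp (of_real (y powr g) * cis (g * \<phi>)))"
    and "(LINT y:{0<..}|lborel. of_real (y powr (s - 1)) * exp (of_real (y powr g) * cis (g * \<phi>)))
      = of_real (Gamma (s / g) / g) * cis (pi * (s / g) - \<phi> * s)"
proof -
  have g: "0 < g" using g1 by simp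
  have c: "- (- cis (g * \<phi>)) * z = z * cis (g * \<phi>)" for z by simp
  note G = Gamma_integral_powr[OF s g rotation_powr(2)[OF \<phi>], unfolded c rotation_powr(1)[OF \<phi>]]
  show "set_integrable lborel {0<..} (\<lambda>y. of_real (y powr (s - 1)) * exp (of_real (y powr g) * cis (g * \<phi>)))"
    by (rule G(1))
  have "g * \<phi> * (s / g) = \<phi> * s" using g by simp
  then show "(LINT y:{0<..}|lborel. of_real (y powr (s - 1)) * exp (of_real (y powr g) * cis (g * \<phi>)))
      = of_real (Gamma (s / g) / g) * cis (pi * (s / g) - \<phi> * s)"
    using G(2) by simp
qed

text \<open>Expanding the last exponential of \<open>ray_kernel\<close> and integrating term by
  term, the phase \<open>cis (\<phi> * real (Suc n))\<close> of the powers cancels the angle in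
  \<open>ray_moment\<close>. All admissible angles therefore give the same series, which replaces a
  shift of contour.\<close>

lemma ray_series:
  assumes \<phi>: "pi / 2 < g * \<phi>" "g * \<phi> < pi"
  shows "set_integrable lborel {0<..} (ray_kernel \<phi> x)"
    and "(\<lambda>n. rGamma (1 - real (Suc n) / g) / (g * fact n) * (- x) ^ n) sums (Im (ray_integral \<phi> x) / pi)"
proof -
  have g: "0 < g" using g1 by simp
  define k where "k = - cos (g * \<phi>)"
  have k: "0 < k" using rotation_powr(2)[OF \<phi>] by (simp add: k_def)
  define K where "K = (\<lambda>y. exp (\<bar>x\<bar> * y - k * y powr g))"
  have K: "set_integrable lborel {0<..} K" unfolding K_def by (rule integrable_exp_minus_powr[OF k])
  define E where "E y = exp (of_real (y powr g) * cis (g * \<phi>))" for y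
  have nE: "norm (E y) = exp (- k * y powr g)" for y by (simp add: E_def k_def)
  define z where "z y = - (of_real x * of_real y * cis \<phi>)" for y
  have nz: "norm (z y) = \<bar>x\<bar> * y" if "0 < y" for y using that by (simp add: z_def norm_mult)
  define T where "T n y = of_real ((- x) ^ n / fact n) * cis (\<phi> * real (Suc n)) * (of_real (y powr (real (Suc n) - 1)) * E y)" for n y
  have T: "T n y = cis \<phi> * E y * (z y ^ n /\<^sub>R fact n)" if "0 < y" for n y
  proof -
    have "cis (\<phi> * real (Suc n)) = cis \<phi> * cis \<phi> ^ n" by (simp add: Complex.DeMoivre cis_mult algebra_simps)
    then show ?thesis using that
      by (simp add: T_def z_def powr_realpow power_mult_distrib power_minus[of "_ * _"] power_minus[of "of_real x"] scaleR_conv_of_real field_simps)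
  qed
  have kern: "ray_kernel \<phi> x y = cis \<phi> * E y * exp (z y)" for y by (simp add: ray_kernel_def E_def z_def)
  have Ti: "set_integrable lborel {0<..} (T n)" for n
    unfolding T_def E_def by (intro set_integrable_mult_right ray_moment(1)[OF \<phi>]) simp
  have Tv: "(LINT y:{0<..}|lborel. T n y) = of_real ((- x) ^ n / fact n * (Gamma (real (Suc n) / g) / g)) * cis (pi * (real (Suc n) / g))" for n
  proof -
    have "(LINT y:{0<..}|lborel. T n y) = of_real ((- x) ^ n / fact n) * cis (\<phi> * real (Suc n)) * (of_real (Gamma (real (Suc n) / g) / g) * cis (pi * (real (Suc n) / g) - \<phi> * real (Suc n)))"
      unfolding T_def E_def set_integral_mult_right by (subst ray_moment(2)[OF \<phi>]) simp_all
    also have "\<dots> = of_real ((- x) ^ n / fact n * (Gamma (real (Suc n) / g) / g)) * (cis (\<phi> * real (Suc n)) * cis (pi * (real (Suc n) / g) - \<phi> * real (Suc n)))"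
      by simp
    finally show ?thesis unfolding cis_mult by simp
  qed
  have Kb: "norm (\<Sum>n<N. T n y) \<le> K y" if "0 < y" for N y
  proof -
    have "norm (\<Sum>n<N. T n y) = norm (E y) * norm (\<Sum>n<N. z y ^ n /\<^sub>R fact n)"
      unfolding T[OF that] sum_distrib_left[symmetric] norm_mult by simp
    also have "norm (\<Sum>n<N. z y ^ n /\<^sub>R fact n) \<le> (\<Sum>n<N. norm (z y) ^ n /\<^sub>R fact n)"
      by (rule sum_norm_le) (simp add: norm_power divide_inverse)
    also have "\<dots> \<le> exp (norm (z y))"
      unfolding exp_def by (rule sum_le_suminf[OF summable_exp_generic]) auto
    finally show ?thesis using nz[OF that] by (simp add: nE K_def mult_left_mono exp_diff exp_minus field_simps)
  qed
  have lim: "(\<lambda>N. \<Sum>n<N. T n y) \<longlonglongrightarrow> ray_kernel \<phi> x y" if "0 < y" for y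
  proof -
    have "(\<lambda>n. z y ^ n /\<^sub>R fact n) sums exp (z y)" by (rule exp_converges)
    then have "(\<lambda>n. T n y) sums (cis \<phi> * E y * exp (z y))" unfolding T[OF that] by (rule sums_mult)
    then show ?thesis by (simp add: sums_def kern)
  qed
  have Tm: "(\<lambda>y. \<Sum>n<N. T n y) \<in> borel_measurable borel" for N unfolding T_def E_def by measurable
  have kmeas: "ray_kernel \<phi> x \<in> borel_measurable borel" unfolding ray_kernel_def by measurable
  note dc = integrable_dominated_convergence[of "\<lambda>y. indicator {0<..} y *\<^sub>R ray_kernel \<phi> x y" lborel "\<lambda>N y. indicator {0<..} y *\<^sub>R (\<Sum>n<N. T n y)" "\<lambda>y. indicator {0<..} y *\<^sub>R K y"]
  note dc2 = integral_dominated_convergence[of "\<lambda>y. indicator {0<..} y *\<^sub>R ray_kernel \<phi> x y" lborel "\<lambda>N y. indicator {0<..} y *\<^sub>R (\<Sum>n<N. T n y)" "\<lambda>y. indicator {0<..} y *\<^sub>R K y"]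
  show ki: "set_integrable lborel {0<..} (ray_kernel \<phi> x)"
    unfolding set_integrable_def
  proof (rule dc)
    show "integrable lborel (\<lambda>y. indicator {0<..} y *\<^sub>R K y)" using K by (simp add: set_integrable_def)
  qed (use lim Kb kmeas Tm in \<open>auto simp: indicator_def intro!: AE_I2\<close>)
  have "(\<lambda>N. LINT y|lborel. indicator {0<..} y *\<^sub>R (\<Sum>n<N. T n y)) \<longlonglongrightarrow> ray_integral \<phi> x"
    unfolding ray_integral_def set_lebesgue_integral_def
  proof (rule dc2)
    show "integrable lborel (\<lambda>y. indicator {0<..} y *\<^sub>R K y)" using K by (simp add: set_integrable_def)
  qed (use lim Kb kmeas Tm in \<open>auto simp: indicator_def intro!: AE_I2\<close>)
  also have "(\<lambda>N. LINT y|lborel. indicator {0<..} y *\<^sub>R (\<Sum>n<N. T n y)) = (\<lambda>N. \<Sum>n<N. (LINT y:{0<..}|lborel. T n y))"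
    unfolding scaleR_sum_right set_lebesgue_integral_def using Ti by (subst Bochner_Integration.integral_sum) (auto simp: set_integrable_def)
  finally have "(\<lambda>n. LINT y:{0<..}|lborel. T n y) sums ray_integral \<phi> x" by (simp add: sums_def)
  then have "(\<lambda>n. Im (LINT y:{0<..}|lborel. T n y) / pi) sums (Im (ray_integral \<phi> x) / pi)"
    by (intro sums_divide sums_Im)
  moreover have "Im (LINT y:{0<..}|lborel. T n y) / pi = rGamma (1 - real (Suc n) / g) / (g * fact n) * (- x) ^ n" for n
  proof -
    define b where "b = real (Suc n) / g"
    have b: "0 < b" using g by (simp add: b_def)
    have "Im (of_real r * cis t) = r * sin t" for r t by simp
    then have "Im (LINT y:{0<..}|lborel. T n y) / pi = (- x) ^ n / fact n * (Gamma b / g) * sin (pi * b) / pi"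
      unfolding Tv b_def by (simp only:)
    also have "\<dots> = (- x) ^ n / (g * fact n) * (Gamma b * sin (pi * b) / pi)" by (simp only: times_divide_eq_left times_divide_eq_right divide_divide_eq_left mult_ac)
    also have "\<dots> = rGamma (1 - b) / (g * fact n) * (- x) ^ n" unfolding Gamma_times_sin[OF b] by simp
    finally show ?thesis by (simp only: b_def)
  qed
  ultimately show "(\<lambda>n. rGamma (1 - real (Suc n) / g) / (g * fact n) * (- x) ^ n) sums (Im (ray_integral \<phi> x) / pi)"
    by simp
qed

lemma imaginary_powr:
  assumes "0 < y" shows "(\<i> * of_real y) powr of_real g = of_real (y powr g) * cis (g * (pi / 2))"
proof -
  have e: "\<i> * of_real y = exp (of_real (ln y) + \<i> * of_real (pi / 2))"
    unfolding exp_add cis_conv_exp[symmetric] cis_pi_half using assms by (simp add: exp_of_real)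
  have "Ln (\<i> * of_real y) = of_real (ln y) + \<i> * of_real (pi / 2)"
    unfolding e by (rule Ln_exp) auto
  then have "(\<i> * of_real y) powr of_real g = exp (of_real (g * ln y)) * exp (\<i> * of_real (g * (pi / 2)))"
    using assms by (simp add: powr_def exp_add[symmetric] algebra_simps)
  then show ?thesis using assms by (simp add: cis_conv_exp powr_def flip: exp_of_real)
qed

lemma stable_char_pos: "0 < y \<Longrightarrow> stable_char y = exp (of_real (y powr g) * cis (g * (pi / 2)))"
  by (simp add: stable_char_def imaginary_powr)

lemma stable_char_uminus: "stable_char (- y) = cnj (stable_char y)"
proof (cases "y = 0")
  case False
  have "(\<i> * of_real (- y)) powr of_real g = cnj ((\<i> * of_real y) powr of_real g)"
    using cnj_powr[of "\<i> * of_real y" "of_real g"] False by simp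
  then show ?thesis by (simp add: stable_char_def exp_cnj)
qed (simp add: stable_char_def)

lemma quarter_turn: "pi / 2 < g * (pi / 2)" "g * (pi / 2) < pi"
  using g1 g2 by simp_all

text \<open>Conjugate symmetry of \<open>stable_char\<close> folds the line integral onto the
  half-line, and the factor \<open>cis (pi / 2) = \<i>\<close> turns the real part into an imaginary
  part.\<close>

lemma stable_density_eq_ray: "stable_density x = Im (ray_integral (pi / 2) x) / pi"
proof -
  define h where "h y = iexp (- (y * x)) * stable_char y" for y
  have hm: "Re (h (- y)) = Re (h y)" for y
  proof -
    have "h (- y) = cnj (h y)" by (simp add: h_def stable_char_uminus exp_cnj)
    then show ?thesis by simp
  qed
  have [measurable]: "stable_char \<in> borel_measurable borel"
    using borel_measurable_integrable[OF stable_density_dichotomy(1)] by simp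
  have [measurable]: "h \<in> borel_measurable borel" unfolding h_def[abs_def] by measurable
  have "integrable lborel h"
    by (rule Bochner_Integration.integrable_bound[OF stable_density_dichotomy(1)])
       (auto simp: h_def norm_mult)
  then have hi: "integrable lborel (\<lambda>y. Re (h y))" by (rule integrable_Re)
  have i1: "integrable lborel (\<lambda>y. indicator A y *\<^sub>R Re (h y))" if "A \<in> sets lborel" for A
    using integrable_mult_indicator[OF that hi] .
  have "Re (CLINT y|lborel. h y) = (LINT y|lborel. Re (h y))"
    using \<open>integrable lborel h\<close> by (rule integral_Re[symmetric])
  also have "\<dots> = (LINT y|lborel. indicator {0<..} y *\<^sub>R Re (h y) + indicator {..<0} y *\<^sub>R Re (h y))"
  proof (rule integral_cong_AE)
    show "AE y in lborel. Re (h y) = indicator {0<..} y *\<^sub>R Re (h y) + indicator {..<0} y *\<^sub>R Re (h y)"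
      using AE_lborel_neq[of 0] by eventually_elim (auto simp: indicator_def)
  qed simp_all
  also have "\<dots> = (LINT y|lborel. indicator {0<..} y *\<^sub>R Re (h y)) + (LINT y|lborel. indicator {..<0} y *\<^sub>R Re (h y))"
    by (intro Bochner_Integration.integral_add i1) auto
  also have "(LINT y|lborel. indicator {..<0} y *\<^sub>R Re (h y)) = (LINT y|lborel. indicator {0<..} y *\<^sub>R Re (h y))"
    by (subst lborel_integral_real_affine[of "-1" _ 0]) (auto intro!: Bochner_Integration.integral_cong simp: indicator_def hm)
  finally have "Re (CLINT y|lborel. h y) = 2 * (LINT y|lborel. indicator {0<..} y *\<^sub>R Re (h y))" by simp
  also have "(LINT y|lborel. indicator {0<..} y *\<^sub>R Re (h y)) = (LINT y|lborel. Im (indicator {0<..} y *\<^sub>R ray_kernel (pi / 2) x y))"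
    by (intro Bochner_Integration.integral_cong) (auto simp: indicator_def h_def stable_char_pos ray_kernel_def mult_ac)
  also have "\<dots> = Im (ray_integral (pi / 2) x)"
    unfolding ray_integral_def set_lebesgue_integral_def
    using ray_series(1)[OF quarter_turn] by (intro integral_Im) (simp add: set_integrable_def)
  finally show ?thesis by (simp add: stable_density_def inverse_fourier_def h_def)
qed

text \<open>With \<open>\<alpha> = 1 / g\<close> the sum is \<open>\<alpha>\<close> times the Wright
  function \<open>\<phi>(-\<alpha>, 1 - \<alpha>, -x)\<close>, here at every real \<open>x\<close>;
  its first three coefficients produce \<open>turan\<close>.\<close>

theorem stable_density_series:
  "(\<lambda>n. rGamma (1 - real (Suc n) / g) / (g * fact n) * (- x) ^ n) sums stable_density x"
  unfolding stable_density_eq_ray by (rule ray_series(2)[OF quarter_turn])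

lemma stable_density_eq_ray_integral:
  assumes "pi / 2 < g * \<phi>" "g * \<phi> < pi"
  shows "stable_density x = Im (ray_integral \<phi> x) / pi"
  by (rule sums_unique2[OF stable_density_series ray_series(2)[OF assms]])

end

section \<open>Behaviour at the origin and Mellin transform\<close>

context stable_index begin

lemma stable_density_continuous: "continuous_on A stable_density"
proof -
  let ?c = "\<lambda>n. rGamma (1 - real (Suc n) / g) / (g * fact n)"
  have s: "(\<lambda>n. ?c n * y ^ n) sums stable_density (- y)" for y using stable_density_series[of "- y"] by simp
  have "isCont (\<lambda>y. \<Sum>n. ?c n * y ^ n) y" for y
    by (rule isCont_powser_converges_everywhere) (rule sums_summable[OF s])
  then have "continuous_on UNIV (\<lambda>y. stable_density (- y))"
    unfolding sums_unique[OF s] by (simp add: continuous_on_eq_continuous_at)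
  then have "continuous_on UNIV (\<lambda>y. stable_density (- (- y)))"
    by (rule continuous_on_compose2) (auto intro: continuous_intros)
  then show ?thesis by (auto intro: continuous_on_subset)
qed

lemma stable_density_measurable [measurable]: "stable_density \<in> borel_measurable borel"
  by (rule borel_measurable_continuous_onI[OF stable_density_continuous])

text \<open>In the numerator the terms of order zero and one in \<open>h\<close> cancel, and the
  coefficient of \<open>h\<^sup>2\<close> is \<open>2 * c 0 * c 2 - (c 1)\<^sup>2\<close>. The limit
  is \<open>- turan (1 / g) / g\<^sup>2\<close>.\<close>

lemma stable_density_second_difference:
  "(\<lambda>h. (stable_density 0 * stable_density (2 * h) - (stable_density h)\<^sup>2) / h\<^sup>2)
    \<midarrow>0\<rightarrow> (rGamma (1 - 1 / g) * rGamma (1 - 3 / g) - (rGamma (1 - 2 / g))\<^sup>2) / g\<^sup>2"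
proof -
  define c where "c n = rGamma (1 - real (Suc n) / g) / (g * fact n) * (- 1) ^ n" for n
  have s: "(\<lambda>n. c n * x ^ n) sums stable_density x" for x
    using stable_density_series[of x] unfolding c_def power_minus[of x] by (simp add: mult.assoc)
  have s3: "summable (\<lambda>n. c (n + 3) * x ^ n)" for x
  proof (cases "x = 0")
    case False
    have "summable (\<lambda>n. c (n + 3) * x ^ (n + 3))"
      using sums_summable[OF s, of x] by (subst summable_iff_shift)
    then have "summable (\<lambda>n. c (n + 3) * x ^ (n + 3) * (1 / x ^ 3))" by (rule summable_mult2)
    then show ?thesis using False by (simp add: power_add)
  qed simp
  \<comment> \<open>The remainder is itself an everywhere convergent power series, so its continuity
    at \<open>0\<close> settles the limit.\<close>
  define R where "R x = (\<Sum>n. c (n + 3) * x ^ n)" for x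
  have p: "stable_density x = c 0 + c 1 * x + c 2 * x\<^sup>2 + x ^ 3 * R x" for x
  proof -
    have "stable_density x = (\<Sum>n. c n * x ^ n)" by (rule sums_unique[OF s])
    also have "\<dots> = (\<Sum>n. c (n + 3) * x ^ (n + 3)) + (\<Sum>n<3. c n * x ^ n)"
      by (rule suminf_split_initial_segment[OF sums_summable[OF s]])
    also have "(\<lambda>n. c (n + 3) * x ^ (n + 3)) = (\<lambda>n. x ^ 3 * (c (n + 3) * x ^ n))" by (simp add: power_add mult_ac)
    also have "(\<Sum>n. x ^ 3 * (c (n + 3) * x ^ n)) = x ^ 3 * R x" unfolding R_def by (rule suminf_mult[OF s3])
    also have "(\<Sum>n<3. c n * x ^ n) = c 0 + c 1 * x + c 2 * x\<^sup>2" by (simp add: eval_nat_numeral)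
    finally show ?thesis by simp
  qed
  have "isCont R x" for x unfolding R_def by (rule isCont_powser_converges_everywhere) (rule s3)
  then have R: "(\<lambda>h. R (k * h)) \<midarrow>0\<rightarrow> R 0" for k
    by (rule isCont_tendsto_compose) (auto intro!: tendsto_eq_intros)
  define S where "S h = 2 * c 0 * c 2 - (c 1)\<^sup>2 + h * (8 * c 0 * R (2 * h) - 2 * c 1 * c 2 - 2 * c 0 * R (1 * h) - h * (c 2)\<^sup>2 - 2 * h * c 1 * R (1 * h) - 2 * h\<^sup>2 * c 2 * R (1 * h) - h ^ 3 * (R (1 * h))\<^sup>2)" for h
  have eq: "(stable_density 0 * stable_density (2 * h) - (stable_density h)\<^sup>2) / h\<^sup>2 = S h" if "h \<noteq> 0" for h
  proof -
    have "stable_density 0 * stable_density (2 * h) - (stable_density h)\<^sup>2 = h\<^sup>2 * S h"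
      unfolding p S_def mult_1 by (simp add: power2_eq_square power3_eq_cube algebra_simps)
    then show ?thesis using that by simp
  qed
  have "S \<midarrow>0\<rightarrow> 2 * c 0 * c 2 - (c 1)\<^sup>2 + 0 * (8 * c 0 * R 0 - 2 * c 1 * c 2 - 2 * c 0 * R 0 - 0 * (c 2)\<^sup>2 - 2 * 0 * c 1 * R 0 - 2 * 0\<^sup>2 * c 2 * R 0 - 0 ^ 3 * (R 0)\<^sup>2)"
    unfolding S_def by (intro tendsto_intros R)
  also have "2 * c 0 * c 2 - (c 1)\<^sup>2 + 0 * (8 * c 0 * R 0 - 2 * c 1 * c 2 - 2 * c 0 * R 0 - 0 * (c 2)\<^sup>2 - 2 * 0 * c 1 * R 0 - 2 * 0\<^sup>2 * c 2 * R 0 - 0 ^ 3 * (R 0)\<^sup>2) =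
    (rGamma (1 - 1 / g) * rGamma (1 - 3 / g) - (rGamma (1 - 2 / g))\<^sup>2) / g\<^sup>2"
    by (simp add: c_def power2_eq_square numeral_3_eq_3 diff_divide_distrib)
  finally show ?thesis
    by (rule Lim_transform_eventually) (auto simp: eventually_at_filter eq)
qed

text \<open>For an angle below \<open>pi / 2\<close> the kernel decays in \<open>x\<close>, the
  double integral converges absolutely, and the order may be exchanged. The bounds on
  \<open>w\<close> are those of the two Gamma integrals: \<open>0 < 1 + w\<close> in
  \<open>x\<close> and \<open>0 < - w\<close> in \<open>y\<close>.\<close>

lemma stable_density_mellin:
  assumes w: "- 1 < w" "w < 0"
  shows "(\<integral>\<^sup>+x\<in>{0<..}. ennreal (x powr w * (g * stable_density x)) \<partial>lborel) = ennreal (Gamma (1 + w) / Gamma (1 + w / g))"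
proof -
  have g: "0 < g" using g1 by simp
  \<comment> \<open>The midpoint between \<open>pi / (2 * g)\<close>, where
    \<open>cos (g * \<phi>)\<close> vanishes, and \<open>pi / 2\<close>, where
    \<open>cos \<phi>\<close> vanishes.\<close>
  define \<phi> where "\<phi> = (pi / (2 * g) + pi / 2) / 2"
  have gphi: "g * \<phi> = pi / 4 + g * (pi / 4)" using g by (simp add: \<phi>_def field_simps)
  have p1: "1 * (pi / 4) < g * (pi / 4)" "g * (pi / 4) < 2 * (pi / 4)" using g1 g2 by (auto intro!: mult_strict_right_mono)
  have \<phi>: "pi / 2 < g * \<phi>" "g * \<phi> < pi" unfolding gphi using p1 pi_gt_zero by linarith+
  have "pi / (2 * g) < pi / 2" using g1 by (simp add: field_simps)
  moreover have "0 < pi / (2 * g)" using g by simp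
  moreover have "0 < (q + p) / 2" "(q + p) / 2 < p" if "q < p" "0 < q" for p q :: real using that by auto
  ultimately have \<phi>2: "0 < \<phi>" "\<phi> < pi / 2" unfolding \<phi>_def by blast+
  have C: "0 < cos \<phi>" by (rule cos_gt_zero_pi) (use \<phi>2 in auto)
  define E where "E y = exp (of_real (y powr g) * cis (g * \<phi>))" for y
  define F where "F y x = indicator {0<..} y *\<^sub>R (cis \<phi> * E y) * (indicator {0<..} x *\<^sub>R (of_real (x powr ((1 + w) - 1)) * exp (- (of_real y * cis \<phi>) * of_real x)))" for y x
  have kern: "of_real (x powr w) * ray_kernel \<phi> x y = cis \<phi> * E y * (of_real (x powr ((1 + w) - 1)) * exp (- (of_real y * cis \<phi>) * of_real x))" for x y
    by (simp add: ray_kernel_def E_def mult_ac)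
  have Fm: "case_prod F \<in> borel_measurable (lborel \<Otimes>\<^sub>M lborel)"
    unfolding F_def E_def by measurable
  have w1: "0 < 1 + w" using w by simp
  have c: "0 < Re (of_real y * cis \<phi>)" if "0 < y" for y using C that by simp
  note G = Gamma_integral_rotated[OF w1 c]
  have inner: "integrable lborel (F y)" for y
  proof (cases "0 < y")
    case True
    then show ?thesis using G(1)[OF True] unfolding F_def set_integrable_def by (intro integrable_mult_right) auto
  next
    case False
    then have "F y = (\<lambda>x. 0)" by (auto simp: F_def)
    then show ?thesis by simp
  qed
  have power: "(of_real y * cis \<phi>) powr (- of_real (1 + w)) = of_real (y powr (- w - 1)) * cis (- (\<phi> * (1 + w)))" if "0 < y" for y
  proof -
    have "of_real y * cis \<phi> = exp (of_real (ln y) + \<i> * of_real \<phi>)"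
      unfolding exp_add cis_conv_exp[symmetric] using that by (simp add: exp_of_real)
    moreover have "Ln (exp (of_real (ln y) + \<i> * of_real \<phi>)) = of_real (ln y) + \<i> * of_real \<phi>"
      by (rule Ln_exp) (use \<phi>2 in auto)
    ultimately have "(of_real y * cis \<phi>) powr (- of_real (1 + w)) = exp (- of_real (1 + w) * (of_real (ln y) + \<i> * of_real \<phi>))"
      by (simp add: powr_def)
    also have "- of_real (1 + w) * (of_real (ln y) + \<i> * of_real \<phi>) = of_real ((- w - 1) * ln y) + \<i> * of_real (- (\<phi> * (1 + w)))"
      by (simp add: algebra_simps)
    finally show ?thesis unfolding exp_add cis_conv_exp[symmetric] exp_of_real using that by (simp add: powr_def)
  qed
  have inner_value: "(LINT x|lborel. F y x) = of_real (Gamma (1 + w)) * cis (- (\<phi> * w)) * (indicator {0<..} y *\<^sub>R (of_real (y powr (- w - 1)) * E y))" for y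
  proof (cases "0 < y")
    case True
    have "(LINT x|lborel. F y x) = cis \<phi> * E y * (of_real (Gamma (1 + w)) * (of_real (y powr (- w - 1)) * cis (- (\<phi> * (1 + w)))))"
      using G(2)[OF True] unfolding F_def set_lebesgue_integral_def integral_mult_right_zero power[OF True] using True by simp
    also have "\<dots> = of_real (Gamma (1 + w)) * (cis \<phi> * cis (- (\<phi> * (1 + w)))) * (of_real (y powr (- w - 1)) * E y)" by simp
    finally show ?thesis unfolding cis_mult using True by (simp add: algebra_simps)
  qed (simp add: F_def)
  have inner_norm: "(LINT x|lborel. norm (F y x)) = Gamma (1 + w) * cos \<phi> powr - (1 + w) * norm (indicator {0<..} y *\<^sub>R (of_real (y powr (- w - 1)) * E y))" for y
  proof (cases "0 < y")
    case True
    have cy: "0 < y * cos \<phi>" using True C by simp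
    have "(LINT x:{0<..}|lborel. x powr ((1 + w) - 1) * exp (- (y * cos \<phi>) * x)) = Gamma (1 + w) * (y * cos \<phi>) powr - (1 + w)"
      by (rule set_integral_nonneg_nn(2)[OF _ _ nn_integral_Gamma[OF w1 cy]])
         (use w1 cy Gamma_real_nonneg[of "1 + w"] in \<open>auto simp: set_borel_measurable_def\<close>)
    moreover have "norm (F y x) = norm (E y) * (indicator {0<..} x *\<^sub>R (x powr ((1 + w) - 1) * exp (- (y * cos \<phi>) * x)))" for x
      using True by (auto simp: F_def norm_mult indicator_def)
    ultimately have "(LINT x|lborel. norm (F y x)) = norm (E y) * (Gamma (1 + w) * (y * cos \<phi>) powr - (1 + w))"
      by (simp only: integral_mult_right_zero set_lebesgue_integral_def)
    also have "(y * cos \<phi>) powr - (1 + w) = y powr (- w - 1) * cos \<phi> powr - (1 + w)"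
      using True C by (simp add: powr_mult minus_diff_commute)
    finally show ?thesis using True by (simp add: norm_mult)
  qed (simp add: F_def)
  have mw: "0 < - w" using w by simp
  note M = ray_moment[OF \<phi> mw, folded E_def]
  have FI: "integrable (lborel \<Otimes>\<^sub>M lborel) (case_prod F)"
  proof (rule lborel_pair.Fubini_integrable[OF Fm])
    show "integrable lborel (\<lambda>y. LINT x|lborel. norm (case_prod F (y, x)))"
      unfolding prod.case inner_norm using M(1) by (intro integrable_mult_right integrable_norm) (simp add: set_integrable_def)
  qed (simp add: inner)
  have outer: "(LINT y|lborel. F y x) = indicator {0<..} x *\<^sub>R (of_real (x powr w) * ray_integral \<phi> x)" for x
  proof -
    have "F y x = indicator {0<..} x *\<^sub>R of_real (x powr w) * (indicator {0<..} y *\<^sub>R ray_kernel \<phi> x y)" for y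
      using kern[of x y] by (auto simp: F_def indicator_def)
    then have "(LINT y|lborel. F y x) = indicator {0<..} x *\<^sub>R of_real (x powr w) * (LINT y|lborel. indicator {0<..} y *\<^sub>R ray_kernel \<phi> x y)"
      by (simp only: integral_mult_right_zero)
    then show ?thesis by (simp add: ray_integral_def set_lebesgue_integral_def)
  qed
  have swap: "(LINT x|lborel. indicator {0<..} x *\<^sub>R (of_real (x powr w) * ray_integral \<phi> x)) =
      of_real (Gamma (1 + w)) * cis (- (\<phi> * w)) * (of_real (Gamma (- w / g) / g) * cis (pi * (- w / g) - \<phi> * (- w)))"
  proof -
    have "(LINT x|lborel. indicator {0<..} x *\<^sub>R (of_real (x powr w) * ray_integral \<phi> x)) = (LINT y|lborel. LINT x|lborel. F y x)"
      using lborel_pair.Fubini_integral[OF FI] unfolding outer .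
    also have "\<dots> = of_real (Gamma (1 + w)) * cis (- (\<phi> * w)) * (LINT y|lborel. indicator {0<..} y *\<^sub>R (of_real (y powr (- w - 1)) * E y))"
      unfolding inner_value by (rule integral_mult_right_zero)
    finally show ?thesis by (simp only: M(2)[unfolded set_lebesgue_integral_def])
  qed
  have "integrable lborel (\<lambda>x. LINT y|lborel. F y x)" by (rule lborel_pair.integrable_snd[OF FI])
  then have i: "integrable lborel (\<lambda>x. indicator {0<..} x *\<^sub>R (of_real (x powr w) * ray_integral \<phi> x))" unfolding outer .
  have r: "indicator {0<..} x *\<^sub>R (x powr w * (g * stable_density x)) = g / pi * Im (indicator {0<..} x *\<^sub>R (of_real (x powr w) * ray_integral \<phi> x))" for x
    by (simp add: stable_density_eq_ray_integral[OF \<phi>])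
  have ri: "integrable lborel (\<lambda>x. indicator {0<..} x *\<^sub>R (x powr w * (g * stable_density x)))"
    unfolding r using i by (intro integrable_mult_right integrable_Im)
  have "(LINT x|lborel. indicator {0<..} x *\<^sub>R (x powr w * (g * stable_density x))) = g / pi * Im (LINT x|lborel. indicator {0<..} x *\<^sub>R (of_real (x powr w) * ray_integral \<phi> x))"
    unfolding r by (subst integral_mult_right_zero, subst integral_Im[OF i], rule refl)
  also have "(LINT x|lborel. indicator {0<..} x *\<^sub>R (of_real (x powr w) * ray_integral \<phi> x)) = of_real (Gamma (1 + w) * (Gamma (- w / g) / g)) * (cis (- (\<phi> * w)) * cis (pi * (- w / g) - \<phi> * (- w)))"
    unfolding swap by simp
  also have "\<dots> = of_real (Gamma (1 + w) * (Gamma (- w / g) / g)) * cis (pi * (- w / g))"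
    unfolding cis_mult by simp
  also have "g / pi * Im \<dots> = Gamma (1 + w) * (Gamma (- w / g) * sin (pi * (- w / g)) / pi)"
    using g by simp
  also have "\<dots> = Gamma (1 + w) * rGamma (1 - - w / g)"
    using w g by (subst Gamma_times_sin) (auto simp: divide_neg_pos)
  finally have v: "(LINT x|lborel. indicator {0<..} x *\<^sub>R (x powr w * (g * stable_density x))) = Gamma (1 + w) / Gamma (1 + w / g)"
    by (simp add: rGamma_inverse_Gamma divide_inverse)
  have "(\<integral>\<^sup>+x\<in>{0<..}. ennreal (x powr w * (g * stable_density x)) \<partial>lborel) = (\<integral>\<^sup>+x. ennreal (indicator {0<..} x *\<^sub>R (x powr w * (g * stable_density x))) \<partial>lborel)"
    by (intro nn_integral_cong) (auto simp: indicator_def)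
  also have "\<dots> = ennreal (Gamma (1 + w) / Gamma (1 + w / g))"
    unfolding v[symmetric] using g by (intro nn_integral_eq_integral ri) (auto simp: indicator_def stable_density_dichotomy(2) intro!: AE_I2)
  finally show ?thesis .
qed

end

text \<open>Only \<open>g\<close> decreasing to the limit is needed, since \<open>1 / g\<close> approaches the critical index from below.\<close>

lemma stable_density_limit:
  assumes g: "stable_index g" and gn: "\<And>n. stable_index (G n)" and le: "\<And>n. g \<le> G n" and lim: "G \<longlonglongrightarrow> g"
  shows "(\<lambda>n. stable_index.stable_density (G n) x) \<longlonglongrightarrow> stable_index.stable_density g x"
proof -
  interpret A: stable_index g by fact
  interpret B: stable_index "G n" for n by fact
  define k where "k = - cos (g * (pi / 2))"
  have k: "0 < k" using A.rotation_powr(2)[OF A.quarter_turn] by (simp add: k_def)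
  have cosG: "k \<le> - cos (G n * (pi / 2))" for n
    unfolding k_def using A.quarter_turn B.quarter_turn[of n] le[of n] by (auto intro!: cos_monotone_0_pi_le mult_right_mono)
  have na: "norm (A.stable_char y) = exp (- k * y powr g)" "norm (B.stable_char n y) = exp (cos (G n * (pi / 2)) * y powr G n)" if "0 < y" for y n
    using that by (simp_all add: A.stable_char_pos B.stable_char_pos k_def mult.commute)
  \<comment> \<open>For \<open>y \<ge> 1\<close> a larger exponent only strengthens the decay; for
    \<open>y < 1\<close> the constant \<open>exp k\<close> makes up for the difference.\<close>
  have b: "norm (B.stable_char n y) \<le> exp k * norm (A.stable_char y)" if y: "0 < y" for y n
  proof (cases "1 \<le> y")
    case True
    then have "y powr g \<le> y powr G n" using le by (intro powr_mono) auto
    then have "k * y powr g \<le> - cos (G n * (pi / 2)) * y powr G n" using cosG[of n] k by (intro mult_mono) auto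
    then show ?thesis using k by (simp add: na[OF y] exp_add[symmetric])
  next
    case False
    have "y powr g \<le> 1" using False y A.g1 by (intro powr_le1) auto
    then have "k * y powr g \<le> k" using k by (simp add: mult_left_le)
    moreover have "cos (G n * (pi / 2)) * y powr G n \<le> 0"
      using cosG[of n] k by (intro mult_nonpos_nonneg) auto
    ultimately show ?thesis by (simp add: na[OF y] exp_add[symmetric])
  qed
  have bound: "norm (B.stable_char n y) \<le> exp k * norm (A.stable_char y)" if "y \<noteq> 0" for y n
    using b[of y n] b[of "- y" n] that A.stable_char_uminus[of y] B.stable_char_uminus[of n y]
    by (cases "0 < y") auto
  have pt: "(\<lambda>n. B.stable_char n y) \<longlonglongrightarrow> A.stable_char y" for y
  proof (cases "y = 0")
    case False
    then show ?thesis unfolding A.stable_char_def B.stable_char_def powr_def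
      by (auto intro!: tendsto_intros lim)
  qed (simp add: A.stable_char_def B.stable_char_def)
  have [measurable]: "A.stable_char \<in> borel_measurable borel" "B.stable_char n \<in> borel_measurable borel" for n
    using borel_measurable_integrable[OF A.stable_density_dichotomy(1)] borel_measurable_integrable[OF B.stable_density_dichotomy(1)] by auto
  have "(\<lambda>n. CLINT y|lborel. iexp (- (y * x)) * B.stable_char n y) \<longlonglongrightarrow> (CLINT y|lborel. iexp (- (y * x)) * A.stable_char y)"
  proof (rule integral_dominated_convergence[where w = "\<lambda>y. exp k * norm (A.stable_char y)"])
    show "integrable lborel (\<lambda>y. exp k * norm (A.stable_char y))"
      by (intro integrable_mult_right integrable_norm A.stable_density_dichotomy(1))
    show "AE y in lborel. (\<lambda>n. iexp (- (y * x)) * B.stable_char n y) \<longlonglongrightarrow> iexp (- (y * x)) * A.stable_char y"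
      by (intro AE_I2 tendsto_mult tendsto_const pt)
    show "AE y in lborel. norm (iexp (- (y * x)) * B.stable_char n y) \<le> exp k * norm (A.stable_char y)" for n
      using AE_lborel_neq[of 0] by eventually_elim (simp add: norm_mult bound)
  qed measurable
  then show ?thesis
    unfolding A.stable_density_def B.stable_density_def inverse_fourier_def
    by (intro tendsto_divide tendsto_Re tendsto_const) auto
qed

section \<open>Log-concavity beyond index one half\<close>

text \<open>The logarithm turns powers into exponentials, so \<open>bilateral_laplace_unique\<close>
  applies to the images of the measures; \<open>exp\<close> brings them back.\<close>

lemma mellin_unique:
  fixes M1 M2 :: "real measure"
  assumes sets: "sets M1 = sets borel" "sets M2 = sets borel" and "c < d"
    and pos: "AE x in M1. 0 < x" "AE x in M2. 0 < x"
    and eq: "\<And>w. c < w \<Longrightarrow> w < d \<Longrightarrow> (\<integral>\<^sup>+x. ennreal (x powr w) \<partial>M1) = (\<integral>\<^sup>+x. ennreal (x powr w) \<partial>M2)"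
    and fin: "\<And>w. c < w \<Longrightarrow> w < d \<Longrightarrow> (\<integral>\<^sup>+x. ennreal (x powr w) \<partial>M1) < \<infinity>"
  shows "M1 = M2"
proof -
  note [measurable_cong] = sets
  have t: "(\<integral>\<^sup>+v. ennreal (exp (w * v)) \<partial>distr M borel ln) = (\<integral>\<^sup>+x. ennreal (x powr w) \<partial>M)"
    if [measurable_cong]: "sets M = sets borel" and p: "AE x in M. 0 < x" for M :: "real measure" and w
  proof -
    have "(\<integral>\<^sup>+v. ennreal (exp (w * v)) \<partial>distr M borel ln) = (\<integral>\<^sup>+x. ennreal (exp (w * ln x)) \<partial>M)"
      by (subst nn_integral_distr) auto
    also have "\<dots> = (\<integral>\<^sup>+x. ennreal (x powr w) \<partial>M)"
      by (rule nn_integral_cong_AE) (use p in \<open>eventually_elim, simp add: powr_def\<close>)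
    finally show ?thesis .
  qed
  have b: "distr (distr M borel ln) borel exp = M"
    if s [measurable_cong]: "sets M = sets borel" and p: "AE x in M. 0 < x" for M :: "real measure"
  proof -
    have "distr (distr M borel ln) borel exp = distr M borel (exp \<circ> ln)" by (rule distr_distr) auto
    also have "\<dots> = distr M M (\<lambda>x. x)"
      by (rule distr_cong_AE) (use p s in \<open>auto elim!: eventually_mono\<close>)
    finally show ?thesis by simp
  qed
  note t1 = t[OF sets(1) pos(1)] and t2 = t[OF sets(2) pos(2)]
  have "distr M1 borel ln = distr M2 borel ln"
  proof (rule bilateral_laplace_unique[OF _ _ \<open>c < d\<close>])
    show "(\<integral>\<^sup>+v. ennreal (exp (w * v)) \<partial>distr M1 borel ln) = (\<integral>\<^sup>+v. ennreal (exp (w * v)) \<partial>distr M2 borel ln)"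
      if "c < w" "w < d" for w
      unfolding t1 t2 by (rule eq[OF that])
    show "(\<integral>\<^sup>+v. ennreal (exp (w * v)) \<partial>distr M1 borel ln) < \<infinity>" if "c < w" "w < d" for w
      unfolding t1 by (rule fin[OF that])
  qed (rule sets_distr)+
  then have "distr (distr M1 borel ln) borel exp = distr (distr M2 borel ln) borel exp" by (rule arg_cong)
  then show ?thesis unfolding b[OF sets(1) pos(1)] b[OF sets(2) pos(2)] .
qed

lemma continuous_AE_eq:
  fixes f q :: "real \<Rightarrow> real"
  assumes f: "continuous_on {0<..} f" and q: "continuous_on {0<..} q"
    and ae: "AE x in lborel. 0 < x \<longrightarrow> f x = q x" and z: "0 < z"
  shows "f z = q z"
proof (rule ccontr)
  assume ne: "f z \<noteq> q z"
  have "open ({0<..} \<inter> (\<lambda>x. f x - q x) -` (- {0}))"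
    by (intro continuous_open_preimage continuous_on_diff f q) auto
  moreover have "z \<in> {0<..} \<inter> (\<lambda>x. f x - q x) -` (- {0})" using ne z by simp
  ultimately obtain e where e: "0 < e" "ball z e \<subseteq> {0<..} \<inter> (\<lambda>x. f x - q x) -` (- {0})"
    by (rule openE)
  have "AE x in lborel. x \<notin> {z - e<..<z + e}"
    using ae
  proof eventually_elim
    case (elim x)
    show ?case
    proof
      assume "x \<in> {z - e<..<z + e}"
      then have "x \<in> ball z e" by (auto simp: dist_real_def)
      then show False using e elim by auto
    qed
  qed
  then have "emeasure lborel {z - e<..<z + e} = 0"
    by (subst (asm) AE_iff_null_sets[symmetric]) (auto simp: null_sets_def)
  then show False using e(1) by simp
qed

context stable_index begin

lemma four_points_if_turan_pos:
  assumes pos: "0 < turan (1 / g)" and x: "0 < x" "x < r" "x < r'" "r + r' = x + t"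
  shows "stable_density x * stable_density t \<le> stable_density r * stable_density r'"
proof (rule ccontr)
  assume "\<not> ?thesis"
  then have neg: "stable_density x * stable_density x \<le> stable_density (x - h) * stable_density (x + h)" if "0 < h" "x + h < 0" for x h
    using stable_density_dichotomy(3) x that by blast
  have cont: "isCont stable_density x" for x
    using stable_density_continuous[of UNIV] by (simp add: continuous_on_eq_continuous_at)
  \<comment> \<open>The second alternative is pushed to the boundary \<open>h = - x\<close>, where
    the right-hand point reaches the origin.\<close>
  have ge: "(stable_density x)\<^sup>2 \<le> stable_density 0 * stable_density (2 * x)" if x: "x < 0" for x
  proof -
    have "((\<lambda>h. stable_density (x - h) * stable_density (x + h)) \<longlongrightarrow> stable_density (x - (- x)) * stable_density (x + (- x))) (at_left (- x))"
      by (intro tendsto_mult isCont_tendsto_compose[OF cont] tendsto_intros)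
    moreover have "\<forall>\<^sub>F h in at_left (- x). stable_density x * stable_density x \<le> stable_density (x - h) * stable_density (x + h)"
      using eventually_at_left_real[of 0 "- x"] x by (auto elim!: eventually_mono intro!: neg)
    ultimately have "stable_density x * stable_density x \<le> stable_density (x - (- x)) * stable_density (x + (- x))"
      by (rule tendsto_lowerbound) simp
    then show ?thesis by (simp add: power2_eq_square mult.commute)
  qed
  have "((\<lambda>h. (stable_density 0 * stable_density (2 * h) - (stable_density h)\<^sup>2) / h\<^sup>2)
    \<longlongrightarrow> (rGamma (1 - 1 / g) * rGamma (1 - 3 / g) - (rGamma (1 - 2 / g))\<^sup>2) / g\<^sup>2) (at_left 0)"
    using stable_density_second_difference by (rule filterlim_mono) (auto simp: at_le)
  moreover have "\<forall>\<^sub>F h in at_left 0. 0 \<le> (stable_density 0 * stable_density (2 * h) - (stable_density h)\<^sup>2) / h\<^sup>2"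
    using eventually_at_left_real[of "-1" 0] by (auto elim!: eventually_mono intro!: divide_nonneg_nonneg ge)
  ultimately have "0 \<le> (rGamma (1 - 1 / g) * rGamma (1 - 3 / g) - (rGamma (1 - 2 / g))\<^sup>2) / g\<^sup>2"
    by (rule tendsto_lowerbound) simp
  then have "0 \<le> rGamma (1 - 1 / g) * rGamma (1 - 3 / g) - (rGamma (1 - 2 / g))\<^sup>2"
    using g1 by (simp add: zero_le_divide_iff)
  then show False using pos by (simp add: turan_def)
qed

lemma turan_nonneg_if_midpoint:
  assumes mid: "\<And>x y. 0 < x \<Longrightarrow> 0 < y \<Longrightarrow> stable_density x * stable_density y \<le> (stable_density ((x + y) / 2))\<^sup>2"
  shows "0 \<le> turan (1 / g)"
proof -
  have cont: "isCont stable_density x" for x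
    using stable_density_continuous[of UNIV] by (simp add: continuous_on_eq_continuous_at)
  have le: "stable_density 0 * stable_density (2 * h) \<le> (stable_density h)\<^sup>2" if h: "0 < h" for h
  proof -
    have "((\<lambda>x. (stable_density ((x + 2 * h) / 2))\<^sup>2) \<longlongrightarrow> (stable_density ((0 + 2 * h) / 2))\<^sup>2) (at_right 0)"
      by (intro tendsto_power isCont_tendsto_compose[OF cont] tendsto_intros) auto
    moreover have "((\<lambda>x. stable_density x * stable_density (2 * h)) \<longlongrightarrow> stable_density 0 * stable_density (2 * h)) (at_right 0)"
      by (intro tendsto_mult isCont_tendsto_compose[OF cont] tendsto_intros)
    moreover have "\<forall>\<^sub>F x in at_right 0. stable_density x * stable_density (2 * h) \<le> (stable_density ((x + 2 * h) / 2))\<^sup>2"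
      using eventually_at_right_real[of 0 1] h by (auto elim!: eventually_mono intro!: mid)
    ultimately have "stable_density 0 * stable_density (2 * h) \<le> (stable_density ((0 + 2 * h) / 2))\<^sup>2"
      by (intro tendsto_le[OF _ _ _]) auto
    then show ?thesis by simp
  qed
  have "((\<lambda>h. (stable_density 0 * stable_density (2 * h) - (stable_density h)\<^sup>2) / h\<^sup>2)
    \<longlongrightarrow> (rGamma (1 - 1 / g) * rGamma (1 - 3 / g) - (rGamma (1 - 2 / g))\<^sup>2) / g\<^sup>2) (at_right 0)"
    using stable_density_second_difference by (rule filterlim_mono) (auto simp: at_le)
  moreover have "\<forall>\<^sub>F h in at_right 0. (stable_density 0 * stable_density (2 * h) - (stable_density h)\<^sup>2) / h\<^sup>2 \<le> 0"
    using eventually_at_right_real[of 0 1] by (auto elim!: eventually_mono intro!: divide_nonpos_nonneg le)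
  ultimately have "(rGamma (1 - 1 / g) * rGamma (1 - 3 / g) - (rGamma (1 - 2 / g))\<^sup>2) / g\<^sup>2 \<le> 0"
    by (rule tendsto_upperbound) simp
  then have "rGamma (1 - 1 / g) * rGamma (1 - 3 / g) - (rGamma (1 - 2 / g))\<^sup>2 \<le> 0"
    using g1 by (simp add: divide_le_0_iff)
  then show ?thesis by (simp add: turan_def)
qed

text \<open>Positivity of \<open>turan\<close> is available strictly below \<open>1 / g\<close>
  only, so the index is approached by \<open>b n\<close> from below and the inequality passes
  through \<open>stable_density_limit\<close>. This includes the critical index, where
  \<open>turan\<close> vanishes.\<close>

lemma four_points_limiting:
  assumes pos: "\<And>b. 1 / 2 < b \<Longrightarrow> b < 1 / g \<Longrightarrow> 0 < turan b"
    and x: "0 < x" "x < r" "x < r'" "r + r' = x + t"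
  shows "stable_density x * stable_density t \<le> stable_density r * stable_density r'"
proof -
  have ginv: "1 / 2 < 1 / g" "1 / g < 1" using g1 g2 by (auto simp: field_simps)
  define b where "b n = 1 / g - (1 / g - 1 / 2) / (real n + 2)" for n
  have b: "1 / 2 < b n" "b n < 1 / g" for n
  proof -
    have "(1 / g - 1 / 2) / (real n + 2) < (1 / g - 1 / 2) / 1"
      using ginv by (intro divide_strict_left_mono) auto
    moreover have "1 / 2 < p - q" if "q < (p - 1 / 2) / 1" for p q :: real using that by simp
    ultimately show "1 / 2 < b n" unfolding b_def by blast
    have "0 < (1 / g - 1 / 2) / (real n + 2)" using ginv by (intro divide_pos_pos) auto
    then show "b n < 1 / g" unfolding b_def by linarith
  qed
  define G where "G n = 1 / b n" for n
  have G: "stable_index (G n)" "g \<le> G n" for n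
  proof -
    have "0 < b n" "b n < 1" using b[of n] ginv by linarith+
    have "1 < 1 / t \<and> 1 / t < 2" if "1 / 2 < t" "t < 1" for t :: real using that by (auto simp: field_simps)
    then show "stable_index (G n)" unfolding stable_index_def G_def using b[of n] \<open>b n < 1\<close> by blast
    have "g \<le> 1 / t" if "0 < t" "t < 1 / g" for t using that g1 by (simp add: field_simps)
    then show "g \<le> G n" unfolding G_def using b[of n] \<open>0 < b n\<close> by blast
  qed
  have "(\<lambda>n. (1 / g - 1 / 2) / (real n + 2)) \<longlonglongrightarrow> 0" by real_asymp
  then have "b \<longlonglongrightarrow> 1 / g - 0" unfolding b_def by (intro tendsto_diff tendsto_const)
  then have "G \<longlonglongrightarrow> 1 / (1 / g - 0)" unfolding G_def using g1 by (intro tendsto_divide tendsto_const) auto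
  then have lim: "G \<longlonglongrightarrow> g" using g1 by simp
  have "1 / G n = b n" for n by (simp add: G_def)
  then have le: "stable_index.stable_density (G n) x * stable_index.stable_density (G n) t \<le> stable_index.stable_density (G n) r * stable_index.stable_density (G n) r'" for n
    using pos[OF b] by (intro stable_index.four_points_if_turan_pos[OF G(1) _ x]) simp
  note L = stable_density_limit[OF stable_index_axioms G lim]
  show ?thesis
    by (rule LIMSEQ_le[OF tendsto_mult[OF L L] tendsto_mult[OF L L]]) (intro exI allI impI, rule le)
qed

end

context mittag_leffler_density begin

text \<open>\<open>moment\<close> and \<open>stable_density_mellin\<close> agree for
  \<open>w\<close> between \<open>-1\<close> and \<open>0\<close>, which identifies the measures;
  continuity then gives equality at every positive point.\<close>

lemma density_eq_stable:
  assumes a: "1 / 2 < a" and x: "0 < x"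
  shows "f x = 1 / a * stable_index.stable_density (1 / a) x"
proof -
  interpret S: stable_index "1 / a"
    using a a1 by unfold_locales (auto simp: field_simps)
  define N where "N = density lborel (\<lambda>x. ennreal (indicator {0<..} x * (1 / a * S.stable_density x)))"
  have N: "(\<integral>\<^sup>+x. ennreal (x powr w) \<partial>N) = ennreal (Gamma (1 + w) / Gamma (1 + a * w))" if "- 1 < w" "w < 0" for w
  proof -
    have "(\<integral>\<^sup>+x. ennreal (x powr w) \<partial>N) = (\<integral>\<^sup>+x\<in>{0<..}. ennreal (x powr w * (1 / a * S.stable_density x)) \<partial>lborel)"
      unfolding N_def
      by (subst nn_integral_density)
         (use a0 S.stable_density_dichotomy(2) in \<open>auto intro!: nn_integral_cong simp: indicator_def ennreal_mult[symmetric] mult_ac\<close>)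
    then show ?thesis using S.stable_density_mellin[OF that] by (simp add: mult.commute)
  qed
  have "L = N"
  proof (rule mellin_unique[of _ _ "-1" 0])
    show "AE x in N. 0 < x" unfolding N_def by (subst AE_density) (auto simp: indicator_def split: if_splits)
  qed (use N moment L_pos in \<open>auto simp: N_def\<close>)
  then have "AE x in lborel. ennreal (f x) = ennreal (indicator {0<..} x * (1 / a * S.stable_density x))"
    unfolding L_density N_def by (intro sigma_finite_measure.density_unique[OF lborel.sigma_finite_measure_axioms]) auto
  then have ae: "AE x in lborel. 0 < x \<longrightarrow> f x = 1 / a * S.stable_density x"
    by eventually_elim (use a0 f_nonneg S.stable_density_dichotomy(2) in auto)
  show ?thesis
    by (rule continuous_AE_eq[OF f_cont _ ae x]) (intro continuous_intros S.stable_density_continuous)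
qed

lemma log_concave_if_turan_pos:
  assumes pos: "\<And>b. 1 / 2 < b \<Longrightarrow> b < a \<Longrightarrow> 0 < turan b"
  shows "log_concave f"
proof (cases "a \<le> 1 / 2")
  case True
  then show ?thesis by (rule log_concave_half)
next
  case False
  then interpret S: stable_index "1 / a"
    using a1 by unfold_locales (auto simp: field_simps)
  show ?thesis
  proof (rule log_concave_from_four_points)
    fix x r r' t :: real assume x: "0 < x" "x < r" "x < r'" "r + r' = x + t"
    have "S.stable_density x * S.stable_density t \<le> S.stable_density r * S.stable_density r'"
      by (rule S.four_points_limiting[OF _ x]) (use pos in simp)
    then have "(1 / a)\<^sup>2 * (S.stable_density x * S.stable_density t) \<le> (1 / a)\<^sup>2 * (S.stable_density r * S.stable_density r')"
      by (rule mult_left_mono) simp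
    then show "f x * f t \<le> f r * f r'"
      using False x by (simp add: density_eq_stable power2_eq_square mult_ac)
  qed
qed

lemma turan_nonneg_if_log_concave:
  assumes a: "1 / 2 < a" and lc: "log_concave f"
  shows "0 \<le> turan a"
proof -
  interpret S: stable_index "1 / a"
    using a a1 by unfold_locales (auto simp: field_simps)
  have "0 \<le> turan (1 / (1 / a))"
  proof (rule S.turan_nonneg_if_midpoint)
    fix x y :: real assume xy: "0 < x" "0 < y"
    have p: "0 < f x" "0 < f y" "0 < f ((x + y) / 2)" using lc xy by (auto simp: log_concave_def)
    have c: "concave_on {0<..} (\<lambda>x. ln (f x))" using lc by (simp add: log_concave_def)
    have "(1 - 1 / 2) * ln (f x) + 1 / 2 * ln (f y) \<le> ln (f ((1 - 1 / 2) *\<^sub>R x + (1 / 2) *\<^sub>R y))"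
      by (rule concave_onD[OF c]) (use xy in auto)
    then have "ln (f x) + ln (f y) \<le> 2 * ln (f ((x + y) / 2))" by (simp add: add_divide_distrib)
    then have "ln (f x * f y) \<le> ln ((f ((x + y) / 2))\<^sup>2)" using p by (simp add: ln_mult ln_realpow)
    then have "f x * f y \<le> (f ((x + y) / 2))\<^sup>2" using p by simp
    then have "a\<^sup>2 * (f x * f y) \<le> a\<^sup>2 * (f ((x + y) / 2))\<^sup>2" by (rule mult_left_mono) simp
    then show "S.stable_density x * S.stable_density y \<le> (S.stable_density ((x + y) / 2))\<^sup>2"
      using xy a by (simp add: density_eq_stable power2_eq_square field_simps)
  qed
  then show ?thesis by simp
qed

end

section \<open>Index zero and the final equivalence\<close>

lemma log_concave_exp_law:
  fixes f :: "real \<Rightarrow> real"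
  assumes nn: "\<And>x. 0 \<le> f x" and [measurable]: "f \<in> borel_measurable borel" and cont: "continuous_on {0<..} f"
    and eq: "density lborel (\<lambda>x. ennreal (f x)) = exp_law"
  shows "log_concave f"
proof -
  have "AE x in lborel. ennreal (f x) = ennreal (exp (- x)) * indicator {0<..} x"
    using eq unfolding exp_law_def by (intro sigma_finite_measure.density_unique[OF lborel.sigma_finite_measure_axioms]) auto
  then have ae: "AE x in lborel. 0 < x \<longrightarrow> f x = exp (- x)"
    by eventually_elim (use nn in auto)
  have f: "f x = exp (- x)" if "0 < x" for x
    by (rule continuous_AE_eq[OF cont _ ae that]) (intro continuous_intros)
  have "concave_on {0<..} (\<lambda>x. ln (f x))"
    unfolding concave_on_iff
  proof (intro conjI ballI allI impI)
    fix x y u v :: real assume "x \<in> {0<..}" "y \<in> {0<..}" "0 \<le> u" "0 \<le> v" "u + v = 1"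
    moreover from this have "u *\<^sub>R x + v *\<^sub>R y \<in> {0<..}" by (intro convexD[OF convex_real_interval(3)])
    ultimately show "u * ln (f x) + v * ln (f y) \<le> ln (f (u *\<^sub>R x + v *\<^sub>R y))" using f by simp
  qed simp
  then show ?thesis using f by (simp add: log_concave_def)
qed

theorem theoremB:
  shows "\<exists>\<alpha>\<^sub>s::real. 0 < \<alpha>\<^sub>s \<and> \<alpha>\<^sub>s < 1 \<and>
     (\<forall>a::real. 0 < a \<and> a < 1 \<longrightarrow>
        ((rGamma (1 - 2 * a))\<^sup>2 = rGamma (1 - a) * rGamma (1 - 3 * a) \<longleftrightarrow> a = \<alpha>\<^sub>s)) \<and>
     0.771667 \<le> \<alpha>\<^sub>s \<and> \<alpha>\<^sub>s < 0.771668 \<and>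
     (\<forall>(\<alpha>::real) (M::'a measure) (X::'a \<Rightarrow> real) (f::real \<Rightarrow> real).
        0 \<le> \<alpha> \<and> \<alpha> < 1 \<and> mittag_leffler_rv \<alpha> M X \<and> continuous_density M X f \<longrightarrow>
        (log_concave f \<longleftrightarrow> \<alpha> \<le> \<alpha>\<^sub>s))"
proof -
  obtain s :: real where s: "771667 / 1000000 < s" "s < 771668 / 1000000" "turan s = 0"
    and above: "\<And>a. 0 < a \<Longrightarrow> a < s \<Longrightarrow> 0 < turan a" and below: "\<And>a. s < a \<Longrightarrow> a < 1 \<Longrightarrow> turan a < 0"
    using turan_root by blast
  have root: "(rGamma (1 - 2 * a))\<^sup>2 = rGamma (1 - a) * rGamma (1 - 3 * a) \<longleftrightarrow> a = s" if "0 < a" "a < 1" for a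
  proof -
    consider "a < s" | "a = s" | "s < a" by linarith
    then have "turan a = 0 \<longleftrightarrow> a = s"
      by cases (use above[of a] below[of a] s(3) that in auto)
    then show ?thesis by (simp add: turan_def)
  qed
  have main: "log_concave f \<longleftrightarrow> \<alpha> \<le> s"
    if \<alpha>: "0 \<le> \<alpha>" "\<alpha> < 1" and rv: "mittag_leffler_rv \<alpha> M X" and dens: "continuous_density M X f"
    for \<alpha> and M :: "'a measure" and X f
  proof -
    have M: "prob_space M" and X [measurable]: "X \<in> borel_measurable M" and Xpos: "AE \<omega> in M. 0 < X \<omega>"
      and mgf: "\<And>z::complex. (\<alpha> = 0 \<longrightarrow> Re z < 1) \<Longrightarrow> integrable M (\<lambda>\<omega>. exp (z * of_real (X \<omega>)))"
        "\<And>z::complex. (\<alpha> = 0 \<longrightarrow> Re z < 1) \<Longrightarrow> (LINT \<omega>|M. exp (z * of_real (X \<omega>))) = mittag_leffler \<alpha> z"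
      using rv by (auto simp: mittag_leffler_rv_def)
    have nn: "\<And>x. 0 \<le> f x" and cont: "continuous_on {0<..} f" and dist: "distributed M lborel X (\<lambda>x. ennreal (f x))"
      using dens by (auto simp: continuous_density_def)
    have "(\<lambda>x. ennreal (f x)) \<in> borel_measurable borel" using distributed_borel_measurable[OF dist] by simp
    then have "(\<lambda>x. enn2real (ennreal (f x))) \<in> borel_measurable borel" by measurable
    then have fm [measurable]: "f \<in> borel_measurable borel" using nn by simp
    define L where "L = distr M borel X"
    have L: "L = density lborel (\<lambda>x. ennreal (f x))"
    proof -
      have "L = distr M lborel X" unfolding L_def by (rule distr_cong) auto
      then show ?thesis using distributed_distr_eq_density[OF dist] by simp
    qed
    have mgfL: "(\<integral>\<^sup>+x. ennreal (exp (l * x)) \<partial>L) = ennreal (Re (mittag_leffler \<alpha> (of_real l)))" if "\<alpha> = 0 \<longrightarrow> l < 1" for l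
    proof -
      have c: "exp (of_real l * of_real (X \<omega>)) = complex_of_real (exp (l * X \<omega>))" for \<omega>
        by (simp add: exp_of_real flip: of_real_mult)
      have i: "integrable M (\<lambda>\<omega>. complex_of_real (exp (l * X \<omega>)))"
        using mgf(1)[of "of_real l"] that by (simp only: c Re_complex_of_real)
      then have "integrable M (\<lambda>\<omega>. Re (complex_of_real (exp (l * X \<omega>))))" by (rule integrable_Re)
      then have ir: "integrable M (\<lambda>\<omega>. exp (l * X \<omega>))" by simp
      have "complex_of_real (LINT \<omega>|M. exp (l * X \<omega>)) = mittag_leffler \<alpha> (of_real l)"
        using mgf(2)[of "of_real l"] that unfolding c Re_complex_of_real integral_complex_of_real by simp
      then have v: "(LINT \<omega>|M. exp (l * X \<omega>)) = Re (mittag_leffler \<alpha> (of_real l))" by (metis Re_complex_of_real)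
      have "(\<integral>\<^sup>+x. ennreal (exp (l * x)) \<partial>L) = (\<integral>\<^sup>+\<omega>. ennreal (exp (l * X \<omega>)) \<partial>M)"
        unfolding L_def by (subst nn_integral_distr) auto
      also have "\<dots> = ennreal (LINT \<omega>|M. exp (l * X \<omega>))" by (rule nn_integral_eq_integral[OF ir]) simp
      finally show ?thesis by (simp add: v)
    qed
    interpret PL: prob_space L unfolding L_def using X by (rule prob_space.prob_space_distr[OF M])
    have rd: "real_distribution L" by unfold_locales (simp_all add: L_def)
    show ?thesis
    proof (cases "\<alpha> = 0")
      case True
      \<comment> \<open>At index zero the transform is \<open>1 / (1 - z)\<close>, that of the
        exponential law; the comparison is made on a negative interval.\<close>
      have "L = exp_law"
      proof (rule bilateral_laplace_unique[of _ _ "-1" 0])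
        fix w :: real assume w: "- 1 < w" "w < 0"
        have "mittag_leffler \<alpha> (of_real w) = complex_of_real (1 / (1 - w))" using True by (simp add: mittag_leffler_def)
        then have m: "Re (mittag_leffler \<alpha> (of_real w)) = 1 / (1 - w)" by (metis Re_complex_of_real)
        show "(\<integral>\<^sup>+v. ennreal (exp (w * v)) \<partial>L) = (\<integral>\<^sup>+v. ennreal (exp (w * v)) \<partial>exp_law)"
          using w mgfL[of w] nn_integral_exp_law_exp[of w] True m by simp
        show "(\<integral>\<^sup>+v. ennreal (exp (w * v)) \<partial>L) < \<infinity>" using w mgfL[of w] by simp
      qed (auto simp: L_def)
      then have "log_concave f" by (intro log_concave_exp_law nn cont fm) (simp add: L)
      then show ?thesis using True s by simp
    next
      case False
      then have \<alpha>0: "0 < \<alpha>" using \<alpha> by simp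
      interpret mittag_leffler_density L \<alpha> f
      proof (rule mittag_leffler_density.intro)
        show "mittag_leffler_law L \<alpha>"
        proof (rule mittag_leffler_law.intro[OF rd])
          show "mittag_leffler_law_axioms L \<alpha>"
          proof
            show "AE x in L. 0 < x" unfolding L_def using Xpos by (subst AE_distr_iff) auto
            fix l :: real assume l: "0 < l"
            have "mittag_leffler \<alpha> (of_real l) = (\<Sum>n. complex_of_real (l ^ n * rGamma (1 + \<alpha> * real n)))"
              unfolding mittag_leffler_def using False by (simp add: rGamma_complex_of_real[symmetric])
            also have "\<dots> = of_real (\<Sum>n. l ^ n * rGamma (1 + \<alpha> * real n))"
              by (rule suminf_of_real[OF summable_mittag_leffler[OF \<alpha>0 l], symmetric])
            finally show "(\<integral>\<^sup>+x. ennreal (exp (l * x)) \<partial>L) = ennreal (\<Sum>n. l ^ n * rGamma (1 + \<alpha> * real n))"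
              using mgfL[of l] False by simp
          qed (use \<alpha>0 \<alpha> in auto)
        qed
        show "mittag_leffler_density_axioms L f"
          by unfold_locales (use nn fm cont L in auto)
      qed
      show ?thesis
      proof
        assume lc: "log_concave f"
        show "\<alpha> \<le> s"
        proof (rule ccontr)
          assume "\<not> \<alpha> \<le> s"
          then have "turan \<alpha> < 0" "1 / 2 < \<alpha>" using below \<alpha> s by auto
          then show False using turan_nonneg_if_log_concave[OF _ lc] by simp
        qed
      next
        assume "\<alpha> \<le> s"
        then show "log_concave f" by (intro log_concave_if_turan_pos above) auto
      qed
    qed
  qed
  show ?thesis
    by (rule exI[of _ s]) (use s root main in auto)
qed

end
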